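(* Let $M$ be a compact irreducible real algebraic variety and let $A,B\subset M$ be disjoint open semialgebraic subsets. Assume that $M$ is non-singular and that all the walls of $A$ and $B$ are non-singular and normal crossings. Then $A$ and $B$ are generically separable if and only if $\widetilde A$ and $\widetilde B$ are separable in all subspaces $\Sigma_W[\mathbb{Z}_2]$, for all the walls $W$ of $A$ and $B$ in $M$.
   Context: For an irreducible real algebraic variety $M$ (real algebraic subset of some $\mathbb{R}^N$), $\mathfrak{R}(M)$ is its ring of regular functions (quotients $p/q$ of polynomial functions with $q$ nowhere zero on $M$) and $K=K(M)$ is the quotient field. *Generic separability.* $A,B\subset M$ are generically separable if there is a non-zero $f\in\mathfrak{R}(M)$ with $f\ge 0$ on $A$ and $f\le 0$ on $B$. *Walls.* With $n=\dim M$ and $\partial S=\overline S\setminus\operatorname{Int}(S)$, the walls of $A$ and $B$ in $M$ are the irreducible components of dimension $n-1$ of the union of the Zariski closures of $\partial A$ and $\partial B$. *Normal crossings.* That the walls are normal crossings means: $A$ and $B$ are described by (boolean combinations of sign conditions on) a family of polynomials $f_1,\dots,f_s$ which are all normal crossings, i.e. at each point $x\in M$ there is a regular system of parameters $x_1,\dots,x_n$ of the local ring $\mathfrak{R}(M)_x$ such that every $f_j=a_jx_1^{m_{j1}}\cdots x_n^{m_{jn}}$ with $a_j$ a unit of $\mathfrak{R}(M)_x$ and $m_{ji}\ge 0$ integers. *Tilde and $\Sigma_W[\mathbb{Z}_2]$.* $\Sigma_K$ is the set of orderings of $K$; for $\sigma\in\Sigma_K$, $f\in K^*$ write $f(\sigma)>0$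 or $f(\sigma)<0$ for the sign of $f$ in $\sigma$. For a semialgebraic set $S\subset M$, $\widetilde S\subset\Sigma_K$ is the constructible set defined by the same formula as $S$. For a wall $W$ of the non-singular $M$ with ideal $\mathfrak{J}(W)\subset\mathfrak{R}(M)$, the localization $\mathfrak{R}(M)_{\mathfrak{J}(W)}$ is a discrete valuation ring of $K$ of rank 1 with residue field the function field $K(W)$ of $W$; $\Sigma_W[\mathbb{Z}_2]\subset\Sigma_K$ is the set of all orderings of $K$ for which the maximal ideal of $\mathfrak{R}(M)_{\mathfrak{J}(W)}$ is convex (equivalently, the pull-back of the space $\Sigma_W$ of orderings of $K(W)$). $\widetilde A,\widetilde B$ are separable in $\Sigma_W[\mathbb{Z}_2]$ if there is $g\in K^*$ with $g>0$ on $\widetilde A\cap\Sigma_W[\mathbb{Z}_2]$ and $g<0$ on $\widetilde B\cap\Sigma_W[\mathbb{Z}_2]$. *)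

theory Defs
  imports "HOL-Analysis.Analysis" "HOL-Algebra.Ideal" "HOL-Library.Extended_Nat"
begin

definition frac_rel :: "('a, 'm) ring_scheme \<Rightarrow> (('a \<times> 'a) \<times> ('a \<times> 'a)) set" where
  "frac_rel R = {((a, b), (c, d)) | a b c d.
     a \<in> carrier R \<and> c \<in> carrier R \<and>
     b \<in> carrier R - {\<zero>\<^bsub>R\<^esub>} \<and> d \<in> carrier R - {\<zero>\<^bsub>R\<^esub>} \<and>
     a \<otimes>\<^bsub>R\<^esub> d = c \<otimes>\<^bsub>R\<^esub> b}"

definition fraction :: "('a, 'm) ring_scheme \<Rightarrow> 'a \<Rightarrow> 'a \<Rightarrow> ('a \<times> 'a) set" where
  "fraction R a b = frac_rel R `` {(a, b)}"

text \<open>The quotient field; meaningful when \<open>R\<close> is an integral domain.\<close>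

definition frac_field :: "('a, 'm) ring_scheme \<Rightarrow> ('a \<times> 'a) set ring" where
  "frac_field R =
    \<lparr> carrier = (carrier R \<times> (carrier R - {\<zero>\<^bsub>R\<^esub>})) // frac_rel R,
      monoid.mult = (\<lambda>X Y. \<Union>(a, b)\<in>X. \<Union>(c, d)\<in>Y. fraction R (a \<otimes>\<^bsub>R\<^esub> c) (b \<otimes>\<^bsub>R\<^esub> d)),
      one = fraction R \<one>\<^bsub>R\<^esub> \<one>\<^bsub>R\<^esub>,
      zero = fraction R \<zero>\<^bsub>R\<^esub> \<one>\<^bsub>R\<^esub>,
      add = (\<lambda>X Y. \<Union>(a, b)\<in>X. \<Union>(c, d)\<in>Y.
               fraction R (a \<otimes>\<^bsub>R\<^esub> d \<oplus>\<^bsub>R\<^esub> c \<otimes>\<^bsub>R\<^esub> b) (b \<otimes>\<^bsub>R\<^esub> d)) \<rparr>"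

text \<open>The localization of the domain \<open>R\<close> at a prime ideal \<open>p\<close>, as a subring of the quotient
  field, and its maximal ideal.\<close>

definition localization :: "('a, 'm) ring_scheme \<Rightarrow> 'a set \<Rightarrow> ('a \<times> 'a) set ring" where
  "localization R p =
    (frac_field R)\<lparr>carrier := {fraction R a b | a b. a \<in> carrier R \<and> b \<in> carrier R - p}\<rparr>"

definition localization_max :: "('a, 'm) ring_scheme \<Rightarrow> 'a set \<Rightarrow> ('a \<times> 'a) set set" where
  "localization_max R p = {fraction R a b | a b. a \<in> p \<and> b \<in> carrier R - p}"

definition krull_dim :: "('a, 'm) ring_scheme \<Rightarrow> enat" where
  "krull_dim R = Sup {enat k | k. \<exists>P :: nat \<Rightarrow> 'a set.
     (\<forall>i\<le>k. primeideal (P i) R) \<and> (\<forall>i<k. P i \<subset> P (Suc i))}"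

text \<open>For a (noetherian) local ring \<open>L\<close>: since \<open>L\<close> has only one maximal ideal, the ideal generated
  by the parameters is the maximal ideal of \<open>L\<close>. The ring \<open>L\<close> is regular iff such a system exists.\<close>

definition regular_system_of_parameters :: "('a, 'm) ring_scheme \<Rightarrow> 'a list \<Rightarrow> bool" where
  "regular_system_of_parameters L xs \<longleftrightarrow>
     set xs \<subseteq> carrier L \<and> enat (length xs) = krull_dim L \<and> maximalideal (genideal L (set xs)) L"

text \<open>An ordering is given by its set of elements \<open>\<ge> 0\<close>.\<close>

definition field_ordering :: "('a, 'm) ring_scheme \<Rightarrow> 'a set \<Rightarrow> bool" where
  "field_ordering K P \<longleftrightarrow>
     P \<subseteq> carrier K \<and>
     (\<forall>a\<in>P. \<forall>b\<in>P. a \<oplus>\<^bsub>K\<^esub> b \<in> P \<and> a \<otimes>\<^bsub>K\<^esub> b \<in> P) \<and>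
     (\<forall>a\<in>carrier K. a \<in> P \<or> \<ominus>\<^bsub>K\<^esub> a \<in> P) \<and>
     (\<forall>a\<in>P. \<ominus>\<^bsub>K\<^esub> a \<in> P \<longrightarrow> a = \<zero>\<^bsub>K\<^esub>)"

definition positive_in :: "('a, 'm) ring_scheme \<Rightarrow> 'a set \<Rightarrow> 'a \<Rightarrow> bool" where
  "positive_in K P a \<longleftrightarrow> a \<in> P \<and> a \<noteq> \<zero>\<^bsub>K\<^esub>"

definition negative_in :: "('a, 'm) ring_scheme \<Rightarrow> 'a set \<Rightarrow> 'a \<Rightarrow> bool" where
  "negative_in K P a \<longleftrightarrow> positive_in K P (\<ominus>\<^bsub>K\<^esub> a)"

definition convex_in :: "('a, 'm) ring_scheme \<Rightarrow> 'a set \<Rightarrow> 'a set \<Rightarrow> bool" where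
  "convex_in K P I \<longleftrightarrow>
     (\<forall>a\<in>I. \<forall>c\<in>I. \<forall>b\<in>carrier K. b \<ominus>\<^bsub>K\<^esub> a \<in> P \<and> c \<ominus>\<^bsub>K\<^esub> b \<in> P \<longrightarrow> b \<in> I)"

definition algebraic_set :: "'a::euclidean_space set \<Rightarrow> bool" where
  "algebraic_set V \<longleftrightarrow>
     (\<exists>F. (\<forall>f\<in>F. real_polynomial_function f) \<and> V = {x. \<forall>f\<in>F. f x = 0})"

definition irreducible_algebraic_set :: "'a::euclidean_space set \<Rightarrow> bool" where
  "irreducible_algebraic_set V \<longleftrightarrow>
     algebraic_set V \<and> V \<noteq> {} \<and>
     (\<forall>V1 V2. algebraic_set V1 \<and> algebraic_set V2 \<and> V = V1 \<union> V2 \<longrightarrow> V = V1 \<or> V = V2)"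

definition zariski_closure :: "'a::euclidean_space set \<Rightarrow> 'a set" where
  "zariski_closure S = \<Inter>{V. algebraic_set V \<and> S \<subseteq> V}"

definition irreducible_components :: "'a::euclidean_space set \<Rightarrow> 'a set set" where
  "irreducible_components V =
     {W. irreducible_algebraic_set W \<and> W \<subseteq> V \<and>
         (\<forall>W'. irreducible_algebraic_set W' \<and> W \<subseteq> W' \<and> W' \<subseteq> V \<longrightarrow> W' = W)}"

text \<open>Functions on \<open>M\<close> are represented extensionally (\<open>undefined\<close> outside \<open>M\<close>).\<close>

definition function_ring :: "'a set \<Rightarrow> ('a \<Rightarrow> real) set \<Rightarrow> ('a \<Rightarrow> real) ring" where
  "function_ring M F =
    \<lparr> carrier = (\<lambda>f. restrict f M) ` F,
      monoid.mult = (\<lambda>f g. \<lambda>x\<in>M. f x * g x),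
      one = (\<lambda>x\<in>M. 1),
      zero = (\<lambda>x\<in>M. 0),
      add = (\<lambda>f g. \<lambda>x\<in>M. f x + g x) \<rparr>"

definition polynomial_ring :: "'a::euclidean_space set \<Rightarrow> ('a \<Rightarrow> real) ring" where
  "polynomial_ring M = function_ring M {p. real_polynomial_function p}"

definition regular_ring :: "'a::euclidean_space set \<Rightarrow> ('a \<Rightarrow> real) ring" where
  "regular_ring M = function_ring M {\<lambda>x. p x / q x | p q.
     real_polynomial_function p \<and> real_polynomial_function q \<and> (\<forall>x\<in>M. q x \<noteq> 0)}"

definition function_field ::
    "'a::euclidean_space set \<Rightarrow> (('a \<Rightarrow> real) \<times> ('a \<Rightarrow> real)) set ring" where
  "function_field M = frac_field (regular_ring M)"

definition algebraic_dim :: "'a::euclidean_space set \<Rightarrow> enat" where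
  "algebraic_dim M = krull_dim (polynomial_ring M)"

definition vanishing_ideal :: "'a::euclidean_space set \<Rightarrow> 'a set \<Rightarrow> ('a \<Rightarrow> real) set" where
  "vanishing_ideal M W = {f \<in> carrier (regular_ring M). \<forall>x\<in>W. f x = 0}"

definition local_ring ::
    "'a::euclidean_space set \<Rightarrow> 'a \<Rightarrow> (('a \<Rightarrow> real) \<times> ('a \<Rightarrow> real)) set ring" where
  "local_ring M x = localization (regular_ring M) (vanishing_ideal M {x})"

definition nonsingular :: "'a::euclidean_space set \<Rightarrow> bool" where
  "nonsingular M \<longleftrightarrow>
     (\<forall>x\<in>M. krull_dim (local_ring M x) = algebraic_dim M \<and>
             (\<exists>xs. regular_system_of_parameters (local_ring M x) xs))"

definition poly_in_field ::
    "'a::euclidean_space set \<Rightarrow> ('a \<Rightarrow> real) \<Rightarrow> (('a \<Rightarrow> real) \<times> ('a \<Rightarrow> real)) set" where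
  "poly_in_field M f = fraction (regular_ring M) (restrict f M) \<one>\<^bsub>regular_ring M\<^esub>"

text \<open>Boolean combinations of sign conditions; \<open>f < 0\<close> is \<open>Conj (Neg (Pos f)) (Neg (Vanish f))\<close>.\<close>

datatype (atoms: 'f) sign_formula =
    Pos 'f
  | Vanish 'f
  | Neg "'f sign_formula"
  | Conj "'f sign_formula" "'f sign_formula"

primrec holds :: "('f \<Rightarrow> bool) \<Rightarrow> ('f \<Rightarrow> bool) \<Rightarrow> 'f sign_formula \<Rightarrow> bool" where
  "holds pos zer (Pos f) \<longleftrightarrow> pos f"
| "holds pos zer (Vanish f) \<longleftrightarrow> zer f"
| "holds pos zer (Neg \<phi>) \<longleftrightarrow> \<not> holds pos zer \<phi>"
| "holds pos zer (Conj \<phi> \<psi>) \<longleftrightarrow> holds pos zer \<phi> \<and> holds pos zer \<psi>"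

definition holds_at :: "'a \<Rightarrow> ('a \<Rightarrow> real) sign_formula \<Rightarrow> bool" where
  "holds_at x = holds (\<lambda>f. f x > 0) (\<lambda>f. f x = 0)"

definition holds_in_ordering ::
    "'a::euclidean_space set \<Rightarrow> (('a \<Rightarrow> real) \<times> ('a \<Rightarrow> real)) set set \<Rightarrow>
     ('a \<Rightarrow> real) sign_formula \<Rightarrow> bool" where
  "holds_in_ordering M \<sigma> =
     holds (\<lambda>f. positive_in (function_field M) \<sigma> (poly_in_field M f))
           (\<lambda>f. poly_in_field M f = \<zero>\<^bsub>function_field M\<^esub>)"

definition describes ::
    "'a::euclidean_space set \<Rightarrow> ('a \<Rightarrow> real) sign_formula \<Rightarrow> 'a set \<Rightarrow> bool" where
  "describes M \<phi> S \<longleftrightarrow>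
     (\<forall>f\<in>atoms \<phi>. real_polynomial_function f) \<and> S = {x\<in>M. holds_at x \<phi>}"

definition semialgebraic_in :: "'a::euclidean_space set \<Rightarrow> 'a set \<Rightarrow> bool" where
  "semialgebraic_in M S \<longleftrightarrow> (\<exists>\<phi>. describes M \<phi> S)"

text \<open>By the Artin--Lang theorem, whether a formula describing \<open>S\<close> holds in an ordering does not
  depend on the choice of the formula.\<close>

definition tilde ::
    "'a::euclidean_space set \<Rightarrow> 'a set \<Rightarrow> (('a \<Rightarrow> real) \<times> ('a \<Rightarrow> real)) set set set" where
  "tilde M S =
     {\<sigma>. field_ordering (function_field M) \<sigma> \<and> (\<exists>\<phi>. describes M \<phi> S \<and> holds_in_ordering M \<sigma> \<phi>)}"

text \<open>The boundary is taken in the Euclidean topology of \<open>M\<close>.\<close>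

definition walls :: "'a::euclidean_space set \<Rightarrow> 'a set \<Rightarrow> 'a set \<Rightarrow> 'a set set" where
  "walls M A B =
     {W \<in> irreducible_components (zariski_closure (top_of_set M frontier_of A) \<union>
                                  zariski_closure (top_of_set M frontier_of B)).
        algebraic_dim W + 1 = algebraic_dim M}"

text \<open>Normal crossings is a property of a finite family of polynomials from which both sets can be
  described; at each point one system of parameters serves all members of the family.\<close>

definition normal_crossings_family :: "'a::euclidean_space set \<Rightarrow> ('a \<Rightarrow> real) set \<Rightarrow> bool" where
  "normal_crossings_family M F \<longleftrightarrow>
     (\<forall>x\<in>M. \<exists>xs. regular_system_of_parameters (local_ring M x) xs \<and>
        (\<forall>f\<in>F. \<exists>a\<in>Units (local_ring M x). \<exists>m :: nat \<Rightarrow> nat.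
           poly_in_field M f =
             a \<otimes>\<^bsub>local_ring M x\<^esub>
               (\<Otimes>\<^bsub>local_ring M x\<^esub>i\<in>{..<length xs}. (xs ! i) [^]\<^bsub>local_ring M x\<^esub> m i)))"

definition walls_normal_crossings :: "'a::euclidean_space set \<Rightarrow> 'a set \<Rightarrow> 'a set \<Rightarrow> bool" where
  "walls_normal_crossings M A B \<longleftrightarrow>
     (\<exists>F \<phi> \<psi>. finite F \<and> (\<forall>f\<in>F. real_polynomial_function f) \<and>
        atoms \<phi> \<subseteq> F \<and> describes M \<phi> A \<and> atoms \<psi> \<subseteq> F \<and> describes M \<psi> B \<and>
        normal_crossings_family M F)"

definition generically_separable :: "'a::euclidean_space set \<Rightarrow> 'a set \<Rightarrow> 'a set \<Rightarrow> bool" where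
  "generically_separable M A B \<longleftrightarrow>
     (\<exists>f\<in>carrier (regular_ring M). f \<noteq> \<zero>\<^bsub>regular_ring M\<^esub> \<and>
        (\<forall>x\<in>A. f x \<ge> 0) \<and> (\<forall>x\<in>B. f x \<le> 0))"

text \<open>The space of orderings \<open>\<Sigma>\<^sub>W[\<int>\<^sub>2]\<close>.\<close>

definition wall_orderings ::
    "'a::euclidean_space set \<Rightarrow> 'a set \<Rightarrow> (('a \<Rightarrow> real) \<times> ('a \<Rightarrow> real)) set set set" where
  "wall_orderings M W =
     {\<sigma>. field_ordering (function_field M) \<sigma> \<and>
         convex_in (function_field M) \<sigma>
           (localization_max (regular_ring M) (vanishing_ideal M W))}"

definition separable_in ::
    "'a::euclidean_space set \<Rightarrow> 'a set \<Rightarrow> 'a set \<Rightarrow>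
     (('a \<Rightarrow> real) \<times> ('a \<Rightarrow> real)) set set set \<Rightarrow> bool" where
  "separable_in M A B X \<longleftrightarrow>
     (\<exists>g\<in>carrier (function_field M) - {\<zero>\<^bsub>function_field M\<^esub>}.
        (\<forall>\<sigma>\<in>tilde M A \<inter> X. positive_in (function_field M) \<sigma> g) \<and>
        (\<forall>\<sigma>\<in>tilde M B \<inter> X. negative_in (function_field M) \<sigma> g))"

end

theory Submission
  imports Defs "HOL-Algebra.Algebraic_Closure_Type" "HOL-Library.Multiset_Order"
    "HOL-Computational_Algebra.Fraction_Field"
begin

text \<open>An ordering of the residue field of a prime ideal \<open>P\<close> is a sign function on the ring of
  polynomial functions that vanishes exactly on \<open>P\<close>. By the Artin--Lang theorem, which follows by
  transferring sign tables from a real closure to the reals, finitely many of its values are attained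
  at a real point. Call \<open>P\<close> separated if \<open>A\<close> and \<open>B\<close> are separated on the orderings of the function
  field that are compatible with \<open>P\<close>. All primes between the ideal \<open>I\<close> of \<open>M\<close> and a point are
  separated, by induction from the larger primes to the smaller ones; the case \<open>P = I\<close> is the theorem.

  Derivations dual to local parameters lift orderings of the residue field of \<open>P\<close> to the function
  field. If \<open>P\<close> contains a wall, the hypothesis applies, because the local ring of the wall is a
  discrete valuation ring (Krull's intersection theorem, applied with an Euler operator). Otherwise,
  by normal crossings, the formulas that describe \<open>A\<close> and \<open>B\<close> depend only on the ordering of the
  residue field. If \<open>P\<close> were not separated, there would be a semiordering of that field which is
  nonnegative on the functions \<open>f + g\<close> with \<open>f >= 0\<close> on \<open>A\<close> and \<open>g >= 0\<close> on \<open>B\<close>. As \<open>M\<close> is compact,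
  its infinitely small elements are the ideal of a point, its valuation singles out a larger prime
  ideal, and a separating function for this prime leads to a contradiction.\<close>

hide_const (open) up_ring.coeff up_ring.monom Polynomials.degree Polynomials.lead_coeff Coset.order module.smult

no_notation var (\<open>X\<index>\<close>)

text \<open>The obstacle in the induction is that a function separating at a larger prime
  \<open>P'\<close> controls only the orderings for which \<open>P'\<close> is convex. At the others
  some \<open>z\<close> in \<open>P'\<close> is at least as large in absolute value as some
  \<open>u\<close> outside \<open>P'\<close>. Compactness of the space of orderings merges these
  alternatives into one inequality, whose high powers bound the error of the separating function
  \<open>h\<close>. In the valuation of the semiordering this says that a multiple of
  \<open>h\<close> is smaller than all powers of one infinitely small element, which forces it into
  \<open>P\<close>. Only a semiordering is obtained because the set of sums \<open>f + g\<close> is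
  a module over the functions nonnegative on both sets, with no claim about products; comparing
  squares still gives a valuation. Dimension theory enters only through lengths of prime chains,
  which a count of monomials bounds by the number of variables. This bound makes repeated lifting
  stop and shows that the dual derivations preserve \<open>I\<close>. Signs on the ring of all
  polynomial functions take the place of ordered fields, since the residue field changes with
  \<open>P\<close>.\<close>

class rcf = linordered_field +
  assumes ivt_sum: "x < y ==> (\<Sum>k\<le>n. c k * x ^ k) < 0 ==> 0 < (\<Sum>k\<le>n. c k * y ^ k)
    ==> \<exists>z>x. z < y & (\<Sum>k\<le>n. c k * z ^ k) = 0"

text \<open>The class axiom speaks of coefficient sums, which keeps the type \<open>poly\<close> out
  of the class specification; this is its usual form.\<close>

lemma poly_ivt:
  fixes p :: "'a::rcf poly"
  shows "x < y ==> poly p x < 0 ==> 0 < poly p y ==> \<exists>z>x. z < y & poly p z = 0"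
  using ivt_sum[of x y "coeff p" "degree p"] by (simp add: poly_altdef)

instance real :: rcf
proof
  fix x y :: real and c n
  assume "x < y" "(\<Sum>k\<le>n. c k * x ^ k) < 0" "0 < (\<Sum>k\<le>n. c k * y ^ k)"
  thus "\<exists>z>x. z < y & (\<Sum>k\<le>n. c k * z ^ k) = 0"
    using IVT'[of "\<lambda>x. (\<Sum>k\<le>n. c k * x ^ k)" x 0 y]
    by (fastforce simp: le_less intro!: continuous_intros)
qed

text \<open>Integer values make the signs in different ordered rings comparable.\<close>

definition sg :: "'a::linordered_idom => int" where
  "sg x = (if x > 0 then 1 else if x = 0 then 0 else - 1)"

lemma sg_simps [simp]:
  "sg (0::'a::linordered_idom) = 0" "sg (1::'a) = 1" "sg (- x :: 'a) = - sg x"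
  by (auto simp: sg_def)

lemma sg_eq_iff [simp]:
  fixes x :: "'a::linordered_idom"
  shows "sg x = 1 \<longleftrightarrow> x > 0" "sg x = - 1 \<longleftrightarrow> x < 0" "sg x = 0 \<longleftrightarrow> x = 0"
  by (auto simp: sg_def)

lemma sg_mult: "sg (x * y) = sg x * sg (y::'a::linordered_idom)"
  by (auto simp: sg_def zero_less_mult_iff not_less order_le_less mult_neg_neg)

lemma sg_cases: "sg (x::'a::linordered_idom) \<in> {- 1, 0, 1}"
  by (simp add: sg_def)

subsection \<open>Polynomials over real closed fields\<close>

lemma poly_ivt_sg:
  fixes p :: "'a::rcf poly"
  assumes "x < y" "sg (poly p x) * sg (poly p y) = - 1"
  shows "\<exists>z>x. z < y & poly p z = 0"
proof (cases "poly p x < 0")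
  case True
  thus ?thesis using poly_ivt[OF assms(1), of p] assms(2) by (auto simp: sg_def split: if_splits)
next
  case False
  thus ?thesis using poly_ivt[OF assms(1), of "- p"] assms(2) by (auto simp: sg_def split: if_splits)
qed

lemma sg_const_on:
  fixes p :: "'a::rcf poly"
  assumes "x < y" "!!z. x <= z ==> z <= y ==> poly p z ~= 0"
  shows "sg (poly p x) = sg (poly p y)"
proof -
  have "sg (poly p x) * sg (poly p y) ~= - 1"
    using poly_ivt_sg[OF assms(1), of p] assms(2) by force
  thus ?thesis using assms by (auto simp: sg_def split: if_splits)
qed

lemma poly_rolle:
  fixes p :: "'a::rcf poly"
  assumes ab: "a < b" and pa: "poly p a = 0" and pb: "poly p b = 0"
  shows "\<exists>c>a. c < b & poly (pderiv p) c = 0"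
proof (cases "p = 0")
  case True
  thus ?thesis using dense[OF ab] by auto
next
  case False
  define R where "R = {x. poly p x = 0 & a < x & x <= b}"
  have finR: "finite R" unfolding R_def using poly_roots_finite[OF False] by auto
  define b' where "b' = Min R"
  have ab': "a < b'" and b'b: "b' <= b" and pb': "poly p b' = 0" using ab pb finR Min_in by (auto simp: R_def b'_def)
  have noroot: "poly p x ~= 0" if "a < x" "x < b'" for x
  proof
    assume "poly p x = 0"
    hence "b' <= x" using that b'b finR by (auto simp: R_def b'_def)
    thus False using that by simp
  qed
  define m where "m = order a p"
  obtain q1 where q1: "p = [:- a, 1:] ^ m * q1" "\<not> [:- a, 1:] dvd q1"
    using order_decomp[OF False, of a] m_def by blast
  have q1n: "q1 ~= 0" using q1 by auto
  have q1a: "poly q1 a ~= 0" using q1(2) poly_eq_0_iff_dvd by blast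
  define k where "k = order b' q1"
  obtain q where q: "q1 = [:- b', 1:] ^ k * q" "\<not> [:- b', 1:] dvd q"
    using order_decomp[OF q1n, of b'] k_def by blast
  have qa: "poly q a ~= 0" using q1a q by auto
  have qb: "poly q b' ~= 0" using q(2) poly_eq_0_iff_dvd by blast
  have peq: "p = [:- a, 1:] ^ m * ([:- b', 1:] ^ k * q)" using q1 q by simp
  have m0: "m > 0" using q1 pa q1a by (cases m) auto
  have k0: "k > 0"
    using peq qb ab' pb' by auto
  have qsame: "sg (poly q a) = sg (poly q b')"
  proof (rule sg_const_on[OF ab'])
    fix z assume z: "a <= z" "z <= b'"
    show "poly q z ~= 0"
    proof (cases "z = a | z = b'")
      case True thus ?thesis using qa qb by auto
    next
      case False
      thus ?thesis using noroot z peq by auto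
    qed
  qed
  obtain m' where m': "m = Suc m'" using m0 by (cases m) auto
  obtain k' where k': "k = Suc k'" using k0 by (cases k) auto
  \<comment> \<open>\<open>r\<close> is what remains of \<open>pderiv p\<close> after one power less
    of each linear factor is split off; at \<open>a\<close> and at \<open>b'\<close> only one
    summand survives.\<close>
  define r where "r = smult (of_nat m) ([:- b', 1:] * q) + smult (of_nat k) ([:- a, 1:] * q)
     + [:- a, 1:] * [:- b', 1:] * pderiv q"
  have pd: "pderiv p = [:- a, 1:] ^ m' * [:- b', 1:] ^ k' * r"
  proof -
    define A where "A = [:- a, 1:]"
    define B where "B = [:- b', 1:]"
    have dA: "pderiv A = 1" and dB: "pderiv B = 1" by (simp_all add: A_def B_def pderiv_pCons)
    have "pderiv p = A ^ m * pderiv (B ^ k * q) + (B ^ k * q) * (smult (of_nat m) (A ^ m'))"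
      unfolding peq A_def[symmetric] B_def[symmetric] pderiv_mult using m'
      by (simp add: pderiv_power_Suc dA del: power_Suc)
    also have "pderiv (B ^ k * q) = B ^ k * pderiv q + q * (smult (of_nat k) (B ^ k'))"
      unfolding pderiv_mult using k' by (simp add: pderiv_power_Suc dB del: power_Suc)
    finally show ?thesis
      unfolding r_def m' k' A_def[symmetric] B_def[symmetric]
      by (simp add: algebra_simps smult_add_right)
  qed
  have ra: "poly r a = of_nat m * (a - b') * poly q a" unfolding r_def by (simp add: algebra_simps)
  have "sg (poly r a) = - sg (poly q a)"
    using ab' m0 by (simp add: ra sg_mult) (simp add: sg_def)
  moreover have "sg (poly r b') = sg (poly q b')" using ab' k0 by (auto simp: r_def algebra_simps sg_def)
  ultimately have "sg (poly r a) * sg (poly r b') = - 1"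
    using qsame qa qb by (auto simp: sg_def split: if_splits)
  from poly_ivt_sg[OF ab' this] obtain z where "z > a" "z < b'" "poly r z = 0" by blast
  thus ?thesis using b'b pd by (intro exI[of _ z]) auto
qed

lemma poly_mvt:
  fixes p :: "'a::rcf poly"
  assumes ab: "a < b"
  shows "\<exists>c>a. c < b & poly p b - poly p a = (b - a) * poly (pderiv p) c"
proof -
  define g where "g = smult (b - a) p - smult (poly p b - poly p a) [:- a, 1:] - [: (b - a) * poly p a :]"
  have "poly g a = 0" "poly g b = 0" by (simp_all add: g_def algebra_simps)
  from poly_rolle[OF ab this] obtain c where c: "c > a" "c < b" "poly (pderiv g) c = 0" by blast
  show ?thesis using c by (auto simp: g_def pderiv_diff pderiv_smult pderiv_pCons)
qed

text \<open>The uniform bound \<open>e\<close> carries the induction: \<open>y * e\<close>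
  eventually exceeds the absolute value of the next constant coefficient.\<close>

lemma poly_eventually_ge:
  fixes p :: "'a::linordered_field poly"
  assumes "lead_coeff p > 0"
  shows "\<exists>B>0. \<exists>e>0. \<forall>y\<ge>B. poly p y >= e"
  using assms
proof (induction p)
  case 0 thus ?case by simp
next
  case (pCons a q)
  show ?case
  proof (cases "q = 0")
    case True
    thus ?thesis using pCons.prems by (intro exI[of _ 1] conjI exI[of _ a]) auto
  next
    case False
    then obtain B e where B: "B > 0" "e > 0" "!!y. y >= B ==> poly q y >= e" using pCons.prems pCons.IH by auto
    define B' where "B' = max B ((\<bar>a\<bar> + 1) / e)"
    have "poly (pCons a q) y >= 1" if y: "y >= B'" for y
    proof -
      have "y >= B" "y >= (\<bar>a\<bar> + 1) / e" using y by (auto simp: B'_def)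
      hence "y * e >= \<bar>a\<bar> + 1" "y > 0" using B by (auto simp: field_simps)
      moreover have "y * poly q y >= y * e" using B(3)[OF \<open>y >= B\<close>] \<open>y > 0\<close> by simp
      ultimately show ?thesis by (simp; linarith)
    qed
    moreover have "B' > 0" using B by (auto simp: B'_def)
    ultimately show ?thesis by (intro exI[of _ B'] conjI exI[of _ 1]) auto
  qed
qed

lemma sg_poly_at_top:
  fixes p :: "'a::linordered_field poly"
  shows "\<exists>B. \<forall>y\<ge>B. sg (poly p y) = sg (lead_coeff p)"
proof (cases "lead_coeff p = 0")
  case True thus ?thesis by simp
next
  case False
  have *: "\<exists>B. \<forall>y\<ge>B. sg (poly q y) = 1" if "lead_coeff q > 0" for q :: "'a poly"
    using poly_eventually_ge[OF that] by (force simp: intro: less_le_trans)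
  show ?thesis
  proof (cases "lead_coeff p > 0")
    case True thus ?thesis using *[OF True] by (metis sg_eq_iff(1))
  next
    case f: False
    have neg: "lead_coeff p < 0" using f False by (metis linorder_neqE)
    hence "lead_coeff (- p) > 0" by (simp add: lead_coeff_minus)
    from *[OF this] obtain B where "\<forall>y\<ge>B. sg (poly (- p) y) = 1" by blast
    hence "\<forall>y\<ge>B. sg (poly p y) = - 1" by auto
    moreover have "sg (lead_coeff p) = - 1" using neg by simp
    ultimately show ?thesis by metis
  qed
qed

lemma sg_poly_at_bot:
  fixes p :: "'a::linordered_field poly"
  shows "\<exists>B. \<forall>y\<le>B. sg (poly p y) = (- 1) ^ degree p * sg (lead_coeff p)"
proof -
  define q where "q = pcompose p [:0, - 1:]"
  have q: "poly q y = poly p (- y)" for y by (simp add: q_def poly_pcompose)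
  have lc: "lead_coeff q = lead_coeff p * (- 1) ^ degree p"
    unfolding q_def by (subst lead_coeff_comp) auto
  obtain B where B: "\<forall>y\<ge>B. sg (poly q y) = sg (lead_coeff q)" using sg_poly_at_top by blast
  have "sg (lead_coeff q) = (- 1) ^ degree p * sg (lead_coeff p)"
    unfolding lc sg_mult by (cases "even (degree p)") auto
  thus ?thesis using B q by (metis le_minus_iff minus_minus)
qed

subsection \<open>Sign tables\<close>

text \<open>Corresponding positions: either two matching points of \<open>X\<close> and its image,
  or two points in corresponding gaps.\<close>

definition cut_match :: "'a::linorder set => ('a => 'b::linorder) => 'a => 'b => bool" where
  "cut_match X f y y' \<longleftrightarrow>
     (y \<in> X & y' = f y) | (y ~: X & y' ~: f ` X & (\<forall>x\<in>X. y < x \<longleftrightarrow> y' < f x))"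

text \<open>The classical sign diagram without sample points: finite sets containing all roots of
  the nonzero polynomials, matched by an order isomorphism, such that paired polynomials have equal
  signs at corresponding positions. Points that are no roots are allowed.\<close>

definition sign_table :: "('a::rcf poly \<times> 'b::rcf poly) set => 'a set => ('a => 'b) => bool" where
  "sign_table Z X f \<longleftrightarrow> finite X & strict_mono_on X f &
     (\<forall>(p, q)\<in>Z. (p ~= 0 --> (\<forall>x. poly p x = 0 --> x \<in> X)) &
                 (q ~= 0 --> (\<forall>x. poly q x = 0 --> x \<in> f ` X))) &
     (\<forall>y y'. cut_match X f y y' --> (\<forall>(p, q)\<in>Z. sg (poly p y) = sg (poly q y')))"

lemma sign_tableD:
  assumes "sign_table Z X f"
  shows "finite X" "strict_mono_on X f"
    "!!p q x. (p, q) \<in> Z ==> p ~= 0 ==> poly p x = 0 ==> x \<in> X"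
    "!!p q x. (p, q) \<in> Z ==> q ~= 0 ==> poly q x = 0 ==> x \<in> f ` X"
    "!!p q y y'. (p, q) \<in> Z ==> cut_match X f y y' ==> sg (poly p y) = sg (poly q y')"
  using assms unfolding sign_table_def by fast+

lemma strict_mono_on_less_iff:
  fixes f :: "'a::linorder => 'b::linorder"
  assumes "strict_mono_on X f" "x \<in> X" "y \<in> X"
  shows "f x < f y \<longleftrightarrow> x < y"
  using assms by (metis linorder_neqE_linordered_idom less_imp_not_less linorder_neqE not_less_iff_gr_or_eq strict_mono_onD)

lemma strict_mono_on_imp_inj:
  fixes f :: "'a::linorder => 'b::linorder"
  shows "strict_mono_on X f ==> inj_on f X"
  by (rule strict_mono_on_imp_inj_on)

lemma cut_match_sym:
  assumes "strict_mono_on X f" "cut_match X f y y'"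
  shows "cut_match (f ` X) (inv_into X f) y' y"
proof -
  have inj: "inj_on f X" using assms(1) strict_mono_on_imp_inj by blast
  have iv: "inv_into X f (f x) = x" if "x \<in> X" for x using inj that by simp
  show ?thesis
    using assms(2) iv by (fastforce simp: cut_match_def)
qed

lemma strict_mono_on_inv:
  fixes f :: "'a::linorder => 'b::linorder"
  assumes "strict_mono_on X f"
  shows "strict_mono_on (f ` X) (inv_into X f)"
  using strict_mono_on_less_iff[OF assms] by (auto simp: assms strict_mono_on_imp_inj intro!: strict_mono_onI)

lemma inv_inv_on:
  assumes "inj_on f X" "x \<in> X" shows "inv_into (f ` X) (inv_into X f) x = f x"
proof -
  have "inj_on (inv_into X f) (f ` X)" by (rule inj_on_inv_into) simp
  thus ?thesis using assms by (metis imageI inv_into_f_f)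
qed

lemma cut_match_sym':
  assumes "strict_mono_on X f" "cut_match (f ` X) (inv_into X f) y' y"
  shows "cut_match X f y y'"
proof -
  have inj: "inj_on f X" using assms(1) strict_mono_on_imp_inj by blast
  have 1: "cut_match X (inv_into (f ` X) (inv_into X f)) y y'" using inj cut_match_sym[OF strict_mono_on_inv[OF assms(1)] assms(2)] by (simp add: inv_into_image_cancel)
  thus ?thesis using inv_inv_on[OF inj] unfolding cut_match_def by (auto simp: image_iff)
qed

text \<open>The exchange of sides lets statements about the left polynomials be used for the right
  ones.\<close>

lemma sign_table_sym:
  assumes "sign_table Z X f"
  shows "sign_table (Z\<inverse>) (f ` X) (inv_into X f)"
proof -
  note D = sign_tableD[OF assms]
  show ?thesis using strict_mono_on_imp_inj[OF D(2)] D strict_mono_on_inv[OF D(2)] cut_match_sym'[OF D(2)] by (fastforce simp: sign_table_def)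
qed

lemma finite_between:
  fixes A B :: "'a::linordered_field set"
  assumes "finite A" "finite B" "!!a b. a \<in> A ==> b \<in> B ==> a < b"
  shows "\<exists>z. (\<forall>a\<in>A. a < z) & (\<forall>b\<in>B. z < b)"
proof -
  consider "A = {}" "B = {}" | "A ~= {}" "B = {}" | "A = {}" "B ~= {}" | "A ~= {}" "B ~= {}" by blast
  thus ?thesis
  proof cases
    case 2
    obtain z where "Max A < z" using gt_ex by blast
    thus ?thesis using 2 assms Max_less_iff by auto
  next
    case 3
    obtain z where "z < Min B" using lt_ex by blast
    thus ?thesis using 3 assms Min_gr_iff by auto
  next
    case 4
    hence "Max A < Min B" using assms by auto
    then obtain z where "Max A < z" "z < Min B" using dense by blast
    thus ?thesis using 4 assms Max_less_iff Min_gr_iff by auto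
  qed auto
qed

lemma cut_match_ex:
  fixes f :: "'a::linordered_field => 'b::linordered_field"
  assumes "finite X" "strict_mono_on X f"
  shows "\<exists>y'. cut_match X f y y'"
proof (cases "y \<in> X")
  case True thus ?thesis by (auto simp: cut_match_def)
next
  case False
  have "\<exists>z. (\<forall>a\<in>f ` {x\<in>X. x < y}. a < z) & (\<forall>b\<in>f ` {x\<in>X. y < x}. z < b)"
    by (rule finite_between) (use assms strict_mono_on_less_iff[OF assms(2)] in auto)
  then obtain z where z: "\<forall>x\<in>X. x < y --> f x < z" "\<forall>x\<in>X. y < x --> z < f x" by auto
  have "f x < z | z < f x" if "x \<in> X" for x
    using that z False by (metis linorder_neqE)
  hence "z ~: f ` X" by auto
  thus ?thesis using z False by (fastforce simp: cut_match_def)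
qed

lemma cut_match_ex':
  fixes f :: "'a::linordered_field => 'b::linordered_field"
  assumes "finite X" "strict_mono_on X f"
  shows "\<exists>y. cut_match X f y y'"
  using cut_match_ex[OF finite_imageI[OF assms(1)] strict_mono_on_inv[OF assms(2)]]
    cut_match_sym'[OF assms(2)] by blast

section \<open>Inserting a polynomial into a sign table that contains its derivative\<close>

lemma pderiv_sg_mono:
  fixes p :: "'a::rcf poly"
  assumes "a < b" "!!z. a < z ==> z < b ==> sg (poly (pderiv p) z) = s"
  shows "sg (poly p b - poly p a) = s"
proof -
  obtain c where "a < c" "c < b" "poly p b - poly p a = (b - a) * poly (pderiv p) c"
    using poly_mvt[OF assms(1)] by blast
  thus ?thesis using assms by (auto simp: sg_mult)
qed

text \<open>With the derivatives in the table both polynomials are strictly monotone in every gap.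
  Equal degrees and leading signs make the signs agree at both infinities.\<close>

definition insertable :: "('a::rcf poly \<times> 'b::rcf poly) set => 'a set => ('a => 'b) => 'a poly => 'b poly => bool" where
  "insertable Z X f p q \<longleftrightarrow> sign_table Z X f & (pderiv p, pderiv q) \<in> Z & pderiv p ~= 0 & pderiv q ~= 0 &
     degree p = degree q & sg (lead_coeff p) = sg (lead_coeff q) &
     (\<forall>x\<in>X. sg (poly p x) = sg (poly q (f x)))"

lemma insertable_sym:
  assumes "insertable Z X f p q"
  shows "insertable (Z\<inverse>) (f ` X) (inv_into X f) q p"
proof -
  have "inj_on f X" using assms by (auto simp: insertable_def sign_table_def intro: strict_mono_on_imp_inj)
  thus ?thesis using assms sign_table_sym unfolding insertable_def by auto
qed

text \<open>The nearest table point to the left serves; if there is none, a point so far out that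
  degree and leading coefficient decide the sign.\<close>

lemma insertable_left:
  assumes "insertable Z X f p q" "y ~: X" "cut_match X f y y'"
  shows "\<exists>a a'. a < y & a' < y' & sg (poly p a) = sg (poly q a') &
      (\<forall>x\<in>X. \<not> (a < x & x < y)) & (\<forall>x\<in>X. \<not> (a' < f x & f x < y'))"
proof -
  note D = sign_tableD[of Z X f]
  have st: "sign_table Z X f" using assms by (simp add: insertable_def)
  note D = sign_tableD[OF st]
  have cm: "y' ~: f ` X" "!!x. x \<in> X ==> y < x \<longleftrightarrow> y' < f x" using assms by (auto simp: cut_match_def)
  have cm': "x < y \<longleftrightarrow> f x < y'" if "x \<in> X" for x
    using cm that assms(2) by (metis image_eqI less_asym linorder_neqE)
  define L where "L = {x\<in>X. x < y}"
  have finL: "finite L" using D by (simp add: L_def)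
  show ?thesis
  proof (cases "L = {}")
    case False
    define l where "l = Max L"
    have l: "l \<in> L" using False finL by (simp add: l_def)
    have lm: "x <= l" if "x \<in> X" "x < y" for x using that finL by (simp add: l_def L_def)
    show ?thesis
    proof (intro exI[of _ l] exI[of _ "f l"] conjI ballI)
      show "l < y" "f l < y'" using l cm' by (auto simp: L_def)
      show "sg (poly p l) = sg (poly q (f l))" using l assms(1) by (auto simp: L_def insertable_def)
      fix x assume x: "x \<in> X"
      show "\<not> (l < x & x < y)" using lm[OF x] by auto
      show "\<not> (f l < f x & f x < y')"
        using lm[OF x] cm'[OF x] l strict_mono_on_less_iff[OF D(2)] x by (auto simp: L_def)
    qed
  next
    case True
    obtain B where B: "!!z. z <= B ==> sg (poly p z) = (- 1) ^ degree p * sg (lead_coeff p)"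
      using sg_poly_at_bot by blast
    obtain B' where B': "!!z. z <= B' ==> sg (poly q z) = (- 1) ^ degree q * sg (lead_coeff q)"
      using sg_poly_at_bot by blast
    define a where "a = min B (y - 1)"
    define a' where "a' = min B' (y' - 1)"
    show ?thesis
    proof (intro exI[of _ a] exI[of _ a'] conjI ballI)
      show "a < y" "a' < y'" by (auto simp: a_def a'_def min_less_iff_disj)
      show "sg (poly p a) = sg (poly q a')"
        using B[of a] B'[of a'] assms(1) by (metis a_def a'_def insertable_def min.cobounded1)
      fix x assume x: "x \<in> X"
      show "\<not> (a < x & x < y)" using x True by (auto simp: L_def)
      show "\<not> (a' < f x & f x < y')" using x True cm' by (auto simp: L_def)
    qed
  qed
qed

lemma insertable_right:
  assumes "insertable Z X f p q" "y ~: X" "cut_match X f y y'"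
  shows "\<exists>a a'. y < a & y' < a' & sg (poly p a) = sg (poly q a') &
      (\<forall>x\<in>X. \<not> (y < x & x < a)) & (\<forall>x\<in>X. \<not> (y' < f x & f x < a'))"
proof -
  have st: "sign_table Z X f" using assms by (simp add: insertable_def)
  note D = sign_tableD[OF st]
  have cm: "y' ~: f ` X" "!!x. x \<in> X ==> y < x \<longleftrightarrow> y' < f x" using assms by (auto simp: cut_match_def)
  define L where "L = {x\<in>X. y < x}"
  have finL: "finite L" using D by (simp add: L_def)
  show ?thesis
  proof (cases "L = {}")
    case False
    define l where "l = Min L"
    have l: "l \<in> L" using False finL by (simp add: l_def)
    have lm: "l <= x" if "x \<in> X" "y < x" for x using that finL by (simp add: l_def L_def)
    show ?thesis
    proof (intro exI[of _ l] exI[of _ "f l"] conjI ballI)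
      show "y < l" "y' < f l" using l cm by (auto simp: L_def)
      show "sg (poly p l) = sg (poly q (f l))" using l assms(1) by (auto simp: L_def insertable_def)
      fix x assume x: "x \<in> X"
      show "\<not> (y < x & x < l)" using lm[OF x] by auto
      show "\<not> (y' < f x & f x < f l)"
        using lm[OF x] cm(2)[OF x] l strict_mono_on_less_iff[OF D(2)] x by (auto simp: L_def)
    qed
  next
    case True
    obtain B where B: "!!z. z >= B ==> sg (poly p z) = sg (lead_coeff p)"
      using sg_poly_at_top by blast
    obtain B' where B': "!!z. z >= B' ==> sg (poly q z) = sg (lead_coeff q)"
      using sg_poly_at_top by blast
    define a where "a = max B (y + 1)"
    define a' where "a' = max B' (y' + 1)"
    show ?thesis
    proof (intro exI[of _ a] exI[of _ a'] conjI ballI)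
      show "y < a" "y' < a'" by (auto simp: a_def a'_def less_max_iff_disj)
      show "sg (poly p a) = sg (poly q a')"
        using B[of a] B'[of a'] assms(1) by (metis a_def a'_def insertable_def max.cobounded1)
      fix x assume x: "x \<in> X"
      show "\<not> (y < x & x < a)" using x True by (auto simp: L_def)
      show "\<not> (y' < f x & f x < a')" using x True cm by (auto simp: L_def)
    qed
  qed
qed

lemma sign_table_sg_const:
  assumes st: "sign_table Z X f" and pq: "(p, q) \<in> Z" and y: "y ~: X"
    and z: "z ~: X" "\<forall>x\<in>X. z < x \<longleftrightarrow> y < x"
  shows "sg (poly p z) = sg (poly p y)"
proof -
  note D = sign_tableD[OF st]
  obtain y' where y': "cut_match X f y y'" using cut_match_ex[OF D(1,2)] by blast
  thus ?thesis by (smt (verit) y z D(5)[OF pq] cut_match_def)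
qed

text \<open>The derivatives have a constant sign \<open>s\<close> in the gap, so a root of
  \<open>p\<close> forces the signs \<open>- s\<close> and \<open>s\<close> at the sample points to
  its left and right. \<open>q\<close> has the same signs at the corresponding points and hence a
  root between them, and no table point intervenes.\<close>

lemma insertable_root:
  assumes ins: "insertable Z X f p q" and y: "y ~: X" and y': "cut_match X f y y'" and py: "poly p y = 0"
  shows "\<exists>z'. cut_match X f y z' & poly q z' = 0"
proof -
  have st: "sign_table Z X f" using ins by (simp add: insertable_def)
  note D = sign_tableD[OF st]
  have pZ: "(pderiv p, pderiv q) \<in> Z" "pderiv p ~= 0" using ins by (auto simp: insertable_def)
  define s where "s = sg (poly (pderiv p) y)"
  have s1: "s = 1 | s = - 1" using D(3)[OF pZ] y sg_cases[of "poly (pderiv p) y"] by (auto simp: s_def)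
  obtain a a' where a: "a < y" "a' < y'" "sg (poly p a) = sg (poly q a')"
    "!!x. x \<in> X ==> \<not> (a < x & x < y)" "!!x. x \<in> X ==> \<not> (a' < f x & f x < y')"
    using insertable_left[OF ins y y'] by blast
  obtain b b' where b: "y < b" "y' < b'" "sg (poly p b) = sg (poly q b')"
    "!!x. x \<in> X ==> \<not> (y < x & x < b)" "!!x. x \<in> X ==> \<not> (y' < f x & f x < b')"
    using insertable_right[OF ins y y'] by blast
  have ab: "sg (poly (pderiv p) z) = s" if z: "a < z" "z < b" for z
    by (smt (verit) z y linorder_neqE a(4) b(4) less_trans s_def sign_table_sg_const[OF st pZ(1) y])
  have "sg (poly p y - poly p a) = s" by (rule pderiv_sg_mono[OF a(1)]) (use ab b in auto)
  hence sa: "sg (poly q a') = - s" using a(3) py by simp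
  have "sg (poly p b - poly p y) = s" by (rule pderiv_sg_mono[OF b(1)]) (use ab a in auto)
  hence sb: "sg (poly q b') = s" using b(3) py by simp
  have "sg (poly q a') * sg (poly q b') = - 1" unfolding sa sb using s1 by auto
  from poly_ivt_sg[OF _ this] obtain z where z: "a' < z" "z < b'" "poly q z = 0"
    using a(2) b(2) by force
  have cm: "y' ~: f ` X" "!!x. x \<in> X ==> y < x \<longleftrightarrow> y' < f x" using y y' by (auto simp: cut_match_def)
  have zX: "z ~: f ` X" using a(5) b(5) z cm by (metis image_iff linorder_neqE)
  moreover have "\<forall>x\<in>X. y < x \<longleftrightarrow> z < f x"
    using cm(1) cm(2) a(5) b(5) z by fastforce
  ultimately show ?thesis using z y by (auto simp: cut_match_def)
qed

lemma insertable_root_unique: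
  assumes ins: "insertable Z X f p q" and "y ~: X" "z ~: X" "\<forall>x\<in>X. y < x \<longleftrightarrow> z < x"
    "poly p y = 0" "poly p z = 0"
  shows "y = z"
proof (rule ccontr)
  assume "y ~= z"
  have st: "sign_table Z X f" using ins by (simp add: insertable_def)
  note D = sign_tableD[OF st]
  have *: False if h: "a < b" "poly p a = 0" "poly p b = 0" "\<forall>x\<in>X. a < x \<longleftrightarrow> b < x" for a b
    using poly_rolle[OF h(1-3)] ins D(3) h(4) by (auto simp: insertable_def)
  show False using *[of y z] *[of z y] \<open>y ~= z\<close> assms by (metis linorder_neqE)
qed

text \<open>If the gap contains a root, the side of the root and the sign of the derivative decide.
  Otherwise the sign is that of the left sample point, or that of the derivative if the left sample
  point is itself a root.\<close>

lemma insertable_sign: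
  assumes ins: "insertable Z X f p q" and y: "y ~: X" and y': "cut_match X f y y'"
    and r: "poly p y ~= 0" "poly q y' ~= 0"
    and ro: "!!z z'. cut_match X f z z' ==> z ~: X ==> poly p z = 0 ==> poly q z' = 0 ==> y < z \<longleftrightarrow> y' < z'"
  shows "sg (poly p y) = sg (poly q y')"
proof -
  have st: "sign_table Z X f" using ins by (simp add: insertable_def)
  note D = sign_tableD[OF st]
  have pZ: "(pderiv p, pderiv q) \<in> Z" "pderiv p ~= 0" "pderiv q ~= 0" using ins by (auto simp: insertable_def)
  have cm: "y' ~: f ` X" "!!x. x \<in> X ==> y < x \<longleftrightarrow> y' < f x" using y y' by (auto simp: cut_match_def)
  have st': "sign_table (Z\<inverse>) (f ` X) (inv_into X f)" using sign_table_sym[OF st] .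
  have dd: "sg (poly (pderiv p) y) = sg (poly (pderiv q) y')" using D(5) pZ(1) y' by blast
  have cs: "sg (poly (pderiv p) z) = sg (poly (pderiv p) y)" if "z ~: X" "\<forall>x\<in>X. z < x \<longleftrightarrow> y < x" for z
    using sign_table_sg_const[OF st pZ(1) y that] .
  have cs': "sg (poly (pderiv q) z) = sg (poly (pderiv q) y')" if "z ~: f ` X" "\<forall>x\<in>X. z < f x \<longleftrightarrow> y' < f x" for z
    by (rule sign_table_sg_const[OF st', of "pderiv q" "pderiv p"]) (use pZ cm that in auto)
  show ?thesis
  proof (cases "\<exists>z. z ~: X & (\<forall>x\<in>X. z < x \<longleftrightarrow> y < x) & poly p z = 0")
    case True
    then obtain z where z: "z ~: X" "\<forall>x\<in>X. z < x \<longleftrightarrow> y < x" "poly p z = 0" by blast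
    then obtain z' where z': "cut_match X f z z'" "poly q z' = 0" by (smt (verit) cm insertable_root[OF ins z(1) _ z(3)] cut_match_def)
    have zz: "z' ~: f ` X" "!!x. x \<in> X ==> z < x \<longleftrightarrow> z' < f x" using z z' by (auto simp: cut_match_def)
    have iff: "y < z \<longleftrightarrow> y' < z'" using ro[OF z'(1) z(1,3) z'(2)] .
    have ne: "y ~= z" "y' ~= z'" using r z z' by auto
    have zi: "\<forall>x\<in>X. z' < f x \<longleftrightarrow> y' < f x" using z zz cm by auto
    have bt: "sg (poly (pderiv p) w) = sg (poly (pderiv p) y)" if "min y z < w" "w < max y z" for w
    proof -
      have wX: "w ~: X" using that z(2) y z(1) by (auto simp: min_def max_def split: if_splits)
      show ?thesis
      proof (rule cs[OF wX], rule ballI)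
        fix x assume x: "x \<in> X"
        show "w < x \<longleftrightarrow> y < x" using bspec[OF z(2) x] that by (auto simp: min_def max_def split: if_splits)
      qed
    qed
    have bt': "sg (poly (pderiv q) w) = sg (poly (pderiv q) y')" if "min y' z' < w" "w < max y' z'" for w
    proof -
      have wX: "w ~: f ` X" using that zi cm(1) zz(1) by (auto simp: min_def max_def split: if_splits)
      show ?thesis
      proof (rule cs'[OF wX], rule ballI)
        fix x assume x: "x \<in> X"
        show "w < f x \<longleftrightarrow> y' < f x" using bspec[OF zi x] that by (auto simp: min_def max_def split: if_splits)
      qed
    qed
    show ?thesis
    proof (cases "y < z")
      case True
      have "sg (poly p z - poly p y) = sg (poly (pderiv p) y)"
        by (rule pderiv_sg_mono[OF True]) (use bt True in auto)
      moreover have "sg (poly q z' - poly q y') = sg (poly (pderiv q) y')"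
        by (rule pderiv_sg_mono) (use bt' True iff in auto)
      ultimately show ?thesis using z z' dd by simp
    next
      case False
      hence lt: "z < y" "z' < y'" using ne iff by auto
      have "sg (poly p y - poly p z) = sg (poly (pderiv p) y)"
        by (rule pderiv_sg_mono[OF lt(1)]) (use bt lt in auto)
      moreover have "sg (poly q y' - poly q z') = sg (poly (pderiv q) y')"
        by (rule pderiv_sg_mono[OF lt(2)]) (use bt' lt in auto)
      ultimately show ?thesis using z z' dd by simp
    qed
  next
    case nor: False
    have nor': "\<not> (\<exists>z. z ~: f ` X & (\<forall>x\<in>X. z < f x \<longleftrightarrow> y' < f x) & poly q z = 0)"
    proof
      assume "\<exists>z. z ~: f ` X & (\<forall>x\<in>X. z < f x \<longleftrightarrow> y' < f x) & poly q z = 0"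
      then obtain z where z: "z ~: f ` X" "\<forall>x\<in>X. z < f x \<longleftrightarrow> y' < f x" "poly q z = 0" by blast
      have "cut_match (f ` X) (inv_into X f) z y" by (smt (verit) z cm y cut_match_sym D(2) cut_match_def)
      from insertable_root[OF insertable_sym[OF ins] z(1) this z(3)] obtain w
        where w: "cut_match (f ` X) (inv_into X f) z w" "poly p w = 0" by blast
      hence "cut_match X f w z" using cut_match_sym' D(2) by blast
      thus False using nor w z cm by (auto simp: cut_match_def)
    qed
    obtain a a' where a: "a < y" "a' < y'" "sg (poly p a) = sg (poly q a')"
      "!!x. x \<in> X ==> \<not> (a < x & x < y)" "!!x. x \<in> X ==> \<not> (a' < f x & f x < y')"
      using insertable_left[OF ins y y'] by blast
    have in1: "w ~: X & (\<forall>x\<in>X. w < x \<longleftrightarrow> y < x)" if "a < w" "w <= y" for w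
      using that a(4) y by (metis less_trans linorder_neqE order_le_less less_asym)
    have in2: "w ~: f ` X & (\<forall>x\<in>X. w < f x \<longleftrightarrow> y' < f x)" if "a' < w" "w <= y'" for w
    proof -
      have "w ~: f ` X" using that a(5) cm(1) by (metis image_iff order_le_less)
      moreover have "w < f x \<longleftrightarrow> y' < f x" if "x \<in> X" for x
      proof -
        have "f x ~= y'" using cm(1) that by blast
        thus ?thesis using a(5)[OF that] \<open>a' < w\<close> \<open>w <= y'\<close> by auto
      qed
      ultimately show ?thesis by blast
    qed
    have nr1: "poly p w ~= 0" if "a < w" "w <= y" for w using in1[OF that] nor by blast
    have nr2: "poly q w ~= 0" if "a' < w" "w <= y'" for w using in2[OF that] nor' by blast
    show ?thesis
    proof (cases "poly p a = 0")
      case True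
      hence "poly q a' = 0" using a(3) by (metis sg_eq_iff(3))
      have "sg (poly p y - poly p a) = sg (poly (pderiv p) y)"
        by (rule pderiv_sg_mono[OF a(1)]) (meson cs in1 less_imp_le)
      moreover have "sg (poly q y' - poly q a') = sg (poly (pderiv q) y')"
        by (rule pderiv_sg_mono[OF a(2)]) (meson cs' in2 less_imp_le)
      ultimately show ?thesis using True \<open>poly q a' = 0\<close> dd by simp
    next
      case False
      hence "poly q a' ~= 0" using a(3) by (metis sg_eq_iff(3))
      have "sg (poly p a) = sg (poly p y)"
        by (rule sg_const_on[OF a(1)]) (use nr1 False in "auto simp: order_le_less")
      moreover have "sg (poly q a') = sg (poly q y')"
        by (rule sg_const_on[OF a(2)]) (use nr2 \<open>poly q a' ~= 0\<close> in "auto simp: order_le_less")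
      ultimately show ?thesis using a(3) by simp
    qed
  qed
qed

text \<open>The new points are the roots \<open>N\<close> of \<open>p\<close> outside the table,
  sent to the roots of \<open>q\<close> in the corresponding gaps. By Rolle's theorem a gap contains
  at most one root.\<close>

lemma sign_table_insert:
  assumes ins: "insertable Z X f p q"
  shows "\<exists>X' f'. sign_table (insert (p, q) Z) X' f'"
proof -
  have st: "sign_table Z X f" using ins by (simp add: insertable_def)
  note D = sign_tableD[OF st]
  have p0: "p ~= 0" "q ~= 0" using ins by (auto simp: insertable_def)
  define N where "N = {y. y ~: X & poly p y = 0}"
  have finN: "finite N" using poly_roots_finite[OF p0(1)] by (simp add: N_def)
  define g where "g y = (SOME z. cut_match X f y z & poly q z = 0)" for y
  have g: "cut_match X f y (g y)" "poly q (g y) = 0" if "y \<in> N" for y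
  proof -
    have "\<exists>z. cut_match X f y z & poly q z = 0"
      using insertable_root[OF ins] cut_match_ex[OF D(1,2)] that unfolding N_def by blast
    thus "cut_match X f y (g y)" "poly q (g y) = 0" unfolding g_def by (metis (mono_tags, lifting) someI_ex)+
  qed
  have gn: "g y ~: f ` X" "!!x. x \<in> X ==> y < x \<longleftrightarrow> g y < f x" "!!x. x \<in> X ==> x < y \<longleftrightarrow> f x < g y"
    if "y \<in> N" for y
  proof -
    show 1: "g y ~: f ` X" and 2: "!!x. x \<in> X ==> y < x \<longleftrightarrow> g y < f x"
      using g(1)[OF that] that by (auto simp: cut_match_def N_def)
    show "x < y \<longleftrightarrow> f x < g y" if x: "x \<in> X" for x
      using 1 2[OF x] x \<open>y \<in> N\<close> unfolding N_def by (metis (no_types, lifting) image_eqI less_asym linorder_neqE mem_Collect_eq)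
  qed
  define X' where "X' = X \<union> N"
  define f' where "f' x = (if x \<in> X then f x else g x)" for x
  have fX: "f' x = f x" if "x \<in> X" for x using that by (simp add: f'_def)
  have fN: "f' x = g x" if "x \<in> N" for x using that by (simp add: f'_def N_def)
  have fim: "f' ` X' = f ` X \<union> g ` N" unfolding X'_def using fX fN by (auto simp: image_Un)
  have mono: "strict_mono_on X' f'"
  proof (rule strict_mono_onI)
    fix r s assume rs: "r \<in> X'" "s \<in> X'" "r < s"
    consider "r \<in> X" "s \<in> X" | "r \<in> X" "s \<in> N" | "r \<in> N" "s \<in> X" | "r \<in> N" "s \<in> N"
      using rs by (auto simp: X'_def)
    thus "f' r < f' s"
    proof cases
      case 1 thus ?thesis using rs fX strict_mono_on_less_iff[OF D(2)] by simp
    next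
      case 2 thus ?thesis using rs fX fN gn by simp
    next
      case 3 thus ?thesis using rs fX fN gn by simp
    next
      case 4
      obtain x where x: "x \<in> X" "\<not> (r < x \<longleftrightarrow> s < x)" using insertable_root_unique[OF ins, of r s] 4 rs by (auto simp: N_def)
      thus ?thesis using rs 4 fN gn(2)[of r x] gn(3)[of s x] by (auto simp: N_def not_less order_le_less)
    qed
  qed
  have inv: "insertable (Z\<inverse>) (f ` X) (inv_into X f) q p" using insertable_sym[OF ins] .
  have qroots: "z \<in> f' ` X'" if qz: "poly q z = 0" for z
  proof (cases "z \<in> f ` X")
    case False
    obtain y0 where "cut_match X f y0 z" using cut_match_ex'[OF D(1,2)] by blast
    hence "cut_match (f ` X) (inv_into X f) z y0" using cut_match_sym D(2) by blast
    from insertable_root[OF inv False this qz] obtain y where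
      y: "cut_match (f ` X) (inv_into X f) z y" "poly p y = 0" by blast
    have yz: "cut_match X f y z" using cut_match_sym' D(2) y by blast
    hence yN: "y \<in> N" using False y by (auto simp: N_def cut_match_def)
    show ?thesis using yz yN gn(2)[OF yN] fim insertable_root_unique[OF inv False gn(1)[OF yN] _ qz g(2)[OF yN]] by (auto simp: N_def cut_match_def)
  qed (use fim in auto)
  have cm: "cut_match X f y y'" if "cut_match X' f' y y'" for y y'
  proof -
    consider "y \<in> X" | "y \<in> N" | "y ~: X'" by (auto simp: X'_def)
    thus ?thesis
    proof cases
      case 1
      thus ?thesis using that fX by (auto simp: cut_match_def X'_def)
    next
      case 2
      thus ?thesis using that fN g by (auto simp: cut_match_def X'_def)
    next
      case 3
      thus ?thesis using that fim fX by (auto simp: cut_match_def X'_def)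
    qed
  qed
  have sgp: "sg (poly p y) = sg (poly q y')" if c: "cut_match X' f' y y'" for y y'
  proof -
    consider "y \<in> X" | "y \<in> N" | "y ~: X'" by (auto simp: X'_def)
    thus ?thesis
    proof cases
      case 1
      thus ?thesis using c fX ins by (auto simp: cut_match_def X'_def insertable_def)
    next
      case 2
      thus ?thesis using c fN g by (auto simp: cut_match_def X'_def N_def)
    next
      case 3
      hence c3: "y' ~: f' ` X'" "\<forall>x\<in>X'. y < x \<longleftrightarrow> y' < f' x" using c by (auto simp: cut_match_def)
      show ?thesis
      proof (rule insertable_sign[OF ins])
        show "y ~: X" using 3 by (simp add: X'_def)
        show "cut_match X f y y'" using cm[OF c] .
        show "poly p y ~= 0" using 3 by (auto simp: X'_def N_def)
        show "poly q y' ~= 0" using qroots c3 by blast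
        fix z z' assume z: "cut_match X f z z'" "z ~: X" "poly p z = 0" "poly q z' = 0"
        hence zN: "z \<in> N" by (simp add: N_def)
        have "z' ~: f ` X" "\<forall>x\<in>X. z < x \<longleftrightarrow> z' < f x" using z by (auto simp: cut_match_def)
        thus "y < z \<longleftrightarrow> y' < z'" using gn(2)[OF zN] insertable_root_unique[OF inv \<open>z' ~: f ` X\<close> gn(1)[OF zN] _ z(4) g(2)[OF zN]] c3(2) zN fN by (auto simp: X'_def)
      qed
    qed
  qed
  have "sign_table (insert (p, q) Z) X' f'"
    unfolding sign_table_def
  proof (intro conjI)
    show "finite X'" using finN D by (simp add: X'_def)
    show "strict_mono_on X' f'" by (rule mono)
    show "\<forall>(p', q')\<in>insert (p, q) Z. (p' ~= 0 --> (\<forall>x. poly p' x = 0 --> x \<in> X')) &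
                 (q' ~= 0 --> (\<forall>x. poly q' x = 0 --> x \<in> f' ` X'))"
      using D(3,4) qroots unfolding fim by (auto simp: X'_def N_def)
    show "\<forall>y y'. cut_match X' f' y y' --> (\<forall>(p', q')\<in>insert (p, q) Z. sg (poly p' y) = sg (poly q' y'))"
      using sgp D(5) cm by auto
  qed
  thus ?thesis by blast
qed

section \<open>Ring homomorphisms, subrings and pseudo-division\<close>

definition rhom :: "('c::comm_ring_1 => 'a::comm_ring_1) => bool" where
  "rhom a \<longleftrightarrow> a 1 = 1 & (\<forall>x y. a (x + y) = a x + a y) & (\<forall>x y. a (x * y) = a x * a y)"

lemma rhomD:
  assumes "rhom a"
  shows "a 1 = 1" "a (x + y) = a x + a y" "a (x * y) = a x * a y" "a 0 = 0" "a (- x) = - a x"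
    "a (x - y) = a x - a y" "a (x ^ k) = a x ^ k" "a (of_nat n) = of_nat n"
proof -
  show 1: "a 1 = 1" and 2: "a (x + y) = a x + a y" and 3: "a (x * y) = a x * a y" for x y
    using assms by (auto simp: rhom_def)
  show 4: "a 0 = 0" using 2[of 0 0] by simp
  show 5: "a (- x) = - a x" for x using 2[of x "- x"] 4 by (simp add: eq_neg_iff_add_eq_0 add.commute)
  show "a (x - y) = a x - a y" using 2[of x "- y"] 5 by simp
  show "a (x ^ k) = a x ^ k" by (induction k) (auto simp: 1 3)
  show "a (of_nat n) = of_nat n" by (induction n) (auto simp: 1 2 4)
qed

lemma rhom_sum: "rhom a ==> a (sum g S) = (\<Sum>x\<in>S. a (g x))"
  by (induction S rule: infinite_finite_induct) (auto simp: rhomD)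

lemma rhom_map_poly:
  assumes "rhom a"
  shows "map_poly a (p + q) = map_poly a p + map_poly a q"
    "map_poly a (p * q) = map_poly a p * map_poly a q"
    "map_poly a (smult c p) = smult (a c) (map_poly a p)"
    "map_poly a (pderiv p) = pderiv (map_poly a p)"
  by (rule poly_eqI, simp add: coeff_map_poly coeff_mult coeff_pderiv rhomD[OF assms] rhom_sum[OF assms])+

definition subringp :: "'c::comm_ring_1 set => bool" where
  "subringp A \<longleftrightarrow> 1 \<in> A & (\<forall>x\<in>A. \<forall>y\<in>A. x - y \<in> A) & (\<forall>x\<in>A. \<forall>y\<in>A. x * y \<in> A)"

lemma subringpD:
  assumes "subringp A"
  shows "1 \<in> A" "0 \<in> A" "x \<in> A ==> y \<in> A ==> x - y \<in> A" "x \<in> A ==> y \<in> A ==> x * y \<in> A"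
    "x \<in> A ==> - x \<in> A" "x \<in> A ==> y \<in> A ==> x + y \<in> A" "of_nat n \<in> A" "x \<in> A ==> x ^ k \<in> A"
proof -
  show 1: "1 \<in> A" and 2: "x \<in> A ==> y \<in> A ==> x - y \<in> A" and 3: "x \<in> A ==> y \<in> A ==> x * y \<in> A" for x y
    using assms by (auto simp: subringp_def)
  show 4: "0 \<in> A" using 2[OF 1 1] by simp
  show 5: "x \<in> A ==> - x \<in> A" for x using 2[OF 4, of x] by simp
  show 6: "x \<in> A ==> y \<in> A ==> x + y \<in> A" for x y using 2[of x "- y"] 5[of y] by simp
  show "of_nat n \<in> A" by (induction n) (auto simp: 1 4 6)
  show "x \<in> A ==> x ^ k \<in> A" by (induction k) (auto simp: 1 3)
qed

lemma subringp_sum: "subringp A ==> (!!x. x \<in> S ==> g x \<in> A) ==> sum g S \<in> A"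
  by (induction S rule: infinite_finite_induct) (auto simp: subringpD)

definition polys_over :: "'c::comm_ring_1 set => 'c poly set" where
  "polys_over A = {p. \<forall>i. coeff p i \<in> A}"

lemma polys_over_closed:
  assumes "subringp A" "p \<in> polys_over A"
  shows "q \<in> polys_over A ==> p - q \<in> polys_over A" "c \<in> A ==> smult c p \<in> polys_over A"
    "pderiv p \<in> polys_over A" "q \<in> polys_over A ==> p * q \<in> polys_over A"
    "q \<in> polys_over A ==> p + q \<in> polys_over A" "- p \<in> polys_over A"
  using assms by (auto simp: polys_over_def coeff_pderiv coeff_mult
      intro!: subringpD(3-6)[OF assms(1)] subringp_sum[OF assms(1)] subringpD(2,7)[OF assms(1)]
      simp del: of_nat_Suc)

lemma polys_over_monom: "subringp A ==> c \<in> A ==> monom c n \<in> polys_over A"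
  by (auto simp: polys_over_def coeff_monom subringpD)

lemma degree_diff_lead_cancel':
  assumes "degree p <= n" "degree q <= n" "coeff p n = coeff q n" "n >= 1"
  shows "degree (p - q) < n"
proof -
  have "coeff (p - q) i = 0" if "i > n - 1" for i
  proof (cases "i = n")
    case True thus ?thesis using assms by simp
  next
    case False
    thus ?thesis using that assms by (simp add: coeff_eq_0)
  qed
  hence "degree (p - q) <= n - 1" by (intro degree_le) auto
  thus ?thesis using assms by linarith
qed

lemma degree_pderiv_le: "degree (pderiv p) <= degree p - 1"
  by (rule degree_le) (auto simp: coeff_pderiv coeff_eq_0)

text \<open>Multiplying by the leading coefficient instead of dividing keeps the remainder over
  \<open>A\<close>; it can then take part in the induction that eliminates the variable.\<close>

lemma pseudo_remainder_over:
  fixes A :: "'c::idom set"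
  assumes A: "subringp A" and q: "q \<in> polys_over A" "degree q >= 1"
  shows "p \<in> polys_over A ==>
    \<exists>k s r. r \<in> polys_over A & smult (lead_coeff q ^ k) p = q * s + r & degree r < degree q"
proof (induction "degree p" arbitrary: p rule: less_induct)
  case less
  show ?case
  proof (cases "degree p < degree q")
    case True
    thus ?thesis using less.prems by (intro exI[of _ 0] exI[of _ p]) auto
  next
    case False
    define m where "m = monom (lead_coeff p) (degree p - degree q) * q"
    define p1 where "p1 = smult (lead_coeff q) p - m"
    have mo: "m \<in> polys_over A"
      unfolding m_def by (rule polys_over_closed(4)[OF A polys_over_monom[OF A _] q(1)])
        (use less.prems in "simp add: polys_over_def")
    have p1o: "p1 \<in> polys_over A"
      unfolding p1_def
      by (rule polys_over_closed(1)[OF A polys_over_closed(2)[OF A less.prems] mo])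
        (use q in "simp add: polys_over_def")
    have "degree p1 < degree p"
      unfolding p1_def
    using False degree_mult_le[of "monom (lead_coeff p) (degree p - degree q)" q] degree_monom_le[of "lead_coeff p" "degree p - degree q"] q by (auto simp: m_def coeff_monom_mult intro!: degree_diff_lead_cancel')
    from less.hyps[OF this p1o] obtain k s r where
      r: "r \<in> polys_over A" "smult (lead_coeff q ^ k) p1 = q * s + r" "degree r < degree q" by blast
    have "smult (lead_coeff q ^ Suc k) p = smult (lead_coeff q ^ k) (p1 + m)"
      by (simp add: p1_def mult.commute)
    also have "\<dots> = q * (s + smult (lead_coeff q ^ k) (monom (lead_coeff p) (degree p - degree q))) + r"
      by (simp add: smult_add_right r m_def algebra_simps)
    finally show ?thesis using r by blast
  qed
qed

lemma sign_table_empty: "sign_table {} {} f"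
  by (simp add: sign_table_def)

lemma sign_table_insert_const:
  assumes "sign_table Z X f" "degree p = 0" "degree q = 0" "sg (coeff p 0) = sg (coeff q 0)"
  shows "sign_table (insert (p, q) Z) X f"
proof -
  obtain c where p: "p = [:c:]" using assms degree_eq_zeroE by blast
  obtain d where q: "q = [:d:]" using assms degree_eq_zeroE by blast
  show ?thesis using assms unfolding p q sign_table_def by auto
qed

lemma sign_table_subset: "sign_table Z X f ==> Z0 <= Z ==> sign_table Z0 X f"
  unfolding sign_table_def by (fastforce dest: subsetD)

lemma map_poly_degree_le:
  assumes "a 0 = 0" shows "degree (map_poly a p) <= degree p"
  by (rule degree_le) (simp add: coeff_map_poly assms coeff_eq_0)

text \<open>Auxiliary polynomials are dropped together with their roots. The fine table matches
  \<open>y\<close> with some \<open>w\<close> in the same gap of the coarse table as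
  \<open>y'\<close>, and between \<open>w\<close> and \<open>y'\<close> no remaining
  \<open>q\<close> has a root.\<close>

lemma sign_table_restrict:
  assumes st: "sign_table Z X f" and Z0: "Z0 <= Z" and nz: "!!p q. (p, q) \<in> Z0 ==> p ~= 0 & q ~= 0"
    and X0: "X0 <= X" and r: "!!p q x. (p, q) \<in> Z0 ==> poly p x = 0 ==> x \<in> X0"
  shows "sign_table Z0 X0 f"
proof -
  note D = sign_tableD[OF st]
  have inj: "inj_on f X" using D(2) by (rule strict_mono_on_imp_inj)
  have mono0: "strict_mono_on X0 f" using D(2) X0 by (rule monotone_on_subset)
  have r': "x \<in> f ` X0" if pq: "(p, q) \<in> Z0" "poly q x = 0" for p q x
    using D(4)[of p q x] pq Z0 nz[OF pq(1)] D(5) r[OF pq(1)] by (fastforce simp: cut_match_def)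
  have sgn: "sg (poly p y) = sg (poly q y')" if pq: "(p, q) \<in> Z0" and cm: "cut_match X0 f y y'" for p q y y'
  proof (cases "y \<in> X0")
    case True
    thus ?thesis using cm X0 D(5) pq Z0 by (fastforce simp: cut_match_def)
  next
    case False
    hence y': "y' ~: f ` X0" "!!x. x \<in> X0 ==> y < x \<longleftrightarrow> y' < f x" using cm by (auto simp: cut_match_def)
    obtain w where w: "cut_match X f y w" using cut_match_ex[OF D(1,2)] by blast
    hence 1: "sg (poly p y) = sg (poly q w)" using D(5) pq Z0 by blast
    have wn: "w ~: f ` X0"
    proof (cases "y \<in> X")
      case True
      thus ?thesis using w inj X0 False by (auto simp: cut_match_def inj_on_def)
    next
      case False thus ?thesis using w X0 by (auto simp: cut_match_def)
    qed
    have wc: "w < f x \<longleftrightarrow> y' < f x" if "x \<in> X0" for x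
    proof (cases "y \<in> X")
      case True
      thus ?thesis using w y'(2)[OF that] strict_mono_on_less_iff[OF D(2) True, of x] that X0 by (auto simp: cut_match_def)
    next
      case False thus ?thesis using w X0 y'(2)[OF that] that by (auto simp: cut_match_def)
    qed
    have *: "poly q z ~= 0" if "min w y' <= z" "z <= max w y'" for z
    proof
      assume "poly q z = 0"
      then obtain x where x: "x \<in> X0" "z = f x" using r'[OF pq] by blast
      thus False using wn y' that wc[OF x(1)] by (auto simp: min_def max_def split: if_splits)
    qed
    have "sg (poly q w) = sg (poly q y')"
    proof (cases "w = y'")
      case False
      then consider "w < y'" | "y' < w" by fastforce
      thus ?thesis
      proof cases
        case 1 thus ?thesis by (intro sg_const_on) (use * in auto)
      next
        case 2
        hence "sg (poly q y') = sg (poly q w)" by (intro sg_const_on) (use * in auto)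
        thus ?thesis by simp
      qed
    qed simp
    thus ?thesis using 1 by simp
  qed
  show ?thesis unfolding sign_table_def
    using finite_subset[OF X0 D(1)] mono0 r r' sgn by fast
qed

section \<open>Elimination of one variable\<close>

definition table_pairs :: "('c::comm_ring_1 => 'a::comm_ring_1) => ('c => 'b::comm_ring_1) => 'c poly set => ('a poly \<times> 'b poly) set" where
  "table_pairs a b H = (\<lambda>p. (map_poly a p, map_poly b p)) ` H"

lemma lead_coeff_map:
  assumes "rhom a" "a (lead_coeff p) ~= 0"
  shows "degree (map_poly a p) = degree p" "lead_coeff (map_poly a p) = a (lead_coeff p)" "map_poly a p ~= 0"
proof -
  have c: "coeff (map_poly a p) (degree p) = a (lead_coeff p)"
    by (simp add: coeff_map_poly rhomD[OF assms(1)])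
  thus d: "degree (map_poly a p) = degree p" by (metis assms(2) le_antisym le_degree rhomD[OF assms(1)] map_poly_degree_le)
  thus "lead_coeff (map_poly a p) = a (lead_coeff p)" using c by simp
  thus "map_poly a p ~= 0" using assms(2) by auto
qed

text \<open>At a root of \<open>q\<close> the pseudo-division identity reduces to
  \<open>lead_coeff q ^ k * p = r\<close>, so the remainders in \<open>H'\<close> decide the sign of
  \<open>p\<close> there. The table is therefore first restricted to the roots of
  \<open>pderiv p\<close> and \<open>H\<close>, and then \<open>p\<close> is insertable.\<close>

lemma sign_table_main_step:
  fixes a :: "'c::idom => 'a::rcf" and b :: "'c => 'b::rcf"
  assumes ab: "rhom a" "rhom b"
    and lc: "!!q. q \<in> insert p H ==> degree q >= 1 & a (lead_coeff q) ~= 0 & b (lead_coeff q) ~= 0 &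
      sg (a (lead_coeff q)) = sg (b (lead_coeff q))"
    and rem: "!!q. q \<in> insert (pderiv p) H ==> degree q >= 1 ==>
      r q \<in> H' & smult (lead_coeff q ^ k q) p = q * s q + r q"
    and st: "sign_table (table_pairs a b (insert (pderiv p) H \<union> H')) X f"
  shows "\<exists>X f. sign_table (table_pairs a b (insert p H)) X f"
proof -
  note D = sign_tableD[OF st]
  have p1: "degree p >= 1" using lc by auto
  have lcd: "lead_coeff (pderiv p) = of_nat (degree p) * lead_coeff p & degree (pderiv p) = degree p - 1"
  proof -
    have "of_nat (degree p) * lead_coeff p ~= 0"
    proof
      assume "of_nat (degree p) * lead_coeff p = 0"
      hence "of_nat (degree p) * a (lead_coeff p) = 0"
        by (metis rhomD(3,4,8)[OF ab(1)])
      thus False using lc[of p] p1 by simp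
    qed
    hence c: "coeff (pderiv p) (degree p - 1) = of_nat (degree p) * lead_coeff p"
      "coeff (pderiv p) (degree p - 1) ~= 0"
      using p1 by (simp_all add: coeff_pderiv del: of_nat_Suc)
    show ?thesis by (metis le_degree le_antisym degree_pderiv_le c)
  qed
  have lc': "a (lead_coeff q) ~= 0 & b (lead_coeff q) ~= 0 & sg (a (lead_coeff q)) = sg (b (lead_coeff q))"
    if "q \<in> insert (pderiv p) H" for q
  proof (cases "q = pderiv p")
    case True
    have "a (lead_coeff q) = of_nat (degree p) * a (lead_coeff p)" "b (lead_coeff q) = of_nat (degree p) * b (lead_coeff p)"
      using True lcd rhomD(3,8)[OF ab(1)] rhomD(3,8)[OF ab(2)] by metis+
    hence "sg (a (lead_coeff q)) = sg (a (lead_coeff p))" "sg (b (lead_coeff q)) = sg (b (lead_coeff p))" using p1 by (auto simp: sg_mult)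
    thus ?thesis using conjunct1[OF conjunct2[OF conjunct2[OF lc[OF insertI1]]]] conjunct2[OF conjunct2[OF conjunct2[OF lc[OF insertI1]]]] by auto
  qed (use that lc in blast)
  define Z0 where "Z0 = table_pairs a b (insert (pderiv p) H)"
  define X0 where "X0 = {x\<in>X. \<exists>q\<in>insert (pderiv p) H. poly (map_poly a q) x = 0}"
  have st0: "sign_table Z0 X0 f"
  proof (rule sign_table_restrict[OF st])
    show "Z0 <= table_pairs a b (insert (pderiv p) H \<union> H')" by (auto simp: Z0_def table_pairs_def)
    show nz: "p' ~= 0 & q' ~= 0" if pq': "(p', q') \<in> Z0" for p' q'
    proof -
      obtain q where "q \<in> insert (pderiv p) H" "p' = map_poly a q" "q' = map_poly b q"
        using pq' by (auto simp: Z0_def table_pairs_def)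
      thus ?thesis using lc'[of q] lead_coeff_map(3)[OF ab(1), of q] lead_coeff_map(3)[OF ab(2), of q] by metis
    qed
    show "X0 <= X" by (auto simp: X0_def)
    fix p' q' x assume pq: "(p', q') \<in> Z0" "poly p' x = 0"
    then obtain q where q: "q \<in> insert (pderiv p) H" "p' = map_poly a q" by (auto simp: Z0_def table_pairs_def)
    show "x \<in> X0" using D(3)[of p' q' x] pq nz[OF pq(1)] by (auto simp: Z0_def table_pairs_def X0_def)
  qed
  have "insertable Z0 X0 f (map_poly a p) (map_poly b p)"
    unfolding insertable_def
  proof (intro conjI ballI)
    show "sign_table Z0 X0 f" by (rule st0)
    show "(pderiv (map_poly a p), pderiv (map_poly b p)) \<in> Z0"
      by (auto simp: Z0_def table_pairs_def rhom_map_poly(4)[OF ab(1)] rhom_map_poly(4)[OF ab(2)])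
    show "pderiv (map_poly a p) ~= 0" "pderiv (map_poly b p) ~= 0"
      using lead_coeff_map(3)[OF ab(1), of "pderiv p"] lead_coeff_map(3)[OF ab(2), of "pderiv p"] lc'[of "pderiv p"]
      by (simp_all add: rhom_map_poly(4)[OF ab(1)] rhom_map_poly(4)[OF ab(2)])
    show "degree (map_poly a p) = degree (map_poly b p)"
      "sg (lead_coeff (map_poly a p)) = sg (lead_coeff (map_poly b p))"
      using lead_coeff_map[OF ab(1), of p] lead_coeff_map[OF ab(2), of p] lc[of p] by auto
    fix x assume x: "x \<in> X0"
    then obtain q where q: "q \<in> insert (pderiv p) H" "poly (map_poly a q) x = 0" "x \<in> X" by (auto simp: X0_def)
    have cm: "cut_match X f x (f x)" using q by (simp add: cut_match_def)
    have qb: "poly (map_poly b q) (f x) = 0"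
    proof -
      have "sg (poly (map_poly a q) x) = sg (poly (map_poly b q) (f x))"
        by (rule D(5)[OF _ cm]) (use q in "auto simp: table_pairs_def")
      thus ?thesis using q by simp
    qed
    have dq: "degree q >= 1"
    proof (rule ccontr)
      assume "\<not> degree q >= 1"
      then obtain c where c: "q = [:c:]" using degree_eq_zeroE by (metis less_one not_le)
      thus False using q(2) lc'[OF q(1)] by (simp add: map_poly_pCons rhomD[OF ab(1)])
    qed
    note R = rem[OF q(1) dq]
    have "poly (map_poly a (smult (lead_coeff q ^ k q) p)) x = poly (map_poly a (q * s q + r q)) x"
      "poly (map_poly b (smult (lead_coeff q ^ k q) p)) (f x) = poly (map_poly b (q * s q + r q)) (f x)" using R by simp_all
    hence e: "a (lead_coeff q) ^ k q * poly (map_poly a p) x = poly (map_poly a (r q)) x"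
      "b (lead_coeff q) ^ k q * poly (map_poly b p) (f x) = poly (map_poly b (r q)) (f x)"
      using q(2) qb by (simp_all add: rhom_map_poly[OF ab(1)] rhom_map_poly[OF ab(2)] rhomD[OF ab(1)] rhomD[OF ab(2)])
    have "sg (poly (map_poly a (r q)) x) = sg (poly (map_poly b (r q)) (f x))"
      by (rule D(5)[OF _ cm]) (use R in "auto simp: table_pairs_def")
    hence eq: "sg (a (lead_coeff q) ^ k q) * sg (poly (map_poly a p) x) =
        sg (b (lead_coeff q) ^ k q) * sg (poly (map_poly b p) (f x))"
      unfolding e[symmetric] sg_mult .
    have sp: "sg (c ^ n) = sg c ^ n" for c :: "'x::linordered_idom" and n
      by (induction n) (auto simp: sg_mult)
    show "sg (poly (map_poly a p) x) = sg (poly (map_poly b p) (f x))" using lc'[OF q(1)] eq by (simp_all add: sp)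
  qed
  from sign_table_insert[OF this] obtain X1 f1 where
    "sign_table (insert (map_poly a p, map_poly b p) Z0) X1 f1" by blast
  thus ?thesis by (auto simp: Z0_def table_pairs_def intro!: sign_table_subset)
qed

text \<open>Quantifier elimination without formulas: if the signs of finitely many elements of
  \<open>A\<close> agree under two homomorphisms, the two families of images have a common sign
  table. The \<open>itself\<close> arguments fix the two real closed fields.\<close>

definition transferable :: "'a::rcf itself => 'b::rcf itself => 'c::idom set => 'c poly set => bool" where
  "transferable _ _ A H \<longleftrightarrow> (\<exists>S. finite S & S <= A &
     (\<forall>(a :: 'c => 'a) (b :: 'c => 'b). rhom a --> rhom b --> (\<forall>c\<in>S. sg (a c) = sg (b c)) -->
        (\<exists>X f. sign_table (table_pairs a b H) X f)))"

lemma less_multiset_replace: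
  assumes "x \<in># M" "!!y. y \<in># N ==> y < (x::nat)"
  shows "M - {#x#} + N < M"
proof -
  obtain M' where M: "M = add_mset x M'" using assms(1) by (metis mset_add)
  show ?thesis using assms(2) M by simp
qed

text \<open>Induction on the multiset of degrees. A polynomial whose leading coefficient maps to
  zero is replaced by its tail \<open>tr q\<close>. If there is none, a polynomial \<open>p\<close>
  of maximal degree is replaced by its derivative and its remainders, all of smaller degree. Which
  case applies depends on the homomorphism, so the finite set unites the data of all cases with the
  leading coefficients themselves.\<close>

theorem transferable_all:
  fixes A :: "'c::idom set"
  assumes A: "subringp A" and H: "finite H" "H <= polys_over A"
  shows "transferable TYPE('a::rcf) TYPE('b::rcf) A H"
proof -
  have "set_mset M <= polys_over A ==> transferable TYPE('a::rcf) TYPE('b::rcf) A (set_mset M)" for M :: "'c poly multiset"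
  proof (induction "image_mset degree M" arbitrary: M rule: wf_induct_rule[OF wf_less_multiset])
    case (1 M)
    have IH: "transferable TYPE('a) TYPE('b) A (set_mset M')"
      if "image_mset degree M' < image_mset degree M" "set_mset M' <= polys_over A" for M'
      using 1(1)[of M'] that by auto
    have over: "coeff q i \<in> A" if "q \<in># M" for q i using 1(2) that by (auto simp: polys_over_def)
    consider "M = {#}" | p where "p \<in># M" "degree p = 0" | "M ~= {#}" "!!p. p \<in># M ==> degree p >= 1"
      by (metis less_one not_le)
    thus ?case
    proof cases
      case 1
      thus ?thesis
        unfolding transferable_def table_pairs_def using sign_table_empty by (intro exI[of _ "{}"]) auto
    next
      case (2 p)
      obtain M' where M': "M = add_mset p M'" using 2 by (metis mset_add)
      have "transferable TYPE('a) TYPE('b) A (set_mset M')"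
        by (rule IH) (use M' 1(2) in auto)
      then obtain S where S: "finite S" "S <= A" "!!(a :: 'c => 'a) (b :: 'c => 'b). rhom a ==> rhom b ==>
        (\<forall>c\<in>S. sg (a c) = sg (b c)) ==> (\<exists>X f. sign_table (table_pairs a b (set_mset M')) X f)"
        unfolding transferable_def by blast
      show ?thesis unfolding transferable_def
      proof (intro exI[of _ "insert (coeff p 0) S"] conjI allI impI)
        show "finite (insert (coeff p 0) S)" "insert (coeff p 0) S <= A" using S over 2 by auto
        fix a :: "'c => 'a" and b :: "'c => 'b"
        assume ab: "rhom a" "rhom b" "\<forall>c\<in>insert (coeff p 0) S. sg (a c) = sg (b c)"
        then obtain X f where "sign_table (table_pairs a b (set_mset M')) X f" using S(3)[of a b] by auto
        hence "sign_table (insert (map_poly a p, map_poly b p) (table_pairs a b (set_mset M'))) X f"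
          by (rule sign_table_insert_const)
            (use 2 ab map_poly_degree_le[of a p] map_poly_degree_le[of b p] in "auto simp: coeff_map_poly rhomD")
        thus "\<exists>X f. sign_table (table_pairs a b (set_mset M)) X f"
          unfolding M' by (auto simp: table_pairs_def)
      qed
    next
      case 3
      define d where "d = Max (degree ` set_mset M)"
      have "d \<in> degree ` set_mset M" unfolding d_def using 3 by (intro Max_in) auto
      then obtain p where p: "p \<in># M" "degree p = d" by auto
      have dmax: "degree q <= d" if "q \<in># M" for q unfolding d_def using that by auto
      have d1: "d >= 1" using 3 p by auto
      define H where "H = set_mset (M - {#p#})"
      have Msplit: "set_mset M = insert p H" unfolding H_def using p by (metis insert_DiffM set_mset_add_mset_insert)
      define Q where "Q = {q \<in> insert (pderiv p) H. degree q >= 1}"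
      have finQ: "finite Q" by (auto simp: H_def Q_def)
      have po: "p \<in> polys_over A" using 1(2) p by auto
      have Qo: "q \<in> polys_over A" if "q \<in> insert (pderiv p) H" for q
        using that 1(2) Msplit polys_over_closed(3)[OF A po] by auto
      have "\<forall>q\<in>Q. \<exists>k s r. r \<in> polys_over A & smult (lead_coeff q ^ k) p = q * s + r & degree r < degree q"
        using pseudo_remainder_over[OF A] Qo po unfolding Q_def by blast
      then obtain k s r where R: "!!q. q \<in> Q ==> r q \<in> polys_over A & smult (lead_coeff q ^ k q) p = q * s q + r q & degree (r q) < degree q"
        by metis
      define N where "N = add_mset (pderiv p) (image_mset r (mset_set Q))"
      have dpd: "degree (pderiv p) < d"
        using degree_pderiv_le[of p] p d1 by linarith
      have Ndeg: "degree y < d" if "y \<in># N" for y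
        using that R dmax finQ dpd unfolding N_def Q_def Msplit by (fastforce)
      have trM: "transferable TYPE('a) TYPE('b) A (set_mset (M - {#p#} + N))"
      proof (rule IH)
        have "image_mset degree (M - {#p#} + N) = image_mset degree M - {#d#} + image_mset degree N"
          using p by (simp only: image_mset_union) (simp add: image_mset_Diff)
        also have "\<dots> < image_mset degree M"
          by (rule less_multiset_replace) (use p Ndeg in auto)
        finally show "image_mset degree (M - {#p#} + N) < image_mset degree M" .
        show "set_mset (M - {#p#} + N) <= polys_over A"
          using 1(2) Qo R finQ unfolding N_def by (auto dest: in_diffD)
      qed
      define tr where "tr q = q - monom (lead_coeff q) (degree q)" for q :: "'c poly"
      have trq: "transferable TYPE('a) TYPE('b) A (set_mset (M - {#q#} + {#tr q#}))" if q: "q \<in># M" for q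
      proof (rule IH)
        have "image_mset degree (M - {#q#} + {#tr q#}) = image_mset degree M - {#degree q#} + {#degree (tr q)#}"
          using q by (simp add: image_mset_Diff)
        also have "\<dots> < image_mset degree M" using 3(2)[OF q] q by (fastforce simp: tr_def degree_monom_le intro: degree_diff_lead_cancel' less_multiset_replace)
        finally show "image_mset degree (M - {#q#} + {#tr q#}) < image_mset degree M" .
        have "tr q \<in> polys_over A" unfolding tr_def
          using 1(2) q over[OF q] by (intro polys_over_closed polys_over_monom A) auto
        thus "set_mset (M - {#q#} + {#tr q#}) <= polys_over A"
          using 1(2) by (auto dest: in_diffD)
      qed
      obtain S0 where S0: "finite S0" "S0 <= A" "!!(a :: 'c => 'a) (b :: 'c => 'b). rhom a ==> rhom b ==>
        (\<forall>c\<in>S0. sg (a c) = sg (b c)) ==> (\<exists>X f. sign_table (table_pairs a b (set_mset (M - {#p#} + N))) X f)"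
        using trM unfolding transferable_def by blast
      have "\<forall>q. \<exists>S. q \<in># M --> finite S & S <= A & (\<forall>(a :: 'c => 'a) (b :: 'c => 'b). rhom a --> rhom b -->
        (\<forall>c\<in>S. sg (a c) = sg (b c)) --> (\<exists>X f. sign_table (table_pairs a b (set_mset (M - {#q#} + {#tr q#}))) X f))"
      proof
        fix q
        show "\<exists>S. q \<in># M --> finite S & S <= A & (\<forall>(a :: 'c => 'a) (b :: 'c => 'b). rhom a --> rhom b -->
        (\<forall>c\<in>S. sg (a c) = sg (b c)) --> (\<exists>X f. sign_table (table_pairs a b (set_mset (M - {#q#} + {#tr q#}))) X f))"
        proof (cases "q \<in># M")
          case True
          from trq[OF True, unfolded transferable_def] show ?thesis by (elim exE) (rule exI, rule impI)
        qed simp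
      qed
      from choice[OF this] obtain SS where SS: "!!q. q \<in># M ==> finite (SS q) & SS q <= A & (\<forall>(a :: 'c => 'a) (b :: 'c => 'b). rhom a --> rhom b -->
        (\<forall>c\<in>SS q. sg (a c) = sg (b c)) --> (\<exists>X f. sign_table (table_pairs a b (set_mset (M - {#q#} + {#tr q#}))) X f))"
        by blast
      show ?thesis unfolding transferable_def
      proof (intro exI[of _ "S0 \<union> (\<Union>q\<in>set_mset M. SS q) \<union> lead_coeff ` set_mset M"] conjI allI impI)
        show "finite (S0 \<union> (\<Union>q\<in>set_mset M. SS q) \<union> lead_coeff ` set_mset M)" using S0 SS by auto
        show "S0 \<union> (\<Union>q\<in>set_mset M. SS q) \<union> lead_coeff ` set_mset M <= A" using S0 SS over by blast
        fix a :: "'c => 'a" and b :: "'c => 'b"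
        assume ab: "rhom a" "rhom b" and sS: "\<forall>c\<in>S0 \<union> (\<Union>q\<in>set_mset M. SS q) \<union> lead_coeff ` set_mset M. sg (a c) = sg (b c)"
        show "\<exists>X f. sign_table (table_pairs a b (set_mset M)) X f"
        proof (cases "\<exists>q\<in>#M. a (lead_coeff q) = 0")
          case True
          then obtain q where q: "q \<in># M" "a (lead_coeff q) = 0" by blast
          hence "sg (a (lead_coeff q)) = sg (b (lead_coeff q))" using sS by blast
          hence bq: "b (lead_coeff q) = 0" using q by simp
          have "set_mset M = insert q (set_mset (M - {#q#}))"
            using q by (metis insert_DiffM set_mset_add_mset_insert)
          hence "table_pairs a b (set_mset (M - {#q#} + {#tr q#})) = table_pairs a b (set_mset M)" by (auto simp: tr_def coeff_map_poly rhomD[OF ab(1)] rhomD[OF ab(2)] q bq table_pairs_def intro!: poly_eqI)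
          moreover have "\<exists>X f. sign_table (table_pairs a b (set_mset (M - {#q#} + {#tr q#}))) X f"
          proof (rule SS[OF q(1), THEN conjunct2, THEN conjunct2, THEN spec, THEN spec, THEN mp, THEN mp, THEN mp])
            show "\<forall>c\<in>SS q. sg (a c) = sg (b c)" using sS q(1) by blast
          qed (use ab in auto)
          ultimately show ?thesis by simp
        next
          case False
          obtain X f where X: "sign_table (table_pairs a b (set_mset (M - {#p#} + N))) X f"
            using S0(3)[OF ab] sS by blast
          have setN: "set_mset (M - {#p#} + N) = insert (pderiv p) H \<union> r ` Q"
            using finQ by (auto simp: H_def N_def)
          have "\<exists>X f. sign_table (table_pairs a b (insert p H)) X f"
          proof (rule sign_table_main_step[OF ab _ _ X[unfolded setN]])
            fix q assume q: "q \<in> insert p H"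
            hence qM: "q \<in># M" using Msplit by simp
            thus "1 <= degree q & a (lead_coeff q) ~= 0 & b (lead_coeff q) ~= 0 & sg (a (lead_coeff q)) = sg (b (lead_coeff q))" using sS False 3(2) sg_eq_iff(3) by fastforce
          next
            fix q assume "q \<in> insert (pderiv p) H" "1 <= degree q"
            thus "r q \<in> r ` Q & smult (lead_coeff q ^ k q) p = q * s q + r q"
              using R by (auto simp: Q_def)
          qed
          thus ?thesis by (simp add: Msplit)
        qed
      qed
    qed
  qed
  from this[of "mset_set H"] show ?thesis using H by simp
qed

corollary sign_transfer:
  fixes A :: "'c::idom set"
  assumes A: "subringp A" and H: "finite H" "H <= polys_over A"
  shows "\<exists>S. finite S & S <= A & (\<forall>(a :: 'c => 'a::rcf) (b :: 'c => 'b::rcf) y.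
     rhom a --> rhom b --> (\<forall>c\<in>S. sg (a c) = sg (b c)) -->
     (\<exists>y'. \<forall>p\<in>H. sg (poly (map_poly a p) y) = sg (poly (map_poly b p) y')))"
proof -
  obtain S where S: "finite S" "S <= A" "!!(a :: 'c => 'a) (b :: 'c => 'b). rhom a ==> rhom b ==>
        (\<forall>c\<in>S. sg (a c) = sg (b c)) ==> (\<exists>X f. sign_table (table_pairs a b H) X f)"
    using transferable_all[OF A H, where 'a='a and 'b='b] unfolding transferable_def by blast
  have "\<exists>y'. \<forall>p\<in>H. sg (poly (map_poly a p) y) = sg (poly (map_poly b p) y')"
    if h: "rhom a" "rhom b" "\<forall>c\<in>S. sg (a c) = sg (b c)" for a :: "'c => 'a" and b :: "'c => 'b" and y
  proof -
    obtain X f where st: "sign_table (table_pairs a b H) X f" using S(3)[OF h] by blast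
    note D = sign_tableD[OF st]
    obtain y' where y': "cut_match X f y y'" using cut_match_ex[OF D(1,2)] by blast
    have "sg (poly (map_poly a p) y) = sg (poly (map_poly b p) y')" if "p \<in> H" for p
      by (rule D(5)[OF _ y']) (use that in "auto simp: table_pairs_def")
    thus ?thesis by blast
  qed
  thus ?thesis using S(1,2) by blast
qed

subsection \<open>The real closure of an ordered field\<close>

text \<open>\<open>T\<close> is only required to be a preordering. That it is an ordering, and that
  \<open>E\<close> is real closed, follows once the pair is maximal.\<close>

definition ordered_subfield :: "'k::linordered_field alg_closure set => 'k alg_closure set => bool" where
  "ordered_subfield E T \<longleftrightarrow> 1 \<in> E & (\<forall>x\<in>E. \<forall>y\<in>E. x - y \<in> E & x * y \<in> E) & (\<forall>x\<in>E. inverse x \<in> E) &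
     T <= E & (\<forall>x\<in>T. \<forall>y\<in>T. x + y \<in> T & x * y \<in> T) & (\<forall>x\<in>E. x * x \<in> T) & - 1 ~: T &
     (\<forall>x\<ge>0. to_ac x \<in> T)"

text \<open>A pair is encoded as one subset of a sum type, so that inclusion orders both components
  at once and Zorn's lemma applies.\<close>

lemma ordered_subfield_maximal:
  "\<exists>Q :: ('k::linordered_field alg_closure + 'k alg_closure) set.
     ordered_subfield (Inl -` Q) (Inr -` Q) &
     (\<forall>Q'. ordered_subfield (Inl -` Q') (Inr -` Q') --> Q <= Q' --> Q' = Q)"
proof -
  define A :: "('k alg_closure + 'k alg_closure) set set" where
    "A = {Q. ordered_subfield (Inl -` Q) (Inr -` Q)}"
  have vim: "Inl -` (Inl ` E \<union> Inr ` T) = E" "Inr -` (Inl ` E \<union> Inr ` T) = T" for E T :: "'k alg_closure set"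
    by auto
  have "ordered_subfield (range to_ac :: 'k alg_closure set) (to_ac ` {x. x >= 0})"
    unfolding ordered_subfield_def
  proof (intro conjI ballI allI impI)
    show "(1 :: 'k alg_closure) \<in> range to_ac" by (metis rangeI to_ac_1)
    show "x - y \<in> range to_ac" "x * y \<in> range to_ac"
      if "x \<in> range to_ac" "y \<in> range to_ac" for x y :: "'k alg_closure"
      using that by (auto simp flip: to_ac_diff to_ac_mult)
    show "inverse x \<in> range to_ac" if "x \<in> range to_ac" for x :: "'k alg_closure"
      using that by (auto simp flip: to_ac_inverse)
    show "to_ac ` {x. 0 <= x} <= range to_ac" by auto
    show "x + y \<in> to_ac ` {x. 0 <= x}" "x * y \<in> to_ac ` {x. 0 <= x}"
      if "x \<in> to_ac ` {x::'k. 0 <= x}" "y \<in> to_ac ` {x. 0 <= x}" for x y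
      using that by (force simp flip: to_ac_add intro!: imageI add_nonneg_nonneg,
        force simp flip: to_ac_mult intro!: imageI mult_nonneg_nonneg)
    show "x * x \<in> to_ac ` {x. 0 <= x}" if "x \<in> range to_ac" for x :: "'k alg_closure"
      using that by (auto simp flip: to_ac_mult)
    show "- 1 ~: to_ac ` {x::'k. 0 <= x}"
    proof
      assume "- 1 \<in> to_ac ` {x::'k. 0 <= x}"
      then obtain x :: 'k where x: "- 1 = to_ac x" "0 <= x" by auto
      hence "to_ac (- 1) = to_ac x" by (metis to_ac_1 to_ac_minus)
      thus False using x by (simp only: to_ac_eq_iff)
    qed
    show "to_ac x \<in> to_ac ` {x. 0 <= x}" if "0 <= x" for x :: 'k using that by auto
  qed
  hence "(Inl ` range to_ac \<union> Inr ` to_ac ` {x. x >= 0}) \<in> A" unfolding A_def mem_Collect_eq vim .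
  hence ne: "A ~= {}" by blast
  have ch: "\<Union>C \<in> A" if C: "C ~= {}" "subset.chain A C" for C
  proof -
    have CA: "C <= A" using C by (auto simp: subset.chain_def)
    have tot: "\<exists>Z\<in>C. X <= Z & Y <= Z" if XY: "X \<in> C" "Y \<in> C" for X Y
      by (metis C(2) XY subset_chain_def)
    have E: "x \<in> Inl -` \<Union>C \<longleftrightarrow> (\<exists>Z\<in>C. x \<in> Inl -` Z)" "x \<in> Inr -` \<Union>C \<longleftrightarrow> (\<exists>Z\<in>C. x \<in> Inr -` Z)" for x by auto
    have os: "ordered_subfield (Inl -` Z) (Inr -` Z)" if "Z \<in> C" for Z using that CA by (auto simp: A_def)
    obtain Z0 where Z0: "Z0 \<in> C" using C by blast
    have "ordered_subfield (Inl -` \<Union>C) (Inr -` \<Union>C)"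
      unfolding ordered_subfield_def
    proof (intro conjI ballI allI impI)
      show "1 \<in> Inl -` \<Union>C" using os[OF Z0] Z0 by (auto simp: ordered_subfield_def)
      show "x - y \<in> Inl -` \<Union>C" "x * y \<in> Inl -` \<Union>C" if xy: "x \<in> Inl -` \<Union>C" "y \<in> Inl -` \<Union>C" for x y
      proof -
        obtain X Y where XY: "X \<in> C" "Y \<in> C" "x \<in> Inl -` X" "y \<in> Inl -` Y" using xy E by blast
        then obtain Z where Z: "Z \<in> C" "X <= Z" "Y <= Z" using tot by blast
        hence "x \<in> Inl -` Z" "y \<in> Inl -` Z" using XY by auto
        hence "x - y \<in> Inl -` Z" "x * y \<in> Inl -` Z" using os[OF Z(1)] by (auto simp: ordered_subfield_def)
        thus "x - y \<in> Inl -` \<Union>C" "x * y \<in> Inl -` \<Union>C" using Z by auto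
      qed
      have os': "x \<in> Inl -` Z ==> inverse x \<in> Inl -` Z" "Inr -` Z <= Inl -` Z" "x \<in> Inl -` Z ==> x * x \<in> Inr -` Z"
        "- 1 ~: Inr -` Z" "0 <= k ==> to_ac k \<in> Inr -` Z"
        if "Z \<in> C" for x Z k using os[OF that] unfolding ordered_subfield_def by simp_all
      show "inverse x \<in> Inl -` \<Union>C" if xC: "x \<in> Inl -` \<Union>C" for x
        using xC os'(1) by auto
      show "Inr -` \<Union>C <= Inl -` \<Union>C"
        using os'(2) by blast
      show "x + y \<in> Inr -` \<Union>C" "x * y \<in> Inr -` \<Union>C" if xy: "x \<in> Inr -` \<Union>C" "y \<in> Inr -` \<Union>C" for x y
      proof -
        obtain X Y where XY: "X \<in> C" "Y \<in> C" "x \<in> Inr -` X" "y \<in> Inr -` Y" using xy E by blast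
        then obtain Z where Z: "Z \<in> C" "X <= Z" "Y <= Z" using tot by blast
        hence "x \<in> Inr -` Z" "y \<in> Inr -` Z" using XY by auto
        hence "x + y \<in> Inr -` Z" "x * y \<in> Inr -` Z" using os[OF Z(1)] by (auto simp: ordered_subfield_def)
        thus "x + y \<in> Inr -` \<Union>C" "x * y \<in> Inr -` \<Union>C" using Z by auto
      qed
      show "x * x \<in> Inr -` \<Union>C" if xC: "x \<in> Inl -` \<Union>C" for x
        using xC os'(3) by auto
      show "- 1 ~: Inr -` \<Union>C" using os'(4) by auto
      show "to_ac x \<in> Inr -` \<Union>C" if "0 <= x" for x
        using os'(5)[OF Z0 that] Z0 by auto
    qed
    thus ?thesis by (simp add: A_def)
  qed
  obtain M where "M \<in> A" "\<forall>X\<in>A. M <= X --> X = M" using subset_Zorn_nonempty[OF ne ch] by blast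
  thus ?thesis unfolding A_def by blast
qed

definition rc_pair :: "('k::linordered_field alg_closure + 'k alg_closure) set" where
  "rc_pair = (SOME Q. ordered_subfield (Inl -` Q) (Inr -` Q) &
     (\<forall>Q'. ordered_subfield (Inl -` Q') (Inr -` Q') --> Q <= Q' --> Q' = Q))"

definition rc_field :: "'k::linordered_field alg_closure set" where "rc_field = Inl -` rc_pair"

definition rc_cone :: "'k::linordered_field alg_closure set" where "rc_cone = Inr -` rc_pair"

lemma
  fixes E T :: "'a::linordered_field alg_closure set"
  shows rc_ordered: "ordered_subfield (rc_field :: 'a alg_closure set) rc_cone"
  and rc_maximal: "ordered_subfield E T ==> rc_field <= E ==> rc_cone <= T ==> E = rc_field & T = rc_cone"
proof -
  have *: "ordered_subfield (Inl -` (rc_pair :: ('a alg_closure + 'a alg_closure) set)) (Inr -` rc_pair) &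
     (\<forall>Q' :: ('a alg_closure + 'a alg_closure) set. ordered_subfield (Inl -` Q') (Inr -` Q') --> rc_pair <= Q' --> Q' = rc_pair)"
    unfolding rc_pair_def by (rule someI_ex) (rule ordered_subfield_maximal)
  thus "ordered_subfield (rc_field :: 'a alg_closure set) rc_cone" by (simp add: rc_field_def rc_cone_def)
  assume ET: "ordered_subfield E T" "rc_field <= E" "rc_cone <= T"
  define Q' where "Q' = Inl ` E \<union> Inr ` T"
  have v: "Inl -` Q' = E" "Inr -` Q' = T" by (auto simp: Q'_def)
  have "rc_pair <= Q'"
  proof
    fix z assume "z \<in> (rc_pair :: ('a alg_closure + 'a alg_closure) set)"
    thus "z \<in> Q'" using ET by (cases z) (auto simp: Q'_def rc_field_def rc_cone_def)
  qed
  hence "Q' = rc_pair" using * ET v by blast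
  thus "E = rc_field & T = rc_cone" using v by (simp add: rc_field_def rc_cone_def)
qed

lemma rc_closed:
  "1 \<in> rc_field" "x \<in> rc_field ==> y \<in> rc_field ==> x - y \<in> rc_field"
  "x \<in> rc_field ==> y \<in> rc_field ==> x * y \<in> rc_field" "x \<in> rc_field ==> inverse x \<in> rc_field"
  "0 \<in> rc_field" "x \<in> rc_field ==> - x \<in> rc_field" "x \<in> rc_field ==> y \<in> rc_field ==> x + y \<in> rc_field"
proof -
  show 1: "1 \<in> rc_field" and 2: "x \<in> rc_field ==> y \<in> rc_field ==> x - y \<in> rc_field"
    and "x \<in> rc_field ==> y \<in> rc_field ==> x * y \<in> rc_field" "x \<in> rc_field ==> inverse x \<in> rc_field" for x y
    using rc_ordered unfolding ordered_subfield_def by blast+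
  show 3: "0 \<in> rc_field" using 2[OF 1 1] by simp
  show 4: "x \<in> rc_field ==> - x \<in> rc_field" for x using 2[OF 3, of x] by simp
  show "x \<in> rc_field ==> y \<in> rc_field ==> x + y \<in> rc_field" using 2[of x "- y"] 4[of y] by simp
qed

lemma rc_cone_closed:
  "x \<in> rc_cone ==> x \<in> rc_field" "x \<in> rc_cone ==> y \<in> rc_cone ==> x + y \<in> rc_cone"
  "x \<in> rc_cone ==> y \<in> rc_cone ==> x * y \<in> rc_cone" "x \<in> rc_field ==> x * x \<in> rc_cone"
  "- 1 ~: rc_cone" "0 <= a ==> to_ac a \<in> rc_cone" "0 \<in> rc_cone" "1 \<in> rc_cone"
  using rc_ordered unfolding ordered_subfield_def apply blast
  using rc_ordered unfolding ordered_subfield_def apply blast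
  using rc_ordered unfolding ordered_subfield_def apply blast
  using rc_ordered unfolding ordered_subfield_def apply blast
  using rc_ordered unfolding ordered_subfield_def apply blast
  using rc_ordered unfolding ordered_subfield_def apply blast
  using rc_ordered unfolding ordered_subfield_def apply (metis order_refl to_ac_0)
  using rc_ordered unfolding ordered_subfield_def apply (metis mult_1)
  done

text \<open>If \<open>a\<close> is outside the cone, adjoining it cannot give a preordering, so
  \<open>- 1\<close> becomes representable. The representations for \<open>a\<close> and for
  \<open>- a\<close> combine to put \<open>- 1\<close> into the cone itself.\<close>

lemma rc_cone_total:
  assumes a: "a \<in> rc_field" shows "a \<in> rc_cone | - a \<in> rc_cone"
proof -
  have step: "\<exists>s\<in>rc_cone. \<exists>t\<in>rc_cone. - 1 = s + a * t" if a: "a \<in> rc_field" "a ~: rc_cone" for a :: "'a alg_closure"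
  proof (rule ccontr)
    assume neg: "\<not> (\<exists>s\<in>rc_cone. \<exists>t\<in>rc_cone. - 1 = s + a * t)"
    define T where "T = {s + a * t |s t. s \<in> rc_cone & t \<in> rc_cone}"
    have sub: "rc_cone <= T"
    proof
      fix s assume "s \<in> (rc_cone :: 'a alg_closure set)"
      hence "s = s + a * 0 & s \<in> rc_cone & 0 \<in> rc_cone" using rc_cone_closed(7) by simp
      thus "s \<in> T" unfolding T_def by blast
    qed
    have "ordered_subfield rc_field T"
      unfolding ordered_subfield_def
    proof (intro conjI ballI allI impI)
      show "1 \<in> rc_field" by (rule rc_closed)
      show "T <= rc_field"
        unfolding T_def using rc_closed(7)[OF rc_cone_closed(1) rc_closed(3)[OF a(1) rc_cone_closed(1)]] by auto
      fix x y assume "x \<in> T" "y \<in> T"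
      then obtain s t s' t' where x: "x = s + a * t" "y = s' + a * t'"
        and st: "s \<in> rc_cone" "t \<in> rc_cone" "s' \<in> rc_cone" "t' \<in> rc_cone" by (auto simp: T_def)
      have "x + y = (s + s') + a * (t + t')" by (simp add: x algebra_simps)
      thus "x + y \<in> T" using st rc_cone_closed(2) by (auto simp: T_def)
      have "x * y = (s * s' + (a * a) * (t * t')) + a * (s * t' + t * s')" by (simp add: x algebra_simps)
      moreover have "s * s' + (a * a) * (t * t') \<in> rc_cone"
        by (rule rc_cone_closed(2)[OF rc_cone_closed(3)[OF st(1,3)]
            rc_cone_closed(3)[OF rc_cone_closed(4)[OF a(1)] rc_cone_closed(3)[OF st(2,4)]]])
      moreover have "s * t' + t * s' \<in> rc_cone"
        by (rule rc_cone_closed(2)[OF rc_cone_closed(3)[OF st(1,4)] rc_cone_closed(3)[OF st(2,3)]])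
      ultimately show "x * y \<in> T" unfolding T_def by blast
    next
      fix x :: 'a
      show "to_ac x \<in> T" if "0 <= x" using sub rc_cone_closed(6)[OF that] by blast
    next
      show "- 1 ~: T" using neg by (auto simp: T_def)
      show "x * x \<in> T" if "x \<in> rc_field" for x using sub rc_cone_closed(4)[OF that] by blast
    qed (rule rc_closed; assumption)+
    from rc_maximal[OF this order_refl sub] have "T = rc_cone" by simp
    moreover have "a = 0 + a * 1" by simp
    hence "a \<in> T" unfolding T_def using rc_cone_closed(7,8) by blast
    ultimately show False using a by simp
  qed
  show ?thesis
  proof (rule ccontr)
    assume "\<not> ?thesis"
    hence n: "a ~: rc_cone" "- a ~: rc_cone" by auto
    obtain s t where st: "s \<in> rc_cone" "t \<in> rc_cone" "- 1 = s + a * t" using step[OF a n(1)] by blast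
    obtain s' t' where st': "s' \<in> rc_cone" "t' \<in> rc_cone" "- 1 = s' + (- a) * t'"
      using step[OF rc_closed(6)[OF a] n(2)] by blast
    \<comment> \<open>The right-hand side vanishes because \<open>1 + s = - (a * t)\<close> and
      \<open>1 + s' = a * t'\<close>.\<close>
    have "1 + (s + s' + s * s' + (a * a) * (t * t')) = (1 + s) * (1 + s') + (a * t) * (a * t')"
      by (simp add: algebra_simps)
    hence "1 + (s + s' + s * s' + (a * a) * (t * t')) = 0" using st(3) st'(3) add_uminus_conv_diff by (metis (no_types, lifting) add.commute add_eq_0_iff add_uminus_conv_diff diff_eq_eq minus_mult_left mult_minus_left uminus_add_conv_diff)
    hence "- 1 \<in> (rc_cone :: 'a alg_closure set)" by (metis st st' rc_cone_closed(2,3,4) a minus_unique)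
    thus False using rc_cone_closed(5) by blast
  qed
qed

lemma rc_cone_antisym: assumes "x \<in> rc_cone" "- x \<in> rc_cone" shows "x = 0"
proof (rule ccontr)
  assume "x ~= 0"
  have "(- x) * x * (inverse x * inverse x) \<in> rc_cone" by (metis assms rc_cone_closed(1,4) rc_closed(4) rc_cone_closed(3))
  thus False using \<open>x ~= 0\<close> rc_cone_closed(5) by (auto simp: field_simps)
qed

typedef (overloaded) 'k real_closure = "rc_field :: 'k::linordered_field alg_closure set"
  morphisms rc_rep rc_abs
  using rc_closed by blast

setup_lifting type_definition_real_closure

instantiation real_closure :: (linordered_field) linordered_field
begin

lift_definition zero_real_closure :: "'a real_closure" is 0 by (rule rc_closed)
lift_definition one_real_closure :: "'a real_closure" is 1 by (rule rc_closed)
lift_definition plus_real_closure :: "'a real_closure => 'a real_closure => 'a real_closure" is "(+)" by (rule rc_closed)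
lift_definition minus_real_closure :: "'a real_closure => 'a real_closure => 'a real_closure" is "(-)" by (rule rc_closed)
lift_definition uminus_real_closure :: "'a real_closure => 'a real_closure" is uminus by (rule rc_closed)
lift_definition times_real_closure :: "'a real_closure => 'a real_closure => 'a real_closure" is "(*)" by (rule rc_closed)
lift_definition inverse_real_closure :: "'a real_closure => 'a real_closure" is inverse by (rule rc_closed)
definition divide_real_closure :: "'a real_closure => 'a real_closure => 'a real_closure" where
  "divide_real_closure x y = x * inverse y"
lift_definition less_eq_real_closure :: "'a real_closure => 'a real_closure => bool" is "\<lambda>x y. y - x \<in> rc_cone" .
definition less_real_closure :: "'a real_closure => 'a real_closure => bool" where
  "less_real_closure x y \<longleftrightarrow> x <= y & x ~= y"
definition abs_real_closure :: "'a real_closure => 'a real_closure" where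
  "abs_real_closure x = (if x < 0 then - x else x)"
definition sgn_real_closure :: "'a real_closure => 'a real_closure" where
  "sgn_real_closure x = (if x = 0 then 0 else if 0 < x then 1 else - 1)"

instance
proof
  fix a b c :: "'a real_closure"
  show "a * b * c = a * (b * c)" "a + b + c = a + (b + c)" by (transfer, simp add: algebra_simps)+
  show "a * b = b * a" "a + b = b + a" by (transfer, simp)+
  show "1 * a = a" "0 + a = a" "- a + a = 0" by (transfer, simp)+
  show "a + b - a = b" "a - b - c = a - (b + c)" "0 * a = 0" "a * 0 = 0" by (transfer, simp add: algebra_simps)+
  show "a - b = a + - b" "(a + b) * c = a * c + b * c" by (transfer, simp add: algebra_simps)+
  show "(0::'a real_closure) ~= 1" by (transfer, simp)
  show "a ~= 0 ==> inverse a * a = 1" by (transfer, simp)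
  show "inverse (0::'a real_closure) = 0" by (transfer, simp)
  show "a div b = a * inverse b" by (simp add: divide_real_closure_def)
  show refl: "a <= a" for a :: "'a real_closure" by transfer (simp add: rc_cone_closed)
  show trans: "a <= b ==> b <= c ==> a <= c"
    by (transfer, drule (1) rc_cone_closed(2), simp)
  show antisym: "a <= b ==> b <= a ==> a = b" for a b :: "'a real_closure"
    by transfer (metis eq_iff_diff_eq_0 minus_diff_eq rc_cone_antisym)
  show "(a < b) = (a <= b & \<not> b <= a)" using antisym refl by (auto simp: less_real_closure_def)
  show tot: "a <= b | b <= a" by transfer (metis minus_diff_eq rc_closed(2) rc_cone_total)
  show "a <= b ==> c + a <= c + b" by transfer simp
  have mul: "0 <= a ==> 0 <= b ==> 0 <= a * b" for a b :: "'a real_closure"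
    by transfer (simp add: rc_cone_closed)
  have add: "a <= b \<longleftrightarrow> 0 <= b - a" for a b :: "'a real_closure" by transfer simp
  show "a < b ==> 0 < c ==> c * a < c * b"
  proof -
    assume h: "a < b" "0 < c"
    have ring: "c * b - c * a = c * (b - a)" by transfer (simp add: algebra_simps)
    have le: "c * a <= c * b" using h mul[of c "b - a"] add[of a b] add[of "c * a" "c * b"] ring
      by (simp add: less_real_closure_def)
    have "c * a ~= c * b" using h unfolding less_real_closure_def by transfer auto
    thus "c * a < c * b" using le by (simp add: less_real_closure_def)
  qed
  show "\<bar>a\<bar> = (if a < 0 then - a else a)" by (simp add: abs_real_closure_def)
  show "sgn a = (if a = 0 then 0 else if 0 < a then 1 else - 1)" by (simp add: sgn_real_closure_def)
qed

end

lift_definition to_rc :: "'k::linordered_field => 'k real_closure" is to_ac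
proof -
  fix x :: 'k
  show "to_ac x \<in> rc_field"
  proof (cases "x >= 0")
    case True thus ?thesis using rc_cone_closed(1,6) by blast
  next
    case False
    thus ?thesis using rc_cone_closed(6)[of "- x"] rc_cone_closed(1) rc_closed(6) by fastforce
  qed
qed

lemma rhom_to_rc: "rhom to_rc"
  unfolding rhom_def by (intro conjI allI; transfer; simp)

lemma sg_to_rc: "sg (to_rc x) = sg x"
proof -
  have le: "0 <= to_rc x" if "0 <= x" for x :: 'a using that by transfer (simp add: rc_cone_closed)
  have z: "to_rc x = 0 \<longleftrightarrow> x = 0" for x :: 'a by transfer simp
  have m: "to_rc (- x) = - to_rc x" for x :: 'a by transfer simp
  have pos: "0 < to_rc x" if "0 < x" for x :: 'a using le[of x] z[of x] that by (simp add: order_le_less)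
  consider "x > 0" | "x = 0" | "x < 0" by fastforce
  thus ?thesis
    using pos[of x] pos[of "- x"] m[of x] by (fastforce simp: sg_def)
qed

section \<open>The intermediate value property of the real closure\<close>

inductive_set weighted_squares :: "'a::comm_ring_1 set => 'a set => 'a set" for B E where
  zero: "0 \<in> weighted_squares B E"
| add: "c \<in> B ==> e \<in> E ==> y \<in> weighted_squares B E ==> c * (e * e) + y \<in> weighted_squares B E"

lemma weighted_squares_add:
  "x \<in> weighted_squares B E ==> y \<in> weighted_squares B E ==> x + y \<in> weighted_squares B E"
  by (induction rule: weighted_squares.induct) (auto simp: add.assoc intro: weighted_squares.add)

lemma weighted_squares_mult:
  assumes B: "!!x y. x \<in> B ==> y \<in> B ==> x * y \<in> B" and E: "!!x y. x \<in> E ==> y \<in> E ==> x * y \<in> E"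
    and y: "y \<in> weighted_squares B E"
  shows "x \<in> weighted_squares B E ==> x * y \<in> weighted_squares B E"
proof (induction rule: weighted_squares.induct)
  case zero thus ?case by (simp add: weighted_squares.zero)
next
  case (add c e z)
  have "c * (e * e) * y \<in> weighted_squares B E"
    using y
  proof (induction rule: weighted_squares.induct)
    case zero thus ?case by (simp add: weighted_squares.zero)
  next
    case (add d f w)
    have "(c * d) * ((e * f) * (e * f)) + c * (e * e) * w \<in> weighted_squares B E"
      by (rule weighted_squares.add) (use B E add \<open>c \<in> B\<close> \<open>e \<in> E\<close> in auto)
    thus ?case by (simp add: algebra_simps)
  qed
  thus ?case using weighted_squares_add add by (simp add: algebra_simps)
qed

lemma rhom_rc_rep: "rhom rc_rep"
  unfolding rhom_def by (simp add: one_real_closure.rep_eq plus_real_closure.rep_eq times_real_closure.rep_eq)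

lemma rc_rep_eq_0: "rc_rep x = 0 \<longleftrightarrow> x = 0"
  by (metis rc_rep_inject zero_real_closure.rep_eq)

text \<open>An argument in the style of Artin and Schreier on a counterexample \<open>p\<close> of
  least degree \<open>d\<close>. Adjoining a root \<open>\<theta>\<close> of \<open>p\<close> gives
  a field preordered by the weighted sums of squares. By maximality \<open>\<theta>\<close> already
  belongs to the real closure, so \<open>d = 1\<close>; but a linear polynomial with a sign change
  has its root in between.\<close>

lemma real_closure_ivt_poly:
  fixes p :: "'k::linordered_field real_closure poly"
  assumes "x < y" "poly p x < 0" "0 < poly p y"
  shows "\<exists>z>x. z < y & poly p z = 0"
proof (rule ccontr)
  assume noz: "\<not> ?thesis"
  define bad where "bad n \<longleftrightarrow> (\<exists>p :: 'k real_closure poly. \<exists>a b. degree p = n & a < b & poly p a * poly p b < 0 &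
     (\<forall>z>a. z < b --> poly p z ~= 0))" for n
  define d where "d = (LEAST n. bad n)"
  have notbad: "\<exists>z>a. z < b & poly q z = 0" if "degree q < d" "a < b" "poly q a * poly q b < 0" for q :: "'k real_closure poly" and a b
    using that not_less_Least[of "degree q" bad] unfolding d_def bad_def by blast
  obtain p :: "'k real_closure poly" and a b where p: "degree p = d" "a < b" "poly p a * poly p b < 0"
    "!!z. a < z ==> z < b ==> poly p z ~= 0" by (metis assms noz mult_neg_pos LeastI d_def bad_def)
  \<comment> \<open>A factor of \<open>p\<close> that changes sign has no root in the interval
    either, so it is again a counterexample.\<close>
  have nofac: "degree q >= d" if "p = q * r" "poly q a * poly q b < 0" for q r
    using notbad[of q a b] that p by (metis mult_eq_0_iff not_le poly_mult)
  have fac: "degree q >= d | degree r >= d" if pq: "p = q * r" for q r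
  proof -
    have "(poly q a * poly q b) * (poly r a * poly r b) < 0" using p(3) pq by (simp add: algebra_simps)
    thus ?thesis by (metis mult_nonneg_nonneg not_le nofac[of q r] nofac[of r q] pq mult.commute)
  qed
  have d1: "d >= 1"
  proof (rule ccontr)
    assume "\<not> d >= 1"
    then obtain c where "p = [:c:]" using p(1) degree_eq_zeroE by (metis less_one not_le)
    thus False using p(3) by (simp add: mult_less_0_iff)
  qed
  have p0: "p ~= 0" using p(1) d1 by auto
  define \<rho> where "\<rho> = (rc_rep :: 'k real_closure => 'k alg_closure)"
  have \<rho>: "rhom \<rho>" and \<rho>0: "\<rho> c = 0 \<longleftrightarrow> c = 0" for c
    using rhom_rc_rep rc_rep_eq_0 by (auto simp: \<rho>_def)
  obtain \<theta> where \<theta>: "poly (map_poly \<rho> p) \<theta> = 0" using p(1) lead_coeff_map[OF \<rho>, of p] leading_coeff_neq_0[OF p0] \<rho>0 alg_closed_imp_poly_has_root[of "map_poly \<rho> p"] d1 by auto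
  define ev where "ev g = poly (map_poly \<rho> g) \<theta>" for g
  have ev: "rhom ev"
    unfolding rhom_def ev_def
    by (auto simp: rhom_map_poly[OF \<rho>] map_poly_1 rhomD[OF \<rho>])
  note evD = rhomD[OF ev]
  have evc: "ev [:c:] = \<rho> c" for c by (simp add: ev_def map_poly_pCons rhomD[OF \<rho>])
  have evp: "ev p = 0" using \<theta> by (simp add: ev_def)
  \<comment> \<open>\<open>r\<close> is a greatest common divisor of \<open>p\<close> and
    \<open>g\<close> in Bezout form. The property \<open>fac\<close> amounts to irreducibility of
    \<open>p\<close>, so one of the factors \<open>r\<close> and \<open>s\<close> is
    constant.\<close>
  have bez: "\<exists>r s s' u v. r = u * g + v * p & p = r * s & g = r * s' & (degree r = 0 | degree s = 0)" for g
  proof -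
    define J where "J = {u * g + v * p | u v. True}"
    have pJ: "p \<in> J" "g \<in> J" unfolding J_def
      by (rule CollectI, rule exI[of _ 0], rule exI[of _ 1], simp)
        (rule CollectI, rule exI[of _ 1], rule exI[of _ 0], simp)
    obtain r where r: "r \<in> J" "r ~= 0" and least: "!!f. f \<in> J ==> f ~= 0 ==> degree r <= degree f"
      using ex_has_least_nat[of "\<lambda>r. r \<in> J & r ~= 0" p degree] pJ(1) p0 by blast
    obtain u v where uv: "r = u * g + v * p" using r by (auto simp: J_def)
    have dvd: "f = r * (f div r)" if f: "f \<in> J" for f
    proof -
      obtain u' v' where f': "f = u' * g + v' * p" using f by (auto simp: J_def)
      define q where "q = f div r"
      have "f mod r = f - r * q" by (simp add: q_def minus_mult_div_eq_mod)
      also have "\<dots> = (u' - u * q) * g + (v' - v * q) * p" by (simp add: f' uv algebra_simps)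
      finally have "f mod r \<in> J" unfolding J_def by blast
      hence "f mod r = 0" using least degree_mod_less'[OF r(2)] by (metis not_less)
      thus ?thesis by (metis add_0_right mult_div_mod_eq)
    qed
    have "degree r = 0 | degree (p div r) = 0"
      using fac[OF dvd[OF pJ(1)]] degree_mult_eq[of r "p div r"] dvd[OF pJ(1)] p(1) p0
      by (metis add_le_same_cancel1 add_le_same_cancel2 le_zero_eq mult_zero_right r(2))
    thus ?thesis using uv dvd pJ by blast
  qed
  have ev_min: "degree m >= d" if m: "ev m = 0" "m ~= 0" for m
  proof -
    obtain r s s' u v where r: "r = u * m + v * p" "p = r * s" "m = r * s'" "degree r = 0 | degree s = 0" using bez by blast
    have nz: "r ~= 0" "s ~= 0" "s' ~= 0" using r(2,3) p0 m(2) by auto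
    have "ev r = 0" using r(1) evD(2,3) evp m(1) by simp
    hence "degree r ~= 0" using evc \<rho>0 nz(1) by (metis degree_eq_zeroE pCons_0_0)
    thus ?thesis using r(4) degree_mult_eq[OF nz(1,2)] degree_mult_eq[OF nz(1,3)] p(1) r(2,3) by simp
  qed
  have ev_mod: "\<exists>h. degree h < d & ev h = ev g" for g
  proof (intro exI conjI)
    show "degree (g mod p) < d" using degree_mod_less[OF p0, of g] p(1) d1 by auto
    show "ev (g mod p) = ev g" using evD(2)[of "p * (g div p)" "g mod p"] evD(3)[of p "g div p"] evp by simp
  qed
  define E' where "E' = range ev"
  define B where "B = \<rho> ` {c. c >= 0}"
  define T' where "T' = weighted_squares B E'"
  have rcE: "rc_field <= E'"
  proof
    fix z assume "z \<in> (rc_field :: 'k alg_closure set)"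
    then obtain c where "z = \<rho> c" unfolding \<rho>_def using rc_abs_inverse by metis
    hence "z = ev [:c:]" using evc by simp
    thus "z \<in> E'" by (simp add: E'_def)
  qed
  have E1: "1 \<in> E'" using evD(1) by (metis E'_def rangeI)
  have Em: "x * y \<in> E'" if "x \<in> E'" "y \<in> E'" for x y
    using that evD(3) unfolding E'_def by (metis (no_types, lifting) imageE rangeI)
  have Ed: "x - y \<in> E'" if "x \<in> E'" "y \<in> E'" for x y
    using that evD(6) unfolding E'_def by (metis (no_types, lifting) imageE rangeI)
  have Ea: "x + y \<in> E'" if "x \<in> E'" "y \<in> E'" for x y
    using that evD(2) unfolding E'_def by (metis (no_types, lifting) imageE rangeI)
  have Ei: "inverse x \<in> E'" if x: "x \<in> E'" for x
  proof (cases "x = 0")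
    case True thus ?thesis using x by simp
  next
    case False
    obtain g where g: "x = ev g" using x by (auto simp: E'_def)
    obtain r s s' u v where r: "r = u * g + v * p" "p = r * s" "g = r * s'" "degree r = 0 | degree s = 0" using bez by blast
    have nz: "r ~= 0" "s ~= 0" using r(2) p0 by auto
    have "degree s ~= 0"
    proof
      assume "degree s = 0"
      hence "ev s ~= 0" using evc \<rho>0 nz(2) by (metis degree_eq_zeroE pCons_0_0)
      thus False using False g r(2,3) evD(3) evp by (metis mult_eq_0_iff)
    qed
    then obtain c where c: "r = [:c:]" using r(4) degree_eq_zeroE by metis
    hence c0: "c ~= 0" using nz by auto
    have "ev [:inverse c:] * ev u * x = 1" by (metis (no_types, lifting) r(1) c evp evD(2,3) evc add.right_neutral mult_zero_right g c0 rhomD(1,3)[OF \<rho>] mult.assoc left_inverse)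
    thus ?thesis using inverse_unique mult.commute Em by (metis E'_def rangeI)
  qed
  have Bm: "x * y \<in> B" if "x \<in> B" "y \<in> B" for x y
    using that rhomD(3)[OF \<rho>] unfolding B_def by (auto simp: image_iff) (metis mult_nonneg_nonneg)
  have TE: "T' <= E'"
  proof
    fix z assume "z \<in> T'"
    thus "z \<in> E'" unfolding T'_def
    proof (induction rule: weighted_squares.induct)
      case zero thus ?case using Ed[OF E1 E1] by simp
    next
      case (add c e y) thus ?case using rcE by (auto simp: B_def \<rho>_def intro!: rc_rep Ea Em)
    qed
  qed
  have B1: "1 \<in> B" unfolding B_def using rhomD(1)[OF \<rho>] by (metis (mono_tags) imageI mem_Collect_eq zero_le_one)
  have BT: "B <= T'"
  proof
    fix c assume "c \<in> B"
    thus "c \<in> T'" using weighted_squares.intros E1 by (fastforce simp: T'_def)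
  qed
  have coneB: "rc_cone <= B"
  proof
    fix z assume z: "z \<in> (rc_cone :: 'k alg_closure set)"
    then obtain c where c: "z = \<rho> c" unfolding \<rho>_def using rc_abs_inverse rc_cone_closed(1) by metis
    thus "z \<in> B" using z by (auto simp: less_eq_real_closure.rep_eq \<rho>_def zero_real_closure.rep_eq B_def)
  qed
  \<comment> \<open>Reducing modulo \<open>p\<close> before squaring leaves the value at
    \<open>\<theta>\<close> unchanged and keeps the degree at most \<open>2 * d - 2\<close>.\<close>
  have posrep: "\<exists>G. ev G = z & (\<forall>t. poly G t >= 0) & degree G <= 2 * d - 2" if "z \<in> T'" for z
    using that unfolding T'_def
  proof (induction rule: weighted_squares.induct)
    case zero thus ?case by (intro exI[of _ 0]) (auto simp: evD)
  next
    case (add c e y)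
    then obtain G where G: "ev G = y" "\<forall>t. poly G t >= 0" "degree G <= 2 * d - 2" by blast
    obtain c' where c': "c = \<rho> c'" "c' >= 0" using add by (auto simp: B_def)
    obtain g0 where "e = ev g0" using add by (auto simp: E'_def)
    then obtain g where g: "e = ev g" "degree g < d" using ev_mod[of g0] by metis
    have "ev ([:c':] * (g * g) + G) = c * (e * e) + y" by (simp only: evD(2,3) evc c' g G)
    moreover have "poly ([:c':] * (g * g) + G) t >= 0" for t
      using G(2)[rule_format, of t] c' by simp
    moreover have "degree ([:c':] * (g * g) + G) <= 2 * d - 2"
    proof (rule degree_add_le)
      show "degree ([:c':] * (g * g)) <= 2 * d - 2" using degree_smult_le[of c' "g * g"] degree_mult_le[of g g] g by simp
    qed (use G in simp)
    ultimately show ?case by blast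
  qed
  have "- 1 ~: T'"
  proof
    assume "- 1 \<in> T'"
    then obtain G where G: "ev G = - 1" "!!t. poly G t >= 0" "degree G <= 2 * d - 2" using posrep by blast
    have ev0: "ev (1 + G) = 0" using G evD(1,2) by simp
    define s where "s = (1 + G) div p"
    have "ev ((1 + G) mod p) = 0" using evD(2)[of "p * s" "(1 + G) mod p"] evD(3)[of p s] evp ev0 by (simp add: s_def)
    hence "(1 + G) mod p = 0" using ev_min degree_mod_less'[OF p0, of "1 + G"] p(1) by (metis not_less)
    hence e: "1 + G = p * s" unfolding s_def by (metis add_0_right mult_div_mod_eq)
    have pos: "poly (1 + G) t > 0" for t using G(2)[of t] by (simp add: add_pos_nonneg)
    have "1 + G ~= 0" using pos[of 0] by (metis less_irrefl poly_0)
    hence s0: "s ~= 0" using e by auto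
    have "degree (1 + G) <= 2 * d - 2" using G(3) by (intro degree_add_le) auto
    moreover have "degree (1 + G) = d + degree s" using e degree_mult_eq[OF p0 s0] p(1) by simp
    ultimately have ds: "degree s < d" using d1 by simp
    have ee: "poly (1 + G) t = poly p t * poly s t" for t by (simp add: e)
    have "(poly p a * poly p b) * (poly s a * poly s b) = poly (1 + G) a * poly (1 + G) b" by (simp only: ee mult_ac)
    hence "(poly p a * poly p b) * (poly s a * poly s b) > 0" using mult_pos_pos[OF pos pos] by metis
    \<comment> \<open>The cofactor \<open>s\<close> has degree below \<open>d\<close> and inherits
      the sign change of \<open>p\<close>. Minimality gives it a root, where \<open>1 + G\<close>
      would vanish although it is positive.\<close>
    hence "poly s a * poly s b < 0" using p(3) by (meson mult_nonpos_nonneg not_le order.strict_implies_order)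
    from notbad[OF ds p(2) this] obtain z where z: "a < z" "z < b" "poly s z = 0" by blast
    thus False using ee[of z] pos[of z] by simp
  qed
  have os: "ordered_subfield E' T'"
    unfolding ordered_subfield_def
  proof (intro conjI ballI allI impI)
    show "x * x \<in> T'" if "x \<in> E'" for x
      using weighted_squares.intros B1 that by (fastforce simp: T'_def)
    show "to_ac c \<in> T'" if "0 <= c" for c using rc_cone_closed(6)[OF that] coneB BT by blast
    show "x + y \<in> T'" "x * y \<in> T'" if "x \<in> T'" "y \<in> T'" for x y
      using that weighted_squares_add weighted_squares_mult[OF Bm Em] unfolding T'_def by blast+
  qed (use E1 Em Ed Ei TE \<open>- 1 ~: T'\<close> in auto)
  from rc_maximal[OF os rcE] coneB BT have "E' = rc_field" by blast
  moreover have "\<theta> = ev [:0, 1:]" by (simp add: ev_def map_poly_pCons rhomD[OF \<rho>])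
  ultimately have "\<theta> \<in> rc_field" by (metis E'_def rangeI)
  then obtain t where t: "\<theta> = \<rho> t" unfolding \<rho>_def using rc_abs_inverse by metis
  have "d = 1" using ev_min[of "[:- t, 1:]"] d1 by (simp add: ev_def map_poly_pCons rhomD[OF \<rho>] t)
  obtain u q where uq: "p = pCons u q" by (cases p)
  have "q ~= 0" using uq p(1) \<open>d = 1\<close> by auto
  moreover have "degree q = 0" using uq p(1) \<open>d = 1\<close> by (simp split: if_splits)
  ultimately obtain v where pe: "p = [:u, v:]" "v ~= 0" using uq degree_eq_zeroE by (metis pCons_0_0)
  define z where "z = - u / v"
  have pz: "poly p w = v * (w - z)" for w using pe by (simp add: z_def field_simps)
  have "(v * v) * ((a - z) * (b - z)) < 0" using p(3) by (simp add: pz algebra_simps)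
  thus False using p(2) p(4)[of z] pz[of z] by (auto simp: mult_less_0_iff)
qed

instance real_closure :: (linordered_field) rcf
proof
  fix x y :: "'a real_closure" and c :: "nat => 'a real_closure" and n
  assume h: "x < y" "(\<Sum>k\<le>n. c k * x ^ k) < 0" "0 < (\<Sum>k\<le>n. c k * y ^ k)"
  define p where "p = (\<Sum>k\<le>n. monom (c k) k)"
  have p: "poly p t = (\<Sum>k\<le>n. c k * t ^ k)" for t by (simp add: p_def poly_sum poly_monom)
  show "\<exists>z>x. z < y & (\<Sum>k\<le>n. c k * z ^ k) = 0"
    using real_closure_ivt_poly[of x y p] h unfolding p by blast
qed

no_notation fps_nth (infixl "$" 75)

subsection \<open>The ring of polynomial functions\<close>

typedef 'n pfun = "{f :: (real ^ 'n::finite) => real. real_polynomial_function f}"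
  morphisms pev Pfun
  by auto

setup_lifting type_definition_pfun

lemma pfun_eqI: "(!!x. pev f x = pev g x) ==> f = g"
  by (metis ext pev_inject)

lemma pev_Pfun: "real_polynomial_function f ==> pev (Pfun f) = f"
  by (simp add: Pfun_inverse)

lemma rpf_pev: "real_polynomial_function (pev f)"
  using pev by blast

text \<open>Restriction to the line through two points reduces the absence of zero divisors to
  polynomials in one variable.\<close>

lemma real_polynomial_function_line:
  assumes "real_polynomial_function f"
  shows "\<exists>P. \<forall>t. f (x + t *\<^sub>R d) = poly P t"
  using assms
proof induction
  case (linear f)
  hence "f (x + t *\<^sub>R d) = poly [:f x, f d:] t" for t
    by (simp add: linear_add linear_scale bounded_linear.linear)
  thus ?case by blast
next
  case (const c)
  thus ?case by (intro exI[of _ "[:c:]"]) simp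
next
  case (add f g)
  then obtain P Q where "\<forall>t. f (x + t *\<^sub>R d) = poly P t" "\<forall>t. g (x + t *\<^sub>R d) = poly Q t" by blast
  thus ?case by (intro exI[of _ "P + Q"]) simp
next
  case (mult f g)
  then obtain P Q where "\<forall>t. f (x + t *\<^sub>R d) = poly P t" "\<forall>t. g (x + t *\<^sub>R d) = poly Q t" by blast
  thus ?case by (intro exI[of _ "P * Q"]) simp
qed

instantiation pfun :: (finite) idom
begin

lift_definition zero_pfun :: "'a pfun" is "\<lambda>x. 0" by auto
lift_definition one_pfun :: "'a pfun" is "\<lambda>x. 1" by auto
lift_definition plus_pfun :: "'a pfun => 'a pfun => 'a pfun" is "\<lambda>f g x. f x + g x" by auto
lift_definition minus_pfun :: "'a pfun => 'a pfun => 'a pfun" is "\<lambda>f g x. f x - g x" by auto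
lift_definition uminus_pfun :: "'a pfun => 'a pfun" is "\<lambda>f x. - f x" by auto
lift_definition times_pfun :: "'a pfun => 'a pfun => 'a pfun" is "\<lambda>f g x. f x * g x" by auto

instance
proof
  fix a b c :: "'a pfun"
  show "a * b * c = a * (b * c)" "a + b + c = a + (b + c)" "a * b = b * a" "a + b = b + a"
    "1 * a = a" "0 + a = a" "- a + a = 0" "a - b = a + - b" "(a + b) * c = a * c + b * c"
    "0 * a = 0" "a * 0 = 0" "a * (b + c) = a * b + a * c"
    by (transfer, simp add: algebra_simps fun_eq_iff)+
  show "(0::'a pfun) ~= 1" by transfer (simp add: fun_eq_iff)
  show "a ~= 0 ==> b ~= 0 ==> a * b ~= 0"
  proof transfer
    fix f g :: "real ^ 'a => real"
    assume f: "real_polynomial_function f" "f ~= (\<lambda>x. 0)" and g: "real_polynomial_function g" "g ~= (\<lambda>x. 0)"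
    obtain x where x: "f x ~= 0" using f by auto
    obtain y where y: "g y ~= 0" using g by auto
    obtain P where P: "!!t. f (x + t *\<^sub>R (y - x)) = poly P t" using real_polynomial_function_line[OF f(1)] by metis
    obtain Q where Q: "!!t. g (x + t *\<^sub>R (y - x)) = poly Q t" using real_polynomial_function_line[OF g(1)] by metis
    have "P * Q ~= 0" using Q[of 1] y P[of 0] x by auto
    then obtain t where "poly (P * Q) t ~= 0" using poly_all_0_iff_0 by blast
    hence "f (x + t *\<^sub>R (y - x)) * g (x + t *\<^sub>R (y - x)) ~= 0" by (simp add: P Q)
    thus "(\<lambda>x. f x * g x) ~= (\<lambda>x. 0)" by metis
  qed
qed

end

instantiation pfun :: (finite) real_algebra_1
begin
lift_definition scaleR_pfun :: "real => 'a pfun => 'a pfun" is "\<lambda>c f x. c * f x" by auto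
instance by standard (transfer, simp add: algebra_simps fun_eq_iff)+
end

lift_definition pvar :: "'n::finite => 'n pfun" is "\<lambda>i x. x $ i"
  by (rule real_polynomial_function.intros(1)) (rule bounded_linear_vec_nth)

lemma pev_simps [simp]:
  "pev 0 x = 0" "pev 1 x = 1" "pev (f + g) x = pev f x + pev g x" "pev (f - g) x = pev f x - pev g x"
  "pev (- f) x = - pev f x" "pev (f * g) x = pev f x * pev g x" "pev (c *\<^sub>R f) x = c * pev f x"
  "pev (pvar i) x = x $ i"
  by (transfer, simp)+

lemma pev_of_real [simp]: "pev (of_real c) x = c"
  by (simp add: of_real_def)

lemma pev_power [simp]: "pev (f ^ k) x = pev f x ^ k"
  by (induction k) auto

lemma pev_of_nat [simp]: "pev (of_nat k) x = of_nat k"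
  by (induction k) auto

lemma pev_sum [simp]: "pev (sum f A) x = (\<Sum>a\<in>A. pev (f a) x)"
  by (induction A rule: infinite_finite_induct) auto

lemma pev_prod [simp]: "pev (prod f A) x = (\<Prod>a\<in>A. pev (f a) x)"
  by (induction A rule: infinite_finite_induct) auto

lemma continuous_on_pev: "continuous_on S (pev f)"
proof -
  have "continuous_on S f" if "real_polynomial_function f" for f :: "real ^ 'a => real"
    using that by (induction) (auto intro!: continuous_intros simp: linear_continuous_on)
  thus ?thesis using rpf_pev by blast
qed

text \<open>Enlarging \<open>I\<close> by one variable at a time is the induction behind both the
  basis theorem and the Artin--Lang theorem.\<close>

inductive_set vars_ring :: "'n::finite set => 'n pfun set" for I where
  const: "of_real c \<in> vars_ring I"
| var: "i \<in> I ==> pvar i \<in> vars_ring I"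
| add: "f \<in> vars_ring I ==> g \<in> vars_ring I ==> f + g \<in> vars_ring I"
| mult: "f \<in> vars_ring I ==> g \<in> vars_ring I ==> f * g \<in> vars_ring I"

lemma subringp_vars_ring: "subringp (vars_ring I)"
proof -
  have "of_real (- 1) * f \<in> vars_ring I" if "f \<in> vars_ring I" for f
    using that by (intro vars_ring.intros)
  hence m: "- f \<in> vars_ring I" if "f \<in> vars_ring I" for f using that by simp
  have "f - g \<in> vars_ring I" if "f \<in> vars_ring I" "g \<in> vars_ring I" for f g
    using vars_ring.add[OF that(1) m[OF that(2)]] by simp
  moreover have "1 \<in> vars_ring I" using vars_ring.const[of 1 I] by simp
  ultimately show ?thesis unfolding subringp_def by (blast intro: vars_ring.mult)
qed

lemma vars_ring_UNIV: "f \<in> vars_ring UNIV"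
proof -
  have "\<exists>g \<in> vars_ring UNIV. pev g = h" if "real_polynomial_function h" for h :: "real ^ 'a => real"
    using that
  proof induction
    case (linear h)
    define g where "g = (\<Sum>i\<in>UNIV. of_real (h (axis i 1)) * pvar i :: 'a pfun)"
    have "g \<in> vars_ring UNIV" unfolding g_def
      by (intro subringp_sum[OF subringp_vars_ring] vars_ring.intros) auto
    moreover have "pev g x = h x" for x
    proof -
      have "h x = h (\<Sum>i\<in>UNIV. (x $ i) *\<^sub>R axis i 1)" using basis_expansion[of x] by (simp add: scalar_mult_eq_scaleR)
      also have "\<dots> = (\<Sum>i\<in>UNIV. (x $ i) * h (axis i 1))"
        using linear by (simp add: linear_sum linear_scale bounded_linear.linear)
      finally show ?thesis by (simp add: g_def mult.commute)
    qed
    ultimately show ?case by blast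
  next
    case (const c)
    show ?case by (rule bexI[of _ "of_real c"]) (auto intro: vars_ring.intros)
  next
    case (add f g)
    then obtain f' g' where "f' \<in> vars_ring UNIV" "pev f' = f" "g' \<in> vars_ring UNIV" "pev g' = g" by blast
    thus ?case by (intro bexI[of _ "f' + g'"]) (auto intro: vars_ring.intros)
  next
    case (mult f g)
    then obtain f' g' where "f' \<in> vars_ring UNIV" "pev f' = f" "g' \<in> vars_ring UNIV" "pev g' = g" by blast
    thus ?case by (intro bexI[of _ "f' * g'"]) (auto intro: vars_ring.intros)
  qed
  from this[OF rpf_pev[of f]] show ?thesis by (metis pev_inject)
qed

lemma pfun_induct [case_names const var add mult]:
  assumes "!!c. P (of_real c)" "!!i. P (pvar i)" "!!f g. P f ==> P g ==> P (f + g)" "!!f g. P f ==> P g ==> P (f * g)"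
  shows "P f"
  using vars_ring_UNIV[of f] by (induction rule: vars_ring.induct) (use assms in auto)

lemma vars_ring_empty: "f \<in> vars_ring {} ==> \<exists>c. f = of_real c"
proof (induction rule: vars_ring.induct)
  case (add f g) thus ?case by (metis of_real_add)
next
  case (mult f g) thus ?case by (metis of_real_mult)
qed auto

lemma vars_ring_cong:
  "f \<in> vars_ring I ==> (!!i. i \<in> I ==> x $ i = y $ i) ==> pev f x = pev f y"
  by (induction rule: vars_ring.induct) auto

lemma vars_ring_insert:
  assumes "f \<in> vars_ring (insert i I)"
  shows "\<exists>P \<in> polys_over (vars_ring I). f = poly P (pvar i)"
  using assms
proof (induction rule: vars_ring.induct)
  case (const c)
  show ?case by (rule bexI[of _ "[:of_real c:]"])
      (auto simp: polys_over_def coeff_pCons split: nat.split intro: vars_ring.const subringpD[OF subringp_vars_ring])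
next
  case (var j)
  show ?case
  proof (cases "j = i")
    case True
    show ?thesis by (rule bexI[of _ "[:0, 1:]"])
      (auto simp: True polys_over_def coeff_pCons split: nat.split intro: subringpD[OF subringp_vars_ring])
  next
    case False
    thus ?thesis using var by (intro bexI[of _ "[:pvar j:]"])
      (auto simp: polys_over_def coeff_pCons split: nat.split intro: vars_ring.var subringpD[OF subringp_vars_ring])
  qed
next
  case (add f g)
  thus ?case using polys_over_closed(5)[OF subringp_vars_ring] by (metis poly_add)
next
  case (mult f g)
  thus ?case using polys_over_closed(4)[OF subringp_vars_ring] by (metis poly_mult)
qed

lemma vars_ring_poly:
  assumes "P \<in> polys_over (vars_ring I)" shows "poly P (pvar i) \<in> vars_ring (insert i I)"
proof -
  have "vars_ring I <= vars_ring (insert i I)"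
  proof
    fix f assume "f \<in> vars_ring I"
    thus "f \<in> vars_ring (insert i I)" by (induction rule: vars_ring.induct) (auto intro: vars_ring.intros)
  qed
  hence "coeff P k * pvar i ^ k \<in> vars_ring (insert i I)" for k
    using assms by (intro vars_ring.mult subringpD(8)[OF subringp_vars_ring] vars_ring.var) (auto simp: polys_over_def)
  thus ?thesis unfolding poly_altdef by (intro subringp_sum[OF subringp_vars_ring])
qed

subsection \<open>The Hilbert basis theorem\<close>

inductive_set ideal_gen :: "'c::comm_ring_1 set => 'c set => 'c set" for A G where
  zero: "0 \<in> ideal_gen A G"
| add: "a \<in> A ==> g \<in> G ==> y \<in> ideal_gen A G ==> a * g + y \<in> ideal_gen A G"

lemma ideal_gen_add: "x \<in> ideal_gen A G ==> y \<in> ideal_gen A G ==> x + y \<in> ideal_gen A G"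
  by (induction rule: ideal_gen.induct) (auto simp: add.assoc intro: ideal_gen.add)

lemma ideal_gen_mult:
  assumes "subringp A" "b \<in> A" shows "x \<in> ideal_gen A G ==> b * x \<in> ideal_gen A G"
proof (induction rule: ideal_gen.induct)
  case zero thus ?case by (simp add: ideal_gen.zero)
next
  case (add a g y)
  hence "(b * a) * g + b * y \<in> ideal_gen A G"
    using assms by (intro ideal_gen.add) (auto intro: subringpD)
  thus ?case by (simp add: algebra_simps)
qed

lemma ideal_gen_base: "subringp A ==> g \<in> G ==> g \<in> ideal_gen A G"
  using ideal_gen.add[OF subringpD(1) _ ideal_gen.zero, of A g G] by simp

definition ideal_in :: "'c::comm_ring_1 set => 'c set => bool" where
  "ideal_in A J \<longleftrightarrow> J <= A & 0 \<in> J & (\<forall>x\<in>J. \<forall>y\<in>J. x + y \<in> J) & (\<forall>a\<in>A. \<forall>x\<in>J. a * x \<in> J)"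

definition noetherian :: "'c::comm_ring_1 set => bool" where
  "noetherian A \<longleftrightarrow> (\<forall>J. ideal_in A J --> (\<exists>G. finite G & G <= J & J <= ideal_gen A G))"

text \<open>\<open>z\<close> may satisfy relations over \<open>A\<close>: degrees and coefficients
  are taken from representing polynomials. \<open>L n\<close> is the ideal of coefficients at
  \<open>n\<close> of polynomials of degree at most \<open>n\<close> whose value at \<open>z\<close>
  lies in \<open>J\<close>.\<close>

theorem hilbert_basis:
  fixes A B :: "'c::idom set"
  assumes A: "subringp A" and noe: "noetherian A" and B: "subringp B"
    and AB: "!!f. f \<in> B \<longleftrightarrow> (\<exists>P\<in>polys_over A. f = poly P z)"
  shows "noetherian B"
  unfolding noetherian_def
proof (intro allI impI)
  fix J assume J: "ideal_in B J"
  have Jadd: "x + y \<in> J" if "x \<in> J" "y \<in> J" for x y using J that by (auto simp: ideal_in_def)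
  have Jmul: "b * x \<in> J" if "b \<in> B" "x \<in> J" for b x using J that by (auto simp: ideal_in_def)
  have J0: "0 \<in> J" "J <= B" using J by (auto simp: ideal_in_def)
  have AsubB: "a \<in> B" if "a \<in> A" for a
    unfolding AB using that subringpD(2)[OF A]
    by (intro bexI[of _ "[:a:]"]) (auto simp: polys_over_def coeff_pCons split: nat.split)
  have zB: "z ^ k \<in> B" for k
    unfolding AB using subringpD(1)[OF A] by (intro bexI[of _ "monom 1 k"] polys_over_monom[OF A]) (auto simp: poly_monom)
  define W where "W n c P \<longleftrightarrow> P \<in> polys_over A & degree P <= n & coeff P n = c & poly P z \<in> J" for n c P
  define L where "L n = {c. \<exists>P. W n c P}" for n
  have Wadd: "W n (c + d) (P + Q)" if "W n c P" "W n d Q" for n c d P Q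
    using that Jadd polys_over_closed(5)[OF A] by (auto simp: W_def intro: degree_add_le)
  have Wmul: "W n (a * c) (smult a P)" if "W n c P" "a \<in> A" for n a c P
    using that Jmul AsubB polys_over_closed(2)[OF A] by (auto simp: W_def intro: order_trans[OF degree_smult_le])
  have Wsh: "W (n + k) c (monom 1 k * P)" if "W n c P" for n k c P
    using degree_mult_le[of "monom 1 k" P] degree_monom_le[of "1::'c" k] that Jmul[OF zB[of k]] polys_over_closed(4)[OF A polys_over_monom[OF A subringpD(1)[OF A]]] by (auto simp: W_def poly_monom coeff_monom_mult)
  have L_ideal: "ideal_in A (L n)" for n
    unfolding ideal_in_def
  proof (intro conjI ballI)
    show "L n <= A" by (auto simp: L_def W_def polys_over_def)
    show "0 \<in> L n" unfolding L_def W_def using J0 subringpD(2)[OF A] by (auto intro!: exI[of _ 0] simp: polys_over_def)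
    show "x + y \<in> L n" if "x \<in> L n" "y \<in> L n" for x y
      using that Wadd unfolding L_def by blast
    show "a * x \<in> L n" if "a \<in> A" "x \<in> L n" for a x
      using that Wmul unfolding L_def by blast
  qed
  have Lmono: "L n <= L m" if "n <= m" for n m
    using that Wsh[of n _ _ "m - n"] by (fastforce simp: L_def)
  have LU: "ideal_in A (\<Union>n. L n)"
    unfolding ideal_in_def
  proof (intro conjI ballI)
    show "(\<Union>n. L n) <= A" "0 \<in> (\<Union>n. L n)" using L_ideal unfolding ideal_in_def by blast+
    show "x + y \<in> (\<Union>n. L n)" if xy: "x \<in> (\<Union>n. L n)" "y \<in> (\<Union>n. L n)" for x y
    proof -
      obtain n m where "x \<in> L n" "y \<in> L m" using xy by blast
      hence "x \<in> L (max n m)" "y \<in> L (max n m)" using Lmono[of n "max n m"] Lmono[of m "max n m"] by auto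
      thus ?thesis using L_ideal[of "max n m"] by (auto simp: ideal_in_def)
    qed
    show "a * x \<in> (\<Union>n. L n)" if "a \<in> A" "x \<in> (\<Union>n. L n)" for a x
      using that L_ideal unfolding ideal_in_def by blast
  qed
  obtain GL where GL: "finite GL" "GL <= (\<Union>n. L n)" "(\<Union>n. L n) <= ideal_gen A GL"
    using noe LU unfolding noetherian_def by blast
  have "\<exists>n0. GL <= L n0"
    using GL(1,2)
  proof (induction GL)
    case (insert g S)
    then obtain n m where "S <= L n" "g \<in> L m" by auto
    hence "insert g S <= L (max n m)" using Lmono[of n "max n m"] Lmono[of m "max n m"] by auto
    thus ?case by blast
  qed simp
  then obtain n0 where n0: "GL <= L n0" by blast
  have "\<forall>n. \<exists>G. finite G & G <= L n & L n <= ideal_gen A G" using noe L_ideal unfolding noetherian_def by blast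
  then obtain G where G: "!!n. finite (G n) & G n <= L n & L n <= ideal_gen A (G n)" by metis
  \<comment> \<open>At \<open>n0\<close> generators of the union of all \<open>L n\<close> are used;
    they serve every degree from \<open>n0\<close> on, so finitely many degrees need
    generators.\<close>
  define GG where "GG n = (if n = n0 then GL else G n)" for n
  have GG: "finite (GG n)" "GG n <= L n" for n using G GL n0 by (auto simp: GG_def)
  have GGm: "\<exists>m\<le>n. m <= n0 & L n <= ideal_gen A (GG m)" for n
  proof (cases "n < n0")
    case True thus ?thesis using G by (intro exI[of _ n]) (auto simp: GG_def)
  next
    case False thus ?thesis using GL(3) by (intro exI[of _ n0]) (auto simp: GG_def)
  qed
  define PP where "PP n c = (SOME P. W n c P)" for n c
  have PP: "W n c (PP n c)" if "c \<in> L n" for n c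
    using that by (auto simp: L_def PP_def intro!: someI_ex)
  define GS where "GS = (\<Union>n\<in>{..n0}. (\<lambda>c. poly (PP n c) z) ` GG n)"
  have finGS: "finite GS" using GG(1) by (auto simp: GS_def)
  have GSJ: "GS <= J" using PP GG(2) by (fastforce simp: GS_def W_def)
  have lift: "\<exists>R. R \<in> polys_over A & degree R <= n & coeff R n = c & poly R z \<in> ideal_gen B GS"
    if c: "c \<in> ideal_gen A (GG m)" and m: "m <= n0" "m <= n" for c m n
    using c
  proof (induction rule: ideal_gen.induct)
    case zero
    show ?case using subringpD(2)[OF A] by (intro exI[of _ 0]) (auto simp: polys_over_def intro: ideal_gen.zero)
  next
    case (add a g y)
    then obtain R where R: "R \<in> polys_over A" "degree R <= n" "coeff R n = y" "poly R z \<in> ideal_gen B GS" by blast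
    have Wg: "W m g (PP m g)" using PP GG(2) add by blast
    define Q where "Q = monom a (n - m) * PP m g"
    have "Q \<in> polys_over A" unfolding Q_def
      using Wg add polys_over_closed(4)[OF A polys_over_monom[OF A]] by (auto simp: W_def)
    moreover have "degree Q <= n"
      using degree_mult_le[of "monom a (n - m)" "PP m g"] degree_monom_le[of a "n - m"] Wg m
      unfolding Q_def W_def by linarith
    moreover have "coeff Q n = a * g" using m Wg by (simp add: Q_def coeff_monom_mult W_def)
    moreover have "poly Q z \<in> ideal_gen B GS"
    proof -
      have "poly (PP m g) z \<in> GS" using m add by (auto simp: GS_def)
      moreover have "a * z ^ (n - m) \<in> B" using AsubB add zB subringpD(4)[OF B] by blast
      ultimately show ?thesis
        using ideal_gen_mult[OF B] ideal_gen_base[OF B] by (simp add: Q_def poly_monom)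
    qed
    ultimately show ?case using R polys_over_closed(5)[OF A]
      by (intro exI[of _ "Q + R"]) (auto intro: degree_add_le ideal_gen_add)
  qed
  have main: "poly P z \<in> ideal_gen B GS" if "P \<in> polys_over A" "poly P z \<in> J" "degree P <= n" for P n
    using that
  proof (induction n arbitrary: P rule: less_induct)
    case (less n)
    have "coeff P n \<in> L n" using less.prems by (auto simp: L_def W_def)
    then obtain m where m: "m <= n" "m <= n0" "coeff P n \<in> ideal_gen A (GG m)" using GGm by blast
    obtain R where R: "R \<in> polys_over A" "degree R <= n" "coeff R n = coeff P n" "poly R z \<in> ideal_gen B GS"
      using lift[OF m(3,2,1)] by blast
    have GSgen: "ideal_gen B GS <= J"
    proof
      fix x assume "x \<in> ideal_gen B GS"
      thus "x \<in> J" by (induction rule: ideal_gen.induct) (use J0 GSJ Jadd Jmul in auto)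
    qed
    have PR: "P - R \<in> polys_over A" using less.prems R polys_over_closed(1)[OF A] by blast
    have mB: "- 1 \<in> B" using subringpD(1,5)[OF B] by blast
    have "poly (P - R) z \<in> J"
      using Jmul[OF mB] R GSgen Jadd less.prems by fastforce
    have "poly (P - R) z \<in> ideal_gen B GS"
    proof (cases n)
      case 0
      hence "degree (P - R) = 0" using less.prems R degree_diff_le[of P 0 R] by simp
      hence "P - R = 0" using R 0 by (metis cancel_comm_monoid_add_class.diff_cancel coeff_diff leading_coeff_0_iff)
      thus ?thesis by (simp add: ideal_gen.zero)
    next
      case (Suc k)
      have "degree (P - R) < n"
        by (rule degree_diff_lead_cancel') (use less.prems R Suc in auto)
      thus ?thesis using less.IH[of "degree (P - R)"] PR \<open>poly (P - R) z \<in> J\<close> by blast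
    qed
    hence "poly (P - R) z + poly R z \<in> ideal_gen B GS" using R ideal_gen_add by blast
    thus ?case by simp
  qed
  have "J <= ideal_gen B GS"
  proof
    fix f assume f: "f \<in> J"
    then obtain P where "P \<in> polys_over A" "f = poly P z" using AB J0 by blast
    thus "f \<in> ideal_gen B GS" using main f by blast
  qed
  thus "\<exists>G. finite G & G <= J & J <= ideal_gen B G" using finGS GSJ by blast
qed

lemma noetherian_vars_ring: "finite I ==> noetherian (vars_ring I)"
proof (induction I rule: finite_induct)
  case empty
  show ?case unfolding noetherian_def
  proof (intro allI impI)
    fix J :: "'a pfun set" assume J: "ideal_in (vars_ring {}) J"
    show "\<exists>G. finite G & G <= J & J <= ideal_gen (vars_ring {}) G"
    proof (cases "J <= {0}")
      case True
      thus ?thesis by (intro exI[of _ "{}"]) (auto intro: ideal_gen.zero)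
    next
      case False
      then obtain f where f: "f \<in> J" "f ~= 0" by blast
      then obtain c where c: "f = of_real c" using J vars_ring_empty unfolding ideal_in_def by blast
      have "J <= ideal_gen (vars_ring {}) {f}"
      proof
        fix g assume "g \<in> J"
        then obtain d where d: "g = of_real d" using J vars_ring_empty unfolding ideal_in_def by blast
        have "of_real (d / c) * f = g" using f c d by (simp flip: of_real_mult)
        thus "g \<in> ideal_gen (vars_ring {}) {f}" using ideal_gen_mult ideal_gen_base subringp_vars_ring vars_ring.const by blast
      qed
      thus ?thesis using f by (intro exI[of _ "{f}"]) auto
    qed
  qed
next
  case (insert i I)
  show ?case
    by (rule hilbert_basis[OF subringp_vars_ring insert.IH subringp_vars_ring, of _ "pvar i"])
      (use vars_ring_insert vars_ring_poly in blast)
qed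

lemma noetherian_pfun: "noetherian (UNIV :: 'n::finite pfun set)"
proof -
  have "vars_ring UNIV = (UNIV :: 'n pfun set)" using vars_ring_UNIV by blast
  thus ?thesis using noetherian_vars_ring[of "UNIV :: 'n set"] by simp
qed

subsection \<open>Orderings as sign functions\<close>

text \<open>The sign functions on a ring are the points of its real spectrum: \<open>s\<close> is the sign function
  of an ordering of the residue field of the prime ideal \<open>supp s\<close>.\<close>

definition sgnf :: "('r::comm_ring_1 => int) => bool" where
  "sgnf s \<longleftrightarrow> s 1 = 1 & s (- 1) = - 1 & (\<forall>x. s x \<in> {- 1, 0, 1}) & (\<forall>x y. s (x * y) = s x * s y) &
     (\<forall>x y. s x = 0 --> s (x + y) = s y) & (\<forall>x y. s x = 1 --> s y = 1 --> s (x + y) = 1)"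

definition supp :: "('r::comm_ring_1 => int) => 'r set" where
  "supp s = {x. s x = 0}"

lemma sgnfD:
  assumes "sgnf s"
  shows "s 1 = 1" "s (- 1) = - 1" "s x \<in> {- 1, 0, 1}" "s (x * y) = s x * s y" "s x = 0 ==> s (x + y) = s y"
    "s x = 1 ==> s y = 1 ==> s (x + y) = 1" "s (- x) = - s x" "s 0 = 0" "s (x ^ k) = s x ^ k"
    "s y = 0 ==> s (x + y) = s x" "s y = 0 ==> s (x - y) = s x" "s x = 0 ==> s (x - y) = - s y"
    "s x >= 0 ==> s y >= 0 ==> s (x + y) >= 0" "s (x - y) = - s (y - x)"
    "s x >= 0 ==> s y = 1 ==> s (x + y) = 1" "s x = 1 ==> s y >= 0 ==> s (x + y) = 1"
proof -
  show 1: "s 1 = 1" "s (- 1) = - 1" "s x \<in> {- 1, 0, 1}" for x using assms by (simp_all add: sgnf_def)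
  show 2: "s (x * y) = s x * s y" "s x = 0 ==> s (x + y) = s y"
    "s x = 1 ==> s y = 1 ==> s (x + y) = 1" for x y using assms by (simp_all add: sgnf_def)
  show 3: "s (- x) = - s x" for x using 2(1)[of "- 1" x] 1 by simp
  show 4: "s 0 = 0" using 3[of 0] by simp
  show "s (x ^ k) = s x ^ k" by (induction k) (auto simp: 1 2)
  show 5: "s y = 0 ==> s (x + y) = s x" for x y using 2(2)[of y x] by (simp add: add.commute)
  show "s y = 0 ==> s (x - y) = s x" using 5[of "- y" x] 3[of y] by simp
  show "s x = 0 ==> s (x - y) = - s y" using 2(2)[of x "- y"] 3[of y] by simp
  show 6: "s x >= 0 ==> s y = 1 ==> s (x + y) = 1" for x y using 1(3)[of x] 2(2,3)[of x y] by auto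
  thus "s x = 1 ==> s y >= 0 ==> s (x + y) = 1" using 6[of y x] by (simp add: add.commute)
  show "s x >= 0 ==> s y >= 0 ==> s (x + y) >= 0"
    using 6[of x y] 5[of y x] 1(3)[of y] 1(3)[of x] by auto
  show "s (x - y) = - s (y - x)" using 3[of "y - x"] by simp
qed

lemma sgnf_square: "sgnf s ==> s (x * x) = (if s x = 0 then 0 else 1)"
  using sgnfD(3)[of s x] sgnfD(4)[of s x x] by auto

lemma sgnf_of_real:
  fixes s :: "'r::{comm_ring_1,real_algebra_1} => int"
  assumes "sgnf s" shows "s (of_real c) = sg c"
proof -
  have pos: "s (of_real d) = 1" if "d > 0" for d
  proof -
    have "s (of_real (sqrt d) * of_real (inverse (sqrt d))) = 1" using that sgnfD(1)[OF assms]
      by (simp flip: of_real_mult)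
    hence "s (of_real (sqrt d) * of_real (sqrt d)) = 1" using sgnfD(4)[OF assms] sgnf_square[OF assms] by auto
    thus ?thesis using that by (simp flip: of_real_mult)
  qed
  consider "c > 0" | "c = 0" | "c < 0" by linarith
  thus ?thesis
  proof cases
    case 3
    thus ?thesis using pos[of "- c"] sgnfD(7)[OF assms, of "of_real c"] by (simp add: sg_def)
  qed (use pos sgnfD(8)[OF assms] in "auto simp: sg_def")
qed

lemma sgnf_rhom: "rhom (a :: 'r::comm_ring_1 => 'a::linordered_idom) ==> sgnf (\<lambda>f. sg (a f))"
  unfolding sgnf_def
  by (auto simp: rhomD sg_mult)

definition point_sgn :: "real ^ 'n::finite => 'n pfun => int" where
  "point_sgn x f = sg (pev f x)"

lemma rhom_pev: "rhom (\<lambda>f. pev f x)"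
  by (simp add: rhom_def)

lemma sgnf_point: "sgnf (point_sgn x)"
  using sgnf_rhom[OF rhom_pev[of x]] by (simp add: point_sgn_def[abs_def])

definition primeI :: "'r::comm_ring_1 set => bool" where
  "primeI Q \<longleftrightarrow> 0 \<in> Q & 1 ~: Q & (\<forall>x\<in>Q. \<forall>y\<in>Q. x + y \<in> Q) & (\<forall>x. \<forall>y\<in>Q. x * y \<in> Q) &
     (\<forall>x y. x * y \<in> Q --> x \<in> Q | y \<in> Q)"

lemma primeID:
  assumes "primeI Q"
  shows "0 \<in> Q" "1 ~: Q" "x \<in> Q ==> y \<in> Q ==> x + y \<in> Q" "y \<in> Q ==> x * y \<in> Q" "x \<in> Q ==> x * y \<in> Q"
    "x * y \<in> Q ==> x \<in> Q | y \<in> Q" "x \<in> Q ==> - x \<in> Q" "x \<in> Q ==> y \<in> Q ==> x - y \<in> Q"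
    "x ^ k \<in> Q ==> x \<in> Q" "y \<in> Q ==> x + y \<in> Q \<longleftrightarrow> x \<in> Q"  "x * y \<in> Q \<longleftrightarrow> x \<in> Q | y \<in> Q"
    "y \<in> Q ==> x - y \<in> Q \<longleftrightarrow> x \<in> Q"
proof -
  show 0: "0 \<in> Q" "1 ~: Q" and 1: "x \<in> Q ==> y \<in> Q ==> x + y \<in> Q" and 2: "y \<in> Q ==> x * y \<in> Q"
    and 3: "x * y \<in> Q ==> x \<in> Q | y \<in> Q" for x y using assms unfolding primeI_def by blast+
  show 4: "x \<in> Q ==> x * y \<in> Q" for x y using 2[of x y] by (simp add: mult.commute)
  show 5: "x \<in> Q ==> - x \<in> Q" for x using 2[of x "- 1"] by simp
  show 6: "x \<in> Q ==> y \<in> Q ==> x - y \<in> Q" for x y using 1[of x "- y"] 5[of y] by simp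
  show "x ^ k \<in> Q ==> x \<in> Q" using 0 3 by (induction k) auto
  show "y \<in> Q ==> x + y \<in> Q \<longleftrightarrow> x \<in> Q" using 1 6[of "x + y" y] by auto
  show "y \<in> Q ==> x - y \<in> Q \<longleftrightarrow> x \<in> Q" using 6 1[of "x - y" y] by auto
  show "x * y \<in> Q \<longleftrightarrow> x \<in> Q | y \<in> Q" using 2 3 4 by blast
qed

lemma primeI_supp: "sgnf s ==> primeI (supp s)"
  unfolding primeI_def supp_def by (auto simp: sgnfD)

lemma primeI_const:
  fixes Q :: "'r::{comm_ring_1,real_algebra_1} set"
  assumes "primeI Q" shows "of_real c \<in> Q \<longleftrightarrow> c = 0"
proof
  assume h: "of_real c \<in> Q"
  show "c = 0"
  proof (rule ccontr)
    assume "c ~= 0"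
    hence "of_real (inverse c) * of_real c = (1::'r)" by (simp flip: of_real_mult)
    thus False using primeID(2,4)[OF assms] h by metis
  qed
qed (use primeID(1)[OF assms] in simp)

lemma primeI_of_nat:
  fixes Q :: "'r::{comm_ring_1,real_algebra_1} set"
  assumes "primeI Q" shows "of_nat k \<in> Q \<longleftrightarrow> k = 0"
  using primeI_const[OF assms, of "of_nat k"] by simp

subsection \<open>The Artin--Lang theorem\<close>

definition realizable :: "('n::finite pfun => int) => bool" where
  "realizable s \<longleftrightarrow> (\<forall>H. finite H --> (\<exists>x. (\<forall>f\<in>supp s. pev f x = 0) & (\<forall>h\<in>H. sg (pev h x) = s h)))"

text \<open>A counterexample to the Artin--Lang theorem, if there is one: fixing it globally makes the
  ordered domain that it defines available as a type.\<close>

definition bad_sgn :: "'n::finite pfun => int" where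
  "bad_sgn = (if \<exists>s :: 'n pfun => int. sgnf s & \<not> realizable s
     then SOME s. sgnf s & \<not> realizable s else point_sgn 0)"

lemma sgnf_bad_sgn: "sgnf (bad_sgn :: 'n::finite pfun => int)"
  by (smt (verit) someI_ex bad_sgn_def sgnf_point)

lemma realizable_bad_sgn:
  assumes "realizable (bad_sgn :: 'n::finite pfun => int)" "sgnf (s :: 'n pfun => int)"
  shows "realizable s"
  by (smt (verit) assms someI_ex bad_sgn_def)

quotient_type 'n residue_dom = "'n::finite pfun" / "\<lambda>f g. bad_sgn (f - g) = 0"
  morphisms rd_rep rd_class
proof (rule equivpI)
  show "reflp (\<lambda>f g :: 'n pfun. bad_sgn (f - g) = 0)" by (simp add: reflp_def sgnfD(8)[OF sgnf_bad_sgn])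
  show "symp (\<lambda>f g :: 'n pfun. bad_sgn (f - g) = 0)"
    using sgnfD(14)[OF sgnf_bad_sgn] by (metis (mono_tags, lifting) neg_equal_0_iff_equal sympI)
  show "transp (\<lambda>f g :: 'n pfun. bad_sgn (f - g) = 0)"
  proof (rule transpI)
    fix x y z :: "'n pfun"
    assume h: "bad_sgn (x - y) = 0" "bad_sgn (y - z) = 0"
    show "bad_sgn (x - z) = 0" using sgnfD(5)[OF sgnf_bad_sgn h(1), of "y - z"] h(2) by simp
  qed
qed

lemma bad_sgn_cong: "bad_sgn (f - g) = 0 ==> bad_sgn f = bad_sgn g"
  using sgnfD(5)[OF sgnf_bad_sgn, of "f - g" g] by simp

instantiation residue_dom :: (finite) linordered_idom
begin

lift_definition zero_residue_dom :: "'a residue_dom" is 0 .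
lift_definition one_residue_dom :: "'a residue_dom" is 1 .

lift_definition plus_residue_dom :: "'a residue_dom => 'a residue_dom => 'a residue_dom" is "(+)"
  using sgnfD(5)[OF sgnf_bad_sgn] by (metis add_diff_add)

lift_definition uminus_residue_dom :: "'a residue_dom => 'a residue_dom" is uminus
  using sgnfD(14)[OF sgnf_bad_sgn] by (metis minus_diff_minus minus_diff_eq neg_equal_0_iff_equal)

lift_definition minus_residue_dom :: "'a residue_dom => 'a residue_dom => 'a residue_dom" is "(-)"
proof -
  fix a b c d :: "'a pfun"
  assume h: "bad_sgn (a - b) = 0" "bad_sgn (c - d) = 0"
  have "(a - c) - (b - d) = (a - b) - (c - d)" by simp
  thus "bad_sgn ((a - c) - (b - d)) = 0" using h sgnfD(11)[OF sgnf_bad_sgn] by metis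
qed

lift_definition times_residue_dom :: "'a residue_dom => 'a residue_dom => 'a residue_dom" is "(*)"
proof -
  fix a b c d :: "'a pfun"
  assume h: "bad_sgn (a - b) = 0" "bad_sgn (c - d) = 0"
  have "a * c - b * d = (a - b) * c + b * (c - d)" by (simp add: algebra_simps)
  thus "bad_sgn (a * c - b * d) = 0"
    using h sgnfD(4,5)[OF sgnf_bad_sgn] by (metis mult_zero_left mult_zero_right)
qed

lift_definition less_eq_residue_dom :: "'a residue_dom => 'a residue_dom => bool" is "\<lambda>f g. bad_sgn (g - f) >= 0"
proof -
  fix a b c d :: "'a pfun"
  assume h: "bad_sgn (a - b) = 0" "bad_sgn (c - d) = 0"
  have "(c - d) - (a - b) = (c - a) - (d - b)" by simp
  thus "(0 <= bad_sgn (c - a)) = (0 <= bad_sgn (d - b))" using h sgnfD(11)[OF sgnf_bad_sgn] bad_sgn_cong by metis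
qed

definition less_residue_dom :: "'a residue_dom => 'a residue_dom => bool" where
  "less_residue_dom x y \<longleftrightarrow> x <= y & x ~= y"
definition abs_residue_dom :: "'a residue_dom => 'a residue_dom" where
  "abs_residue_dom x = (if x < 0 then - x else x)"
definition sgn_residue_dom :: "'a residue_dom => 'a residue_dom" where
  "sgn_residue_dom x = (if x = 0 then 0 else if 0 < x then 1 else - 1)"

instance
proof
  note S = sgnf_bad_sgn
  fix a b c :: "'a residue_dom"
  show "a * b * c = a * (b * c)" by (transfer, simp add: algebra_simps sgnfD(8)[OF sgnf_bad_sgn])
  show "a + b + c = a + (b + c)" by (transfer, simp add: algebra_simps sgnfD(8)[OF sgnf_bad_sgn])
  show "a * b = b * a" by (transfer, simp add: algebra_simps sgnfD(8)[OF sgnf_bad_sgn])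
  show "a + b = b + a" by (transfer, simp add: algebra_simps sgnfD(8)[OF sgnf_bad_sgn])
  show "1 * a = a" by (transfer, simp add: algebra_simps sgnfD(8)[OF sgnf_bad_sgn])
  show "0 + a = a" by (transfer, simp add: algebra_simps sgnfD(8)[OF sgnf_bad_sgn])
  show "- a + a = 0" by (transfer, simp add: algebra_simps sgnfD(8)[OF sgnf_bad_sgn])
  show "a + b - a = b" "a - b - c = a - (b + c)" by (transfer, simp add: algebra_simps sgnfD(8)[OF sgnf_bad_sgn])+
  show "a - b = a + - b" by (transfer, simp add: algebra_simps sgnfD(8)[OF sgnf_bad_sgn])
  show "(a + b) * c = a * c + b * c" by (transfer, simp add: algebra_simps sgnfD(8)[OF sgnf_bad_sgn])
  show "0 * a = 0" by (transfer, simp add: algebra_simps sgnfD(8)[OF sgnf_bad_sgn])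
  show "a * 0 = 0" by (transfer, simp add: algebra_simps sgnfD(8)[OF sgnf_bad_sgn])
  show "(0::'a residue_dom) ~= 1" by transfer (simp add: sgnfD[OF sgnf_bad_sgn])
  show refl: "a <= a" for a :: "'a residue_dom" by transfer (simp add: sgnfD(8)[OF sgnf_bad_sgn])
  show trans: "a <= b ==> b <= c ==> a <= c"
    by (transfer, drule (1) sgnfD(13)[OF sgnf_bad_sgn], simp)
  show antisym: "a <= b ==> b <= a ==> a = b" for a b :: "'a residue_dom"
    by transfer (metis antisym_conv neg_0_le_iff_le sgnfD(14)[OF sgnf_bad_sgn])
  show "(a < b) = (a <= b & \<not> b <= a)" using antisym refl by (auto simp: less_residue_dom_def)
  show tot: "a <= b | b <= a"
    by transfer (metis linear neg_0_le_iff_le sgnfD(14)[OF sgnf_bad_sgn])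
  show "a <= b ==> c + a <= c + b" by transfer simp
  have mul: "0 <= a ==> 0 <= b ==> 0 <= a * b" for a b :: "'a residue_dom"
    by transfer (simp add: sgnfD(4)[OF sgnf_bad_sgn])
  have add: "a <= b \<longleftrightarrow> 0 <= b - a" for a b :: "'a residue_dom" by transfer simp
  have nzd: "a * b = 0 ==> a = 0 | b = 0" for a b :: "'a residue_dom" by transfer (simp add: sgnfD(4)[OF sgnf_bad_sgn])
  show "a < b ==> 0 < c ==> c * a < c * b"
  proof -
    assume h: "a < b" "0 < c"
    have ring: "c * b - c * a = c * (b - a)" by transfer (simp add: algebra_simps sgnfD(8)[OF sgnf_bad_sgn])
    have le: "c * a <= c * b" using h mul[of c "b - a"] add[of a b] add[of "c * a" "c * b"] ring
      by (simp add: less_residue_dom_def)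
    have "c * a ~= c * b"
    proof
      assume e: "c * a = c * b"
      have "c * b - c * a = 0" unfolding e by transfer (simp add: sgnfD(8)[OF sgnf_bad_sgn])
      hence "b - a = 0" using ring nzd[of c "b - a"] h(2) by (auto simp: less_residue_dom_def)
      hence "a = b" by transfer (metis neg_equal_0_iff_equal sgnfD(14)[OF sgnf_bad_sgn] diff_zero)
      thus False using h by (simp add: less_residue_dom_def)
    qed
    thus "c * a < c * b" using le by (simp add: less_residue_dom_def)
  qed
  show "\<bar>a\<bar> = (if a < 0 then - a else a)" by (simp add: abs_residue_dom_def)
  show "sgn a = (if a = 0 then 0 else if 0 < a then 1 else - 1)" by (simp add: sgn_residue_dom_def)
qed

end

text \<open>The tautological point: residue class, fraction field, real closure. Its coordinates are
  the images of the variables.\<close>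

definition generic_pt :: "'n::finite pfun => 'n residue_dom fract real_closure" where
  "generic_pt f = to_rc (Fraction_Field.Fract (rd_class f) 1)"

lemma rhom_generic_pt: "rhom (generic_pt :: 'n::finite pfun => _)"
proof -
  have "rd_class (f + g) = rd_class f + rd_class g"
    "rd_class (f * g) = rd_class f * rd_class g" "rd_class (1 :: 'n pfun) = 1" for f g :: "'n pfun"
    by (simp_all add: plus_residue_dom.abs_eq times_residue_dom.abs_eq one_residue_dom.abs_eq)
  moreover have "Fraction_Field.Fract (a + b) 1 = Fraction_Field.Fract a 1 + Fraction_Field.Fract b 1"
    "Fraction_Field.Fract (a * b) 1 = Fraction_Field.Fract a 1 * Fraction_Field.Fract b 1"
    "Fraction_Field.Fract 1 1 = (1 :: 'n residue_dom fract)" for a b :: "'n residue_dom"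
    by (simp_all add: Fraction_Field.One_fract_def)
  ultimately show ?thesis
    unfolding rhom_def generic_pt_def by (simp only: rhomD(1-3)[OF rhom_to_rc]) simp
qed

lemma sg_generic_pt: "sg (generic_pt f) = bad_sgn f"
proof -
  have le: "0 <= rd_class f \<longleftrightarrow> bad_sgn f >= 0"
    by (simp add: zero_residue_dom.abs_eq less_eq_residue_dom.abs_eq)
  have eq: "rd_class f = 0 \<longleftrightarrow> bad_sgn f = 0"
    unfolding zero_residue_dom_def by (simp add: residue_dom.abs_eq_iff)
  have "sg (generic_pt f) = sg (Fraction_Field.Fract (rd_class f) 1)"
    by (simp add: generic_pt_def sg_to_rc)
  also have "\<dots> = sg (rd_class f)"
    by (simp add: sg_def Fraction_Field.zero_less_Fract_iff Fraction_Field.Zero_fract_def Fraction_Field.eq_fract)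
  also have "\<dots> = bad_sgn f" using le eq sgnfD(3)[OF sgnf_bad_sgn, of f] by (auto simp: sg_def)
  finally show ?thesis .
qed

text \<open>Induction on the variables. Eliminating \<open>pvar i\<close> leaves a finite set
  \<open>S\<close> of polynomials in the other variables; the induction hypothesis realizes their
  signs at a real \<open>x\<close>, and the transfer then supplies the coordinate
  \<open>y'\<close>.\<close>

lemma realize_vars:
  "finite I ==> finite H ==> H <= vars_ring I ==> \<exists>x. \<forall>h\<in>H. sg (pev h x) = sg (generic_pt h)"
proof (induction I arbitrary: H rule: finite_induct)
  case empty
  have "sg (pev h x) = sg (generic_pt h)" if hH: "h \<in> H" for h x
  proof -
    obtain c where "h = of_real c" using vars_ring_empty[of h] hH empty by blast
    thus ?thesis using sg_generic_pt[of h] sgnf_of_real[OF sgnf_bad_sgn[where 'n='a], of c] by simp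
  qed
  thus ?case by blast
next
  case (insert i I)
  obtain P where P: "!!h. h \<in> H ==> P h \<in> polys_over (vars_ring I) & h = poly (P h) (pvar i)" using vars_ring_insert[of _ i I] insert.prems(2) subsetD by metis
  have PH: "finite (P ` H)" "P ` H <= polys_over (vars_ring I)" using P insert.prems by auto
  from sign_transfer[OF subringp_vars_ring PH, where 'a="'a residue_dom fract real_closure" and 'b=real]
  obtain S where S0: "finite S & S <= vars_ring I &
     (\<forall>(a :: 'a pfun => 'a residue_dom fract real_closure) (b :: 'a pfun => real) y. rhom a --> rhom b -->
     (\<forall>c\<in>S. sg (a c) = sg (b c)) --> (\<exists>y'. \<forall>p\<in>P ` H. sg (poly (map_poly a p) y) = sg (poly (map_poly b p) y')))"
    by (rule exE)
  note S = conjunct1[OF S0] conjunct1[OF conjunct2[OF S0]]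
  note S3 = conjunct2[OF conjunct2[OF S0]]
  obtain x where x: "!!c. c \<in> S ==> sg (pev c x) = sg (generic_pt c)" using insert.IH[OF S(1,2)] by blast
  obtain y' where y': "!!p. p \<in> P ` H ==> sg (poly (map_poly generic_pt p) (generic_pt (pvar i))) = sg (poly (map_poly (\<lambda>f. pev f x) p) y')"
    using S3[THEN spec, THEN spec, THEN spec, THEN mp, THEN mp, THEN mp, OF rhom_generic_pt rhom_pev[of x]] x
    by (metis (no_types, lifting))
  define x' where "x' = (\<chi> j. if j = i then y' else x $ j)"
  have ph: "a (poly p z) = poly (map_poly a p) (a z)" if "rhom a" for a :: "'a pfun => 'c::comm_ring_1" and p z
    using that by (induction p) (auto simp: map_poly_pCons rhomD)
  have "sg (pev h x') = sg (generic_pt h)" if "h \<in> H" for h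
  proof -
    have Ph: "P h \<in> polys_over (vars_ring I)" "h = poly (P h) (pvar i)" using P that by auto
    have "map_poly (\<lambda>f. pev f x') (P h) = map_poly (\<lambda>f. pev f x) (P h)"
    proof (rule poly_eqI)
      fix k
      have "pev (coeff (P h) k) x' = pev (coeff (P h) k) x"
        by (rule vars_ring_cong[of _ I]) (use Ph insert.hyps in "auto simp: polys_over_def x'_def")
      thus "coeff (map_poly (\<lambda>f. pev f x') (P h)) k = coeff (map_poly (\<lambda>f. pev f x) (P h)) k"
        by (simp add: coeff_map_poly)
    qed
    thus ?thesis using ph[OF rhom_pev[of x'], of "P h" "pvar i"] Ph ph[OF rhom_generic_pt, of "P h" "pvar i"] y' that by (simp add: x'_def)
  qed
  thus ?case by blast
qed

text \<open>Generators of the support join the finite list, so that the real point lies on the zero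
  set of the whole support. Treating \<open>bad_sgn\<close> suffices, since it is a counterexample
  if there is any.\<close>

theorem artin_lang:
  fixes s :: "'n::finite pfun => int"
  assumes "sgnf s" "finite H"
  shows "\<exists>x. (\<forall>f\<in>supp s. pev f x = 0) & (\<forall>h\<in>H. sg (pev h x) = s h)"
proof -
  have "realizable (bad_sgn :: 'n pfun => int)"
    unfolding realizable_def
  proof (intro allI impI)
    fix H :: "'n pfun set" assume H: "finite H"
    have "ideal_in UNIV (supp (bad_sgn :: 'n pfun => int))"
      using primeI_supp[OF sgnf_bad_sgn] by (auto simp: ideal_in_def primeI_def)
    then obtain G where G: "finite G" "G <= supp (bad_sgn :: 'n pfun => int)" "supp bad_sgn <= ideal_gen UNIV G"
      using noetherian_pfun unfolding noetherian_def by blast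
    obtain x where x: "!!h. h \<in> H \<union> G ==> sg (pev h x) = bad_sgn h"
      using realize_vars[of UNIV "H \<union> G"] H G(1) vars_ring_UNIV sg_generic_pt by (metis finite_UnI finite subsetI)
    have "pev f x = 0" if "f \<in> ideal_gen UNIV G" for f
      using that
    proof (induction rule: ideal_gen.induct)
      case (add a g y)
      have "sg (pev g x) = 0" using x[of g] add G(2) by (auto simp: supp_def)
      thus ?case using add by simp
    qed simp
    thus "\<exists>x. (\<forall>f\<in>supp bad_sgn. pev f x = 0) & (\<forall>h\<in>H. sg (pev h x) = bad_sgn h)"
      using G(3) x by blast
  qed
  thus ?thesis using realizable_bad_sgn assms unfolding realizable_def by blast
qed

subsection \<open>Chains of prime ideals\<close>

definition prime_chain :: "nat => 'r::comm_ring_1 set => 'r set => bool" where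
  "prime_chain k A B \<longleftrightarrow> (\<exists>P :: nat => 'r set. P 0 = A & P k = B & (\<forall>i\<le>k. primeI (P i)) & (\<forall>i<k. P i \<subset> P (Suc i)))"

lemma prime_chain_refl: "primeI A ==> prime_chain 0 A A"
  unfolding prime_chain_def by (intro exI[of _ "\<lambda>_. A"]) auto

lemma prime_chain_prime: "prime_chain k A B ==> primeI A & primeI B"
  unfolding prime_chain_def by auto

lemma prime_chain_Cons:
  assumes "primeI A" "A \<subset> B" "prime_chain k B C"
  shows "prime_chain (Suc k) A C"
proof -
  obtain P where P: "P 0 = B" "P k = C" "\<forall>i\<le>k. primeI (P i)" "\<forall>i<k. P i \<subset> P (Suc i)"
    using assms unfolding prime_chain_def by blast
  have "\<forall>i\<le>Suc k. primeI (case_nat A P i)" "\<forall>i<Suc k. case_nat A P i \<subset> case_nat A P (Suc i)"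
    using P assms by (auto split: nat.split)
  thus ?thesis unfolding prime_chain_def using P by (intro exI[of _ "case_nat A P"]) auto
qed

lemma prime_chain_trans:
  "prime_chain k A B ==> prime_chain l B C ==> prime_chain (k + l) A C"
proof (induction k arbitrary: A)
  case 0
  thus ?case by (auto simp: prime_chain_def)
next
  case (Suc k)
  from Suc.prems(1) obtain P where P: "P 0 = A" "P (Suc k) = B" "\<forall>i\<le>Suc k. primeI (P i)" "\<forall>i<Suc k. P i \<subset> P (Suc i)"
    unfolding prime_chain_def by blast
  show ?case using P Suc exI[of _ "\<lambda>i. P (Suc i)"] prime_chain_Cons[of A "P 1" "k + l" C] by (auto simp: prime_chain_def)
qed

lemma prime_chain_snoc:
  assumes "prime_chain k A B" "primeI C" "B \<subset> C"
  shows "prime_chain (Suc k) A C"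
  using prime_chain_trans[OF assms(1) prime_chain_Cons[OF _ assms(3) prime_chain_refl[OF assms(2)]]]
    prime_chain_prime[OF assms(1)] by simp

section \<open>A bound for prime chains by counting monomials\<close>

definition exps :: "nat => nat => nat list set" where
  "exps m d = {es. length es = m & set es <= {..d}}"

definition mon :: "'r::comm_ring_1 list => nat list => 'r" where
  "mon bs es = prod_list (map2 (^) bs es)"

lemma mon_simps [simp]: "mon [] es = 1" "mon (b # bs) (k # es) = b ^ k * mon bs es"
  by (simp_all add: mon_def)

lemma finite_exps: "finite (exps m d)"
  unfolding exps_def using finite_lists_length_eq[of "{..d}" m] by (simp add: conj_commute)

lemma card_exps: "card (exps m d) = Suc d ^ m"
  unfolding exps_def using card_lists_length_eq[of "{..d}" m] by (simp add: conj_commute)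

lemma sum_exps_Suc:
  "(\<Sum>es\<in>exps (Suc m) d. g es) = (\<Sum>k\<le>d. \<Sum>es\<in>exps m d. g (k # es))"
proof -
  have "exps (Suc m) d = (\<lambda>(k, es). k # es) ` ({..d} \<times> exps m d)"
    unfolding exps_def by (force simp: length_Suc_conv image_iff)
  hence "(\<Sum>es\<in>exps (Suc m) d. g es) = (\<Sum>x\<in>{..d} \<times> exps m d. g (case x of (k, es) => k # es))" by (auto simp: inj_on_def sum.reindex)
  also have "\<dots> = (\<Sum>k\<le>d. \<Sum>es\<in>exps m d. g (k # es))"
    by (simp add: sum.cartesian_product case_prod_beta')
  finally show ?thesis .
qed

text \<open>Algebraic independence over the reals of the residues modulo \<open>Q\<close>.\<close>

definition indep_mod :: "'r::{comm_ring_1,real_algebra_1} set => 'r list => bool" where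
  "indep_mod Q bs \<longleftrightarrow> (\<forall>d c. (\<Sum>es\<in>exps (length bs) d. of_real (c es) * mon bs es) \<in> Q -->
     (\<forall>es\<in>exps (length bs) d. c es = 0))"

lemma primeI_sum:
  assumes Q: "primeI Q" shows "(!!x. x \<in> S ==> g x \<in> Q) ==> sum g S \<in> Q"
  by (induction S rule: infinite_finite_induct) (simp_all add: primeID(1)[OF Q] primeID(3)[OF Q])

lemma indep_mod_Cons:
  fixes P Q :: "'r::{comm_ring_1,real_algebra_1} set"
  assumes P: "primeI P" and Q: "primeI Q" and PQ: "P <= Q" and b: "b \<in> Q" "b ~: P" and ind: "indep_mod Q bs"
  shows "indep_mod P (b # bs)"
  unfolding indep_mod_def
proof (intro allI impI)
  fix d c
  define m where "m = length bs"
  define F where "F k = (\<Sum>es\<in>exps m d. of_real (c (k # es)) * mon bs es)" for k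
  assume "(\<Sum>es\<in>exps (length (b # bs)) d. of_real (c es) * mon (b # bs) es) \<in> P"
  hence S: "(\<Sum>k\<le>d. b ^ k * F k) \<in> P"
    by (simp add: sum_exps_Suc F_def m_def sum_distrib_left algebra_simps)
  have Fz: "(\<forall>es\<in>exps m d. c (k # es) = 0)" if "F k \<in> Q" for k
    using that ind by (fastforce simp: F_def m_def indep_mod_def)
  have "k <= d ==> (\<forall>es\<in>exps m d. c (k # es) = 0)" for k
  proof (induction k rule: less_induct)
    case (less k)
    have "F j = 0" if "j < k" for j using less that by (simp add: F_def)
    hence "(\<Sum>j\<le>d. b ^ j * F j) = (\<Sum>j\<in>{k..d}. b ^ j * F j)"
      by (intro sum.mono_neutral_right) auto
    also have "\<dots> = b ^ k * (\<Sum>j\<in>{k..d}. b ^ (j - k) * F j)"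
      unfolding sum_distrib_left by (intro sum.cong) (auto simp: mult.assoc[symmetric] simp flip: power_add)
    finally have "b ^ k * (\<Sum>j\<in>{k..d}. b ^ (j - k) * F j) \<in> P" using S by simp
    hence inQ: "(\<Sum>j\<in>{k..d}. b ^ (j - k) * F j) \<in> Q" using b primeID(6,9)[OF P] PQ by blast
    have "(\<Sum>j\<in>{k..d}. b ^ (j - k) * F j) = F k + (\<Sum>j\<in>{Suc k..d}. b ^ (j - k) * F j)"
      using less.prems by (simp add: sum.atLeast_Suc_atMost)
    moreover have "(\<Sum>j\<in>{Suc k..d}. b ^ (j - k) * F j) \<in> Q"
    proof (rule primeI_sum[OF Q])
      fix j assume "j \<in> {Suc k..d}"
      then obtain i where "j - k = Suc i" by (metis Suc_diff_Suc atLeastAtMost_iff less_eq_Suc_le)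
      thus "b ^ (j - k) * F j \<in> Q" using b primeID(5)[OF Q] by simp
    qed
    ultimately have "F k \<in> Q" using inQ primeID(10)[OF Q] by metis
    thus ?case by (rule Fz)
  qed
  moreover have "\<exists>k es'. es = k # es' & k <= d & es' \<in> exps m d" if "es \<in> exps (length (b # bs)) d" for es
    using that by (auto simp: exps_def m_def length_Suc_conv)
  ultimately show "\<forall>es\<in>exps (length (b # bs)) d. c es = 0" by blast
qed

lemma prime_chain_indep:
  fixes A B :: "'r::{comm_ring_1,real_algebra_1} set"
  shows "prime_chain m A B ==> \<exists>bs. length bs = m & indep_mod A bs"
proof (induction m arbitrary: A)
  case 0
  hence "primeI A" by (auto simp: prime_chain_def)
  have e: "exps 0 d = {[]}" for d by (auto simp: exps_def)
  show ?case
    by (intro exI[of _ "[]"]) (simp add: indep_mod_def e primeI_const[OF \<open>primeI A\<close>])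
next
  case (Suc m)
  from Suc.prems obtain P where P: "P 0 = A" "P (Suc m) = B" "\<forall>i\<le>Suc m. primeI (P i)" "\<forall>i<Suc m. P i \<subset> P (Suc i)"
    unfolding prime_chain_def by blast
  have "prime_chain m (P 1) B"
    unfolding prime_chain_def using P by (intro exI[of _ "\<lambda>i. P (Suc i)"] conjI allI impI) simp_all
  then obtain bs where bs: "length bs = m" "indep_mod (P 1) bs" using Suc by blast
  have sub: "A \<subset> P 1" using P by (metis One_nat_def zero_less_Suc)
  then obtain b where "b \<in> P 1" "b ~: A" by blast
  moreover have "primeI A" "primeI (P 1)" using P by auto
  ultimately have "indep_mod A (b # bs)" using indep_mod_Cons[of A "P 1" b bs] sub bs by blast
  thus ?case using bs by (intro exI[of _ "b # bs"]) auto
qed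

definition monomials_upto :: "nat => 'n::finite pfun set" where
  "monomials_upto K = (\<lambda>\<beta>. \<Prod>i\<in>UNIV. pvar i ^ \<beta> i) ` (UNIV \<rightarrow>\<^sub>E {..K})"

lemma card_monomials_upto: "finite (monomials_upto K :: 'n::finite pfun set)"
    "card (monomials_upto K :: 'n::finite pfun set) <= Suc K ^ CARD('n)"
proof -
  have fin: "finite ((UNIV :: 'n set) \<rightarrow>\<^sub>E {..K})" by (intro finite_PiE) auto
  thus "finite (monomials_upto K :: 'n pfun set)" by (simp add: monomials_upto_def)
  have "card (monomials_upto K :: 'n pfun set) <= card ((UNIV :: 'n set) \<rightarrow>\<^sub>E {..K})"
    unfolding monomials_upto_def by (rule card_image_le[OF fin])
  also have "\<dots> = Suc K ^ CARD('n)" by (simp add: card_PiE)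
  finally show "card (monomials_upto K :: 'n pfun set) <= Suc K ^ CARD('n)" .
qed

lemma span_mult_closed:
  fixes A B C :: "'r::{comm_ring_1,real_algebra_1} set"
  assumes "f \<in> span A" "g \<in> span B" and AB: "!!a b. a \<in> A ==> b \<in> B ==> a * b \<in> span C"
  shows "f * g \<in> span C"
proof -
  have 1: "a * g \<in> span C" if a: "a \<in> A" for a
    using assms(2)
  proof (induction rule: span_induct)
    case base
    thus ?case unfolding subspace_def
      by (auto simp: distrib_left span_add span_scale span_zero)
  qed (use AB a in auto)
  show ?thesis using assms(1)
  proof (induction rule: span_induct)
    case base
    thus ?case unfolding subspace_def
      by (auto simp: distrib_right span_add span_scale span_zero)
  qed (use 1 in auto)
qed

lemma monomials_upto_mult:
  "a \<in> monomials_upto K ==> b \<in> monomials_upto L ==> a * b \<in> monomials_upto (K + L)"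
proof -
  assume "a \<in> monomials_upto K" "b \<in> monomials_upto L"
  then obtain \<beta> \<gamma> where "a = (\<Prod>i\<in>UNIV. pvar i ^ \<beta> i)" "\<forall>i. \<beta> i <= K" "b = (\<Prod>i\<in>UNIV. pvar i ^ \<gamma> i)" "\<forall>i. \<gamma> i <= L"
    by (auto simp: monomials_upto_def)
  thus ?thesis unfolding monomials_upto_def
    by (intro image_eqI[of _ _ "\<lambda>i. \<beta> i + \<gamma> i"]) (auto simp: power_add prod.distrib add_mono)
qed

lemma monomials_upto_mono: "K <= L ==> monomials_upto K <= monomials_upto L"
  unfolding monomials_upto_def by (intro image_mono PiE_mono) auto

lemma monomials_upto_one: "1 \<in> monomials_upto K"
  unfolding monomials_upto_def by (intro image_eqI[of _ _ "\<lambda>_. 0"]) auto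

lemma span_monomials_mult:
  "f \<in> span (monomials_upto K) ==> g \<in> span (monomials_upto L) ==> f * g \<in> span (monomials_upto (K + L))"
  by (erule (1) span_mult_closed) (auto intro: span_base monomials_upto_mult)

lemma span_monomials_mono: "K <= L ==> f \<in> span (monomials_upto K) ==> f \<in> span (monomials_upto L)"
  using span_mono[OF monomials_upto_mono] by blast

lemma span_monomials_power: "f \<in> span (monomials_upto K) ==> f ^ k \<in> span (monomials_upto (k * K))"
  by (induction k) (auto intro: span_base monomials_upto_one span_monomials_mult)

lemma span_monomials_ex: "\<exists>e. f \<in> span (monomials_upto e)"
proof (induction f rule: pfun_induct)
  case (const c)
  show ?case by (metis of_real_def span_scale span_base monomials_upto_one)
next
  case (var i)
  have "(\<Prod>j\<in>UNIV. pvar j ^ (if j = i then 1 else 0)) = pvar i"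
    by (simp add: prod.delta if_distrib[of "\<lambda>k. pvar _ ^ k"] cong: if_cong)
  thus ?case by (auto simp: monomials_upto_def intro!: span_base image_eqI[of _ _ "\<lambda>j. if j = i then 1 else 0"])
next
  case (add f g)
  then obtain e e' where "f \<in> span (monomials_upto e)" "g \<in> span (monomials_upto e')" by blast
  thus ?case using span_monomials_mono[of e "max e e'"] span_monomials_mono[of e' "max e e'"] span_add by fastforce
next
  case (mult f g)
  thus ?case using span_monomials_mult by blast
qed

text \<open>A chain of length \<open>m\<close> gives \<open>m\<close> independent elements, hence
  \<open>(d + 1)^m\<close> linearly independent monomials with exponents up to \<open>d\<close>.
  They lie in a space whose dimension grows at most like a constant times \<open>d^N\<close>, with
  \<open>N\<close> the number of variables.\<close>

theorem prime_chain_bound: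
  fixes A B :: "'n::finite pfun set"
  assumes "prime_chain m A B"
  shows "m <= CARD('n)"
proof (rule ccontr)
  assume "\<not> m <= CARD('n)"
  hence mN: "m >= Suc CARD('n)" by simp
  obtain bs where bs: "length bs = m" "indep_mod A bs" using prime_chain_indep[OF assms] by blast
  have A: "primeI A" using prime_chain_prime[OF assms] by simp
  obtain e where e: "!!b. b \<in> set bs ==> b \<in> span (monomials_upto e)"
  proof -
    have "\<exists>e. \<forall>b\<in>set bs. b \<in> span (monomials_upto e)"
    proof (induction bs)
      case (Cons b bs)
      obtain e e' where "\<forall>b\<in>set bs. b \<in> span (monomials_upto e)" "b \<in> span (monomials_upto e')"
        using Cons span_monomials_ex by blast
      thus ?case using span_monomials_mono[of e "max e e'"] span_monomials_mono[of e' "max e e'"] by auto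
    qed simp
    thus ?thesis using that by blast
  qed
  have mon_span: "mon cs es \<in> span (monomials_upto (length cs * (d * e)))"
    if "length es = length cs" "set es <= {..d}" "set cs <= set bs" for cs es d
    using that
  proof (induction cs es rule: list_induct2'[case_names 1 2 3 4])
    case (4 c cs k es)
    have "c ^ k \<in> span (monomials_upto (k * e))" using span_monomials_power e 4 by auto
    hence "c ^ k \<in> span (monomials_upto (d * e))"
      by (rule span_monomials_mono[rotated]) (use 4 in auto)
    thus ?case using span_monomials_mult[of "c ^ k" "d * e"] 4 by simp
  qed (auto intro: span_base monomials_upto_one)
  have count: "Suc d ^ m <= Suc (m * (d * e)) ^ CARD('n)" for d
  proof -
    have zero: "c es = 0" if "(\<Sum>es\<in>exps m d. c es *\<^sub>R mon bs es) = 0" "es \<in> exps m d" for c es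
    proof -
      have "(\<Sum>es\<in>exps (length bs) d. of_real (c es) * mon bs es) \<in> A"
        using that(1) bs(1) primeID(1)[OF A] by (simp add: scaleR_conv_of_real)
      thus ?thesis using bs that(2) unfolding indep_mod_def by blast
    qed
    have inj: "inj_on (mon bs) (exps m d)"
    proof (rule inj_onI, rule ccontr)
      fix es es' assume h: "es \<in> exps m d" "es' \<in> exps m d" "mon bs es = mon bs es'" "es ~= es'"
      define c where "c x = (if x = es then 1 else if x = es' then - 1 else 0 :: real)" for x
      have "(\<Sum>x\<in>exps m d. c x *\<^sub>R mon bs x) = (\<Sum>x\<in>{es, es'}. c x *\<^sub>R mon bs x)"
        by (rule sum.mono_neutral_right) (use h finite_exps in "auto simp: c_def")
      also have "\<dots> = 0" using h by (simp add: c_def)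
      finally have "c es = 0" using zero h by blast
      thus False by (simp add: c_def)
    qed
    have indep: "independent (mon bs ` exps m d)"
    proof (rule independent_if_scalars_zero)
      show "finite (mon bs ` exps m d)" using finite_exps by blast
      fix f x assume h: "(\<Sum>x\<in>mon bs ` exps m d. f x *\<^sub>R x) = 0" "x \<in> mon bs ` exps m d"
      show "f x = 0" using h(1) zero[of "f \<circ> mon bs"] h(2) by (auto simp: sum.reindex[OF inj])
    qed
    show ?thesis using mon_span[of _ bs d] bs(1) independent_span_bound[OF card_monomials_upto(1) indep] card_image[OF inj] card_exps card_monomials_upto(2)[of "m * (d * e)", where 'n='n] by (fastforce simp: exps_def)
  qed
  define K where "K = Suc (m * e)"
  \<comment> \<open>This choice turns the constant \<open>K ^ CARD('n)\<close> of the upper bound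
    into \<open>d\<close>, which is less than the extra factor \<open>Suc d\<close> of the lower
    bound.\<close>
  define d where "d = K ^ CARD('n)"
  have "Suc d * Suc d ^ CARD('n) <= Suc d ^ m"
    using mN power_increasing[of "Suc CARD('n)" m "Suc d"] by simp
  also have "\<dots> <= Suc (m * (d * e)) ^ CARD('n)" by (rule count)
  also have "\<dots> <= (K * Suc d) ^ CARD('n)"
    by (intro power_mono) (auto simp: K_def algebra_simps)
  also have "\<dots> = d * Suc d ^ CARD('n)" by (simp only: d_def power_mult_distrib)
  finally show False by simp
qed

subsection \<open>Lifting prime ideals and orderings along derivations\<close>

definition derivation :: "('r::{comm_ring_1,real_algebra_1} => 'r) => bool" where
  "derivation D \<longleftrightarrow> (\<forall>x y. D (x + y) = D x + D y) & (\<forall>x y. D (x * y) = D x * y + x * D y) & (\<forall>c. D (of_real c) = 0)"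

lemma derivationD:
  assumes "derivation D"
  shows "D (x + y) = D x + D y" "D (x * y) = D x * y + x * D y" "D (of_real c) = 0" "D 0 = 0"
    "D (- x) = - D x" "D (x - y) = D x - D y" "D (sum g S) = (\<Sum>x\<in>S. D (g x))" "D (of_nat k) = 0"
proof -
  show 1: "D (x + y) = D x + D y" and "D (x * y) = D x * y + x * D y" and 2: "D (of_real c) = 0" for x y c
    using assms by (auto simp: derivation_def)
  show 3: "D 0 = 0" using 2[of 0] by simp
  show 4: "D (- x) = - D x" for x using 1[of x "- x"] 3 by (simp add: eq_neg_iff_add_eq_0 add.commute)
  show "D (x - y) = D x - D y" using 1[of x "- y"] 4 by simp
  show "D (sum g S) = (\<Sum>x\<in>S. D (g x))" by (induction S rule: infinite_finite_induct) (auto simp: 1 3)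
  show "D (of_nat k) = 0" using 2[of "of_nat k"] by simp
qed

lemma derivation_funpow:
  assumes "derivation D"
  shows "(D ^^ n) (x + y) = (D ^^ n) x + (D ^^ n) y" "(D ^^ n) 0 = 0"
  by (induction n) (auto simp: derivationD[OF assms])

lemma derivation_leibniz:
  assumes D: "derivation D"
  shows "(D ^^ n) (f * g) = (\<Sum>k\<le>n. of_nat (n choose k) * ((D ^^ k) f * (D ^^ (n - k)) g))"
proof (induction n)
  case (Suc n)
  define a where "a k = (D ^^ k) f" for k
  define b where "b k = (D ^^ k) g" for k
  have as: "D (a k) = a (Suc k)" "D (b k) = b (Suc k)" for k by (simp_all add: a_def b_def)
  have "(D ^^ Suc n) (f * g) = (\<Sum>k\<le>n. of_nat (n choose k) * (a (Suc k) * b (n - k) + a k * b (Suc (n - k))))"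
    using Suc by (simp add: derivationD[OF D] as a_def[symmetric] b_def[symmetric])
  also have "\<dots> = (\<Sum>k\<le>n. of_nat (n choose k) * (a (Suc k) * b (n - k))) +
      (\<Sum>k\<le>n. of_nat (n choose k) * (a k * b (Suc n - k)))"
    by (simp add: sum.distrib distrib_left Suc_diff_le)
  also have "(\<Sum>k\<le>n. of_nat (n choose k) * (a k * b (Suc n - k))) =
      (\<Sum>k\<le>Suc n. of_nat (n choose k) * (a k * b (Suc n - k)))"
    unfolding sum.atMost_Suc by (simp add: binomial_eq_0)
  also have "\<dots> = a 0 * b (Suc n) + (\<Sum>k\<le>n. of_nat (n choose Suc k) * (a (Suc k) * b (n - k)))"
    by (subst sum.atMost_Suc_shift) simp
  finally have "(D ^^ Suc n) (f * g) = a 0 * b (Suc n) +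
      (\<Sum>k\<le>n. of_nat ((n choose k) + (n choose Suc k)) * (a (Suc k) * b (n - k)))"
    by (simp only: of_nat_add distrib_right sum.distrib add_ac)
  also have "\<dots> = (\<Sum>k\<le>Suc n. of_nat (Suc n choose k) * (a k * b (Suc n - k)))"
    by (subst sum.atMost_Suc_shift) simp
  finally show ?case by (simp add: a_def b_def)
qed simp

text \<open>The largest \<open>D\<close>-stable subset of \<open>P\<close>: geometrically, the
  functions that vanish to infinite order along \<open>D\<close> at the zeros of
  \<open>P\<close>.\<close>

definition dlift :: "('r => 'r) => 'r set => 'r set" where
  "dlift D P = {g. \<forall>m. (D ^^ m) g \<in> P}"

definition dord :: "('r => 'r) => 'r set => 'r => nat" where
  "dord D P g = (LEAST m. (D ^^ m) g ~: P)"

lemma dlift_subset: "dlift D P <= P"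
  unfolding dlift_def by (auto dest: spec[of _ 0])

lemma dlift_mono_stable: "Q <= P ==> (!!g. g \<in> Q ==> D g \<in> Q) ==> Q <= dlift D P"
proof
  fix g assume h: "Q <= P" "!!g. g \<in> Q ==> D g \<in> Q" "g \<in> Q"
  have "(D ^^ m) g \<in> Q" for m by (induction m) (use h in auto)
  thus "g \<in> dlift D P" using h by (auto simp: dlift_def)
qed

lemma dlift_stable: "g \<in> dlift D P ==> D g \<in> dlift D P"
proof -
  assume "g \<in> dlift D P"
  hence "(D ^^ Suc m) g \<in> P" for m unfolding dlift_def by blast
  thus ?thesis by (simp add: dlift_def funpow_swap1)
qed

lemma dord:
  assumes "g ~: dlift D P"
  shows "(D ^^ dord D P g) g ~: P" "m < dord D P g ==> (D ^^ m) g \<in> P"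
proof -
  show "(D ^^ dord D P g) g ~: P" using assms by (auto simp: dlift_def dord_def intro!: LeastI_ex)
  show "m < dord D P g ==> (D ^^ m) g \<in> P" unfolding dord_def using not_less_Least by blast
qed

lemma dord_eqI: "(D ^^ k) g ~: P ==> (!!m. m < k ==> (D ^^ m) g \<in> P) ==> dord D P g = k"
  unfolding dord_def by (rule Least_equality) (auto simp: not_less[symmetric])

lemma dord_0: "g ~: P ==> dord D P g = 0"
  by (rule dord_eqI) auto

lemma leibniz_below:
  assumes D: "derivation D" and P: "primeI P"
    and "!!k. k < a ==> (D ^^ k) f \<in> P" "!!k. k < b ==> (D ^^ k) g \<in> P"
  shows "n < a + b ==> (D ^^ n) (f * g) \<in> P"
    "(D ^^ (a + b)) (f * g) - of_nat ((a + b) choose a) * ((D ^^ a) f * (D ^^ b) g) \<in> P"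
proof -
  have tm: "of_nat c * ((D ^^ k) f * (D ^^ l) g) \<in> P" if "k < a | l < b" for k l c
    using that assms(3)[of k] assms(4)[of l] primeID(4,5)[OF P] by blast
  show "n < a + b ==> (D ^^ n) (f * g) \<in> P"
    unfolding derivation_leibniz[OF D] by (intro primeI_sum[OF P] tm) auto
  have "(D ^^ (a + b)) (f * g) = of_nat ((a + b) choose a) * ((D ^^ a) f * (D ^^ (a + b - a)) g) +
      (\<Sum>k\<in>{..a + b} - {a}. of_nat ((a + b) choose k) * ((D ^^ k) f * (D ^^ (a + b - k)) g))"
    unfolding derivation_leibniz[OF D] by (rule sum.remove) auto
  thus "(D ^^ (a + b)) (f * g) - of_nat ((a + b) choose a) * ((D ^^ a) f * (D ^^ b) g) \<in> P" by (auto intro!: primeI_sum[OF P] tm)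
qed

text \<open>At the sum of the two orders a single term of the Leibniz formula survives modulo
  \<open>P\<close>, and its binomial coefficient is a positive integer, hence not in
  \<open>P\<close>. So orders add.\<close>

lemma dlift_mult:
  assumes D: "derivation D" and P: "primeI P" and fg: "f ~: dlift D P" "g ~: dlift D P"
  shows "f * g ~: dlift D P" "dord D P (f * g) = dord D P f + dord D P g"
    "\<exists>k>0. (D ^^ (dord D P f + dord D P g)) (f * g) - of_nat k * ((D ^^ dord D P f) f * (D ^^ dord D P g) g) \<in> P"
proof -
  define a where "a = dord D P f"
  define b where "b = dord D P g"
  have ab: "(D ^^ a) f ~: P" "(D ^^ b) g ~: P" "!!k. k < a ==> (D ^^ k) f \<in> P" "!!k. k < b ==> (D ^^ k) g \<in> P"
    using dord[OF fg(1)] dord[OF fg(2)] by (auto simp: a_def b_def)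
  note L = leibniz_below[OF D P, of a f b g, OF ab(3) ab(4)]
  have pos: "(a + b) choose a > 0" by simp
  have "of_nat ((a + b) choose a) * ((D ^^ a) f * (D ^^ b) g) ~: P"
    unfolding primeID(11)[OF P] primeI_of_nat[OF P] using ab(1,2) pos by (metis less_irrefl)
  hence n: "(D ^^ (a + b)) (f * g) ~: P"
  proof -
    assume nin: "of_nat ((a + b) choose a) * ((D ^^ a) f * (D ^^ b) g) ~: P"
    show ?thesis
    proof
      assume "(D ^^ (a + b)) (f * g) \<in> P"
      from primeID(8)[OF P this L(2)] show False using nin by simp
    qed
  qed
  thus "f * g ~: dlift D P" by (auto simp: dlift_def)
  show "dord D P (f * g) = dord D P f + dord D P g"
    unfolding a_def[symmetric] b_def[symmetric] by (rule dord_eqI[OF n L(1)])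
  show "\<exists>k>0. (D ^^ (dord D P f + dord D P g)) (f * g) - of_nat k * ((D ^^ dord D P f) f * (D ^^ dord D P g) g) \<in> P"
    unfolding a_def[symmetric] b_def[symmetric] using L(2) pos by blast
qed

lemma primeI_dlift:
  assumes D: "derivation D" and P: "primeI P"
  shows "primeI (dlift D P)"
  unfolding primeI_def
proof (intro conjI allI ballI impI)
  show "0 \<in> dlift D P" using primeID(1)[OF P] by (simp add: dlift_def derivation_funpow(2)[OF D])
  show "1 ~: dlift D P" using subsetD[OF dlift_subset[of D P], of 1] primeID(2)[OF P] by argo
  show "x + y \<in> dlift D P" if "x \<in> dlift D P" "y \<in> dlift D P" for x y
    using that primeID(3)[OF P] by (simp add: dlift_def derivation_funpow(1)[OF D])
  show "x * y \<in> dlift D P" if "y \<in> dlift D P" for x y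
    using that unfolding dlift_def mem_Collect_eq derivation_leibniz[OF D]
    by (blast intro: primeI_sum[OF P] primeID(4)[OF P])
  show "x \<in> dlift D P | y \<in> dlift D P" if "x * y \<in> dlift D P" for x y
    using dlift_mult(1)[OF D P] that by blast
qed

text \<open>The sign of the leading Taylor term of \<open>g\<close> along \<open>D\<close>: the
  point is moved infinitesimally along \<open>D\<close>, forwards for \<open>e = 1\<close> and
  backwards for \<open>e = - 1\<close>.\<close>

definition slift :: "('r::comm_ring_1 => 'r) => int => ('r => int) => 'r => int" where
  "slift D e s g = (if g \<in> dlift D (supp s) then 0
     else e ^ dord D (supp s) g * s ((D ^^ dord D (supp s) g) g))"

lemma supp_slift: "e \<in> {1, - 1} ==> supp (slift D e s) = dlift D (supp s)"
proof -
  assume e: "e \<in> {1, - 1}"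
  have "slift D e s g = 0 \<longleftrightarrow> g \<in> dlift D (supp s)" for g
    using dord(1)[of g D "supp s"] e by (auto simp: slift_def) (auto simp: supp_def)
  thus ?thesis by (simp add: supp_def)
qed

lemma slift_notin: "g ~: supp s ==> slift D e s g = s g"
  using dord_0[of g "supp s" D] dlift_subset[of D "supp s"] by (auto simp: slift_def)

lemma sgnf_cong_supp: "sgnf s ==> x - y \<in> supp s ==> s x = s y"
  using sgnfD(5)[of s "x - y" y] by (simp add: supp_def)

lemma sgnf_pos_nat:
  fixes s :: "'r::{comm_ring_1,real_algebra_1} => int"
  shows "sgnf s ==> k > 0 ==> s (of_nat k) = 1"
  using sgnf_of_real[of s "of_nat k"] by simp

text \<open>Products: orders add, and leading terms multiply up to a positive integer. Sums: the
  summand of lower order decides, and at equal order two leading terms of the same sign cannot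
  cancel.\<close>

lemma sgnf_slift:
  fixes s :: "'r::{comm_ring_1,real_algebra_1} => int"
  assumes D: "derivation D" and s: "sgnf s" and e: "e \<in> {1, - 1}"
  shows "sgnf (slift D e s)"
proof -
  define P where "P = supp s"
  have P: "primeI P" using primeI_supp[OF s] by (simp add: P_def)
  have dl: "primeI (dlift D P)" using primeI_dlift[OF D P] .
  note S = slift_def[of D e s, folded P_def]
  have z: "slift D e s g = 0 \<longleftrightarrow> g \<in> dlift D P" for g
    using supp_slift[OF e, of D s] by (auto simp: supp_def P_def)
  have n1: "slift D e s g = s g" if "g ~: P" for g using slift_notin that by (simp add: P_def)
  have lead: "slift D e s (x + y) = slift D e s x"
    if x: "x ~: dlift D P" and y: "!!m. m <= dord D P x ==> (D ^^ m) y \<in> P" for x y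
  proof -
    let ?a = "dord D P x"
    have 1: "(D ^^ ?a) (x + y) ~: P"
      using dord(1)[OF x] y[of ?a] primeID(10)[OF P] by (simp add: derivation_funpow[OF D])
    have "dord D P (x + y) = ?a"
      by (rule dord_eqI[OF 1]) (use dord(2)[OF x] y in "auto simp: derivation_funpow(1)[OF D] intro!: primeID(3)[OF P]")
    moreover have "s ((D ^^ ?a) (x + y)) = s ((D ^^ ?a) x)"
      using y[of ?a] sgnfD(10)[OF s] by (simp add: derivation_funpow[OF D] P_def supp_def)
    moreover have "x + y ~: dlift D P" using 1 by (auto simp: dlift_def)
    ultimately show ?thesis using x by (simp add: S)
  qed
  show ?thesis unfolding sgnf_def
  proof (intro conjI allI impI)
    have "- 1 ~: P" using primeID(2,7)[OF P] by (metis minus_minus)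
    thus "slift D e s 1 = 1" "slift D e s (- 1) = - 1" using n1 primeID(2)[OF P] sgnfD(1,2)[OF s] by auto
    show "slift D e s x \<in> {- 1, 0, 1}" for x
    proof -
      have "e ^ k \<in> {1, - 1}" for k using e by (cases "even k") auto
      hence "e ^ dord D P x \<in> {1, - 1}" by blast
      thus ?thesis using sgnfD(3)[OF s, of "(D ^^ dord D P x) x"] unfolding S by auto
    qed
    show "slift D e s (x * y) = slift D e s x * slift D e s y" for x y
    proof (cases "x \<in> dlift D P | y \<in> dlift D P")
      case True
      hence "x * y \<in> dlift D P" using primeID(11)[OF dl] by blast
      thus ?thesis using True by (metis z mult_zero_left mult_zero_right)
    next
      case False
      let ?a = "dord D P x" and ?b = "dord D P y"
      obtain k where k: "k > 0" "(D ^^ (?a + ?b)) (x * y) - of_nat k * ((D ^^ ?a) x * (D ^^ ?b) y) \<in> P"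
        using dlift_mult(3)[OF D P] False by blast
      have "s ((D ^^ (?a + ?b)) (x * y)) = s ((D ^^ ?a) x) * s ((D ^^ ?b) y)"
        using sgnf_cong_supp[OF s k(2)[unfolded P_def]] sgnf_pos_nat[OF s k(1)]
        by (simp add: sgnfD(4)[OF s] P_def[symmetric])
      thus ?thesis using dlift_mult(1,2)[OF D P, of x y] False by (simp add: S power_add)
    qed
    show "slift D e s (x + y) = slift D e s y" if x: "slift D e s x = 0" for x y
    proof (cases "y \<in> dlift D P")
      case True
      hence "x + y \<in> dlift D P" using x z primeID(3)[OF dl] by blast
      thus ?thesis using True by (metis z)
    next
      case False
      have "slift D e s (y + x) = slift D e s y"
        by (rule lead[OF False]) (use x z in "auto simp: dlift_def")
      thus ?thesis by (simp add: add.commute)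
    qed
    show "slift D e s (x + y) = 1" if xy: "slift D e s x = 1" "slift D e s y = 1" for x y
    proof -
      have n: "x ~: dlift D P" "y ~: dlift D P" using xy z by (metis zero_neq_one)+
      consider "dord D P x < dord D P y" | "dord D P y < dord D P x" | "dord D P x = dord D P y" by linarith
      thus ?thesis
      proof cases
        case 1
        thus ?thesis using lead[OF n(1), of y] dord(2)[OF n(2)] xy by auto
      next
        case 2
        thus ?thesis using lead[OF n(2), of x] dord(2)[OF n(1)] xy by (auto simp: add.commute)
      next
        case 3
        let ?a = "dord D P x"
        define \<epsilon> where "\<epsilon> = e ^ ?a"
        have \<epsilon>: "\<epsilon> = 1 | \<epsilon> = - 1" using e square_eq_1_iff by (fastforce simp: \<epsilon>_def)
        have sx: "\<epsilon> * s ((D ^^ ?a) x) = 1" "\<epsilon> * s ((D ^^ ?a) y) = 1" using xy n 3 by (auto simp: S \<epsilon>_def)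
        have "\<epsilon> * s ((D ^^ ?a) x + (D ^^ ?a) y) = 1"
        proof (cases "\<epsilon> = 1")
          case True thus ?thesis using sx sgnfD(6)[OF s] by simp
        next
          case False
          hence em: "\<epsilon> = - 1" using \<epsilon> by blast
          hence "s (- (D ^^ ?a) x) = 1" "s (- (D ^^ ?a) y) = 1" using sx sgnfD(7)[OF s] by auto
          hence "s (- (D ^^ ?a) x + - (D ^^ ?a) y) = 1" using sgnfD(6)[OF s] by blast
          moreover have "- (D ^^ ?a) x + - (D ^^ ?a) y = - ((D ^^ ?a) x + (D ^^ ?a) y)" by simp
          ultimately have "- s ((D ^^ ?a) x + (D ^^ ?a) y) = 1" using sgnfD(7)[OF s] by metis
          thus ?thesis using em by simp
        qed
        hence v: "\<epsilon> * s ((D ^^ ?a) (x + y)) = 1" by (simp add: derivation_funpow[OF D])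
        hence "(D ^^ ?a) (x + y) ~: P" by (auto simp: P_def supp_def)
        moreover from this have "dord D P (x + y) = ?a"
          by (rule dord_eqI) (use dord(2)[OF n(1)] dord(2)[OF n(2)] 3 in "auto simp: derivation_funpow(1)[OF D] intro!: primeID(3)[OF P]")
        ultimately show ?thesis using v by (auto simp: S dlift_def \<epsilon>_def)
      qed
    qed
  qed
qed

section \<open>Iterated lifts along several derivations\<close>

primrec ilifts :: "('l => 'r => 'r) => 'l list => 'r set => 'r set" where
  "ilifts D [] P = P"
| "ilifts D (l # ls) P = ilifts D ls (dlift (D l) P)"

primrec slifts :: "('l => 'r::comm_ring_1 => 'r) => 'l list => ('l => int) => ('r => int) => 'r => int" where
  "slifts D [] e s = s"
| "slifts D (l # ls) e s = slifts D ls e (slift (D l) (e l) s)"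

lemma ilifts_append: "ilifts D (xs @ ys) P = ilifts D ys (ilifts D xs P)"
  by (induction xs arbitrary: P) auto

lemma slifts_append: "slifts D (xs @ ys) e s = slifts D ys e (slifts D xs e s)"
  by (induction xs arbitrary: s) auto

lemma ilifts_subset: "ilifts D ls P <= P"
proof (induction ls arbitrary: P)
  case (Cons l ls)
  thus ?case using dlift_subset[of "D l" P] by (metis ilifts.simps(2) subset_trans)
qed simp

lemma primeI_ilifts: "(!!l. l \<in> set ls ==> derivation (D l)) ==> primeI P ==> primeI (ilifts D ls P)"
  by (induction ls arbitrary: P) (auto intro: primeI_dlift)

lemma ilifts_stable_subset:
  "Q <= P ==> (!!l g. l \<in> set ls ==> g \<in> Q ==> D l g \<in> Q) ==> Q <= ilifts D ls P"
proof (induction ls arbitrary: P)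
  case (Cons l ls)
  have "Q <= dlift (D l) P" by (rule dlift_mono_stable) (use Cons in auto)
  thus ?case using Cons by simp
qed simp

lemma slifts:
  fixes s :: "'r::{comm_ring_1,real_algebra_1} => int"
  assumes "!!l. l \<in> set ls ==> derivation (D l)" "sgnf s" "!!l. e l \<in> {1, - 1}"
  shows "sgnf (slifts D ls e s)" "supp (slifts D ls e s) = ilifts D ls (supp s)"
proof -
  have "sgnf (slifts D ls e s) & supp (slifts D ls e s) = ilifts D ls (supp s)"
    using assms(1,2)
  proof (induction ls arbitrary: s)
    case (Cons l ls)
    have "sgnf (slift (D l) (e l) s)" using Cons.prems assms(3) by (intro sgnf_slift) auto
    moreover have "supp (slift (D l) (e l) s) = dlift (D l) (supp s)" by (rule supp_slift) (rule assms(3))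
    ultimately show ?case using Cons by simp
  qed simp
  thus "sgnf (slifts D ls e s)" "supp (slifts D ls e s) = ilifts D ls (supp s)" by auto
qed

lemma slifts_notin:
  assumes "g ~: supp s" "!!l. e l \<in> {1, - 1}"
  shows "slifts D ls e s g = s g"
  using assms(1)
proof (induction ls arbitrary: s)
  case (Cons l ls)
  have "supp (slift (D l) (e l) s) = dlift (D l) (supp s)" by (rule supp_slift) (rule assms(2))
  thus ?case using dlift_subset[of "D l" "supp s"] Cons slift_notin[OF Cons.prems] by auto
qed simp

text \<open>The gain is uniformity: \<open>m\<close> and \<open>h\<close> do not depend on
  \<open>s\<close> and \<open>e\<close>. A function that separates lifted orderings is thereby
  turned into one on the residue field of \<open>P\<close>. If a derivation occurs repeatedly, its
  exponents add.\<close>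

lemma slifts_lex:
  fixes P :: "'r::{comm_ring_1,real_algebra_1} set"
  assumes "!!l. l \<in> set ls ==> derivation (D l)" "primeI P" "g ~: ilifts D ls P"
  shows "\<exists>m. \<exists>h. h ~: P & (\<forall>s e. sgnf s --> supp s = P --> (\<forall>l. e l \<in> {1, - 1}) -->
     slifts D ls e s g = (\<Prod>l\<in>set ls. e l ^ m l) * s h)"
  using assms
proof (induction ls arbitrary: P)
  case Nil
  thus ?case by (intro exI[of _ "\<lambda>_. 0"] exI[of _ g]) auto
next
  case (Cons l ls)
  define P' where "P' = dlift (D l) P"
  have P': "primeI P'" unfolding P'_def using Cons by (intro primeI_dlift) auto
  obtain m h where mh: "h ~: P'" "!!s e. sgnf s ==> supp s = P' ==> (\<forall>l. e l \<in> {1, - 1}) ==>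
     slifts D ls e s g = (\<Prod>l\<in>set ls. e l ^ m l) * s h"
  proof -
    have "g ~: ilifts D ls P'" using Cons.prems by (simp add: P'_def)
    from Cons.IH[OF _ P' this] Cons.prems(1) show ?thesis using that by (metis list.set_intros(2))
  qed
  define k where "k = dord (D l) P h"
  define m' where "m' = m(l := (if l \<in> set ls then m l + k else k))"
  have hk: "((D l) ^^ k) h ~: P" using dord(1)[of h "D l" P] mh(1) by (simp add: P'_def k_def)
  have "slifts D (l # ls) e s g = (\<Prod>l\<in>set (l # ls). e l ^ m' l) * s (((D l) ^^ k) h)"
    if s: "sgnf s" "supp s = P" and e: "\<forall>l. e l \<in> {1, - 1}" for s e
  proof -
    have "sgnf (slift (D l) (e l) s)" by (rule sgnf_slift) (use Cons.prems s e in auto)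
    hence "slifts D (l # ls) e s g = (\<Prod>l\<in>set ls. e l ^ m l) * slift (D l) (e l) s h" using supp_slift[of "e l" "D l" s] e s mh(2) by (simp add: P'_def)
    also have "slift (D l) (e l) s h = e l ^ k * s (((D l) ^^ k) h)"
      using mh(1) s by (simp add: slift_def P'_def k_def)
    also have "(\<Prod>l\<in>set ls. e l ^ m l) * (e l ^ k * s (((D l) ^^ k) h)) =
        (\<Prod>l\<in>set (l # ls). e l ^ m' l) * s (((D l) ^^ k) h)"
    by (fastforce simp: prod.remove m'_def insert_absorb power_add intro: prod.cong)
    finally show ?thesis .
  qed
  thus ?case using hk by blast
qed

lemma dlift_annihilated:
  assumes "derivation D" "primeI P" "y \<in> P" "D y = 0" shows "y \<in> dlift D P"
proof -
  have "(D ^^ m) y \<in> P" for m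
  proof (cases m)
    case (Suc k)
    hence "(D ^^ m) y = (D ^^ k) (D y)" by (simp add: funpow_swap1)
    thus ?thesis using assms derivation_funpow(2)[OF assms(1)] primeID(1)[OF assms(2)] by simp
  qed (use assms in simp)
  thus ?thesis by (simp add: dlift_def)
qed

lemma ilifts_annihilated:
  "(!!l. l \<in> set ls ==> derivation (D l) & D l y = 0) ==> primeI P ==> y \<in> P ==> y \<in> ilifts D ls P"
proof (induction ls arbitrary: P)
  case (Cons l ls)
  have l: "derivation (D l)" "D l y = 0" using Cons.prems(1)[of l] by simp_all
  have "y \<in> dlift (D l) P" using dlift_annihilated[OF l(1) Cons.prems(2,3) l(2)] .
  thus ?case using Cons primeI_dlift[OF l(1) Cons.prems(2)] by simp
qed simp

text \<open>The other derivations annihilate \<open>y\<close> and leave it in the support.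
  \<open>D i\<close> gives it the sign \<open>e i * s b\<close>, and later lifts keep nonzero
  signs.\<close>

lemma slifts_param:
  fixes s :: "'r::{comm_ring_1,real_algebra_1} => int"
  assumes "!!l. l \<in> set ls ==> derivation (D l) & (l ~= i --> D l y = 0)" "D i y = b" "!!l. e l \<in> {1, - 1}"
    and "sgnf s" "y \<in> supp s" "b ~: supp s" "i \<in> set ls"
  shows "slifts D ls e s y = e i * s b"
  using assms(1,4-)
proof (induction ls arbitrary: s)
  case (Cons l ls)
  define s' where "s' = slift (D l) (e l) s"
  have P: "primeI (supp s)" using primeI_supp Cons by blast
  have s': "sgnf s'" unfolding s'_def by (rule sgnf_slift) (use Cons assms in auto)
  have supp': "supp s' = dlift (D l) (supp s)" unfolding s'_def by (rule supp_slift) (use assms in auto)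
  show ?case
  proof (cases "l = i")
    case True
    have y: "y ~: dlift (D l) (supp s)" using Cons.prems assms(2) True by (auto simp: dlift_def intro!: exI[of _ 1])
    have "dord (D l) (supp s) y = 1"
      by (rule dord_eqI) (use Cons.prems assms(2) True in auto)
    hence "s' y = e i * s b" using y True assms(2) by (simp add: s'_def slift_def)
    moreover have "slifts D ls e s' y = s' y" by (rule slifts_notin) (use y supp' assms in auto)
    ultimately show ?thesis by (simp add: s'_def)
  next
    case False
    have "b ~: dlift (D l) (supp s)" using Cons.prems(4) dlift_subset[of "D l" "supp s"] by auto
    hence "slifts D ls e s' y = e i * s' b" using Cons.prems P False Cons.IH[of s'] s' supp' by (auto intro!: dlift_annihilated)
    thus ?thesis using Cons.prems by (auto simp: s'_def intro!: slift_notin)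
  qed
qed simp

text \<open>The lift along \<open>D l\<close> is strict because it expels \<open>t l\<close>. It
  keeps the \<open>t l'\<close> of the later steps, which \<open>D l\<close> annihilates.\<close>

lemma ilifts_drop_chain:
  fixes Q :: "'r::{comm_ring_1,real_algebra_1} set"
  assumes "!!l. l \<in> set ls ==> derivation (D l)" "primeI Q" "b ~: Q" "distinct ls"
    "!!l. l \<in> set ls ==> t l \<in> Q & D l (t l) = b"
    "!!l l'. l \<in> set ls ==> l' \<in> set ls ==> l ~= l' ==> D l (t l') = 0"
  shows "prime_chain (length ls) (ilifts D ls Q) Q"
  using assms
proof (induction ls arbitrary: Q)
  case Nil
  thus ?case by (simp add: prime_chain_refl)
next
  case (Cons l ls)
  have Q': "primeI (dlift (D l) Q)" using Cons.prems by (intro primeI_dlift) auto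
  have "t l ~: dlift (D l) Q" using Cons.prems by (auto simp: dlift_def intro!: exI[of _ 1])
  hence sub: "dlift (D l) Q \<subset> Q" using dlift_subset Cons.prems(5) by fastforce
  have "prime_chain (length ls) (ilifts D ls (dlift (D l) Q)) (dlift (D l) Q)"
  proof (rule Cons.IH[OF _ Q'])
    show "b ~: dlift (D l) Q" using Cons.prems sub by blast
    fix l' assume l': "l' \<in> set ls"
    hence "l ~= l'" using Cons.prems by auto
    thus "t l' \<in> dlift (D l) Q & D l' (t l') = b" using dlift_annihilated[of "D l" Q "t l'"] Cons.prems l' by auto
  qed (use Cons.prems in auto)
  thus ?case using prime_chain_snoc[OF _ Cons.prems(2) sub] by simp
qed

subsection \<open>Partial derivatives and local parameters\<close>

lemma pfun_partial_ex:
  fixes f :: "'n::finite pfun"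
  shows "\<exists>g. \<forall>x. ((\<lambda>t. pev f (x + t *\<^sub>R axis i 1)) has_field_derivative pev g x) (at 0)"
proof (induction f rule: pfun_induct)
  case (const c)
  thus ?case by (intro exI[of _ 0]) simp
next
  case (var j)
  have "((\<lambda>t. pev (pvar j) (x + t *\<^sub>R axis i 1)) has_field_derivative (if i = j then 1 else 0)) (at 0)" for x
    by (auto simp: axis_def intro!: derivative_eq_intros)
  thus ?case by (intro exI[of _ "if i = j then 1 else 0"]) (auto split: if_splits)
next
  case (add f g)
  then obtain f' g' where
    "\<forall>x. ((\<lambda>t. pev f (x + t *\<^sub>R axis i 1)) has_field_derivative pev f' x) (at 0)"
    "\<forall>x. ((\<lambda>t. pev g (x + t *\<^sub>R axis i 1)) has_field_derivative pev g' x) (at 0)" by blast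
  thus ?case by (intro exI[of _ "f' + g'"]) (auto intro: DERIV_add)
next
  case (mult f g)
  then obtain f' g' where d:
    "\<forall>x. ((\<lambda>t. pev f (x + t *\<^sub>R axis i 1)) has_field_derivative pev f' x) (at 0)"
    "\<forall>x. ((\<lambda>t. pev g (x + t *\<^sub>R axis i 1)) has_field_derivative pev g' x) (at 0)" by blast
  have "((\<lambda>t. pev (f * g) (x + t *\<^sub>R axis i 1)) has_field_derivative pev (f' * g + g' * f) x) (at 0)" for x
    using DERIV_mult[OF d(1)[rule_format, of x] d(2)[rule_format, of x]] by simp
  thus ?case by blast
qed

definition pd :: "'n::finite => 'n pfun => 'n pfun" where
  "pd i f = (SOME g. \<forall>x. ((\<lambda>t. pev f (x + t *\<^sub>R axis i 1)) has_field_derivative pev g x) (at 0))"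

lemma pd: "((\<lambda>t. pev f (x + t *\<^sub>R axis i 1)) has_field_derivative pev (pd i f) x) (at 0)"
  using someI_ex[OF pfun_partial_ex[of f i]] unfolding pd_def by blast

lemma pd_eqI:
  assumes "!!x. ((\<lambda>t. pev f (x + t *\<^sub>R axis i 1)) has_field_derivative pev g x) (at 0)"
  shows "pd i f = g"
  by (rule pfun_eqI) (rule DERIV_unique[OF pd assms])

lemma derivation_pd: "derivation (pd i)"
  unfolding derivation_def
proof (intro conjI allI)
  fix f g :: "'a pfun" and c
  show "pd i (f + g) = pd i f + pd i g"
    by (rule pd_eqI) (simp add: DERIV_add[OF pd pd])
  show "pd i (f * g) = pd i f * g + f * pd i g"
    by (rule pd_eqI) (use DERIV_mult[OF pd pd, of f _ i g] in "simp add: mult.commute")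
  show "pd i (of_real c) = 0" by (rule pd_eqI) simp
qed

lemma pd_pvar: "pd i (pvar j) = (if i = j then 1 else 0)"
  by (rule pd_eqI) (auto simp: axis_def intro!: derivative_eq_intros)

definition grad :: "real ^ 'n => 'n::finite pfun => real ^ 'n" where
  "grad p f = (\<chi> k. pev (pd k f) p)"

lemma grad_diff: "grad p (f - g) = grad p f - grad p g"
  by (simp add: grad_def vec_eq_iff derivationD(6)[OF derivation_pd])

lemma grad_sum: "grad p (sum f S) = (\<Sum>x\<in>S. grad p (f x))"
  by (simp add: grad_def vec_eq_iff derivationD(7)[OF derivation_pd])

lemma grad_mult: "pev g p = 0 ==> grad p (f * g) = pev f p *\<^sub>R grad p g"
  by (simp add: grad_def vec_eq_iff derivationD(2)[OF derivation_pd])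

lemma pev_det: "pev (det A) x = det (\<chi> i j. pev (A $ i $ j) x)"
proof -
  have "pev (of_int k) x = of_int k" for k :: int
    using pev_of_real[of "of_int k" x] by simp
  thus ?thesis by (simp add: det_def)
qed

definition jac :: "('n => 'n::finite pfun) => 'n pfun" where
  "jac t = det (\<chi> r k. pd k (t r))"

lemma jac_eq_0: "t i = t j ==> i ~= j ==> jac t = 0"
  unfolding jac_def by (rule det_identical_rows[of i j]) (auto simp: row_def vec_eq_iff)

text \<open>The determinant is linear in row \<open>i\<close>, and the vector of partial derivatives
  obeys the Leibniz rule.\<close>

lemma derivation_jac:
  fixes t :: "'n::finite => 'n pfun"
  shows "derivation (\<lambda>g. jac (t(i := g)))"
proof -
  have J: "jac (t(i := g)) = det (\<chi> r. if r = i then (\<chi> k. pd k g) else (\<chi> k. pd k (t r)))" for g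
    unfolding jac_def by (intro arg_cong[of _ _ det]) (auto simp: vec_eq_iff)
  have add: "det (\<chi> r. if r = i then (a :: 'n pfun ^ 'n) + b else (\<chi> k. pd k (t r))) =
      det (\<chi> r. if r = i then a else (\<chi> k. pd k (t r))) + det (\<chi> r. if r = i then b else (\<chi> k. pd k (t r)))" for a b
    using det_row_add[of i "\<lambda>_. a"] by simp
  have mul: "det (\<chi> r. if r = i then c *s (a :: 'n pfun ^ 'n) else (\<chi> k. pd k (t r))) =
      c * det (\<chi> r. if r = i then a else (\<chi> k. pd k (t r)))" for a c
    using det_row_mul[of i c] by simp
  show ?thesis unfolding derivation_def
  proof (intro conjI allI)
    fix f g :: "'n pfun" and c
    have "(\<chi> k. pd k (f + g)) = (\<chi> k. pd k f) + (\<chi> k. pd k g)"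
      by (simp add: vec_eq_iff derivationD(1)[OF derivation_pd])
    thus "jac (t(i := f + g)) = jac (t(i := f)) + jac (t(i := g))"
      unfolding J by (simp only: add)
    have "(\<chi> k. pd k (f * g)) = g *s (\<chi> k. pd k f) + f *s (\<chi> k. pd k g)"
      by (simp add: vec_eq_iff derivationD(2)[OF derivation_pd])
    thus "jac (t(i := f * g)) = jac (t(i := f)) * g + f * jac (t(i := g))"
      unfolding J by (simp only: add mul) (simp add: mult.commute)
    have "(\<chi> k. pd k (of_real c)) = 0 *s (\<chi> k. pd k f)"
      by (simp add: vec_eq_iff derivationD(3)[OF derivation_pd])
    thus "jac (t(i := of_real c)) = 0"
      unfolding J by (simp only: mul) simp
  qed
qed

lemma jac_nonzero:
  assumes "span (range (\<lambda>i. grad p (t i))) = UNIV"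
  shows "pev (jac t) p ~= 0"
proof -
  define A where "A = (\<chi> r k. pev (pd k (t r)) p)"
  have "rows A = range (\<lambda>i. grad p (t i))"
    by (auto simp: rows_def row_def A_def grad_def)
  thus ?thesis using assms matrix_left_invertible_span_rows[of A] invertible_left_inverse invertible_det_nz by (auto simp: jac_def pev_det A_def)
qed

text \<open>Jacobian determinants give derivations dual to any system \<open>t\<close> of
  coordinates at \<open>p\<close> in the ambient space, and \<open>t\<close> can be chosen among
  \<open>I\<close> and the \<open>y j\<close>. The rest is dimension counting: coordinates in
  \<open>I\<close> give a chain below \<open>I\<close>, the hypothesis one of length
  \<open>n\<close> above it, and the total is at most \<open>CARD('n)\<close>. Hence every
  \<open>y j\<close> occurs among the coordinates.\<close>

theorem dual_derivations:
  fixes y :: "nat => 'n::finite pfun"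
  assumes I: "primeI I" and Ip: "!!f. f \<in> I ==> pev f p = 0"
    and yp: "!!j. j < n ==> pev (y j) p = 0"
    and G: "!!g. pev g p = 0 ==> \<exists>u c. pev u p ~= 0 & u * g - (\<Sum>j<n. c j * y j) \<in> I"
    and ch: "prime_chain n I C"
  obtains \<Delta> b where "!!j. j < n ==> derivation (\<Delta> j)" "!!j f. j < n ==> f \<in> I ==> \<Delta> j f \<in> I"
    "!!i j. i < n ==> j < n ==> \<Delta> j (y i) = (if i = j then b else 0)" "pev b p ~= 0"
proof -
  define S where "S = grad p ` (I \<union> y ` {..<n})"
  have ax: "axis i 1 \<in> span S" for i :: 'n
  proof -
    obtain u c where uc: "pev u p ~= 0" "u * (pvar i - of_real (p $ i)) - (\<Sum>j<n. c j * y j) \<in> I"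
      using G[of "pvar i - of_real (p $ i)"] by auto
    define f where "f = u * (pvar i - of_real (p $ i)) - (\<Sum>j<n. c j * y j)"
    have gx: "grad p (pvar i - of_real (p $ i)) = axis i 1"
      by (auto simp: grad_def derivationD(6)[OF derivation_pd] derivationD(3)[OF derivation_pd] pd_pvar axis_def)
    have "grad p f = pev u p *\<^sub>R axis i 1 - (\<Sum>j<n. pev (c j) p *\<^sub>R grad p (y j))"
      unfolding f_def grad_diff grad_sum by (simp add: grad_mult yp gx)
    hence e: "pev u p *\<^sub>R axis i 1 = grad p f + (\<Sum>j<n. pev (c j) p *\<^sub>R grad p (y j))" by simp
    have "inverse (pev u p) *\<^sub>R (pev u p *\<^sub>R axis i 1) \<in> span S" using uc by (fastforce simp: f_def e S_def intro: span_add span_sum span_scale span_base)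
    thus ?thesis using uc by simp
  qed
  have "UNIV <= span S"
  proof
    fix v :: "real ^ 'n"
    show "v \<in> span S" by (smt (verit) basis_expansion[of v] ax span_scale span_sum scalar_mult_eq_scaleR)
  qed
  obtain B where B: "B <= S" "independent B" "S <= span B" "card B = dim S" by (rule basis_exists)
  have sB: "span B = UNIV" using B(3) \<open>UNIV <= span S\<close> by (metis span_mono span_span top.extremum_uniqueI)
  hence "card B = CARD('n)" using dim_eq_card_independent[OF B(2)] dim_span[of B] by simp
  moreover have fB: "finite B" using B(2) by (rule independent_imp_finite)
  ultimately obtain h where h: "bij_betw h (UNIV :: 'n set) B" using finite_same_card_bij by (metis finite)
  have "\<exists>f. f \<in> I \<union> y ` {..<n} & grad p f = h i" for i
  proof -
    have "h i \<in> S" using h B(1) by (auto simp: bij_betw_def)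
    thus ?thesis by (auto simp: S_def)
  qed
  then obtain t where t: "!!i. t i \<in> I \<union> y ` {..<n}" "!!i. grad p (t i) = h i" by metis
  define b where "b = jac t"
  define T where "T i g = jac (t(i := g))" for i g
  have dT: "derivation (T i)" for i unfolding T_def by (rule derivation_jac)
  have Tt: "T i (t j) = (if i = j then b else 0)" for i j
    using jac_eq_0[of "t(i := t j)" i] by (auto simp: T_def b_def)
  have b: "pev b p ~= 0" unfolding b_def
    by (rule jac_nonzero) (use t h sB in "simp add: bij_betw_def")
  hence bI: "b ~: I" using Ip by auto
  define E where "E = {i. t i \<in> I}"
  obtain es where es: "set es = E" "distinct es" using finite_distinct_list[of E] by auto
  have lE: "length es = card E" using es distinct_card by metis
  have chE: "prime_chain (card E) (ilifts T es Q) Q" if "primeI Q" "Q <= I" "!!l. l \<in> E ==> t l \<in> Q" for Q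
    unfolding lE[symmetric] by (rule ilifts_drop_chain[where t = t and b = b]) (use that es dT Tt bI in auto)
  have "injt": "inj t" using t(2) h by (metis bij_betw_imp_inj_on inj_on_def)
  have "\<exists>j. j < n & t i = y j" if "i ~: E" for i using t(1) that by (auto simp: E_def)
  then obtain k where k: "!!i. i ~: E ==> k i < n & t i = y (k i)" by metis
  have injk: "inj_on k (- E)" using injt k by (metis ComplD injD inj_onI)
  have kn: "k ` (- E) <= {..<n}" using k by auto
  have cardE: "card E + card (- E) = CARD('n)"
    using card_Un_disjoint[of E "- E"] by auto
  have "card (k ` (- E)) >= n" using cardE card_image[OF injk] prime_chain_bound[OF prime_chain_trans[OF chE[OF I order_refl] ch]] by (auto simp: E_def)
  hence kimg: "k ` (- E) = {..<n}" using kn by (intro card_seteq) auto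
  have cE: "card E + n = CARD('n)" using cardE card_image[OF injk] kimg by simp
  \<comment> \<open>A derivation moving \<open>I\<close> would yield a strictly smaller prime still
    containing the coordinates of \<open>E\<close>, and the combined chain would be too long by
    one.\<close>
  have stab: "T i f \<in> I" if i: "i ~: E" and f: "f \<in> I" for i f
  proof (rule ccontr)
    assume nf: "T i f ~: I"
    define Q where "Q = dlift (T i) I"
    have Q: "primeI Q" unfolding Q_def by (rule primeI_dlift[OF dT I])
    have "f ~: Q" using nf by (auto simp: Q_def dlift_def intro!: exI[of _ 1])
    hence sub: "Q \<subset> I" using f dlift_subset[of "T i"] by (auto simp: Q_def)
    have "t l \<in> Q" if "l \<in> E" for l unfolding Q_def
      by (rule dlift_annihilated[OF dT I]) (use that i Tt in "auto simp: E_def")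
    hence "prime_chain (Suc (card E)) (ilifts T es Q) I"
      using prime_chain_snoc[OF chE[OF Q] I sub] sub by simp
    from prime_chain_bound[OF prime_chain_trans[OF this ch]] show False using cE by simp
  qed
  define r where "r = inv_into (- E) k"
  have r: "r j ~: E" "k (r j) = j" if "j < n" for j
    using that kimg inv_into_into[of j k "- E"] f_inv_into_f[of j k] by (auto simp: r_def)
  show ?thesis
    by (smt (verit) stab r k Tt that[of "\<lambda>j. T (r j)" b] dT b)
qed

subsection \<open>Normal crossings data\<close>

definition sat :: "('r => int) => 'r sign_formula => bool" where
  "sat s = holds (\<lambda>f. s f = 1) (\<lambda>f. s f = 0)"

lemma holds_cong:
  "(!!f. f \<in> atoms \<theta> ==> pos f = pos' f & zer f = zer' f) ==> holds pos zer \<theta> = holds pos' zer' \<theta>"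
  by (induction \<theta>) auto

lemma sat_cong: "(!!f. f \<in> atoms \<theta> ==> s f = t f) ==> sat s \<theta> = sat t \<theta>"
  unfolding sat_def by (rule holds_cong) simp

text \<open>\<open>P\<close> is convex for \<open>s\<close>: elements of \<open>P\<close> are
  smaller in absolute value than all elements outside \<open>P\<close>.\<close>

definition compat :: "('r::comm_ring_1 => int) => 'r set => bool" where
  "compat s P \<longleftrightarrow> (\<forall>z\<in>P. \<forall>u. u ~: P --> s (u * u - z * z) = 1)"

definition res :: "'r set => ('r => int) => 'r => int" where
  "res P s f = (if f \<in> P then 0 else s f)"

text \<open>Adding \<open>z\<close> in \<open>P\<close> does not change the sign of \<open>u\<close>
  outside \<open>P\<close>: the numbers \<open>u + z\<close> and \<open>u - z\<close> have a
  positive product and the sum \<open>2 * u\<close>.\<close>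

lemma res:
  fixes s :: "'r::{comm_ring_1,real_algebra_1} => int"
  assumes s: "sgnf s" and P: "primeI P" and c: "compat s P"
  shows "sgnf (res P s)" "supp (res P s) = P" "supp s <= P"
proof -
  have c': "s (u * u - z * z) = 1" if "z \<in> P" "u ~: P" for u z using c that by (auto simp: compat_def)
  have nz: "s u ~= 0" if "u ~: P" for u
    using c'[OF primeID(1)[OF P] that] sgnfD(4)[OF s, of u u] by auto
  show "supp (res P s) = P" using nz by (auto simp: supp_def res_def)
  show "supp s <= P" using nz by (auto simp: supp_def)
  have add: "s (u + z) = s u" if "z \<in> P" "u ~: P" for u z
  proof -
    have m: "s (u + z) * s (u - z) = 1" using c'[OF that] by (auto simp: sgnfD(4)[OF s, symmetric] algebra_simps)
    have cs: "s (u + z) \<in> {-1, 0, 1}" "s (u - z) \<in> {-1, 0, 1}" by (rule sgnfD(3)[OF s])+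
    have "s ((u + z) + (u - z)) = s (of_nat 2 * u)" by (simp add: algebra_simps)
    also have "\<dots> = s u" using sgnfD(4)[OF s] sgnf_pos_nat[OF s, of 2] by simp
    finally have su: "s ((u + z) + (u - z)) = s u" .
    consider "s (u + z) = 1" "s (u - z) = 1" | "s (u + z) = - 1" "s (u - z) = - 1" using m cs by auto
    thus ?thesis
    proof cases
      case 1 thus ?thesis using sgnfD(6)[OF s 1] su by simp
    next
      case 2
      hence "s (- (u + z) + - (u - z)) = 1" by (smt (verit) sgnfD(6)[OF s] sgnfD(7)[OF s])
      thus ?thesis using su sgnfD(7)[OF s] 2 by simp
    qed
  qed
  show "sgnf (res P s)" unfolding sgnf_def
  proof (intro conjI allI impI)
    show "res P s 1 = 1" "res P s (- 1) = - 1" using primeID(2)[OF P] primeID(7)[OF P, of "- 1"] sgnfD(1,2)[OF s] by (auto simp: res_def)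
    show "res P s x \<in> {- 1, 0, 1}" for x using sgnfD(3)[OF s] by (simp add: res_def)
    show "res P s (x * y) = res P s x * res P s y" for x y
      using primeID(11)[OF P, of x y] by (auto simp: res_def sgnfD(4)[OF s])
    show "res P s (x + y) = res P s y" if "res P s x = 0" for x y
    proof -
      have x: "x \<in> P" using that nz by (auto simp: res_def split: if_splits)
      hence "x + y \<in> P \<longleftrightarrow> y \<in> P" using primeID(10)[OF P, of x y] by (simp add: add.commute)
      thus ?thesis using add[OF x, of y] by (auto simp: res_def add.commute)
    qed
    show "res P s (x + y) = 1" if "res P s x = 1" "res P s y = 1" for x y
    proof -
      have x: "x ~: P" "s x = 1" "y ~: P" "s y = 1" using that by (auto simp: res_def split: if_splits)
      have "x + y ~: P"
      proof
        assume z: "x + y \<in> P"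
        have "s (- (x + y)) = - 1" using sgnfD(6)[OF s x(2,4)] unfolding sgnfD(7)[OF s] by linarith
        moreover have "s (x + - (x + y)) = s x" using add[OF primeID(7)[OF P z] x(1)] .
        moreover have "s (x + - (x + y)) = - s y" using sgnfD(7)[OF s, of y] by simp
        ultimately show False using x by simp
      qed
      thus ?thesis using sgnfD(6)[OF s x(2,4)] by (simp add: res_def)
    qed
  qed
qed

lemma res_notin: "f ~: P ==> res P s f = s f"
  by (simp add: res_def)

lemma compat_supp: "sgnf s ==> compat s (supp s)"
proof -
  assume s: "sgnf s"
  have "s (u * u - z * z) = 1" if "z \<in> supp s" "u ~: supp s" for u z
    using that sgnfD(4)[OF s] sgnfD(11)[OF s] sgnf_square[OF s, of u] by (auto simp: supp_def)
  thus ?thesis by (simp add: compat_def)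
qed

text \<open>Convexity only asserts that certain elements are positive, and lifts keep nonzero
  signs.\<close>

lemma compat_slifts:
  assumes "compat s P" "!!l. e l \<in> {1, - 1}"
  shows "compat (slifts D ls e s) P"
  unfolding compat_def
proof (intro ballI allI impI)
  fix z u assume "z \<in> P" "u ~: P"
  hence "s (u * u - z * z) = 1" using assms by (simp add: compat_def)
  moreover from this have "u * u - z * z ~: supp s" by (simp add: supp_def)
  ultimately show "slifts D ls e s (u * u - z * z) = 1" using slifts_notin assms(2) by metis
qed

section \<open>Zero sets, vanishing ideals and the locales of normal crossings\<close>

definition vzeros :: "'n::finite pfun set => (real ^ 'n) set" where
  "vzeros Q = {x. \<forall>f\<in>Q. pev f x = 0}"

definition videal :: "(real ^ 'n) set => 'n::finite pfun set" where
  "videal V = {f. \<forall>x\<in>V. pev f x = 0}"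

lemma primeI_point: "primeI (videal {p})"
  by (auto simp: primeI_def videal_def)

lemma supp_point: "supp (point_sgn x) = videal {x}"
  by (auto simp: supp_def point_sgn_def videal_def sg_eq_iff)

text \<open>The geometric hypotheses with denominators cleared: units of the local ring become
  polynomials \<open>u\<close>, \<open>w\<close> not vanishing at \<open>p\<close>, equations in the
  local ring become congruences modulo \<open>I\<close>, and the dimension \<open>n\<close> is
  expressed by prime chains.\<close>

locale crossing =
  fixes I :: "'n::finite pfun set" and M :: "(real ^ 'n) set" and n :: nat
    and F :: "'n pfun set" and \<phi> \<psi> :: "'n pfun sign_formula"
  assumes prime_I: "primeI I" and M_eq: "M = vzeros I" and I_eq: "I = videal M"
    and compact_M: "compact M"
    and dim_le: "!!m C. prime_chain m I C ==> m <= n" and dim_ge: "\<exists>C. prime_chain n I C"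
    and finite_F: "finite F" and atoms: "atoms \<phi> <= F" "atoms \<psi> <= F"
    and params: "!!p. p \<in> M ==> \<exists>y. (\<forall>j<n. pev (y j) p = 0) &
      (\<forall>g. pev g p = 0 --> (\<exists>u c. pev u p ~= 0 & u * g - (\<Sum>j<n. c j * y j) \<in> I)) &
      (\<forall>f\<in>F. \<exists>u w m. pev u p ~= 0 & pev w p ~= 0 & u * f - w * (\<Prod>j<n. y j ^ m j) \<in> I)"
    and open_A: "openin (top_of_set M) {x \<in> M. sat (point_sgn x) \<phi>}"
    and open_B: "openin (top_of_set M) {x \<in> M. sat (point_sgn x) \<psi>}"
    and disjoint: "!!x. x \<in> M ==> sat (point_sgn x) \<phi> ==> \<not> sat (point_sgn x) \<psi>"
begin

definition separated :: "'n pfun set => bool" where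
  "separated P \<longleftrightarrow> (\<exists>g. g ~: I & (\<forall>s. sgnf s --> supp s = I --> compat s P -->
     (sat s \<phi> --> s g = 1) & (sat s \<psi> --> s g = - 1)))"

lemma separatedI:
  "g ~: I ==> (!!s. sgnf s ==> supp s = I ==> compat s P ==> sat s \<phi> ==> s g = 1) ==>
    (!!s. sgnf s ==> supp s = I ==> compat s P ==> sat s \<psi> ==> s g = - 1) ==> separated P"
  unfolding separated_def by blast

text \<open>The zero sets of these primes turn out to be walls. Codimension one is expressed by a
  chain of length \<open>n - 1\<close> above \<open>Q\<close>, and the last clause places the zero
  set in the Zariski closure of one of the two frontiers.\<close>

definition wall_ideal :: "'n pfun set => bool" where
  "wall_ideal Q \<longleftrightarrow> primeI Q & I \<subset> Q & videal (vzeros Q) = Q & (\<exists>C. prime_chain (n - 1) Q C) & F \<inter> Q ~= {} &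
     (\<exists>\<theta>\<in>{\<phi>, \<psi>}. videal (top_of_set M frontier_of {x \<in> M. sat (point_sgn x) \<theta>}) <= Q)"

end

locale crossing_at = crossing I M n F \<phi> \<psi>
  for I :: "'n::finite pfun set" and M :: "(real ^ 'n) set" and n F \<phi> \<psi> +
  fixes p :: "real ^ 'n" and y :: "nat => 'n pfun" and \<Delta> :: "nat => 'n pfun => 'n pfun" and b :: "'n pfun"
  assumes p: "p \<in> M" and y_p: "!!j. j < n ==> pev (y j) p = 0"
    and gen: "!!g. pev g p = 0 ==> \<exists>u c. pev u p ~= 0 & u * g - (\<Sum>j<n. c j * y j) \<in> I"
    and nc: "!!f. f \<in> F ==> \<exists>u w m. pev u p ~= 0 & pev w p ~= 0 & u * f - w * (\<Prod>j<n. y j ^ m j) \<in> I"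
    and deriv: "!!j. j < n ==> derivation (\<Delta> j)" and stable_I: "!!j f. j < n ==> f \<in> I ==> \<Delta> j f \<in> I"
    and dual: "!!i j. i < n ==> j < n ==> \<Delta> j (y i) = (if i = j then b else 0)" and b_p: "pev b p ~= 0"

lemma (in crossing) ex_at:
  assumes "p \<in> M"
  obtains y \<Delta> b where "crossing_at I M n F \<phi> \<psi> p y \<Delta> b"
proof -
  obtain y where y: "\<forall>j<n. pev (y j) p = 0"
      "\<forall>g. pev g p = 0 --> (\<exists>u c. pev u p ~= 0 & u * g - (\<Sum>j<n. c j * y j) \<in> I)"
      "\<forall>f\<in>F. \<exists>u w m. pev u p ~= 0 & pev w p ~= 0 & u * f - w * (\<Prod>j<n. y j ^ m j) \<in> I"
    using params[OF assms] by blast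
  obtain C where C: "prime_chain n I C" using dim_ge by blast
  have Ip: "pev f p = 0" if "f \<in> I" for f using that assms I_eq by (auto simp: videal_def)
  obtain \<Delta> b where "!!j. j < n ==> derivation (\<Delta> j)" "!!j f. j < n ==> f \<in> I ==> \<Delta> j f \<in> I"
    "!!i j. i < n ==> j < n ==> \<Delta> j (y i) = (if i = j then b else 0)" "pev b p ~= 0"
    using dual_derivations[of I p n y, OF prime_I Ip _ _ C] y by blast
  hence "crossing_at I M n F \<phi> \<psi> p y \<Delta> b"
    using y assms by unfold_locales auto
  thus ?thesis by (rule that)
qed

context crossing_at
begin

lemma I_sub_mp: "I <= videal {p}"
  using p I_eq by (auto simp: videal_def)

lemma b_notin: "Q <= videal {p} ==> b ~: Q"
  using b_p by (auto simp: videal_def)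

lemma y_notin_I: "j < n ==> y j ~: I"
  using stable_I[of j "y j"] dual[of j j] b_notin[OF I_sub_mp] by auto

text \<open>Being stable, \<open>Q\<close> is contained in the iterated lift of the maximal ideal at
  \<open>p\<close>, and above that lift the parameters with index in \<open>J\<close> give a chain
  of length \<open>card J\<close>.\<close>

lemma chain_up:
  assumes Q: "primeI Q" "I <= Q" "Q <= videal {p}" and J: "J <= {..<n}"
    and st: "!!l g. l \<in> J ==> g \<in> Q ==> \<Delta> l g \<in> Q"
  shows "\<exists>C. prime_chain (card J) Q C" "\<exists>C. \<exists>k\<ge>card J. prime_chain k Q C"
proof -
  obtain js where js: "set js = J" "distinct js"
    using finite_distinct_list[of J] J finite_subset by blast
  define R where "R = ilifts \<Delta> js (videal {p})"
  have "prime_chain (length js) R (videal {p})"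
    unfolding R_def
    by (rule ilifts_drop_chain[where t = y and b = b])
      (use js J deriv dual y_p in "auto simp: primeI_point[unfolded videal_def, simplified] b_notin videal_def b_p subset_iff")
  hence R: "prime_chain (card J) R (videal {p})" using js distinct_card by metis
  have QR: "Q <= R" unfolding R_def by (rule ilifts_stable_subset) (use Q js st in auto)
  have 1: "\<exists>C. prime_chain (card J) Q C"
  proof (cases "card J")
    case 0 thus ?thesis using prime_chain_refl[OF Q(1)] by metis
  next
    case (Suc k)
    from R obtain X where X: "X 0 = R" "X (Suc k) = videal {p}" "\<forall>i\<le>Suc k. primeI (X i)" "\<forall>i<Suc k. X i \<subset> X (Suc i)"
      unfolding prime_chain_def Suc by blast
    have "prime_chain k (X 1) (videal {p})"
      unfolding prime_chain_def using X by (intro exI[of _ "\<lambda>i. X (Suc i)"] conjI allI impI) simp_all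
    thus ?thesis using QR X(1,4) One_nat_def subset_psubset_trans zero_less_Suc prime_chain_Cons[OF Q(1)] Suc by metis
  qed
  thus "\<exists>C. prime_chain (card J) Q C" .
  thus "\<exists>C. \<exists>k\<ge>card J. prime_chain k Q C" by blast
qed

text \<open>Lifting is repeated as long as it shrinks the ideal. Every strict step lengthens a prime
  chain, and such lengths are bounded.\<close>

lemma ex_stable_list:
  assumes P: "primeI P" and J: "J <= {..<n}"
  shows "\<exists>ls. set ls = J & (\<forall>l\<in>J. \<forall>g\<in>ilifts \<Delta> ls P. \<Delta> l g \<in> ilifts \<Delta> ls P)"
proof -
  define K where "K k \<longleftrightarrow> (\<exists>ls. set ls <= J & prime_chain k (ilifts \<Delta> ls P) P)" for k
  have "K 0" unfolding K_def by (intro exI[of _ "[]"]) (simp add: prime_chain_refl P)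
  moreover have "K k ==> k <= CARD('n)" for k unfolding K_def using prime_chain_bound by blast
  ultimately obtain k where k: "K k" "!!k'. K k' ==> k' <= k"
    using GreatestI_nat[of K 0] Greatest_le_nat[of K _ "CARD('n)"] by metis
  obtain ls where ls: "set ls <= J" "prime_chain k (ilifts \<Delta> ls P) P" using k(1) by (auto simp: K_def)
  define Q where "Q = ilifts \<Delta> ls P"
  have Q: "primeI Q" using ls prime_chain_prime by (auto simp: Q_def)
  have fix1: "dlift (\<Delta> l) Q = Q" if l: "l \<in> J" for l
  proof (rule ccontr)
    assume "dlift (\<Delta> l) Q ~= Q"
    hence "prime_chain (Suc k) (dlift (\<Delta> l) Q) P" using dlift_subset[of "\<Delta> l" Q] primeI_dlift[OF deriv Q] J l prime_chain_Cons ls(2) Q_def by blast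
    thus False using ls l k(2) by (fastforce simp: K_def ilifts_append Q_def intro: exI[of _ "ls @ [l]"])
  qed
  have st: "\<Delta> l g \<in> Q" if "l \<in> J" "g \<in> Q" for l g
    using dlift_stable[of g "\<Delta> l" Q] fix1 that by simp
  obtain js where js: "set js = J" using finite_list[of J] J finite_subset by blast
  have "set js' <= J ==> ilifts \<Delta> js' Q = Q" for js'
    by (induction js') (auto simp: fix1)
  thus ?thesis using ls st by (auto simp: ilifts_append js Q_def intro!: exI[of _ "ls @ js"])
qed

lemma ilifts_I: "I <= P ==> set ls <= {..<n} ==> I <= ilifts \<Delta> ls P"
  by (rule ilifts_stable_subset) (use stable_I in auto)

lemma stable_all_eq:
  assumes "primeI Q" "I <= Q" "Q <= videal {p}" "!!l g. l < n ==> g \<in> Q ==> \<Delta> l g \<in> Q"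
  shows "Q = I"
proof (rule ccontr)
  assume "Q ~= I"
  hence "I \<subset> Q" using assms by blast
  moreover obtain C where "prime_chain n Q C" using chain_up(1)[of Q "{..<n}"] assms by auto
  ultimately have "prime_chain (Suc n) I C" using prime_chain_Cons[OF prime_I] by blast
  thus False using dim_le by fastforce
qed

text \<open>Lifting in all directions except \<open>i\<close> produces the prime of the divisor
  \<open>y i = 0\<close> near \<open>p\<close>, and one more lift along \<open>\<Delta> i\<close>
  reaches \<open>I\<close>. Lifts from \<open>P\<close> to \<open>I\<close> can thus be routed
  through a divisor of choice.\<close>

lemma ex_divisor_list:
  assumes P: "primeI P" "I <= P" "P <= videal {p}" and i: "i < n" "y i \<in> P"
  obtains ls where "set ls = {..<n} - {i}" "y i \<in> ilifts \<Delta> ls P"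
    "!!l g. l < n ==> l ~= i ==> g \<in> ilifts \<Delta> ls P ==> \<Delta> l g \<in> ilifts \<Delta> ls P"
    "dlift (\<Delta> i) (ilifts \<Delta> ls P) = I" "\<exists>C. prime_chain (n - 1) (ilifts \<Delta> ls P) C"
    "primeI (ilifts \<Delta> ls P)" "I \<subset> ilifts \<Delta> ls P" "ilifts \<Delta> ls P <= P"
proof -
  obtain ls where ls: "set ls = {..<n} - {i}"
      "\<forall>l\<in>{..<n} - {i}. \<forall>g\<in>ilifts \<Delta> ls P. \<Delta> l g \<in> ilifts \<Delta> ls P"
    using ex_stable_list[OF P(1), of "{..<n} - {i}"] by auto
  define Q where "Q = ilifts \<Delta> ls P"
  have Q: "primeI Q" unfolding Q_def by (rule primeI_ilifts) (use deriv ls P in auto)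
  have QP: "Q <= P" unfolding Q_def by (rule ilifts_subset)
  have yQ: "y i \<in> Q" unfolding Q_def
    by (rule ilifts_annihilated) (use ls deriv dual i P in auto)
  have IQ: "I <= Q" unfolding Q_def by (rule ilifts_I) (use P ls in auto)
  hence IQ': "I \<subset> Q" using yQ y_notin_I i by blast
  obtain C where C: "prime_chain (n - 1) Q C" using i chain_up(1)[of Q "{..<n} - {i}"] Q IQ QP P(3) ls(2) by (auto simp: Q_def)
  define R where "R = dlift (\<Delta> i) Q"
  have R: "primeI R" unfolding R_def by (rule primeI_dlift[OF deriv[OF i(1)] Q])
  have "b ~: Q" using b_notin QP P(3) by blast
  hence "y i ~: R" using dual[OF i(1) i(1)] by (auto simp: R_def dlift_def intro!: exI[of _ 1])
  hence RQ: "R \<subset> Q" using yQ dlift_subset[of "\<Delta> i" Q] by (auto simp: R_def)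
  have IR: "I <= R" unfolding R_def by (rule dlift_mono_stable) (use IQ stable_I i in auto)
  have "R = I"
    using IR prime_chain_Cons[OF prime_I _ prime_chain_Cons[OF R RQ C]] dim_le by fastforce
  thus ?thesis using that[of ls] ls yQ C Q IQ' QP by (auto simp: Q_def R_def)
qed

text \<open>By normal crossings a member of \<open>F\<close> is, up to units at \<open>p\<close>, a
  monomial in the parameters. Its sign is thus determined by the signs of the parameters and of the
  two units.\<close>

lemma sgn_F_eq:
  assumes s: "sgnf s" "I <= supp s" and t: "sgnf t" "I <= supp t"
    and yy: "!!j. j < n ==> s (y j) = t (y j)"
    and u: "!!f u w m. f \<in> F ==> pev u p ~= 0 ==> pev w p ~= 0 ==> u * f - w * (\<Prod>j<n. y j ^ m j) \<in> I ==>
      \<exists>u w m. u * f - w * (\<Prod>j<n. y j ^ m j) \<in> I & s u = t u & s u ~= 0 & s w = t w"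
    and f: "f \<in> F"
  shows "s f = t f"
proof -
  obtain u w m where uwm: "u * f - w * (\<Prod>j<n. y j ^ m j) \<in> I" "s u = t u" "s u ~= 0" "s w = t w"
    using nc[OF f] u[OF f] by blast
  have pr: "r (\<Prod>j\<in>X. y j ^ m j) = (\<Prod>j\<in>X. r (y j) ^ m j)" if "sgnf r" "finite X" for r X
    using that(2) by (induction X) (auto simp: sgnfD[OF that(1)])
  have "r u * r f = r w * (\<Prod>j<n. r (y j) ^ m j)" if r: "sgnf r" "I <= supp r" for r
  proof -
    have "u * f - w * (\<Prod>j<n. y j ^ m j) \<in> supp r" using uwm r by blast
    from sgnf_cong_supp[OF r(1) this] show ?thesis using sgnfD(4)[OF r(1)] pr[OF r(1), of "{..<n}"] by simp
  qed
  from this[OF s] this[OF t] have "t u * s f = t u * t f" using uwm yy by simp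
  thus ?thesis using uwm by simp
qed

lemma sgn_F_eq_notin:
  assumes s: "sgnf s" "I <= supp s" and t: "sgnf t" "I <= supp t"
    and yy: "!!j. j < n ==> s (y j) = t (y j)"
    and P: "P <= videal {p}" "!!f. f ~: P ==> s f = t f" "supp s <= P"
    and f: "f \<in> F"
  shows "s f = t f"
proof (rule sgn_F_eq[OF s t yy _ f])
  fix f u w m assume h: "pev u p ~= 0" "pev w p ~= 0" "u * f - w * (\<Prod>j<n. y j ^ m j) \<in> I"
  thus "\<exists>u w m. u * f - w * (\<Prod>j<n. y j ^ m j) \<in> I & s u = t u & s u ~= 0 & s w = t w" using P(1) P(2)[of u] P(2)[of w] P(3) by (auto simp: videal_def supp_def)
qed

lemma F_notin_I: "f \<in> F ==> f ~: I"
proof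
  assume "f \<in> F" "f \<in> I"
  then obtain u w m where "pev w p ~= 0" "u * f - w * (\<Prod>j<n. y j ^ m j) \<in> I" using nc by blast
  hence "w * (\<Prod>j<n. y j ^ m j) \<in> I"
    using primeID(8)[OF prime_I primeID(4)[OF prime_I \<open>f \<in> I\<close>, of u]] by fastforce
  moreover have "w ~: I" using \<open>pev w p ~= 0\<close> I_sub_mp by (auto simp: videal_def)
  moreover have "finite X ==> X <= {..<n} ==> (\<Prod>j\<in>X. y j ^ m j) ~: I" for X
  proof (induction X rule: finite_induct)
    case empty thus ?case using primeID(2)[OF prime_I] by simp
  next
    case (insert j X)
    thus ?case using primeID(6)[OF prime_I, of "y j ^ m j"] primeID(9)[OF prime_I, of "y j" "m j"] y_notin_I by auto
  qed
  ultimately show False using primeID(6)[OF prime_I, of w] by blast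
qed

lemma y_in_of_F:
  assumes Q: "primeI Q" "I <= Q" "Q <= videal {p}" and f: "f \<in> F" "f \<in> Q"
  obtains i where "i < n" "y i \<in> Q"
proof -
  obtain u w m where h: "pev w p ~= 0" "u * f - w * (\<Prod>j<n. y j ^ m j) \<in> I" using nc f by blast
  hence "(\<Prod>j<n. y j ^ m j) \<in> Q" using primeID(8)[OF Q(1) primeID(4)[OF Q(1) f(2), of u]] Q primeID(6)[OF Q(1)] by (fastforce simp: videal_def)
  moreover have "finite X ==> (\<Prod>j\<in>X. y j ^ m j) \<in> Q ==> \<exists>j\<in>X. y j \<in> Q" for X
  proof (induction X rule: finite_induct)
    case empty thus ?case using primeID(2)[OF Q(1)] by simp
  next
    case (insert j X)
    thus ?case using primeID(6)[OF Q(1), of "y j ^ m j"] primeID(9)[OF Q(1), of "y j" "m j"] by auto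
  qed
  ultimately show ?thesis using that by blast
qed

end

lemma slifts_cong: "(!!l. l \<in> set ls ==> e l = e' l) ==> slifts D ls e s = slifts D ls e' s"
  by (induction ls arbitrary: s) auto

section \<open>Orderings centred at a point and the frontier\<close>

context crossing
begin

text \<open>\<open>q\<close> is positive exactly on the ball around \<open>x\<close>, and it is
  positive for \<open>s\<close> because it is positive at \<open>x\<close>. Adding it to the list in
  the Artin--Lang theorem places the real point inside the ball.\<close>

lemma near_point:
  assumes s: "sgnf s" "I <= supp s" and sx: "!!f. pev f x ~= 0 ==> s f = sg (pev f x)" and r: "r > 0"
  shows "\<exists>x'\<in>M. dist x' x < r & (\<forall>f\<in>F. point_sgn x' f = s f)"
proof -
  define q where "q = of_real (r\<^sup>2) - (\<Sum>i\<in>UNIV. (pvar i - of_real (x $ i))\<^sup>2)"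
  have q: "pev q x' = r\<^sup>2 - (dist x' x)\<^sup>2" for x'
    by (simp add: q_def dist_norm power2_norm_eq_inner inner_vec_def) (simp add: power2_eq_square)
  have "s q = 1" using sx[of q] q[of x] r by (simp add: sg_eq_iff)
  obtain x' where x': "\<forall>f\<in>supp s. pev f x' = 0" "\<forall>h\<in>insert q F. sg (pev h x') = s h"
    using artin_lang[OF s(1), of "insert q F"] finite_F by auto
  have "x' \<in> M" using x'(1) s(2) M_eq by (auto simp: vzeros_def)
  moreover have "sg (pev q x') = 1" using x'(2) \<open>s q = 1\<close> by simp
  hence "dist x' x < r" using q r by (simp add: power2_less_imp_less)
  ultimately show ?thesis using x'(2) by (auto simp: point_sgn_def)
qed

text \<open>Both orderings specialize to \<open>x\<close>; arbitrarily near \<open>x\<close> one is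
  imitated by points of the set, the other by points of its complement.\<close>

lemma in_frontier:
  assumes x: "x \<in> M" and \<theta>: "atoms \<theta> <= F"
    and s: "sgnf s" "I <= supp s" "!!f. pev f x ~= 0 ==> s f = sg (pev f x)"
    and t: "sgnf t" "I <= supp t" "!!f. pev f x ~= 0 ==> t f = sg (pev f x)"
    and st: "sat s \<theta>" "\<not> sat t \<theta>"
  shows "x \<in> top_of_set M frontier_of {x \<in> M. sat (point_sgn x) \<theta>}"
proof -
  have "x \<in> top_of_set M closure_of S"
    if S: "!!r. r > 0 ==> \<exists>x'\<in>S. dist x' x < r" "S <= M" for S
  proof -
    have "\<exists>y\<in>S. y \<in> T" if T: "x \<in> T" "openin (top_of_set M) T" for T
    proof -
      obtain r where r: "r > 0" "ball x r \<inter> M <= T" using T by (meson openin_contains_ball)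
      obtain x' where x': "x' \<in> S" "dist x' x < r" using S(1)[OF r(1)] by blast
      show ?thesis using x'(2) x'(1) S(2) r(2) by (auto simp: dist_commute)
    qed
    thus ?thesis using x by (auto simp: in_closure_of)
  qed
  note cl = this
  have "x \<in> top_of_set M closure_of {x \<in> M. sat (point_sgn x) \<theta>}"
  proof (rule cl)
    fix r :: real assume "r > 0"
    then obtain x' where "x' \<in> M" "dist x' x < r" "\<forall>f\<in>F. point_sgn x' f = s f"
      using near_point[OF s] by blast
    moreover from this have "sat (point_sgn x') \<theta>" using st(1) sat_cong[of \<theta> "point_sgn x'" s] \<theta> by blast
    ultimately show "\<exists>x'\<in>{x \<in> M. sat (point_sgn x) \<theta>}. dist x' x < r" by blast
  qed auto
  moreover have "x \<in> top_of_set M closure_of (M - {x \<in> M. sat (point_sgn x) \<theta>})"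
  proof (rule cl)
    fix r :: real assume "r > 0"
    then obtain x' where "x' \<in> M" "dist x' x < r" "\<forall>f\<in>F. point_sgn x' f = t f"
      using near_point[OF t] by blast
    moreover from this have "\<not> sat (point_sgn x') \<theta>" using st(2) sat_cong[of \<theta> "point_sgn x'" t] \<theta> by blast
    ultimately show "\<exists>x'\<in>M - {x \<in> M. sat (point_sgn x) \<theta>}. dist x' x < r" by blast
  qed auto
  ultimately show ?thesis by (simp add: frontier_of_closures)
qed

end

section \<open>Lifts at a point: passing through walls, and flipping signs away from walls\<close>

context crossing_at
begin

lemma slift_y:
  assumes "i < n" "sgnf s" "y i \<in> supp s" "b ~: supp s" "c \<in> {1, - 1}"
  shows "slift (\<Delta> i) c s (y i) = c * s b"
  using slifts_param[of "[i]" \<Delta> i "y i" b "\<lambda>_. c" s] assms deriv dual by simp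

lemma slifts_y:
  assumes s: "sgnf s" "supp s <= videal {p}" and ls: "set ls <= {..<n}" and e: "!!l. e l \<in> {1, - 1}" and j: "j \<in> set ls"
  shows "slifts \<Delta> ls e s (y j) = (if y j \<in> supp s then e j * s b else s (y j))"
proof (cases "y j \<in> supp s")
  case True
  have jn: "j < n" using ls j by auto
  have "slifts \<Delta> ls e s (y j) = e j * s b"
  proof (rule slifts_param[where i = j])
    show "derivation (\<Delta> l) & (l ~= j --> \<Delta> l (y j) = 0)" if "l \<in> set ls" for l
      using ls that deriv dual[OF jn] by auto
  qed (use s True b_notin e j jn dual in auto)
  thus ?thesis using True by simp
next
  case False
  thus ?thesis using slifts_notin[OF False e] by simp
qed

lemma slifts_props:
  assumes s: "sgnf s" "I <= supp s" and ls: "set ls <= {..<n}" and e: "!!l. e l \<in> {1, - 1}"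
  shows "sgnf (slifts \<Delta> ls e s)" "supp (slifts \<Delta> ls e s) = ilifts \<Delta> ls (supp s)" "I <= supp (slifts \<Delta> ls e s)"
proof -
  have d: "!!l. l \<in> set ls ==> derivation (\<Delta> l)" using ls deriv by auto
  show "sgnf (slifts \<Delta> ls e s)" by (rule slifts(1)[OF d s(1) e])
  show 1: "supp (slifts \<Delta> ls e s) = ilifts \<Delta> ls (supp s)" by (rule slifts(2)[OF d s(1) e])
  show "I <= supp (slifts \<Delta> ls e s)" unfolding 1 by (rule ilifts_I[OF s(2) ls])
qed

text \<open>On \<open>F\<close> a lift is determined by \<open>s\<close> outside its support and by
  the signs given to the parameters inside it.\<close>

lemma slifts_F_eq:
  assumes s: "sgnf s" "I <= supp s" "supp s <= videal {p}"
    and t: "sgnf t" "I <= supp t" "!!f. f ~: supp s ==> t f = s f"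
    and ls: "set ls <= {..<n}" and e: "!!l. e l \<in> {1, - 1}"
    and sy: "!!j. j < n ==> y j \<in> supp s ==> j \<in> set ls & t (y j) = e j * s b"
    and f: "f \<in> F"
  shows "slifts \<Delta> ls e s f = t f"
proof (rule sgn_F_eq_notin[OF slifts_props(1,3)[OF s(1,2) ls e] t(1,2) _ s(3) _ _ f])
  show "supp (slifts \<Delta> ls e s) <= supp s" using slifts_props(2)[OF s(1,2) ls e] ilifts_subset[of \<Delta> ls] by simp
  show "slifts \<Delta> ls e s f = t f" if "f ~: supp s" for f using slifts_notin[OF that, of e] e t(3)[OF that] by simp
  show "slifts \<Delta> ls e s (y j) = t (y j)" if "j < n" for j
  proof (cases "y j \<in> supp s")
    case True
    thus ?thesis using slifts_y[OF s(1,3) ls, of e j] e sy[OF that True] by simp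
  next
    case False
    thus ?thesis using slifts_notin[OF False, of e] e t(3)[OF False] by simp
  qed
qed

text \<open>A lift gives \<open>y j\<close> the sign \<open>e j\<close> times that of
  \<open>b\<close>, so this \<open>e j\<close> reproduces the sign of \<open>y j\<close> in
  \<open>s\<close>. Parameters outside \<open>P\<close>, whose sign no lift changes, receive the
  default 1.\<close>

definition relift_sign :: "'n pfun set => ('n pfun => int) => nat => int" where
  "relift_sign P s j = (if j < n & y j \<in> P then s (y j) * s b else 1)"

text \<open>An ordering for which \<open>P\<close> is convex is not in general recovered from its
  residue ordering, but on \<open>F\<close> it agrees with a suitable lift of it.\<close>

lemma relift:
  assumes P: "primeI P" "I <= P" "P <= videal {p}" and ls: "set ls <= {..<n}" "!!j. j < n ==> y j \<in> P ==> j \<in> set ls"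
    and s: "sgnf s" "supp s = I" "compat s P"
  shows "relift_sign P s l \<in> {1, - 1}" "sgnf (slifts \<Delta> ls (relift_sign P s) (res P s))"
    "supp (slifts \<Delta> ls (relift_sign P s) (res P s)) = ilifts \<Delta> ls P"
    "f \<in> F ==> slifts \<Delta> ls (relift_sign P s) (res P s) f = s f"
proof -
  note r = res[OF s(1) P(1) s(3)]
  have b: "b ~: P" "b ~: I" using b_notin P(3) I_sub_mp by auto
  have nz: "s f \<in> {1, - 1}" if "f ~: I" for f using that sgnfD(3)[OF s(1), of f] s(2) by (auto simp: supp_def)
  show e: "relift_sign P s l \<in> {1, - 1}" for l
    using nz[OF b(2)] nz[OF y_notin_I[of l]] by (auto simp: relift_sign_def)
  show "sgnf (slifts \<Delta> ls (relift_sign P s) (res P s))"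
    "supp (slifts \<Delta> ls (relift_sign P s) (res P s)) = ilifts \<Delta> ls P"
    using slifts_props[OF r(1) _ ls(1) e] r(2) P(2) by simp_all
  show "slifts \<Delta> ls (relift_sign P s) (res P s) f = s f" if "f \<in> F"
  proof (rule slifts_F_eq[OF r(1) _ _ s(1) _ _ ls(1) e _ that])
    show "j \<in> set ls & s (y j) = relift_sign P s j * res P s b" if "j < n" "y j \<in> supp (res P s)" for j
      using that ls(2) r(2) nz[OF b(2)] b(1) by (auto simp: relift_sign_def res_def)
  qed (use P r s(2) in "auto simp: res_def")
qed

text \<open>\<open>Q\<close> contains some member of \<open>F\<close> and hence some parameter
  \<open>y i\<close>. If \<open>\<Delta> l\<close> with another index moved \<open>Q\<close>, the
  lifted prime would still contain \<open>y i\<close> and lie strictly between \<open>I\<close> and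
  \<open>Q\<close>, giving a chain of length \<open>n + 1\<close>.\<close>

lemma wall_structure:
  assumes Q: "wall_ideal Q" "Q <= videal {p}"
  obtains i where "i < n" "y i \<in> Q" "!!l g. l < n ==> l ~= i ==> g \<in> Q ==> \<Delta> l g \<in> Q"
    "!!R C. Q \<subset> R ==> \<not> prime_chain (n - 1) R C" "dlift (\<Delta> i) Q = I"
proof -
  have Q': "primeI Q" "I \<subset> Q" "I <= Q" using Q by (auto simp: wall_ideal_def)
  obtain C where C: "prime_chain (n - 1) Q C" using Q by (auto simp: wall_ideal_def)
  obtain f where "f \<in> F" "f \<in> Q" using Q by (auto simp: wall_ideal_def)
  then obtain i where i: "i < n" "y i \<in> Q" using y_in_of_F[OF Q'(1,3) Q(2)] by blast
  have no: "\<not> (I \<subset> R & primeI R & R \<subset> R' & prime_chain (n - 1) R' C')" for R R' C'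
    using prime_chain_Cons[OF prime_I _ prime_chain_Cons[of R R' "n - 1" C']] dim_le[of "Suc (Suc (n - 1))" C'] i(1)
    by auto
  have stQ: "\<Delta> l g \<in> Q" if l: "l < n" "l ~= i" and g: "g \<in> Q" for l g
  proof -
    define R where "R = dlift (\<Delta> l) Q"
    have R: "primeI R" unfolding R_def by (rule primeI_dlift[OF deriv[OF l(1)] Q'(1)])
    have "I <= R" unfolding R_def by (rule dlift_mono_stable) (use Q' stable_I l in auto)
    thus ?thesis using dual l i y_notin_I[OF i(1)] dlift_annihilated[OF deriv[OF l(1)] Q'(1) i(2)] no[of R Q C] R C dlift_subset[of "\<Delta> l" Q] dlift_stable[of g "\<Delta> l" Q] g by (auto simp: R_def)
  qed
  have maxQ: "\<not> prime_chain (n - 1) R C" if "Q \<subset> R" for R C using no[of Q R C] Q' that by blast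
  obtain ls where ls: "set ls = {..<n} - {i}" "dlift (\<Delta> i) (ilifts \<Delta> ls Q) = I"
    using ex_divisor_list[OF Q'(1,3) Q(2) i] by metis
  have "Q <= ilifts \<Delta> ls Q" by (rule ilifts_stable_subset) (use ls(1) stQ in auto)
  thus ?thesis using ilifts_subset[of \<Delta> ls Q] that[OF i stQ maxQ] ls(2) by simp
qed

text \<open>An ordering \<open>s\<close> for which \<open>P\<close> is convex is replaced by a lift
  \<open>s'\<close> of its residue ordering that passes through the wall. Then \<open>Q\<close> is
  convex for \<open>s'\<close>, and \<open>s'\<close> agrees with \<open>s\<close> on
  \<open>F\<close>. The function \<open>g\<close> for \<open>Q\<close> is pulled back with
  \<open>slifts_lex\<close>.\<close>

lemma separated_above_wall:
  assumes P: "primeI P" "I <= P" "P <= videal {p}" and Q: "wall_ideal Q" "separated Q" "Q <= P"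
  shows "separated P"
proof -
  obtain i where i: "i < n" "y i \<in> Q" and stQ: "!!l g. l < n ==> l ~= i ==> g \<in> Q ==> \<Delta> l g \<in> Q"
    and maxQ: "!!R C. Q \<subset> R ==> \<not> prime_chain (n - 1) R C"
    using wall_structure[OF Q(1) subset_trans[OF Q(3) P(3)]] by metis
  obtain ls where ls: "set ls = {..<n} - {i}" "y i \<in> ilifts \<Delta> ls P"
    "dlift (\<Delta> i) (ilifts \<Delta> ls P) = I" "\<exists>C. prime_chain (n - 1) (ilifts \<Delta> ls P) C"
    "primeI (ilifts \<Delta> ls P)"
    using ex_divisor_list[OF P i(1)] i(2) Q(3) by (metis subsetD)
  have "Q <= ilifts \<Delta> ls P" by (rule ilifts_stable_subset[OF Q(3)]) (use ls(1) stQ in auto)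
  hence Qeq: "ilifts \<Delta> ls P = Q" using maxQ ls(4) by blast
  define ks where "ks = ls @ [i]"
  have ks: "set ks = {..<n}" "ilifts \<Delta> ks P = I" using ls(1,3) i by (auto simp: ks_def ilifts_append)
  obtain g where g: "g ~: I" "!!s. sgnf s ==> supp s = I ==> compat s Q ==>
     (sat s \<phi> --> s g = 1) & (sat s \<psi> --> s g = - 1)"
    using Q(2) unfolding separated_def by blast
  have g': "g ~: ilifts \<Delta> ks P" using g(1) ks(2) by simp
  have "derivation (\<Delta> l)" if "l \<in> set ks" for l using that ks(1) deriv by auto
  from slifts_lex[OF this P(1) g'] obtain m h where mh: "h ~: P"
      "!!s e. sgnf s ==> supp s = P ==> (\<forall>l. e l \<in> {1, - 1}) ==> slifts \<Delta> ks e s g = (\<Prod>l\<in>set ks. e l ^ m l) * s h"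
    by blast
  define IP where "IP = {j. j < n & y j \<in> P}"
  have IP: "finite IP" "IP <= {..<n}" by (auto simp: IP_def)
  \<comment> \<open>\<open>slifts_lex\<close> expresses the sign of \<open>g\<close> with factors
    \<open>e j ^ m j\<close>. As \<open>e j\<close> is the sign of \<open>y j * b\<close> for the
    parameters in \<open>P\<close>, and 1 otherwise, the factors are themselves signs of
    polynomials.\<close>
  define k where "k = (\<Prod>j\<in>IP. (y j * b) ^ m j) * h"
  have bI: "b ~: I" using b_notin I_sub_mp by blast
  have "finite X ==> X <= {..<n} ==> (\<Prod>j\<in>X. (y j * b) ^ m j) ~: I" for X
  proof (induction X rule: finite_induct)
    case empty thus ?case using primeID(2)[OF prime_I] by simp
  next
    case (insert j X)
    thus ?case using primeID(6)[OF prime_I, of "(y j * b) ^ m j"] primeID(9)[OF prime_I, of "y j * b" "m j"]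
        primeID(6)[OF prime_I, of "y j" b] y_notin_I bI by auto
  qed
  hence kI: "k ~: I" unfolding k_def using primeID(6)[OF prime_I] IP mh(1) P(2) by blast
  have key: "\<exists>s'. sgnf s' & supp s' = I & compat s' Q & (\<forall>f\<in>F. s' f = s f) & s' g = s k"
    if s: "sgnf s" "supp s = I" "compat s P" for s
  proof -
    define s' where "s' = slifts \<Delta> ks (relift_sign P s) (res P s)"
    note r = res[OF s(1) P(1) s(3)]
    have rl: "relift_sign P s l \<in> {1, - 1}" "sgnf s'" "supp s' = I" "f \<in> F ==> s' f = s f" for l f
      unfolding s'_def using relift[OF P _ _ s, of ks] ks by auto
    define s1 where "s1 = slifts \<Delta> ls (relift_sign P s) (res P s)"
    have s1: "sgnf s1" "supp s1 = Q"
      unfolding s1_def using slifts_props[OF r(1), of ls "relift_sign P s"] r(2) P(2) ls(1) rl(1) Qeq by auto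
    have "compat s' Q" by (metis compat_supp[OF s1(1)] s1(2) rl(1) s'_def s1_def ks_def slifts_append compat_slifts)
    moreover have "s' g = s k"
    proof -
      have pr: "s (\<Prod>j\<in>X. (y j * b) ^ m j) = (\<Prod>j\<in>X. (s (y j) * s b) ^ m j)" if "finite X" for X
        using that by (induction X) (auto simp: sgnfD(1,4,9)[OF s(1)])
      have "s' g = (\<Prod>l<n. relift_sign P s l ^ m l) * res P s h"
        unfolding s'_def using mh(2)[OF r(1,2)] rl(1) ks(1) by auto
      also have "(\<Prod>l<n. relift_sign P s l ^ m l) = (\<Prod>l\<in>IP. relift_sign P s l ^ m l)"
        by (rule prod.mono_neutral_right) (auto simp: IP_def relift_sign_def)
      also have "\<dots> = (\<Prod>j\<in>IP. (s (y j) * s b) ^ m j)"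
        by (intro prod.cong) (auto simp: IP_def relift_sign_def)
      finally show ?thesis using mh(1) pr[OF IP(1)] by (simp add: k_def res_def sgnfD(4)[OF s(1)])
    qed
    ultimately show ?thesis using rl(2-4) by blast
  qed
  show ?thesis
  proof (rule separatedI[OF kI])
    fix s assume s: "sgnf s" "supp s = I" "compat s P"
    obtain s' where s': "sgnf s'" "supp s' = I" "compat s' Q" "\<forall>f\<in>F. s' f = s f" "s' g = s k" using key[OF s] by blast
    have "sat s' \<phi> = sat s \<phi>" "sat s' \<psi> = sat s \<psi>" using s'(4) atoms by (auto intro!: sat_cong)
    thus "sat s \<phi> ==> s k = 1" "sat s \<psi> ==> s k = - 1" using g(2)[OF s'(1-3)] s'(5) by auto
  qed
qed

text \<open>If the sign given to \<open>y i\<close> mattered, the divisor \<open>Q\<close> of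
  \<open>y i\<close> would be a wall ideal inside \<open>P\<close>. The lifts are rearranged so that
  \<open>\<Delta> i\<close> comes last: the two orderings then arise from one ordering
  \<open>s2\<close> with support \<open>Q\<close> by stepping to its two sides.\<close>

lemma flip_sign:
  assumes P: "primeI P" "I <= P" "P <= videal {p}" and nw: "!!Q. wall_ideal Q ==> \<not> Q <= P"
    and ls: "set ls = {..<n}" and s: "sgnf s" "supp s = P" and i: "i < n" "y i \<in> P"
    and e: "!!l. e l \<in> {1, - 1}" and \<theta>: "\<theta> \<in> {\<phi>, \<psi>}"
  shows "sat (slifts \<Delta> ls e s) \<theta> = sat (slifts \<Delta> ls (e(i := - e i)) s) \<theta>"
proof (rule ccontr)
  assume ne: "sat (slifts \<Delta> ls e s) \<theta> ~= sat (slifts \<Delta> ls (e(i := - e i)) s) \<theta>"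
  have \<theta>F: "atoms \<theta> <= F" using \<theta> atoms by auto
  obtain ks where ks: "set ks = {..<n} - {i}" "y i \<in> ilifts \<Delta> ks P"
    "!!l g. l < n ==> l ~= i ==> g \<in> ilifts \<Delta> ks P ==> \<Delta> l g \<in> ilifts \<Delta> ks P"
    "dlift (\<Delta> i) (ilifts \<Delta> ks P) = I" "\<exists>C. prime_chain (n - 1) (ilifts \<Delta> ks P) C"
    "primeI (ilifts \<Delta> ks P)" "I \<subset> ilifts \<Delta> ks P" "ilifts \<Delta> ks P <= P"
    using ex_divisor_list[OF P i] by blast
  define Q where "Q = ilifts \<Delta> ks P"
  define s2 where "s2 = slifts \<Delta> ks e s"
  have s2: "sgnf s2" "supp s2 = Q"
    unfolding s2_def Q_def using slifts_props[OF s(1), of ks e] s(2) P(2) ks(1) e by auto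
  have bQ: "b ~: Q" using b_notin ks(8) P(3) by (auto simp: Q_def)
  have yQ: "y j ~: Q" if "j < n" "j ~= i" for j
    using ks(3)[of j "y j"] dual[of j j] that bQ by (auto simp: Q_def)
  have IQ: "I <= Q" using ks(7) by (auto simp: Q_def)
  define s3 where "s3 c = slift (\<Delta> i) c s2" for c
  have s3: "sgnf (s3 c)" "supp (s3 c) = I" "s3 c (y i) = c * s2 b" if "c \<in> {1, - 1}" for c
    unfolding s3_def using sgnf_slift[OF deriv[OF i(1)] s2(1) that] supp_slift[OF that, of "\<Delta> i" s2] s2(2) ks(2,4)
      slift_y[OF i(1) s2(1) _ _ that] bQ by (auto simp: Q_def)
  have s3n: "s3 c f = s2 f" if "f ~: Q" for c f unfolding s3_def by (rule slift_notin) (use that s2 in auto)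
  have ek: "e' l \<in> {1, - 1}" if "e' = e | e' = e(i := - e i)" for e' l using that e[of l] e[of i] by (cases "l = i") (auto simp: fun_upd_def)
  \<comment> \<open>On \<open>F\<close> the order of the derivations does not matter, because the
    signs of the parameters do not depend on it.\<close>
  have sl: "slifts \<Delta> ls e' s f = s3 (e' i) f" if e': "e' = e | e' = e(i := - e i)" and f: "f \<in> F" for e' f
  proof -
    have "e' l = e l" if "l \<in> set ks" for l
      using that ks(1) e' by fastforce
    hence 1: "slifts \<Delta> ks e' s = s2" unfolding s2_def by (rule slifts_cong)
    have "slifts \<Delta> (ks @ [i]) e' s = s3 (e' i)" by (simp add: slifts_append 1 s3_def)
    moreover have "slifts \<Delta> (ks @ [i]) e' s (y j) = e' j * s b" if "j < n" "y j \<in> supp s" for j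
      using slifts_y[OF s(1), of "ks @ [i]" e' j] s(2) P(3) ks(1) i(1) that ek[OF e'] by auto
    moreover have "slifts \<Delta> (ks @ [i]) e' s f = s f" if "f ~: supp s" for f
      by (rule slifts_notin[OF that ek[OF e']])
    ultimately have s3y: "j < n ==> y j \<in> supp s ==> s3 (e' i) (y j) = e' j * s b" "g ~: supp s ==> s3 (e' i) g = s g" for j g
      by simp_all
    have sub: "I <= supp s" "supp s <= videal {p}" "I <= supp (s3 (e' i))" "set ls <= {..<n}"
      using s(2) P(2,3) s3(2)[OF ek[OF e', of i]] ls by auto
    show ?thesis
      by (rule slifts_F_eq[OF s(1) sub(1,2) s3(1)[OF ek[OF e', of i]] sub(3) s3y(2) sub(4) ek[OF e'] _ f])
        (use s3y(1) ls in auto)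
  qed
  have ne3: "sat (s3 (e i)) \<theta> ~= sat (s3 (- e i)) \<theta>"
    using ne sat_cong[of \<theta> "slifts \<Delta> ls e s" "s3 (e i)"]
      sat_cong[of \<theta> "slifts \<Delta> ls (e(i := - e i)) s" "s3 (- e i)"] sl[of e] sl[of "e(i := - e i)"] \<theta>F by auto
  have FQ: "F \<inter> Q ~= {}"
  proof
    assume FQ: "F \<inter> Q = {}"
    have "s3 (e i) f = s3 (- e i) f" if "f \<in> atoms \<theta>" for f
      using that \<theta>F FQ s3n by fastforce
    thus False using ne3 sat_cong by auto
  qed
  \<comment> \<open>As \<open>Q\<close> is the support of \<open>s2\<close>, the Artin--Lang theorem
    provides enough real points on the zero set of \<open>Q\<close>; in particular \<open>Q\<close>
    is the full vanishing ideal of that set.\<close>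
  have zero: "\<exists>x\<in>vzeros Q. \<forall>h\<in>H. sg (pev h x) = s2 h" if "finite H" for H
    using artin_lang[OF s2(1) that] by (auto simp: s2(2) vzeros_def)
  have van: "videal (vzeros Q) = Q"
  proof (rule antisym)
    show "videal (vzeros Q) <= Q"
    proof
      fix f assume f: "f \<in> videal (vzeros Q)"
      obtain x where "x \<in> vzeros Q" "sg (pev f x) = s2 f" using zero[of "{f}"] by auto
      thus "f \<in> Q" using f s2(2) by (auto simp: videal_def supp_def)
    qed
  qed (auto simp: videal_def vzeros_def)
  \<comment> \<open>A function \<open>q\<close> outside \<open>Q\<close> that vanishes on the
    frontier is nonzero at a real zero \<open>x\<close> of \<open>Q\<close> imitating
    \<open>s2\<close> on the relevant finite set. Lifting \<open>x\<close> along
    \<open>\<Delta> i\<close> to both sides gives orderings that agree on \<open>F\<close> with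
    \<open>s3 1\<close> and \<open>s3 (- 1)\<close>, so \<open>x\<close> is a frontier point, a
    contradiction.\<close>
  have fr: "videal (top_of_set M frontier_of {x \<in> M. sat (point_sgn x) \<theta>}) <= Q"
  proof (rule subsetI, rule ccontr)
    fix q assume q: "q \<in> videal (top_of_set M frontier_of {x \<in> M. sat (point_sgn x) \<theta>})" "q ~: Q"
    have "\<forall>f\<in>F. \<exists>u w m. pev u p ~= 0 & pev w p ~= 0 & u * f - w * (\<Prod>j<n. y j ^ m j) \<in> I" using nc by blast
    then obtain U W m where UW: "!!f. f \<in> F ==> pev (U f) p ~= 0 & pev (W f) p ~= 0 &
        U f * f - W f * (\<Prod>j<n. y j ^ m f j) \<in> I" by metis
    have UQ: "U f ~: Q" "W f ~: Q" if "f \<in> F" for f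
      using UW[OF that] ks(8) P(3) by (auto simp: Q_def videal_def)
    obtain x where x: "x \<in> vzeros Q" "\<forall>h\<in>{q, b} \<union> y ` {..<n} \<union> U ` F \<union> W ` F. sg (pev h x) = s2 h"
      using zero[of "{q, b} \<union> y ` {..<n} \<union> U ` F \<union> W ` F"] finite_F by auto
    have xM: "x \<in> M" using x(1) IQ by (auto simp: M_eq vzeros_def)
    have qx: "pev q x ~= 0" using x(2) q(2) s2(2) by (auto simp: supp_def sg_eq_iff)
    define t where "t = point_sgn x"
    have t: "sgnf t" unfolding t_def by (rule sgnf_point)
    have Qt: "Q <= supp t" using x(1) by (auto simp: t_def supp_point vzeros_def videal_def)
    have tx: "t h = s2 h" if "h \<in> {q, b} \<union> y ` {..<n} \<union> U ` F \<union> W ` F" for h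
      using bspec[OF x(2) that] by (simp add: t_def point_sgn_def)
    have nt: "h ~: supp t" if "h \<in> {q, b} \<union> y ` {..<n} \<union> U ` F \<union> W ` F" "h ~: Q" for h
      using tx[OF that(1)] that(2) s2(2) by (auto simp: supp_def)
    define r where "r c = slift (\<Delta> i) c t" for c
    have r: "sgnf (r c)" "I <= supp (r c)" "r c (y i) = c * t b" "!!f. pev f x ~= 0 ==> r c f = sg (pev f x)"
      if c: "c \<in> {1, - 1}" for c
    proof -
      show "sgnf (r c)" unfolding r_def by (rule sgnf_slift[OF deriv[OF i(1)] t c])
      have "supp (r c) = dlift (\<Delta> i) (supp t)" unfolding r_def by (rule supp_slift[OF c])
      thus "I <= supp (r c)" using dlift_mono_stable[of I "supp t" "\<Delta> i"] stable_I i IQ Qt by auto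
      show "r c (y i) = c * t b" unfolding r_def
        using slift_y[OF i(1) t _ _ c] Qt ks(2) nt[of b] bQ by (auto simp: Q_def)
      show "r c f = sg (pev f x)" if "pev f x ~= 0" for f
        using slift_notin[of f t "\<Delta> i" c] that by (auto simp: r_def t_def supp_point videal_def point_sgn_def)
    qed
    have rF: "r c f = s3 c f" if c: "c \<in> {1, - 1}" and f: "f \<in> F" for c f
    proof (rule sgn_F_eq[OF r(1,2)[OF c] s3(1)[OF c] _ _ _ f])
      show "I <= supp (s3 c)" using s3(2)[OF c] by simp
      show "r c (y j) = s3 c (y j)" if "j < n" for j
      proof (cases "j = i")
        case True
        thus ?thesis using r(3)[OF c] s3(3)[OF c] tx[of b] by simp
      next
        case False
        have yj: "y j \<in> {q, b} \<union> y ` {..<n} \<union> U ` F \<union> W ` F" using that by auto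
        have "r c (y j) = t (y j)" unfolding r_def by (rule slift_notin[OF nt[OF yj yQ[OF that False]]])
        thus ?thesis using tx[OF yj] s3n[OF yQ[OF that False]] by simp
      qed
      fix g assume g: "g \<in> F"
      have UWg: "U g \<in> {q, b} \<union> y ` {..<n} \<union> U ` F \<union> W ` F" "W g \<in> {q, b} \<union> y ` {..<n} \<union> U ` F \<union> W ` F"
        using g by auto
      have "t (U g) ~= 0" using nt[OF UWg(1) UQ(1)[OF g]] by (simp add: supp_def)
      hence "r c (U g) = s3 c (U g) & r c (U g) ~= 0 & r c (W g) = s3 c (W g)" using tx[OF UWg(1)] tx[OF UWg(2)] s3n[OF UQ(1)[OF g]] s3n[OF UQ(2)[OF g]] slift_notin[OF nt[OF UWg(1) UQ(1)[OF g]]] slift_notin[OF nt[OF UWg(2) UQ(2)[OF g]]] by (auto simp: r_def)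
      thus "\<exists>u w m. u * g - w * (\<Prod>j<n. y j ^ m j) \<in> I & r c u = s3 c u & r c u ~= 0 & r c w = s3 c w"
        using UW[OF g] by blast
    qed
    have c: "e i \<in> {1, - 1}" "- e i \<in> {1, - 1}" using e[of i] by auto
    have sr: "sat (r (e i)) \<theta> = sat (s3 (e i)) \<theta>" "sat (r (- e i)) \<theta> = sat (s3 (- e i)) \<theta>"
      by (rule sat_cong, use rF c \<theta>F in blast)+
    have "x \<in> top_of_set M frontier_of {x \<in> M. sat (point_sgn x) \<theta>}"
      using in_frontier[OF xM \<theta>F r(1,2,4)[OF c(1)] r(1,2,4)[OF c(2)]] sr ne3 in_frontier[OF xM \<theta>F r(1,2,4)[OF c(2)] r(1,2,4)[OF c(1)]] by auto
    thus False using q(1) qx by (auto simp: videal_def)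
  qed
  have "wall_ideal Q" unfolding wall_ideal_def
    using ks(5-7) van FQ fr \<theta> unfolding Q_def by blast
  thus False using nw ks(8) by (auto simp: Q_def)
qed

text \<open>One flip at a time over the parameters in \<open>P\<close>; those outside
  \<open>P\<close> keep their sign under every lift.\<close>

lemma sign_independent:
  assumes P: "primeI P" "I <= P" "P <= videal {p}" and nw: "!!Q. wall_ideal Q ==> \<not> Q <= P"
    and ls: "set ls = {..<n}" and s: "sgnf s" "supp s = P"
    and e: "!!l. e l \<in> {1, - 1}" "!!l. e' l \<in> {1, - 1}" and \<theta>: "\<theta> \<in> {\<phi>, \<psi>}"
  shows "sat (slifts \<Delta> ls e s) \<theta> = sat (slifts \<Delta> ls e' s) \<theta>"
proof -
  define IP where "IP = {j. j < n & y j \<in> P}"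
  have \<theta>F: "atoms \<theta> <= F" using \<theta> atoms by auto
  have step: "X <= IP ==> sat (slifts \<Delta> ls (override_on e e' X) s) \<theta> = sat (slifts \<Delta> ls e s) \<theta>" if "finite X" for X
    using that
  proof (induction X rule: finite_induct)
    case (insert i X)
    define d where "d = override_on e e' X"
    have d: "d l \<in> {1, - 1}" for l using e by (auto simp: d_def override_on_def)
    have "override_on e e' (insert i X) = d | override_on e e' (insert i X) = d(i := - d i)"
      using e(2)[of i] d[of i] by (auto simp: d_def override_on_def)
    moreover have "sat (slifts \<Delta> ls d s) \<theta> = sat (slifts \<Delta> ls (d(i := - d i)) s) \<theta>"
      by (rule flip_sign[OF P nw ls s _ _ d \<theta>]) (use insert.prems in "auto simp: IP_def")
    ultimately have "sat (slifts \<Delta> ls (override_on e e' (insert i X)) s) \<theta> = sat (slifts \<Delta> ls d s) \<theta>" by metis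
    thus ?case using insert by (simp only: d_def insert_subset)
  qed simp
  define d where "d = override_on e e' IP"
  have d: "d l \<in> {1, - 1}" for l using e by (auto simp: d_def override_on_def)
  have sub: "set ls <= {..<n}" "I <= supp s" "supp s <= videal {p}" using ls P s by auto
  have "slifts \<Delta> ls d s f = slifts \<Delta> ls e' s f" if "f \<in> F" for f
  proof (rule slifts_F_eq[OF s(1) sub(2,3) slifts_props(1,3)[OF s(1) sub(2,1) e(2)] _ sub(1) d _ that])
    show "slifts \<Delta> ls e' s f = s f" if "f ~: supp s" for f by (rule slifts_notin[OF that e(2)])
    show "j \<in> set ls & slifts \<Delta> ls e' s (y j) = d j * s b" if j: "j < n" "y j \<in> supp s" for j
    proof -
      have jl: "j \<in> set ls" using j ls by simp
      show ?thesis using j s(2) slifts_y[OF s(1) sub(3) sub(1) e(2) jl] jl by (auto simp: d_def override_on_def IP_def)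
    qed
  qed
  hence "sat (slifts \<Delta> ls d s) \<theta> = sat (slifts \<Delta> ls e' s) \<theta>" by (intro sat_cong) (use \<theta>F in auto)
  thus ?thesis using step by (auto simp: d_def IP_def)
qed

end

subsection \<open>Semiorderings\<close>

lemma primeI_minus_one: "primeI P ==> - 1 ~: P"
  using primeID(2)[of P] primeID(7)[of P "- 1"] by auto

lemma real_sq: "c >= 0 ==> of_real c = (of_real (sqrt c) * of_real (sqrt c) :: 'r::real_algebra_1)"
  by (simp flip: of_real_mult)

text \<open>The pull-back of a semiordering of the residue field of \<open>P\<close>: closed under
  multiplication by squares, with no condition on products. The last assumption bounds polynomial
  functions by real constants and will come from compactness of \<open>M\<close>.\<close>

locale semiord =
  fixes S P :: "'n::finite pfun set"
  assumes P: "primeI P" and add: "a \<in> S ==> c \<in> S ==> a + c \<in> S" and sq: "a \<in> S ==> d * d * a \<in> S"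
    and one: "1 \<in> S" and total: "a \<in> S | - a \<in> S" and inter: "a \<in> S ==> - a \<in> S ==> a \<in> P"
    and PS: "P <= S" and cancel: "d ~: P ==> d * d * a \<in> S ==> a \<in> S"
    and bdd: "\<exists>c. of_real c - h * h \<in> S"
begin

lemma square: "a * a \<in> S"
  using sq[OF one, of a] by simp

lemma scale: "c >= 0 ==> a \<in> S ==> of_real c * a \<in> S"
  using sq[of a "of_real (sqrt c)"] real_sq[of c, where 'r = "'n pfun"] by simp

lemma halve: "2 * a \<in> S ==> a \<in> S"
  using scale[of "1 / 2" "2 * a"] of_real_mult[of "1 / 2" 2, where 'a = "'n pfun"] by (simp flip: mult.assoc)

lemma const: "c >= 0 ==> of_real c \<in> S"
  using scale[OF _ one] by simp

lemma const_iff: "of_real c \<in> S \<longleftrightarrow> c >= 0"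
proof
  assume c: "of_real c \<in> S"
  show "c >= 0"
  proof (rule ccontr)
    assume n: "\<not> c >= 0"
    hence "of_real (- c) \<in> S" by (intro const) simp
    thus False using inter[OF c] primeI_const[OF P, of c] n by simp
  qed
qed (rule const)

text \<open>Comparison in the natural valuation: \<open>a / d\<close> is bounded by a real constant.
  Squares are compared because only multiplication by squares preserves \<open>S\<close>.\<close>

definition le :: "'n pfun => 'n pfun => bool" where
  "le a d \<longleftrightarrow> (\<exists>c>0. of_real c * (d * d) - a * a \<in> S)"

lemma leI: "of_real c * (d * d) - a * a \<in> S ==> le a d"
proof -
  assume h: "of_real c * (d * d) - a * a \<in> S"
  have "of_real (\<bar>c\<bar> + 1 - c) * (d * d) + (of_real c * (d * d) - a * a) \<in> S"
    by (rule add[OF scale[OF _ square] h]) simp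
  hence "of_real (\<bar>c\<bar> + 1) * (d * d) - a * a \<in> S" by (simp add: algebra_simps)
  thus "le a d" unfolding le_def by (intro exI[of _ "\<bar>c\<bar> + 1"]) simp
qed

lemma le_refl: "le a a"
  by (rule leI[of 1]) (use const[of 0] in simp)

lemma le_total: "le a d | le d a"
  using total[of "d * d - a * a"] leI[of 1 d a] leI[of 1 a d] by auto

lemma le_trans: assumes "le a d" "le d f" shows "le a f"
proof -
  obtain c c' where c: "c > 0" "of_real c * (d * d) - a * a \<in> S" "of_real c' * (f * f) - d * d \<in> S"
    using assms by (auto simp: le_def)
  have "of_real c * (of_real c' * (f * f) - d * d) + (of_real c * (d * d) - a * a) \<in> S"
    by (rule add[OF scale]) (use c in auto)
  thus ?thesis by (intro leI[of "c * c'"]) (simp add: algebra_simps)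
qed

lemma le_mult: assumes "le a d" "le a' d'" shows "le (a * a') (d * d')"
proof -
  obtain c c' where c: "c > 0" "of_real c * (d * d) - a * a \<in> S" "of_real c' * (d' * d') - a' * a' \<in> S"
    using assms by (auto simp: le_def)
  \<comment> \<open>Each summand is a nonnegative constant and a square times an element of
    \<open>S\<close>; the mixed terms cancel and leave
    \<open>c * c' * (d * d')^2 - (a * a')^2\<close>.\<close>
  have "of_real c * (d * d * (of_real c' * (d' * d') - a' * a')) + a' * a' * (of_real c * (d * d) - a * a) \<in> S"
    by (intro add scale sq) (use c in auto)
  thus ?thesis by (intro leI[of "c * c'"]) (simp add: algebra_simps)
qed

lemma le_power: "le a d ==> le (a ^ k) (d ^ k)"
  by (induction k) (auto simp: le_refl le_mult)

lemma le_add: assumes "le a d" "le a' d" shows "le (a + a') d"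
proof -
  obtain c c' where c: "of_real c * (d * d) - a * a \<in> S" "of_real c' * (d * d) - a' * a' \<in> S"
    using assms by (auto simp: le_def)
  have "of_real 2 * (of_real c * (d * d) - a * a) + of_real 2 * (of_real c' * (d * d) - a' * a') + (a - a') * (a - a') \<in> S"
    by (intro add scale square) (use c in auto)
  thus ?thesis by (intro leI[of "2 * (c + c')"]) (simp add: algebra_simps)
qed

lemma le_one: "le a 1"
  using bdd[of a] by (auto intro: leI)

lemma le_mult_left: "le a d ==> le (r * a) d"
  using le_mult[OF le_one[of r]] by simp

lemma le_cancel: assumes "z ~: P" "le (z * a) (z * d)" shows "le a d"
proof -
  obtain c where "of_real c * (z * d * (z * d)) - z * a * (z * a) \<in> S" using assms by (auto simp: le_def)
  hence "z * z * (of_real c * (d * d) - a * a) \<in> S" by (simp add: algebra_simps)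
  thus ?thesis using cancel[OF assms(1)] leI by blast
qed

lemma le_P: "a \<in> P ==> le a d"
  using PS primeID(5,7)[OF P] by (auto intro!: leI[of 0])

lemma le_in_P: assumes "le a d" "d \<in> P" shows "a \<in> P"
proof -
  obtain c where c: "of_real c * (d * d) - a * a \<in> S" using assms by (auto simp: le_def)
  have "- (of_real c * (d * d)) \<in> S" using assms(2) PS primeID(4,7)[OF P] by blast
  hence "of_real c * (d * d) - a * a + - (of_real c * (d * d)) \<in> S" by (rule add[OF c])
  thus ?thesis using inter[OF square] primeID(6)[OF P] by auto
qed

text \<open>The infinitely small elements, again expressed with squares.\<close>

definition infi :: "'n pfun set" where
  "infi = {h. \<forall>c>0. 1 - of_real c * (h * h) \<in> S}"

lemma infi_le: assumes "le a z" "z \<in> infi" shows "a \<in> infi"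
  unfolding infi_def
proof (intro CollectI allI impI)
  fix c :: real assume c: "c > 0"
  obtain c' where c': "c' > 0" "of_real c' * (z * z) - a * a \<in> S" using assms by (auto simp: le_def)
  have "of_real c * (of_real c' * (z * z) - a * a) + (1 - of_real (c * c') * (z * z)) \<in> S"
    by (intro add scale) (use c c' assms(2) in "auto simp: infi_def simp del: of_real_mult")
  thus "1 - of_real c * (a * a) \<in> S" by (simp add: algebra_simps)
qed

lemma infi_mult: "h \<in> infi ==> r * h \<in> infi"
  by (rule infi_le[OF le_mult_left[OF le_refl]])

lemma infi_add: assumes "h \<in> infi" "h' \<in> infi" shows "h + h' \<in> infi"
  unfolding infi_def
proof (intro CollectI allI impI)
  fix c :: real assume c: "c > 0"
  have "(1 - of_real (4 * c) * (h * h)) + (1 - of_real (4 * c) * (h' * h')) + of_real (2 * c) * ((h - h') * (h - h')) \<in> S"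
    by (intro add scale square) (use c assms in "auto simp: infi_def simp del: of_real_mult")
  thus "1 - of_real c * ((h + h') * (h + h')) \<in> S" using halve by (simp add: algebra_simps)
qed

lemma not_le_infi: assumes "z \<in> infi" shows "\<not> le 1 z"
proof
  assume "le 1 z"
  then obtain c where c: "c > 0" "of_real c * (z * z) - 1 \<in> S" by (auto simp: le_def)
  have "(of_real c * (z * z) - 1) + (1 - of_real (2 * c) * (z * z)) \<in> S"
    by (rule add[OF c(2)]) (use assms c in "auto simp: infi_def simp del: of_real_mult")
  hence "- (of_real c * (z * z)) \<in> S" by (simp add: algebra_simps)
  thus False using le_in_P[OF \<open>le 1 z\<close>] primeID(2)[OF P] by (smt (verit) inter[OF scale[OF _ square]] c primeI_const[OF P, of c] primeID(6)[OF P])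
qed

lemma infi_0: "0 \<in> infi"
  by (simp add: infi_def one)

lemma P_infi: "P <= infi"
  using infi_le[OF le_P infi_0] by blast

text \<open>The standard part is the supremum of the real constants below \<open>h\<close>.\<close>

lemma standard_part: "\<exists>r. h - of_real r \<in> infi"
proof -
  define X where "X = {r. h - of_real r \<in> S}"
  obtain c where c: "of_real c - h * h \<in> S" using bdd by blast
  have "(of_real c - h * h) + (1 + h) * (1 + h) \<in> S" by (rule add[OF c square])
  moreover have "(of_real c - h * h) + (1 + h) * (1 + h) = 2 * (h + of_real ((c + 1) / 2))"
  proof -
    have "2 * (of_real ((c + 1) / 2) :: 'n pfun) = of_real (2 * ((c + 1) / 2))" by (simp only: of_real_mult) simp
    also have "\<dots> = of_real c + 1" by simp
    finally show ?thesis by (simp add: algebra_simps)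
  qed
  ultimately have "h + of_real ((c + 1) / 2) \<in> S" using halve by metis
  hence ne: "X ~= {}" by (auto simp: X_def intro!: exI[of _ "- ((c + 1) / 2)"])
  have ub: "r <= (c + 1) / 2" if "r \<in> X" for r
  proof -
    have "(of_real c - h * h) + (1 - h) * (1 - h) + of_real 2 * (h - of_real r) \<in> S"
      by (intro add scale square c) (use that in "auto simp: X_def")
    hence "of_real (c + 1 - 2 * r) \<in> S" by (simp add: algebra_simps)
    thus ?thesis unfolding const_iff by simp
  qed
  hence bd: "bdd_above X" by (meson bdd_aboveI)
  define r where "r = Sup X"
  define d where "d = h - of_real r"
  have up: "of_real \<epsilon> + d \<in> S" if e: "\<epsilon> > 0" for \<epsilon>
  proof -
    obtain r' where r': "r' \<in> X" "r - \<epsilon> < r'" using less_cSup_iff[OF ne bd, of "r - \<epsilon>"] e by (auto simp: r_def)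
    have "(h - of_real r') + of_real (r' - r + \<epsilon>) \<in> S"
      by (rule add[OF _ const]) (use r' in "auto simp: X_def")
    thus ?thesis by (simp add: d_def algebra_simps)
  qed
  have dn: "of_real \<epsilon> - d \<in> S" if "\<epsilon> > 0" for \<epsilon>
    using cSup_upper[OF _ bd, of "r + \<epsilon>"] that total[of "h - of_real (r + \<epsilon>)"] by (auto simp: r_def X_def d_def algebra_simps)
  have "1 - of_real c * (d * d) \<in> S" if c: "c > 0" for c
  proof -
    define \<epsilon> where "\<epsilon> = 1 / sqrt c"
    have \<epsilon>: "\<epsilon> > 0" "c * (\<epsilon> * \<epsilon>) = 1" using c by (auto simp: \<epsilon>_def field_simps)
    define E :: "'n pfun" where "E = of_real \<epsilon>"
    \<comment> \<open>\<open>E + d\<close> and \<open>E - d\<close> lie in \<open>S\<close>, but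
      their product need not. This combination with squares as weights equals
      \<open>2 * E * (E^2 - d^2)\<close>.\<close>
    have "(E + d) * (E + d) * (E - d) + (E - d) * (E - d) * (E + d) \<in> S"
      unfolding E_def by (intro add sq up dn \<epsilon>)
    hence 1: "of_real (2 * \<epsilon>) * (E * E - d * d) \<in> S" by (auto simp: E_def[symmetric] algebra_simps)
    have "of_real (c / (2 * \<epsilon>)) * (of_real (2 * \<epsilon>) * (E * E - d * d)) \<in> S"
      by (rule scale[OF _ 1]) (use c \<epsilon> in auto)
    moreover have "of_real (c / (2 * \<epsilon>)) * (of_real (2 * \<epsilon>) * (E * E - d * d)) = of_real c * (E * E - d * d)"
      using \<epsilon>(1) by (simp only: mult.assoc[symmetric] of_real_mult[symmetric]) simp
    moreover have "of_real c * (E * E) = (1 :: 'n pfun)"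
      using \<epsilon>(2) by (simp add: E_def flip: of_real_mult)
    ultimately show ?thesis by (simp add: right_diff_distrib)
  qed
  thus ?thesis by (auto simp: infi_def d_def)
qed

text \<open>The coordinates of \<open>x\<close> are the standard parts of the variables; every
  polynomial then differs from its value at \<open>x\<close> by an infinitely small element.\<close>

lemma infi_point: "\<exists>x. infi = videal {x}"
proof -
  have "\<forall>i. \<exists>r. pvar i - of_real r \<in> infi" using standard_part by blast
  from choice[OF this] obtain c where c: "!!i. pvar i - of_real (c i) \<in> infi" by blast
  define x where "x = (\<chi> i. c i)"
  have key: "f - of_real (pev f x) \<in> infi" for f
  proof (induction f rule: pfun_induct)
    case (var i) thus ?case using c[of i] by (simp add: x_def)
  next
    case (add f g) thus ?case using infi_add[OF add] by (simp add: algebra_simps)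
  next
    case (mult f g)
    have "f * (g - of_real (pev g x)) + of_real (pev g x) * (f - of_real (pev f x)) \<in> infi"
      by (intro infi_add infi_mult mult)
    thus ?case by (simp add: algebra_simps)
  qed (simp add: infi_0)
  have "f \<in> infi \<longleftrightarrow> pev f x = 0" for f
  proof
    assume f: "f \<in> infi"
    show "pev f x = 0"
    proof (rule ccontr)
      assume nz: "pev f x ~= 0"
      have "of_real (inverse (pev f x)) * (f + (- 1) * (f - of_real (pev f x))) = 1"
        using nz by (simp flip: of_real_mult)
      hence "1 \<in> infi" by (metis infi_mult infi_add f key)
      thus False using not_le_infi le_refl by blast
    qed
  qed (use key[of f] in simp)
  thus ?thesis by (auto simp: videal_def)
qed

text \<open>For \<open>z\<close> infinitely small and outside \<open>P\<close> this is the largest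
  prime ideal that is convex for the valuation and omits \<open>z\<close>.\<close>

definition qz :: "'n pfun => 'n pfun set" where
  "qz z = {h. \<forall>k. le h (z ^ k)}"

lemma prime_qz:
  assumes z: "z \<in> infi" "z ~: P"
  shows "primeI (qz z)"
proof -
  have zk: "z ^ k ~: P" for k using z primeID(9)[OF P] by blast
  show ?thesis unfolding primeI_def
  proof (intro conjI allI ballI impI)
    show "0 \<in> qz z" by (simp add: qz_def le_P primeID(1)[OF P])
    show "1 ~: qz z" using not_le_infi[OF z(1)] by (auto simp: qz_def intro!: exI[of _ 1])
    show "x + w \<in> qz z" if "x \<in> qz z" "w \<in> qz z" for x w using that by (auto simp: qz_def le_add)
    show "x * w \<in> qz z" if "w \<in> qz z" for x w using that by (auto simp: qz_def le_mult_left)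
    show "x \<in> qz z | w \<in> qz z" if xw: "x * w \<in> qz z" for x w
    proof (rule ccontr)
      assume "\<not> (x \<in> qz z | w \<in> qz z)"
      then obtain k l where "\<not> le x (z ^ k)" "\<not> le w (z ^ l)" by (auto simp: qz_def)
      hence "le (z ^ k * z ^ l) (x * w)" using le_total by (auto intro!: le_mult)
      moreover have "le (x * w) (z ^ k * z ^ l * z)"
      proof -
        have "le (x * w) (z ^ (k + l + 1))" using xw unfolding qz_def by blast
        thus ?thesis by (simp add: power_add mult.commute)
      qed
      ultimately have "le (z ^ k * z ^ l * 1) (z ^ k * z ^ l * z)" using le_trans by simp
      hence "le 1 z" by (rule le_cancel[rotated]) (use zk primeID(6)[OF P] in blast)
      thus False using not_le_infi[OF z(1)] by blast
    qed
  qed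
qed

text \<open>\<open>z\<close> is chosen so that the chain above \<open>qz z\<close> is as long as
  possible. Any \<open>w\<close> in \<open>qz z\<close> outside \<open>P\<close> would give the
  smaller prime \<open>qz w\<close>, which omits \<open>w\<close>, and a longer chain.\<close>

lemma ex_qz:
  assumes "P ~= infi"
  obtains z where "z \<in> infi" "z ~: P" "qz z = P"
proof -
  obtain z0 where z0: "z0 \<in> infi" "z0 ~: P" using assms P_infi by blast
  have sub: "P <= qz z" for z by (auto simp: qz_def le_P)
  define K where "K k \<longleftrightarrow> (\<exists>z C. z \<in> infi & z ~: P & prime_chain k (qz z) C)" for k
  have "K 0" unfolding K_def using prime_chain_refl[OF prime_qz[OF z0]] z0 by blast
  moreover have "K k ==> k <= CARD('n)" for k unfolding K_def using prime_chain_bound by blast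
  ultimately obtain k where k: "K k" "!!k'. K k' ==> k' <= k"
    using GreatestI_nat[of K 0] Greatest_le_nat[of K _ "CARD('n)"] by metis
  obtain z C where z: "z \<in> infi" "z ~: P" "prime_chain k (qz z) C" using k(1) by (auto simp: K_def)
  have "qz z = P"
  proof (rule ccontr)
    assume "qz z ~= P"
    then obtain w where w: "w \<in> qz z" "w ~: P" using sub by blast
    have wz: "le w z" using w(1) by (auto simp: qz_def dest: spec[of _ 1])
    have wi: "w \<in> infi" using infi_le[OF wz z(1)] .
    have "qz w <= qz z"
    proof
      fix h assume "h \<in> qz w"
      thus "h \<in> qz z" using w(1) le_trans by (auto simp: qz_def dest: spec[of _ 1])
    qed
    moreover have "w ~: qz w"
    proof
      assume "w \<in> qz w"
      thus False using le_cancel[OF w(2)] not_le_infi[OF wi] by (auto simp: qz_def power2_eq_square dest: spec[of _ 2])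
    qed
    ultimately have "qz w \<subset> qz z" using w(1) by blast
    thus False using prime_chain_Cons[OF prime_qz[OF wi w(2)] _ z(3)] wi w(2) k(2) by (fastforce simp: K_def)
  qed
  thus ?thesis using that z by blast
qed

text \<open>For the same \<open>z\<close> this is the smallest convex prime ideal that contains
  \<open>z\<close>, and hence the next one above \<open>qz z\<close>.\<close>

definition rz :: "'n pfun => 'n pfun set" where
  "rz z = {h. \<exists>k. le (h ^ k) z}"

lemma prime_rz:
  assumes z: "z \<in> infi" "z ~: P"
  shows "primeI (rz z)" "P \<subset> rz z" "rz z <= infi"
proof -
  show "primeI (rz z)" unfolding primeI_def
  proof (intro conjI allI ballI impI)
    show "0 \<in> rz z" by (auto simp: rz_def le_P primeID(1)[OF P] intro!: exI[of _ 1])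
    show "1 ~: rz z" using not_le_infi[OF z(1)] by (simp add: rz_def)
    show "x + w \<in> rz z" if xw: "x \<in> rz z" "w \<in> rz z" for x w
    proof -
      obtain k l where kl: "le (x ^ k) z" "le (w ^ l) z" using xw by (auto simp: rz_def)
      show ?thesis
      proof (cases "le x w")
        case True
        hence "le ((x + w) ^ l) (w ^ l)" by (intro le_power le_add le_refl)
        thus ?thesis using kl le_trans by (auto simp: rz_def)
      next
        case False
        hence "le ((x + w) ^ k) (x ^ k)" using le_total by (auto intro!: le_power le_add)
        thus ?thesis using kl le_trans by (auto simp: rz_def)
      qed
    qed
    show "x * w \<in> rz z" if "w \<in> rz z" for x w
      using that by (auto simp: rz_def power_mult_distrib intro: le_mult_left)
    show "x \<in> rz z | w \<in> rz z" if "x * w \<in> rz z" for x w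
    proof (rule ccontr)
      assume "\<not> (x \<in> rz z | w \<in> rz z)"
      hence n: "le z (x ^ k)" "le z (w ^ k)" for k using le_total by (auto simp: rz_def)
      obtain k where "le ((x * w) ^ k) z" using \<open>x * w \<in> rz z\<close> by (auto simp: rz_def)
      \<comment> \<open>The exponent 3 exceeds the two lower bounds by \<open>z\<close> for powers
        of \<open>x\<close> and \<open>w\<close>: together they would make \<open>z * z\<close>
        bounded by \<open>z ^ 3\<close>, impossible for infinitely small \<open>z\<close> outside
        \<open>P\<close>.\<close>
      hence "le (((x * w) ^ k) ^ 3) (z ^ 3)" by (rule le_power)
      moreover have "((x * w) ^ k) ^ 3 = x ^ (3 * k) * w ^ (3 * k)"
        by (simp add: power_mult_distrib flip: power_mult) (simp add: mult.commute)
      moreover have "le (z * z) (x ^ (3 * k) * w ^ (3 * k))" by (rule le_mult[OF n])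
      ultimately have "le (z * z) (z ^ 3)" using le_trans by metis
      thus False using z primeID(6)[OF P] not_le_infi[OF z(1)] by (fastforce simp: power3_eq_cube intro: le_cancel[rotated])
    qed
  qed
  have "P <= rz z" by (auto simp: rz_def le_P intro!: exI[of _ 1])
  thus "P \<subset> rz z" using z by (auto simp: rz_def le_refl intro!: exI[of _ 1])
  show "rz z <= infi"
  proof
    fix h assume "h \<in> rz z"
    then obtain k where "le (h ^ k) z" by (auto simp: rz_def)
    hence "h ^ k \<in> infi" using infi_le z by blast
    moreover obtain x where "infi = videal {x}" using infi_point by blast
    ultimately show "h \<in> infi" using primeID(9)[OF primeI_point[of x]] by blast
  qed
qed

text \<open>The weighted combination equals \<open>2 * e * (e^2 - a^2)\<close>; the factor
  \<open>e\<close> is the square of an element outside \<open>P\<close> and can be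
  cancelled.\<close>

lemma le_of_abs:
  assumes "d * d + a \<in> S" "d * d - a \<in> S" "d ~: P"
  shows "le a (d * d)"
proof -
  define e where "e = d * d"
  have "(e + a) * (e + a) * (e - a) + (e - a) * (e - a) * (e + a) \<in> S"
    unfolding e_def by (intro add sq assms)
  hence "of_real 2 * (e * e - a * a) \<in> S" using cancel[OF assms(3)] by (auto simp: e_def algebra_simps)
  thus ?thesis using halve leI[of 1] by (auto simp: e_def)
qed

end

text \<open>Zorn's lemma for sets that contain \<open>C\<close>, are closed under addition and
  multiplication by \<open>T\<close>, and contain no \<open>- (d * d)\<close> with \<open>d\<close>
  outside \<open>P\<close>. A maximal one is a semiordering.\<close>

lemma semiordering_exists:
  fixes P T C :: "'r::{comm_ring_1,real_algebra_1} set"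
  assumes P: "primeI P"
    and T: "!!a c. a \<in> T ==> c \<in> T ==> a + c \<in> T" "!!a c. a \<in> T ==> c \<in> T ==> a * c \<in> T" "!!a. a * a \<in> T"
    and C: "!!a c. a \<in> C ==> c \<in> C ==> a + c \<in> C" "!!t c. t \<in> T ==> c \<in> C ==> t * c \<in> C" "P <= C" "T <= C"
      "!!d. d ~: P ==> - (d * d) ~: C"
  obtains S where "C <= S" "!!a c. a \<in> S ==> c \<in> S ==> a + c \<in> S" "!!d a. a \<in> S ==> d * d * a \<in> S"
    "!!a. a \<in> S | - a \<in> S" "!!a. a \<in> S ==> - a \<in> S ==> a \<in> P" "!!d a. d ~: P ==> d * d * a \<in> S ==> a \<in> S"
proof -
  define \<A> where "\<A> = {S. C <= S & (\<forall>a\<in>S. \<forall>c\<in>S. a + c \<in> S) & (\<forall>t\<in>T. \<forall>c\<in>S. t * c \<in> S) & (\<forall>d. d ~: P --> - (d * d) ~: S)}"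
  have "C \<in> \<A>" using C by (auto simp: \<A>_def)
  moreover have "\<Union>\<C> \<in> \<A>" if ne: "\<C> ~= {}" and ch: "subset.chain \<A> \<C>" for \<C>
  proof -
    have sub: "S \<in> \<A>" if "S \<in> \<C>" for S using ch that by (auto simp: subset.chain_def)
    have lin: "S <= S' | S' <= S" if "S \<in> \<C>" "S' \<in> \<C>" for S S' using ch that by (auto simp: subset.chain_def)
    have "a + c \<in> \<Union>\<C>" if ac: "a \<in> \<Union>\<C>" "c \<in> \<Union>\<C>" for a c
    proof -
      obtain S S' where S: "S \<in> \<C>" "S' \<in> \<C>" "a \<in> S" "c \<in> S'" using ac by blast
      define U where "U = (if S <= S' then S' else S)"
      have U: "U \<in> \<C>" "a \<in> U" "c \<in> U" using S lin[of S S'] by (auto simp: U_def)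
      thus ?thesis using sub[OF U(1)] by (auto simp: \<A>_def)
    qed
    moreover have "C <= \<Union>\<C>" using ne sub by (fastforce simp: \<A>_def)
    moreover have "t * c \<in> \<Union>\<C>" if "t \<in> T" "c \<in> \<Union>\<C>" for t c using that sub by (fastforce simp: \<A>_def)
    moreover have "- (d * d) ~: \<Union>\<C>" if "d ~: P" for d using that sub by (fastforce simp: \<A>_def)
    ultimately show ?thesis by (simp add: \<A>_def)
  qed
  ultimately obtain S where SA: "S \<in> \<A>" and max: "!!X. X \<in> \<A> ==> S <= X ==> X = S"
    using subset_Zorn_nonempty[of \<A>] by blast
  have S: "C <= S" "!!a c. a \<in> S ==> c \<in> S ==> a + c \<in> S" "!!t c. t \<in> T ==> c \<in> S ==> t * c \<in> S"
    "!!d. d ~: P ==> - (d * d) ~: S" using SA by (auto simp: \<A>_def)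
  have T0: "0 \<in> T" using T(3)[of 0] by simp
  have S0: "0 \<in> S" using T0 C(4) S(1) by blast
  have canc: "a \<in> S" if d: "d ~: P" "d * d * a \<in> S" for d a
  proof -
    \<comment> \<open>The saturation of \<open>S\<close> under cancelling squares is again
      admissible, hence equal to \<open>S\<close>.\<close>
    define X where "X = {a. \<exists>d. d ~: P & d * d * a \<in> S}"
    have "X \<in> \<A>" unfolding \<A>_def
    proof (intro CollectI conjI ballI allI impI)
      show "C <= X" using S(1) primeID(2)[OF P] by (auto simp: X_def intro!: exI[of _ 1])
      fix a c assume "a \<in> X" "c \<in> X"
      then obtain d e where de: "d ~: P" "e ~: P" "d * d * a \<in> S" "e * e * c \<in> S" by (auto simp: X_def)
      have "e * e * (d * d * a) + d * d * (e * e * c) \<in> S" by (intro S(2,3) T(3) de)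
      thus "a + c \<in> X" using de primeID(6)[OF P] by (fastforce simp: algebra_simps X_def)
    next
      fix t c assume "t \<in> T" "c \<in> X"
      then obtain d where d: "d ~: P" "d * d * c \<in> S" by (auto simp: X_def)
      show "t * c \<in> X" using S(3)[OF \<open>t \<in> T\<close> d(2)] d by (auto simp: algebra_simps X_def)
    next
      fix f assume f: "f ~: P"
      show "- (f * f) ~: X"
        using f primeID(6)[OF P] S(4) by (fastforce simp: X_def algebra_simps)
    qed
    moreover have "S <= X" using primeID(2)[OF P] by (auto simp: X_def intro!: exI[of _ 1])
    ultimately have "X = S" using max by blast
    thus ?thesis using d by (auto simp: X_def)
  qed
  have int: "a \<in> P" if a: "a \<in> S" "- a \<in> S" for a
  proof -
    \<comment> \<open>Squares weight \<open>a\<close> and \<open>- a\<close> so that the sum is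
      \<open>- (a * a)\<close>, because \<open>(a - 1)^2 - (a + 1)^2 = - 4 * a\<close>.\<close>
    have "(of_real (1 / 2) * (a - 1)) * (of_real (1 / 2) * (a - 1)) * a + (of_real (1 / 2) * (a + 1)) * (of_real (1 / 2) * (a + 1)) * (- a) \<in> S"
      by (intro S(2,3) T(3) a)
    moreover have "(of_real (1 / 2) * (a - 1)) * (of_real (1 / 2) * (a - 1)) * a + (of_real (1 / 2) * (a + 1)) * (of_real (1 / 2) * (a + 1)) * (- a)
        = (of_real (1 / 2) * of_real (1 / 2) * 4) * - (a * a)"
      by (simp add: algebra_simps)
    moreover have "of_real (1 / 2) * of_real (1 / 2) * 4 = (1 :: 'r)"
      using of_real_mult[of "1 / 4" 4, where 'a = 'r] by (simp flip: of_real_mult)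
    ultimately have "- (a * a) \<in> S" by simp
    thus ?thesis using S(4) by blast
  qed
  have tot: "a \<in> S | - a \<in> S" for a
  proof (rule ccontr)
    have ext: "\<exists>d s t. d ~: P & s \<in> S & t \<in> T & - (d * d) = s + t * a" if a: "a ~: S" for a
    proof (rule ccontr)
      assume no: "\<not> ?thesis"
      define X where "X = {s + t * a | s t. s \<in> S & t \<in> T}"
      have "X \<in> \<A>" unfolding \<A>_def
      proof (intro CollectI conjI ballI allI impI)
        have "S <= X"
          using T0 by (fastforce simp: X_def intro: exI[of _ 0])
        thus "C <= X" using S(1) by blast
        fix f g assume "f \<in> X" "g \<in> X"
        then obtain s t s' t' where h: "f = s + t * a" "g = s' + t' * a" "s \<in> S" "s' \<in> S" "t \<in> T" "t' \<in> T"
          by (auto simp: X_def)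
        have "f + g = (s + s') + (t + t') * a" using h(1,2) by (simp add: algebra_simps)
        thus "f + g \<in> X" unfolding X_def using S(2)[OF h(3,4)] T(1)[OF h(5,6)] by blast
      next
        fix r g assume "r \<in> T" "g \<in> X"
        then obtain s t where h: "g = s + t * a" "s \<in> S" "t \<in> T" by (auto simp: X_def)
        show "r * g \<in> X" using h(1) S(3)[OF \<open>r \<in> T\<close> h(2)] T(2)[OF \<open>r \<in> T\<close> h(3)] by (fastforce simp: algebra_simps X_def)
      next
        fix d assume "d ~: P" thus "- (d * d) ~: X" using no by (auto simp: X_def)
      qed
      moreover have "S <= X"
        using T0 by (fastforce simp: X_def intro: exI[of _ 0])
      ultimately have "X = S" using max by blast
      thus False using S0 T(3)[of 1] a by (fastforce simp: X_def)
    qed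
    assume "\<not> (a \<in> S | - a \<in> S)"
    then obtain d s t d' s' t' where h: "d ~: P" "s \<in> S" "t \<in> T" "- (d * d) = s + t * a"
        "d' ~: P" "s' \<in> S" "t' \<in> T" "- (d' * d') = s' + t' * - a"
      using ext[of a] ext[of "- a"] by blast
    \<comment> \<open>\<open>a\<close> is eliminated from the two representations. This puts both
      signs of \<open>d' * d' * t\<close> into \<open>S\<close>, hence \<open>t\<close> into
      \<open>P\<close>, and the first representation then puts \<open>- (d * d)\<close> into
      \<open>S\<close>.\<close>
    have "t' * (- (d * d)) + t * (- (d' * d')) = t' * s + t * s'" unfolding h(4) h(8) by (simp add: algebra_simps)
    hence e: "- (d' * d' * t) = d * d * t' + t' * s + t * s'" by (simp add: algebra_simps)
    have tS: "t \<in> S" "t' \<in> S" using h C(4) S(1) by auto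
    have "d' * d' * t \<in> S" by (intro S(3) T(3) tS)
    hence "t \<in> P" by (metis int e S(2,3) T(3) h tS primeID(6)[OF P])
    hence "- (t * a) \<in> S" "t * a \<in> S" using primeID(5)[OF P] primeID(7)[OF P] C(3) S(1) by blast+
    thus False using S(2) h(2) h(1,4) S(4) by metis
  qed
  show ?thesis
    by (rule that[OF S(1,2) _ tot int canc]) (auto intro: S(3) T(3))
qed

subsection \<open>Compactness of the space of orderings\<close>

text \<open>Every axiom of \<open>sgnf\<close> relates at most three values, so conditions on three
  coordinates suffice.\<close>

lemma open_values: "open {t :: 'r => int. R (t a) (t b) (t c)}"
proof -
  have o: "open {t :: 'r => int. t a = i}" for a i
  proof -
    have "open ((\<lambda>t :: 'r => int. t a) -` {i})" by (auto simp: open_discrete intro!: open_vimage)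
    moreover have "(\<lambda>t :: 'r => int. t a) -` {i} = {t. t a = i}" by auto
    ultimately show ?thesis by simp
  qed
  have "{t :: 'r => int. R (t a) (t b) (t c)} = (\<Union>(i, j, k)\<in>{(i, j, k). R i j k}. {t. t a = i} \<inter> {t. t b = j} \<inter> {t. t c = k})"
    by auto
  also have "open \<dots>" by (intro open_UN) (auto intro!: open_Int o)
  finally show ?thesis .
qed

lemma closed_values: "closed {t :: 'r => int. R (t a) (t b) (t c)}"
  using open_values[of "\<lambda>x y z. \<not> R x y z" a b c] unfolding closed_def Collect_neg_eq[symmetric] .

lemma closed_sat: "open {t :: 'r => int. sat (\<lambda>f. t (h f)) \<theta>} & closed {t :: 'r => int. sat (\<lambda>f. t (h f)) \<theta>}"
proof (induction \<theta>)
  case (Neg \<theta>)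
  thus ?case by (simp add: sat_def Collect_neg_eq closed_def)
next
  case (Conj \<theta>1 \<theta>2)
  thus ?case by (simp add: sat_def Collect_conj_eq open_Int closed_Int)
qed (auto simp: sat_def intro: open_values[of "\<lambda>x _ _. x = 1"] closed_values[of "\<lambda>x _ _. x = 1"]
  open_values[of "\<lambda>x _ _. x = 0"] closed_values[of "\<lambda>x _ _. x = 0"])

text \<open>A closed subset of a power of the finite set of signs, compact by Tychonoff's
  theorem.\<close>

lemma compact_sgnf:
  fixes P :: "'r::comm_ring_1 set"
  shows "compact {t. sgnf t & supp t = P}"
proof -
  have "compact (PiE UNIV (\<lambda>_ :: 'r. {- 1, 0, 1 :: int}))"
  proof -
    have "compactin (product_topology (\<lambda>_ :: 'r. euclidean :: int topology) UNIV) (PiE UNIV (\<lambda>_. {- 1, 0, 1}))"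
      unfolding compactin_PiE by (intro disjI2 ballI) (auto intro: finite_imp_compactin)
    thus ?thesis by (simp add: euclidean_product_topology)
  qed
  moreover have "closed {t :: 'r => int. sgnf t & supp t = P}"
  proof -
    have c: "closed {t :: 'r => int. t x = i}" for x i
      by (rule closed_values[of "\<lambda>v _ _. v = i" x 0 0])
    have c1: "closed {t :: 'r => int. t x \<in> {- 1, 0, 1}}" for x
      by (rule closed_values[of "\<lambda>x _ _. x \<in> {- 1, 0, 1}" x 0 0])
    have c2: "closed {t :: 'r => int. t (x * y) = t x * t y}" for x y
      by (rule closed_values[of "\<lambda>x y z. x = y * z" "x * y" x y])
    have c3: "closed {t :: 'r => int. t x = 0 --> t (x + y) = t y}" for x y
      by (rule closed_values[of "\<lambda>x y z. x = 0 --> y = z" x "x + y" y])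
    have c4: "closed {t :: 'r => int. t x = 1 --> t y = 1 --> t (x + y) = 1}" for x y
      by (rule closed_values[of "\<lambda>x y z. x = 1 --> y = 1 --> z = 1" x y "x + y"])
    have c5: "closed {t :: 'r => int. (t x = 0) = (x \<in> P)}" for x
      by (rule closed_values[of "\<lambda>v _ _. (v = 0) = (x \<in> P)" x 0 0])
    show ?thesis
      unfolding sgnf_def supp_def set_eq_iff mem_Collect_eq Collect_conj_eq Collect_all_eq
      by (intro closed_Int closed_INT ballI; (rule c c1 c2 c3 c4 c5))
  qed
  ultimately have "compact (PiE UNIV (\<lambda>_ :: 'r. {- 1, 0, 1 :: int}) \<inter> {t. sgnf t & supp t = P})"
    by (rule compact_Int_closed)
  moreover have "{t :: 'r => int. sgnf t & supp t = P} <= PiE UNIV (\<lambda>_. {- 1, 0, 1})"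
  proof
    fix t :: "'r => int" assume "t \<in> {t. sgnf t & supp t = P}"
    thus "t \<in> PiE UNIV (\<lambda>_. {- 1, 0, 1})" using sgnfD(3)[of t] by (simp add: PiE_def extensional_def)
  qed
  ultimately show ?thesis by (simp only: Int_absorb1)
qed

lemma sgnf_finite_cover:
  fixes P :: "'r::comm_ring_1 set"
  assumes "closed {t. Z t}" "!!t. sgnf t ==> supp t = P ==> Z t ==> \<exists>v\<in>X. t v >= 0"
  obtains Y where "finite Y" "Y <= X" "!!t. sgnf t ==> supp t = P ==> Z t ==> \<exists>v\<in>Y. t v >= 0"
proof -
  have "compact ({t. sgnf t & supp t = P} \<inter> {t. Z t})" by (rule compact_Int_closed[OF compact_sgnf assms(1)])
  moreover have "open {t :: 'r => int. t v >= 0}" for v by (rule open_values[of "\<lambda>x _ _. x >= 0"])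
  moreover have "({t. sgnf t & supp t = P} \<inter> {t. Z t}) <= (\<Union>v\<in>X. {t. t v >= 0})" using assms(2) by blast
  ultimately obtain Y where "Y <= X" "finite Y" "({t. sgnf t & supp t = P} \<inter> {t. Z t}) <= (\<Union>v\<in>Y. {t. t v >= 0})"
    using compactE_image[of "{t. sgnf t & supp t = P} \<inter> {t. Z t}" X "\<lambda>v. {t. t v >= 0}"] by blast
  thus ?thesis using that[of Y] by blast
qed

subsection \<open>Separation by ascending induction on prime ideals\<close>

context crossing
begin

text \<open>A negative sign would be realized at a real point of \<open>M\<close> by the Artin--Lang
  theorem.\<close>

lemma pos_on_M:
  assumes "!!x. x \<in> M ==> pev f x >= 0" "sgnf t" "I <= supp t"
  shows "t f >= 0"
proof (rule ccontr)
  assume "\<not> t f >= 0"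
  hence tf: "t f = - 1" using sgnfD(3)[OF assms(2), of f] by auto
  obtain x where x: "\<forall>g\<in>supp t. pev g x = 0" "sg (pev f x) = t f"
    using artin_lang[OF assms(2), of "{f}"] by auto
  show False using x(1) assms(3) assms(1)[of x] x(2) tf by (auto simp: M_eq vzeros_def)
qed

lemma bdd_on_M: "\<exists>c>0. \<forall>x\<in>M. \<bar>pev f x\<bar> <= c"
proof -
  have "bounded (pev f ` M)" by (intro compact_imp_bounded compact_continuous_image continuous_on_pev compact_M)
  thus ?thesis unfolding bounded_pos by auto
qed

text \<open>Compactness of \<open>M\<close> enters here: a constant that bounds \<open>f\<close> on
  \<open>M\<close> bounds it in every ordering whose support contains \<open>I\<close>.\<close>

lemma ex_bound:
  obtains c where "c > 0" "!!t. sgnf t ==> I <= supp t ==> t (of_real c - f) >= 0" "!!t. sgnf t ==> I <= supp t ==> t (of_real c + f) >= 0"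
proof -
  obtain c where c: "c > 0" "!!x. x \<in> M ==> \<bar>pev f x\<bar> <= c" using bdd_on_M by blast
  have "pev (of_real c - f) x >= 0" "pev (of_real c + f) x >= 0" if "x \<in> M" for x
    using c(2)[OF that] by auto
  thus ?thesis using that[OF c(1)] pos_on_M by blast
qed

end

lemma sgnf_nonneg:
  assumes "sgnf t" shows "t a >= 0 ==> t c >= 0 ==> t (a * c) >= 0" "t (a * a) >= 0"
    "t a = 0 | t a = 1 \<longleftrightarrow> t a >= 0" "t (a ^ (2 * k)) >= 0"
proof -
  show "t (a * a) >= 0" using sgnf_square[OF assms, of a] by simp
  thus "t (a ^ (2 * k)) >= 0" by (simp add: power_mult sgnfD(9)[OF assms] power2_eq_square)
  show "t a = 0 | t a = 1 \<longleftrightarrow> t a >= 0" using sgnfD(3)[OF assms, of a] by auto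
qed (simp add: sgnfD(4)[OF assms])

lemma sgnf_power_diff:
  assumes t: "sgnf t" and a: "t (Z - a) >= 0" "t a >= 0" "t Z >= 0"
  shows "t (Z ^ k - a ^ k) >= 0"
proof (induction k)
  case 0 thus ?case using sgnfD(8)[OF t] by simp
next
  case (Suc k)
  have "t (Z * (Z ^ k - a ^ k) + (Z - a) * a ^ k) >= 0" using sgnfD(13)[OF t] sgnf_nonneg(1)[OF t] a Suc by (auto simp: sgnfD(9)[OF t])
  thus ?case by (simp add: algebra_simps)
qed

text \<open>Finitely many alternatives \<open>u^2 <= z^2\<close> are merged into the single bound
  \<open>u^2 <= Z\<close>: the \<open>u\<close> are multiplied, and the squares \<open>z^2\<close>
  are added with constant weights. \<open>z0\<close> is built in from the start so that
  \<open>Z\<close> also bounds its square.\<close>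

lemma (in crossing) dominate:
  fixes P' :: "'n pfun set"
  assumes P': "primeI P'" "I <= P'" and z0: "z0 \<in> P'" and Y: "finite Y" "Y <= {z * z - u * u | u z. u ~: P' & z \<in> P'}"
  obtains u Z where "u ~: P'" "Z \<in> P'" "!!t. sgnf t ==> I <= supp t ==> t Z >= 0"
    "!!t. sgnf t ==> I <= supp t ==> t (Z - z0 * z0) >= 0"
    "!!t v. sgnf t ==> I <= supp t ==> v \<in> Y ==> t v >= 0 ==> t (Z - u * u) >= 0"
proof -
  have "\<exists>u Z. u ~: P' & Z \<in> P' & (\<forall>t. sgnf t --> I <= supp t --> t Z >= 0 & t (Z - z0 * z0) >= 0 &
      (\<forall>v\<in>Y. t v >= 0 --> t (Z - u * u) >= 0))"
    using Y
  proof (induction Y rule: finite_induct)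
    case empty
    show ?case using primeID(2)[OF P'(1)] primeID(5)[OF P'(1) z0] exI[of _ "z0 * z0"] by (auto simp: sgnf_nonneg(2) sgnfD(8))
  next
    case (insert v Y)
    from insert obtain u Z where uZ: "u ~: P'" "Z \<in> P'" "!!t. sgnf t ==> I <= supp t ==> t Z >= 0 & t (Z - z0 * z0) >= 0 &
      (\<forall>v\<in>Y. t v >= 0 --> t (Z - u * u) >= 0)" by blast
    from insert obtain u' z where v: "v = z * z - u' * u'" "u' ~: P'" "z \<in> P'" by auto
    obtain c where c: "c > 0" "!!t. sgnf t ==> I <= supp t ==> t (of_real c - u' * u') >= 0" by (rule ex_bound[of "u' * u'"], blast)
    obtain d where d: "d > 0" "!!t. sgnf t ==> I <= supp t ==> t (of_real d - u * u) >= 0" by (rule ex_bound[of "u * u"], blast)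
    \<comment> \<open>\<open>c\<close> bounds \<open>u' * u'\<close> and \<open>d\<close> bounds
      \<open>u * u\<close>. For the new alternative the term with weight \<open>d\<close> dominates
      the product of the two squares, for the old ones \<open>c * Z\<close> does; the additional
      \<open>Z\<close> preserves the bound by \<open>z0 * z0\<close>.\<close>
    define W where "W = of_real (c + 1) * Z + of_real d * (z * z)"
    have "u * u' ~: P'" using primeID(6)[OF P'(1)] uZ(1) v(2) by blast
    moreover have "W \<in> P'" unfolding W_def by (intro primeID(3)[OF P'(1)] primeID(4)[OF P'(1)] uZ(2) v(3))
    moreover have "t W >= 0 & t (W - z0 * z0) >= 0 & (\<forall>w\<in>insert v Y. t w >= 0 --> t (W - u * u' * (u * u')) >= 0)"
      if t: "sgnf t" "I <= supp t" for t
    proof -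
      note A = sgnfD(13)[OF t(1)] and N = sgnf_nonneg(1)[OF t(1)]
      have con: "t (of_real r) >= 0" if "r >= 0" for r
        using sgnf_nonneg(2)[OF t(1), of "of_real (sqrt r)"] real_sq[OF that, where 'r = "'n pfun"] by simp
      have cd: "t (of_real (c + 1)) >= 0" "t (of_real c) >= 0" "t (of_real d) >= 0" using c(1) d(1) by (auto intro!: con simp del: of_real_add)
      have Z: "t Z >= 0" "t (Z - z0 * z0) >= 0" using uZ(3)[OF t] by auto
      have "t W >= 0" unfolding W_def by (intro A N cd Z sgnf_nonneg(2)[OF t(1)])
      moreover have "t (of_real c * Z + of_real d * (z * z) + (Z - z0 * z0)) >= 0" by (intro A N cd Z sgnf_nonneg(2)[OF t(1)])
      hence "t (W - z0 * z0) >= 0" by (simp add: W_def algebra_simps)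
      moreover have "t (W - u * u' * (u * u')) >= 0" if w: "w \<in> insert v Y" "t w >= 0" for w
      proof (cases "w = v")
        case True
        hence "t (of_real (c + 1) * Z + of_real d * (z * z - u' * u') + (of_real d - u * u) * (u' * u')) >= 0" using w v A N cd Z sgnf_nonneg(2)[OF t(1)] d(2)[OF t] by auto
        thus ?thesis by (simp add: W_def algebra_simps)
      next
        case False
        hence "t (of_real c * (Z - u * u) + (of_real c - u' * u') * (u * u) + of_real d * (z * z) + Z) >= 0" using uZ(3)[OF t] w by (auto intro!: A N cd sgnf_nonneg(2)[OF t(1)] c(2)[OF t])
        thus ?thesis by (simp add: W_def algebra_simps)
      qed
      ultimately show ?thesis by blast
    qed
    ultimately show ?case by - (rule exI[of _ "u * u'"], rule exI[of _ W], blast)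
  qed
  then obtain u Z where uZ: "u ~: P'" "Z \<in> P'" "\<forall>t. sgnf t --> I <= supp t --> t Z >= 0 & t (Z - z0 * z0) >= 0 &
      (\<forall>v\<in>Y. t v >= 0 --> t (Z - u * u) >= 0)" by blast
  show ?thesis by (rule that[OF uZ(1,2)]) (use uZ(3) in blast)+
qed

context crossing_at
begin

text \<open>If \<open>P\<close> is not separated, the resulting semiordering has
  \<open>P = qz z0\<close> for some \<open>z0\<close>, and the next convex prime
  \<open>P' = rz z0\<close> is separated. Its separating function, read on the residue field of
  \<open>P\<close> as \<open>h\<close>, has the wrong sign only at orderings for which
  \<open>P'\<close> is not convex. There \<open>u * u\<close> is at most \<open>W\<close>, with
  \<open>u\<close> outside and \<open>W\<close> inside \<open>P'\<close>; high powers of this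
  inequality show that \<open>h * z0\<close> is bounded by every power of \<open>z0\<close> and so
  lies in \<open>P\<close>.\<close>

lemma separated_step:
  assumes P: "primeI P" "I <= P" "P <= videal {p}" and nw: "!!Q. wall_ideal Q ==> \<not> Q <= P"
    and IH: "!!P' x. x \<in> M ==> primeI P' ==> P \<subset> P' ==> P' <= videal {x} ==> separated P'"
  shows "separated P"
proof -
  obtain ls where ls: "set ls = {..<n}" "\<forall>l\<in>{..<n}. \<forall>g\<in>ilifts \<Delta> ls P. \<Delta> l g \<in> ilifts \<Delta> ls P"
    using ex_stable_list[OF P(1), of "{..<n}"] by auto
  have lsD: "!!l. l \<in> set ls ==> derivation (\<Delta> l)" using ls(1) deriv by auto
  have lsI: "ilifts \<Delta> ls P = I"
    by (rule stable_all_eq[OF primeI_ilifts[OF lsD P(1)] ilifts_I[OF P(2)]])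
      (use ls P(3) ilifts_subset[of \<Delta> ls P] in auto)
  \<comment> \<open>All lifting signs are set to 1; by \<open>sign_independent\<close> the two
    formulas do not see the choice.\<close>
  define L where "L t = slifts \<Delta> ls (\<lambda>_. 1) t" for t
  have Lp: "sgnf (L t)" "supp (L t) = I" if "sgnf t" "supp t = P" for t
    unfolding L_def using slifts_props[OF that(1), of ls "\<lambda>_. 1"] that(2) P(2) ls(1) lsI by auto
  have Ln: "L t f = t f" if "f ~: supp t" for t f unfolding L_def by (rule slifts_notin[OF that]) simp
  have lex: "\<exists>h. h ~: P & (\<forall>t. sgnf t --> supp t = P --> L t g = t h)" if "g ~: I" for g
  proof -
    have "g ~: ilifts \<Delta> ls P" using that lsI by simp
    from slifts_lex[OF lsD P(1) this] obtain m h where h: "h ~: P" "!!s e. sgnf s ==> supp s = P ==> (\<forall>l. e l \<in> {1, - 1}) ==>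
        slifts \<Delta> ls e s g = (\<Prod>l\<in>set ls. e l ^ m l) * s h" by blast
    have "L t g = t h" if "sgnf t" "supp t = P" for t using h(2)[OF that, of "\<lambda>_. 1"] by (simp add: L_def)
    thus ?thesis using h(1) by blast
  qed
  have Lsat: "sat (L (res P s)) \<theta> = sat s \<theta>" if s: "sgnf s" "supp s = I" "compat s P" and \<theta>: "\<theta> \<in> {\<phi>, \<psi>}" for s \<theta>
  proof -
    note r = res[OF s(1) P(1) s(3)]
    have rl: "relift_sign P s l \<in> {1, - 1}" "f \<in> F ==> slifts \<Delta> ls (relift_sign P s) (res P s) f = s f" for l f
      using relift(1,4)[OF P _ _ s, of ls] ls(1) by auto
    have "sat (L (res P s)) \<theta> = sat (slifts \<Delta> ls (relift_sign P s) (res P s)) \<theta>"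
      unfolding L_def by (rule sign_independent[OF P nw ls(1) r(1,2) _ rl(1) \<theta>]) auto
    also have "\<dots> = sat s \<theta>" by (rule sat_cong) (use rl(2) \<theta> atoms in auto)
    finally show ?thesis .
  qed
  define A where "A = {t. sgnf t & supp t = P & sat (L t) \<phi>}"
  define B where "B = {t. sgnf t & supp t = P & sat (L t) \<psi>}"
  show ?thesis
  proof (rule ccontr)
    assume ns: "\<not> separated P"
    have nosep: False if h: "h ~: P" "!!t. t \<in> A ==> t h = 1" "!!t. t \<in> B ==> t h = - 1" for h
    proof -
      have "separated P"
      proof (rule separatedI)
        show "h ~: I" using h(1) P(2) by blast
        fix s assume s: "sgnf s" "supp s = I" "compat s P"
        note r = res[OF s(1) P(1) s(3)]
        show "s h = 1" if "sat s \<phi>"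
          using h(2)[of "res P s"] Lsat[OF s, of \<phi>] that r res_notin[OF h(1), of s] by (simp add: A_def)
        show "s h = - 1" if "sat s \<psi>"
          using h(3)[of "res P s"] Lsat[OF s, of \<psi>] that r res_notin[OF h(1), of s] by (simp add: B_def)
      qed
      thus False using ns by blast
    qed
    have ABd: "sgnf t" "supp t = P" "I <= supp t" if "t \<in> A \<union> B" for t using that P(2) by (auto simp: A_def B_def)
    \<comment> \<open>The lift of a common element would be imitated by a real point of
      \<open>M\<close> satisfying both formulas.\<close>
    have AB: "t ~: B" if "t \<in> A" for t
    proof
      assume tB: "t \<in> B"
      have t: "sgnf t" "supp t = P" using that by (auto simp: A_def)
      obtain x where x: "\<forall>f\<in>supp (L t). pev f x = 0" "\<forall>h\<in>F. sg (pev h x) = L t h"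
        using artin_lang[OF Lp(1)[OF t] finite_F] by blast
      have "sat (point_sgn x) \<phi> = sat (L t) \<phi>" "sat (point_sgn x) \<psi> = sat (L t) \<psi>"
        by (rule sat_cong, use x(2) atoms in \<open>force simp: point_sgn_def\<close>)+
      thus False using x(1) Lp(2)[OF t] disjoint that tB by (auto simp: M_eq vzeros_def A_def B_def)
    qed
    have neA: "A ~= {}" using nosep[of "- 1"] primeI_minus_one[OF P(1)] ABd(1) sgnfD(2) by blast
    have neB: "B ~= {}" using nosep[of 1] primeID(2)[OF P(1)] ABd(1) sgnfD(1) by blast
    define T where "T = {f. \<forall>t\<in>A \<union> B. t f >= 0}"
    \<comment> \<open>Sums of a function nonnegative on \<open>A\<close> and one nonnegative on
      \<open>B\<close>. If such a sum were \<open>- (d * d)\<close> with \<open>d\<close> outside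
      \<open>P\<close>, the first summand would separate \<open>A\<close> from
      \<open>B\<close>.\<close>
    define C where "C = {f + g | f g. (\<forall>t\<in>A. t f >= 0) & (\<forall>t\<in>B. t g >= 0)}"
    have CI: "f + g \<in> C" if "!!t. t \<in> A ==> t f >= 0" "!!t. t \<in> B ==> t g >= 0" for f g
      unfolding C_def mem_Collect_eq by (rule exI[of _ f], rule exI[of _ g]) (use that in simp)
    have t0: "t 0 = 0" if "t \<in> A \<union> B" for t using sgnfD(8)[OF ABd(1)[OF that]] .
    have CA: "f \<in> C" if "!!t. t \<in> A ==> t f >= 0" for f
    proof -
      have "f + 0 \<in> C" by (rule CI) (use that in "simp_all add: t0")
      thus ?thesis by simp
    qed
    have CB: "f \<in> C" if "!!t. t \<in> B ==> t f >= 0" for f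
    proof -
      have "0 + f \<in> C" by (rule CI) (use that in "simp_all add: t0")
      thus ?thesis by simp
    qed
    obtain S where S: "C <= S" "!!a c. a \<in> S ==> c \<in> S ==> a + c \<in> S" "!!d a. a \<in> S ==> d * d * a \<in> S"
      "!!a. a \<in> S | - a \<in> S" "!!a. a \<in> S ==> - a \<in> S ==> a \<in> P" "!!d a. d ~: P ==> d * d * a \<in> S ==> a \<in> S"
    proof (rule semiordering_exists[OF P(1), of T C])
      show "a + c \<in> T" if "a \<in> T" "c \<in> T" for a c using that sgnfD(13)[OF ABd(1)] by (simp add: T_def)
      show "a * c \<in> T" if "a \<in> T" "c \<in> T" for a c using that sgnf_nonneg(1)[OF ABd(1)] by (simp add: T_def)
      show "a * a \<in> T" for a using sgnf_nonneg(2)[OF ABd(1)] by (simp add: T_def)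
      show "a + c \<in> C" if ac: "a \<in> C" "c \<in> C" for a c
      proof -
        obtain f g f' g' where h: "a = f + g" "c = f' + g'" "\<forall>t\<in>A. t f >= 0" "\<forall>t\<in>A. t f' >= 0" "\<forall>t\<in>B. t g >= 0" "\<forall>t\<in>B. t g' >= 0"
          using ac by (auto simp: C_def)
        have "(f + f') + (g + g') \<in> C"
          by (rule CI) (use h sgnfD(13)[OF ABd(1)] in auto)
        thus ?thesis using h by (simp add: algebra_simps)
      qed
      show "s * c \<in> C" if sc: "s \<in> T" "c \<in> C" for s c
      proof -
        obtain f g where h: "c = f + g" "\<forall>t\<in>A. t f >= 0" "\<forall>t\<in>B. t g >= 0" using sc by (auto simp: C_def)
        have "s * f + s * g \<in> C"
          by (rule CI) (use h sc(1) sgnf_nonneg(1)[OF ABd(1)] in "auto simp: T_def")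
        thus ?thesis using h by (simp add: algebra_simps)
      qed
      show "P <= C"
      proof
        fix f assume "f \<in> P"
        hence "t f = 0" if "t \<in> A" for t using ABd(2)[of t] that by (auto simp: supp_def)
        thus "f \<in> C" by (intro CA) (metis order_refl)
      qed
      show "T <= C" using CA by (auto simp: T_def)
      show "- (d * d) ~: C" if d: "d ~: P" for d
      proof
        assume "- (d * d) \<in> C"
        then obtain f g where h: "- (d * d) = f + g" "\<forall>t\<in>A. t f >= 0" "\<forall>t\<in>B. t g >= 0" by (auto simp: C_def)
        have neg: "t f = - 1" if t: "t \<in> B" for t
        proof -
          have s: "sgnf t" "supp t = P" using ABd t by auto
          show ?thesis using sgnf_square[OF s(1), of d] d s(2) sgnfD(16)[OF s(1)] h(3) t arg_cong[OF h(1), of uminus] sgnfD(7)[OF s(1), of f] by (fastforce simp: supp_def)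
        qed
        obtain t0 where t0: "t0 \<in> B" using neB by blast
        have fP: "f ~: P" using neg[OF t0] ABd(2)[of t0] t0 by (auto simp: supp_def)
        have "t f = 1" if t: "t \<in> A" for t
          using fP ABd(2)[of t] t h(2) sgnf_nonneg(3)[OF ABd(1), of t f] by (auto simp: supp_def)
        thus False using nosep[OF fP] neg by blast
      qed
    qed blast
    have bd: "\<exists>c. of_real c - h * h \<in> S" for h
    proof -
      obtain c where "!!t. sgnf t ==> I <= supp t ==> t (of_real c - h * h) >= 0" by (rule ex_bound[of "h * h"], blast)
      hence "of_real c - h * h \<in> C" by (intro CA) (use ABd(1,3) in blast)
      thus ?thesis using S(1) by blast
    qed
    have PS: "P <= S"
    proof
      fix f assume "f \<in> P"
      hence "t f = 0" if "t \<in> A" for t using ABd(2)[of t] that by (auto simp: supp_def)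
      thus "f \<in> S" using S(1) by (fastforce intro: CA)
    qed
    have "t 1 >= 0" if "t \<in> A" for t using sgnfD(1)[OF ABd(1), of t] that by simp
    hence oneS: "1 \<in> S" using S(1) CA by blast
    note PP = P
    interpret semiord S P
      by (rule semiord.intro) (fact PP(1) S(2) S(3) oneS S(4) S(5) PS S(6) bd)+
    obtain x where x: "infi = videal {x}" using infi_point by blast
    have xM: "x \<in> M" using P_infi x PP(2) by (auto simp: M_eq vzeros_def videal_def)
    \<comment> \<open>Otherwise \<open>P\<close> is the ideal of a point, whose only ordering is
      evaluation there, while \<open>A\<close> and \<open>B\<close> are nonempty and
      disjoint.\<close>
    have "P ~= infi"
    proof
      assume eq: "P = infi"
      have "t = point_sgn x" if t: "t \<in> A \<union> B" for t
      proof
        fix f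
        have "f - of_real (pev f x) \<in> supp t" using ABd(2)[OF t] eq x by (simp add: videal_def)
        from sgnf_cong_supp[OF ABd(1)[OF t] this] show "t f = point_sgn x f"
          using sgnf_of_real[OF ABd(1)[OF t]] by (simp add: point_sgn_def)
      qed
      hence eqs: "!!t. t \<in> A \<union> B ==> t = point_sgn x" by blast
      obtain t t' where t: "t \<in> A" "t' \<in> B" using neA neB by blast
      thus False using eqs[of t] eqs[of t'] AB by (metis UnI1 UnI2)
    qed
    then obtain z0 where z0: "z0 \<in> infi" "z0 ~: P" "qz z0 = P" using ex_qz by blast
    define P' where "P' = rz z0"
    have P': "primeI P'" "P \<subset> P'" "P' <= videal {x}" using prime_rz[OF z0(1,2)] x by (auto simp: P'_def)
    obtain g where g: "g ~: I" "!!s. sgnf s ==> supp s = I ==> compat s P' ==> (sat s \<phi> --> s g = 1) & (sat s \<psi> --> s g = - 1)"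
      using IH[OF xM P'] unfolding separated_def by blast
    obtain h where h: "h ~: P" "!!t. sgnf t ==> supp t = P ==> L t g = t h" using lex[OF g(1)] by blast
    obtain hf where hf: "!!f t. f \<in> F ==> sgnf t ==> supp t = P ==> L t f = t (hf f)" using lex F_notin_I by metis
    have hfsat: "sat (L t) \<theta> = sat (\<lambda>f. t (hf f)) \<theta>" if "sgnf t" "supp t = P" "\<theta> \<in> {\<phi>, \<psi>}" for t \<theta>
      by (rule sat_cong) (use hf that atoms in auto)
    \<comment> \<open>The orderings at which \<open>h\<close> has the wrong sign. Rewriting the
      formulas with \<open>hf\<close> makes this a closed condition on \<open>t\<close>, as
      compactness requires.\<close>
    define Z' where "Z' t \<longleftrightarrow> sat (\<lambda>f. t (hf f)) \<phi> & t h = - 1 | sat (\<lambda>f. t (hf f)) \<psi> & t h = 1" for t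
    have clZ: "closed {t. Z' t}" unfolding Z'_def Collect_disj_eq Collect_conj_eq
      by (intro closed_Un closed_Int) (use closed_sat closed_values[of "\<lambda>v _ _. v = - 1" h 0 0] closed_values[of "\<lambda>v _ _. v = 1" h 0 0] in blast)+
    have cov: "\<exists>v\<in>{z * z - u * u | u z. u ~: P' & z \<in> P'}. t v >= 0"
      if t: "sgnf t" "supp t = P" and Z: "Z' t" for t
    proof (rule ccontr)
      assume "\<not> ?thesis"
      hence n: "\<not> t (z * z - u * u) >= 0" if "u ~: P'" "z \<in> P'" for u z using that by blast
      have uz: "t (u * u - z * z) = 1" if "u ~: P'" "z \<in> P'" for u z
        using n[OF that] sgnfD(3)[OF t(1), of "u * u - z * z"] sgnfD(14)[OF t(1), of "u * u" "z * z"] by auto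
      have "compat (L t) P'" unfolding compat_def
      proof (intro ballI allI impI)
        fix z u assume "z \<in> P'" "u ~: P'"
        hence 1: "t (u * u - z * z) = 1" using uz by blast
        thus "L t (u * u - z * z) = 1" using Ln[of "u * u - z * z" t] by (simp add: supp_def)
      qed
      thus False using g(2)[OF Lp[OF t]] h(2)[OF t] Z hfsat[OF t] by (auto simp: Z'_def)
    qed
    obtain Y where Y: "finite Y" "Y <= {z * z - u * u | u z. u ~: P' & z \<in> P'}"
      "!!t. sgnf t ==> supp t = P ==> Z' t ==> \<exists>v\<in>Y. t v >= 0"
    using sgnf_finite_cover[OF clZ cov] by blast
    have z0P': "z0 \<in> P'" by (auto simp: P'_def rz_def le_refl intro!: exI[of _ 1])
    have IP': "I <= P'" using PP(2) P'(2) by blast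
    obtain u W where uW: "u ~: P'" "W \<in> P'" "!!t. sgnf t ==> I <= supp t ==> t W >= 0"
      "!!t. sgnf t ==> I <= supp t ==> t (W - z0 * z0) >= 0"
      "!!t v. sgnf t ==> I <= supp t ==> v \<in> Y ==> t v >= 0 ==> t (W - u * u) >= 0"
      using dominate[OF P'(1) IP' z0P' Y(1,2)] by blast
    obtain c where c: "c > 0" "!!t. sgnf t ==> I <= supp t ==> t (of_real c - h) >= 0"
      "!!t. sgnf t ==> I <= supp t ==> t (of_real c + h) >= 0" by (rule ex_bound[of h], blast)
    have WP: "W ~: P"
    proof
      assume "W \<in> P"
      obtain t where t: "t \<in> A" using neA by blast
      have s: "sgnf t" "supp t = P" using ABd t by auto
      have "t W = 0" using s(2) \<open>W \<in> P\<close> by (auto simp: supp_def)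
      thus False using sgnfD(12)[OF s(1)] sgnf_square[OF s(1), of z0] z0(2) s(2) uW(4)[OF ABd(1,3), of t] t by (auto simp: supp_def)
    qed
    \<comment> \<open>It suffices that \<open>d * d + a\<close> is nonnegative on \<open>A\<close>
      and \<open>d * d - a\<close> on \<open>B\<close>, since either kind of function lies in
      \<open>S\<close>. Where \<open>h\<close> has the right sign this is immediate; where it is
      wrong, \<open>u * u\<close> is at most \<open>W\<close>. The even exponents make the cofactors
      squares.\<close>
    have bound: "le (h * u ^ (4 * N)) (W ^ (2 * N))" for N
    proof -
      define d where "d = of_real (sqrt c) * W ^ N"
      define a where "a = h * (u * u) ^ (2 * N)"
      have dd: "d * d = of_real c * W ^ (2 * N)"
        using real_sq[of c, where 'r = "'n pfun"] c(1) by (auto simp: d_def mult_2 power_add)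
      have dP: "d ~: P" unfolding d_def
        using primeI_const[OF PP(1), of "sqrt c"] c(1) primeID(6)[OF PP(1), of "of_real (sqrt c)" "W ^ N"] primeID(9)[OF PP(1), of W N] WP
        by auto
      have ev: "t (W ^ (2 * N)) >= 0" "t ((u * u) ^ (2 * N)) >= 0" "t (of_real c) >= 0" if "sgnf t" for t
        using sgnf_nonneg(4)[OF that] sgnf_nonneg(2)[OF that, of "of_real (sqrt c)"] real_sq[of c, where 'r = "'n pfun"] c(1)
        by simp_all
      have wrong: "t (d * d + a) >= 0" "t (d * d - a) >= 0" if t: "t \<in> A \<union> B" and Zt: "Z' t" for t
      proof -
        note s = ABd[OF t]
        obtain v where "v \<in> Y" "t v >= 0" using Y(3)[OF s(1,2) Zt] by blast
        hence 1: "t (W ^ (2 * N) - (u * u) ^ (2 * N)) >= 0" using uW(5)[OF s(1,3)] sgnf_nonneg(2)[OF s(1)] uW(3)[OF s(1,3)] sgnf_power_diff[OF s(1)] by auto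
        have "t (of_real c * (W ^ (2 * N) - (u * u) ^ (2 * N)) + (of_real c + h) * (u * u) ^ (2 * N)) >= 0"
          by (intro sgnfD(13)[OF s(1)] sgnf_nonneg(1)[OF s(1)] 1 ev[OF s(1)] c(3)[OF s(1,3)])
        thus "t (d * d + a) >= 0" unfolding dd a_def by (simp add: algebra_simps)
        have "t (of_real c * (W ^ (2 * N) - (u * u) ^ (2 * N)) + (of_real c - h) * (u * u) ^ (2 * N)) >= 0"
          by (intro sgnfD(13)[OF s(1)] sgnf_nonneg(1)[OF s(1)] 1 ev[OF s(1)] c(2)[OF s(1,3)])
        thus "t (d * d - a) >= 0" unfolding dd a_def by (simp add: algebra_simps)
      qed
      have hnz: "t h = 1 | t h = - 1" if "t \<in> A \<union> B" for t
        using ABd(1,2)[OF that] h(1) sgnfD(3)[of t h] by (auto simp: supp_def)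
      have "t (d * d + a) >= 0" if t: "t \<in> A" for t
      proof (cases "t h = 1")
        case True
        have s: "sgnf t" using ABd t by blast
        show ?thesis unfolding a_def
          by (intro sgnfD(13)[OF s] sgnf_nonneg(1,2)[OF s] ev[OF s]) (use True in simp)
      next
        case False
        thus ?thesis using hnz[of t] t hfsat[of t] wrong(1) by (auto simp: A_def Z'_def)
      qed
      hence "d * d + a \<in> S" using CA S(1) by blast
      moreover have "t (d * d - a) >= 0" if t: "t \<in> B" for t
      proof (cases "t h = - 1")
        case True
        have s: "sgnf t" using ABd t by blast
        have "t (d * d + - h * (u * u) ^ (2 * N)) >= 0"
          by (intro sgnfD(13)[OF s] sgnf_nonneg(1,2)[OF s] ev[OF s]) (use True sgnfD(7)[OF s, of h] in simp)
        thus ?thesis by (simp add: a_def)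
      next
        case False
        thus ?thesis using hnz[of t] t hfsat[of t] wrong(2) by (auto simp: B_def Z'_def)
      qed
      hence "d * d - a \<in> S" using CB S(1) by blast
      ultimately have "le a (d * d)" using le_of_abs dP by blast
      hence "le a (W ^ (2 * N))" unfolding dd using le_mult_left[OF le_refl] le_trans by blast
      thus ?thesis by (simp add: a_def power_mult_distrib flip: power_add)
    qed
    have uz: "le z0 (u ^ k)" for k using uW(1) le_total by (auto simp: P'_def rz_def)
    obtain k where k: "le (W ^ k) z0" using uW(2) by (auto simp: P'_def rz_def)
    \<comment> \<open>\<open>u\<close> is outside \<open>P'\<close>, so \<open>z0\<close> is bounded
      by every power of \<open>u\<close>; \<open>W\<close> is in \<open>P'\<close>, so
      \<open>W ^ k\<close> is bounded by \<open>z0\<close>. Taking \<open>N = k * m\<close> gives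
      any desired power of \<open>z0\<close>.\<close>
    have "le (h * z0) (z0 ^ m)" for m
    proof -
      have "le (h * z0) (h * u ^ (4 * (k * m)))" by (rule le_mult[OF le_refl uz])
      have "le (h * z0) (W ^ (2 * (k * m)))" using le_trans[OF \<open>le (h * z0) (h * u ^ (4 * (k * m)))\<close> bound] .
      moreover have "le (W ^ (2 * (k * m))) (z0 ^ (2 * m))"
        using le_power[OF k, of "2 * m"] by (simp flip: power_mult add: mult.left_commute)
      moreover have "le (z0 ^ (2 * m)) (z0 ^ m)"
        using le_mult_left[OF le_refl, of "z0 ^ m" "z0 ^ m"] by (simp add: mult_2 power_add)
      ultimately show ?thesis using le_trans by blast
    qed
    thus False using z0(3) primeID(6)[OF PP(1)] h(1) z0(2) by (auto simp: qz_def)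
  qed
qed

end

context crossing
begin

text \<open>Induction on a bound for the chains above \<open>P\<close>. The point has to vary: the
  larger prime found through the semiordering lies below the ideal of another point of
  \<open>M\<close>.\<close>

lemma separated_prime:
  assumes walls: "!!Q. wall_ideal Q ==> separated Q"
    and P: "x \<in> M" "primeI P" "I <= P" "P <= videal {x}"
  shows "separated P"
proof -
  have "(!!m C. prime_chain m P C ==> m <= k) ==> separated P" for k using P
  proof (induction k arbitrary: P x rule: less_induct)
    case (less k)
    obtain y \<Delta> b where "crossing_at I M n F \<phi> \<psi> x y \<Delta> b" using ex_at[OF less.prems(2)] by blast
    then interpret crossing_at I M n F \<phi> \<psi> x y \<Delta> b .
    show ?case
    proof (cases "\<exists>Q. wall_ideal Q & Q <= P")
      case True
      thus ?thesis using separated_above_wall[OF less.prems(3-5)] walls by blast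
    next
      case False
      show ?thesis
      proof (rule separated_step[OF less.prems(3-5)])
        fix P' x' assume h: "x' \<in> M" "primeI P'" "P \<subset> P'" "P' <= videal {x'}"
        have chains: "Suc m <= k" if "prime_chain m P' C" for m C
          using prime_chain_Cons[OF less.prems(3) h(3) that] less.prems(1) by blast
        have "k > 0" using chains[OF prime_chain_refl[OF h(2)]] by simp
        show "separated P'"
          by (rule less.IH[of "k - 1" P' x']) (use chains h \<open>k > 0\<close> less.prems(4) in fastforce)+
      qed (use False in blast)
    qed
  qed
  thus ?thesis using prime_chain_bound by blast
qed

text \<open>A point of an open set at which \<open>h\<close> does not vanish is lifted to an
  ordering with support \<open>I\<close>. By openness the formula holds in this ordering as well,
  and \<open>h\<close> keeps its sign, so weak inequalities follow at all points.\<close>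

theorem separating_polynomial:
  assumes walls: "!!Q. wall_ideal Q ==> separated Q"
  obtains h where "h ~: I" "!!x. x \<in> M ==> sat (point_sgn x) \<phi> ==> pev h x >= 0"
    "!!x. x \<in> M ==> sat (point_sgn x) \<psi> ==> pev h x <= 0"
proof -
  obtain p where p: "p \<in> M" using I_eq primeID(2)[OF prime_I] by (auto simp: videal_def)
  have "separated I" using p I_eq separated_prime[OF walls p prime_I] by (auto simp: videal_def)
  then obtain h where h: "h ~: I" "!!s. sgnf s ==> supp s = I ==> (sat s \<phi> --> s h = 1) & (sat s \<psi> --> s h = - 1)"
    unfolding separated_def using compat_supp by metis
  have lift: "\<exists>s. sgnf s & supp s = I & sat s \<theta> & s h = sg (pev h x)"
    if x: "x \<in> M" "sat (point_sgn x) \<theta>" and hx: "pev h x ~= 0" and \<theta>: "atoms \<theta> <= F"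
      and op: "openin (top_of_set M) {x \<in> M. sat (point_sgn x) \<theta>}" for x \<theta>
  proof -
    obtain y \<Delta> b where "crossing_at I M n F \<phi> \<psi> x y \<Delta> b" using ex_at[OF x(1)] by blast
    then interpret crossing_at I M n F \<phi> \<psi> x y \<Delta> b .
    obtain ls where ls: "set ls = {..<n}" "\<forall>l\<in>{..<n}. \<forall>g\<in>ilifts \<Delta> ls (videal {x}). \<Delta> l g \<in> ilifts \<Delta> ls (videal {x})"
      using ex_stable_list[OF primeI_point, of "{..<n}" x] by auto
    have lsD: "!!l. l \<in> set ls ==> derivation (\<Delta> l)" using ls(1) deriv by auto
    have lsI: "ilifts \<Delta> ls (videal {x}) = I"
      by (rule stable_all_eq[OF primeI_ilifts[OF lsD primeI_point] ilifts_I[OF I_sub_mp]])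
        (use ls ilifts_subset[of \<Delta> ls "videal {x}"] in auto)
    define s where "s = slifts \<Delta> ls (\<lambda>_. 1) (point_sgn x)"
    have s: "sgnf s" "supp s = I"
      unfolding s_def using slifts_props[OF sgnf_point, of x ls "\<lambda>_. 1"] ls(1) lsI I_sub_mp by (auto simp: supp_point)
    have sx: "s f = sg (pev f x)" if "pev f x ~= 0" for f
      unfolding s_def using slifts_notin[of f "point_sgn x" "\<lambda>_. 1" \<Delta> ls] that
      by (auto simp: supp_point videal_def point_sgn_def)
    obtain r where r: "r > 0" "ball x r \<inter> M <= {x \<in> M. sat (point_sgn x) \<theta>}"
      using op x by (metis (no_types, lifting) mem_Collect_eq openin_contains_ball)
    obtain x' where x': "x' \<in> M" "dist x' x < r" "\<forall>f\<in>F. point_sgn x' f = s f"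
      using near_point[OF s(1) _ sx r(1)] s(2) by blast
    show ?thesis using r(2) x'(1,2) sat_cong[of \<theta> "point_sgn x'" s] x'(3) \<theta> s sx[OF hx] by (auto simp: dist_commute subset_iff)
  qed
  show ?thesis
  proof (rule that[OF h(1)])
    fix x assume x: "x \<in> M" "sat (point_sgn x) \<phi>"
    show "pev h x >= 0"
    proof (cases "pev h x = 0")
      case False
      obtain s where "sgnf s" "supp s = I" "sat s \<phi>" "s h = sg (pev h x)"
        using lift[OF x False atoms(1) open_A] by blast
      thus ?thesis using h(2)[of s] by (simp add: sg_eq_iff)
    qed simp
  next
    fix x assume x: "x \<in> M" "sat (point_sgn x) \<psi>"
    show "pev h x <= 0"
    proof (cases "pev h x = 0")
      case False
      obtain s where "sgnf s" "supp s = I" "sat s \<psi>" "s h = sg (pev h x)"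
        using lift[OF x False atoms(2) open_B] by blast
      thus ?thesis by (smt (verit) h(2)[of s] sg_eq_iff)
    qed simp
  qed
qed

end

subsection \<open>Krull's intersection theorem\<close>

abbreviation idl :: "'r::comm_ring_1 set => bool" where
  "idl J \<equiv> ideal_in UNIV J"

lemma idlD:
  assumes "idl J"
  shows "0 \<in> J" "x \<in> J ==> y \<in> J ==> x + y \<in> J" "x \<in> J ==> a * x \<in> J" "x \<in> J ==> x * a \<in> J"
    "x \<in> J ==> - x \<in> J" "x \<in> J ==> y \<in> J ==> x - y \<in> J"
proof -
  show "0 \<in> J" and 1: "x \<in> J ==> y \<in> J ==> x + y \<in> J" and 2: "x \<in> J ==> a * x \<in> J" for x y a
    using assms by (auto simp: ideal_in_def)
  show "x \<in> J ==> x * a \<in> J" using 2[of x a] by (simp add: mult.commute)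
  show 3: "x \<in> J ==> - x \<in> J" for x using 2[of x "- 1"] by simp
  show "x \<in> J ==> y \<in> J ==> x - y \<in> J" using 1[of x "- y"] 3[of y] by simp
qed

lemma idlI:
  "0 \<in> J ==> (!!x y. x \<in> J ==> y \<in> J ==> x + y \<in> J) ==> (!!a x. x \<in> J ==> a * x \<in> J) ==> idl J"
  by (auto simp: ideal_in_def)

lemma idl_sum: "idl J ==> (!!x. x \<in> S ==> f x \<in> J) ==> sum f S \<in> J"
  by (induction S rule: infinite_finite_induct) (auto simp: idlD(1,2))

lemma idl_primeI: "primeI P ==> idl P"
  by (intro idlI primeID(1,3,4))

lemma idl_comb:
  assumes A: "idl A" and B: "idl B" shows "idl {c * a + b | a b. a \<in> A & b \<in> B}"
proof (rule idlI)
  show "0 \<in> {c * a + b | a b. a \<in> A & b \<in> B}"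
    using idlD(1)[OF A] idlD(1)[OF B] by (intro CollectI exI[of _ 0]) simp
  fix x y assume "x \<in> {c * a + b | a b. a \<in> A & b \<in> B}" "y \<in> {c * a + b | a b. a \<in> A & b \<in> B}"
  then obtain a b a' b' where h: "x = c * a + b" "y = c * a' + b'" "a \<in> A" "a' \<in> A" "b \<in> B" "b' \<in> B" by blast
  have "x + y = c * (a + a') + (b + b')" using h(1,2) by (simp add: algebra_simps)
  thus "x + y \<in> {c * a + b | a b. a \<in> A & b \<in> B}" using idlD(2)[OF A h(3,4)] idlD(2)[OF B h(5,6)] by blast
next
  fix d x assume "x \<in> {c * a + b | a b. a \<in> A & b \<in> B}"
  then obtain a b where h: "x = c * a + b" "a \<in> A" "b \<in> B" by blast
  have "d * x = c * (d * a) + d * b" using h(1) by (simp add: algebra_simps)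
  thus "d * x \<in> {c * a + b | a b. a \<in> A & b \<in> B}" using idlD(3)[OF A h(2)] idlD(3)[OF B h(3)] by blast
qed

lemma noetherian_maximal:
  assumes noe: "noetherian (UNIV :: 'r::comm_ring_1 set)" and ne: "\<A> ~= {}" and id: "!!J. J \<in> \<A> ==> idl (J :: 'r set)"
  obtains L where "L \<in> \<A>" "!!X. X \<in> \<A> ==> L <= X ==> X = L"
proof -
  have "\<Union>\<C> \<in> \<A>" if nC: "\<C> ~= {}" and ch: "subset.chain \<A> \<C>" for \<C>
  proof -
    have sub: "S \<in> \<A>" if "S \<in> \<C>" for S using ch that by (auto simp: subset.chain_def)
    have lin: "S <= S' | S' <= S" if "S \<in> \<C>" "S' \<in> \<C>" for S S' using ch that by (auto simp: subset.chain_def)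
    have "idl (\<Union>\<C>)"
    proof (rule idlI)
      obtain S where S: "S \<in> \<C>" using nC by blast
      thus "0 \<in> \<Union>\<C>" using idlD(1)[OF id[OF sub[OF S]]] by blast
      show "a * x \<in> \<Union>\<C>" if x: "x \<in> \<Union>\<C>" for a x
      proof -
        obtain S where S: "S \<in> \<C>" "x \<in> S" using x by blast
        from idlD(3)[OF id[OF sub[OF S(1)]] S(2)] show ?thesis using S(1) by blast
      qed
      show "x + y \<in> \<Union>\<C>" if xy: "x \<in> \<Union>\<C>" "y \<in> \<Union>\<C>" for x y
      proof -
        obtain S S' where S: "S \<in> \<C>" "S' \<in> \<C>" "x \<in> S" "y \<in> S'" using xy by blast
        define U where "U = (if S <= S' then S' else S)"
        have U: "U \<in> \<C>" "x \<in> U" "y \<in> U" using S lin[of S S'] by (auto simp: U_def)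
        thus ?thesis using idlD(2)[OF id[OF sub[OF U(1)]]] by blast
      qed
    qed
    then obtain G where G: "finite G" "G <= \<Union>\<C>" "\<Union>\<C> <= ideal_gen UNIV G" using noe unfolding noetherian_def by blast
    have "\<exists>S\<in>\<C>. G <= S" using G(1,2)
    proof (induction G rule: finite_induct)
      case empty thus ?case using nC by blast
    next
      case (insert x G)
      then obtain S S' where S: "S \<in> \<C>" "S' \<in> \<C>" "x \<in> S" "G <= S'" by auto
      from lin[OF S(1,2)] show ?case
      using S(3,4) by (fastforce intro: bexI[OF _ S(2)] bexI[OF _ S(1)])
    qed
    then obtain S where S: "S \<in> \<C>" "G <= S" by blast
    have "x \<in> ideal_gen UNIV G ==> x \<in> S" for x
      by (induction rule: ideal_gen.induct) (use idlD(1-3)[OF id[OF sub[OF S(1)]]] S(2) in blast)+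
    hence "\<Union>\<C> = S" using G(3) S(1) by blast
    thus ?thesis using sub[OF S(1)] by simp
  qed
  thus ?thesis using subset_Zorn_nonempty[of \<A>] ne that by blast
qed

text \<open>\<open>L\<close> is maximal among the ideals that contain \<open>mG\<close> and meet
  \<open>G\<close> only in \<open>mG\<close>. Maximality forces a power of every \<open>a\<close> in
  \<open>m\<close> into \<open>L\<close>, because the increasing ideals \<open>Q s\<close> become
  stationary. If \<open>g\<close> itself lies in \<open>L\<close>, it lies in \<open>mG\<close>,
  which is the last claim.\<close>

lemma krull_separation:
  fixes m J :: "'r::comm_ring_1 set"
  assumes noe: "noetherian (UNIV :: 'r set)" and m: "idl m" and J: "idl J"
  obtains L where "idl L" "!!a. a \<in> m ==> \<exists>s. a ^ s \<in> L" "J <= L" "g \<in> L ==> \<exists>a\<in>m. g - a * g \<in> J"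
proof -
  define G where "G = {r * g + j | r j. j \<in> J}"
  define mG where "mG = {g * a + j | a j. a \<in> m & j \<in> J}"
  define \<A> where "\<A> = {L. idl L & mG <= L & L \<inter> G <= mG}"
  have "\<A> ~= {}" using idl_comb[OF m J] by (auto simp: mG_def \<A>_def)
  then obtain L where LA: "L \<in> \<A>" and max: "!!X. X \<in> \<A> ==> L <= X ==> X = L"
    by (rule noetherian_maximal[OF noe]) (auto simp: \<A>_def)
  have L: "idl L" "mG <= L" "L \<inter> G <= mG" using LA by (auto simp: \<A>_def)
  have "\<exists>s. a ^ s \<in> L" if a: "a \<in> m" for a
  proof -
    define Q where "Q s = {r. a ^ s * r \<in> L}" for s
    have idQ: "idl (Q s)" for s
    proof (rule idlI)
      show "0 \<in> Q s" using idlD(1)[OF L(1)] by (simp add: Q_def)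
      show "x + y \<in> Q s" if "x \<in> Q s" "y \<in> Q s" for x y
        using idlD(2)[OF L(1), of "a ^ s * x" "a ^ s * y"] that by (simp add: Q_def distrib_left)
      show "c * x \<in> Q s" if "x \<in> Q s" for c x
        using idlD(3)[OF L(1), of "a ^ s * x" c] that by (simp add: Q_def mult.left_commute)
    qed
    have mono: "Q s <= Q (Suc s)" for s using idlD(3)[OF L(1)] by (auto simp: Q_def mult.assoc)
    obtain s where s: "!!t. Q s <= Q t ==> Q t = Q s"
    proof -
      have "range Q ~= {}" "!!J. J \<in> range Q ==> idl J" using idQ by auto
      from noetherian_maximal[OF noe this] obtain K where
        K: "K \<in> range Q" "!!X. X \<in> range Q ==> K <= X ==> X = K" by metis
      obtain s where Ks: "K = Q s" using K(1) by blast
      show ?thesis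
      proof (rule that[of s])
        show "Q t = Q s" if "Q s <= Q t" for t using K(2)[of "Q t"] that unfolding Ks by simp
      qed
    qed
    have eq: "Q (Suc s) = Q s" by (rule s[OF mono])
    \<comment> \<open>By stationarity this enlargement of \<open>L\<close> still meets
      \<open>G\<close> only in \<open>mG\<close>; hence it equals \<open>L\<close> and contains
      \<open>a ^ s\<close>.\<close>
    define X where "X = {a ^ s * r + l | r l. r \<in> UNIV & l \<in> L}"
    have "idl X" unfolding X_def by (rule idl_comb[OF _ L(1)]) (simp add: idlI)
    moreover have LX: "L <= X"
      by (fastforce simp: X_def intro: exI[of _ 0])
    moreover have "w \<in> mG" if w: "w \<in> X" "w \<in> G" for w
    proof -
      obtain l r where h: "w = a ^ s * r + l" "l \<in> L" using w by (auto simp: X_def)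
      obtain r' j where h': "w = r' * g + j" "j \<in> J" using w by (auto simp: G_def)
      have "a * w = g * (r' * a) + a * j" using h'(1) by (simp add: algebra_simps)
      hence "a * w \<in> mG" unfolding mG_def using idlD(3)[OF m a] idlD(3)[OF J h'(2)] by blast
      hence "a * w - a * l \<in> L" using L(2) idlD(3,6)[OF L(1)] h(2) by blast
      thus ?thesis using eq h idlD(2)[OF L(1)] L(3) w(2) by (fastforce simp: algebra_simps Q_def)
    qed
    ultimately have "X \<in> \<A>" using L(2) by (auto simp: \<A>_def)
    hence "X = L" using max LX by blast
    thus ?thesis using idlD(1)[OF L(1)] by (fastforce simp: X_def intro: exI[of _ 0] exI[of _ 1])
  qed
  moreover have "J <= L"
    using idlD(1)[OF m] L(2) by (fastforce simp: mG_def)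
  moreover have "\<exists>a\<in>m. g - a * g \<in> J" if "g \<in> L"
  proof -
    have "g \<in> mG" using idlD(1)[OF J] L(3) that by (fastforce simp: G_def intro: exI[of _ 1])
    then obtain a j where h: "g = a * g + j" "a \<in> m" "j \<in> J" by (auto simp: mG_def mult.commute)
    thus ?thesis by (metis add_diff_cancel_left')
  qed
  ultimately show ?thesis using that L(1) by blast
qed

section \<open>Powers of the ideal of a point\<close>

primrec mpow :: "real ^ 'n => nat => 'n::finite pfun set" where
  "mpow p 0 = UNIV"
| "mpow p (Suc k) = {\<Sum>i\<in>UNIV. (pvar i - of_real (p $ i)) * g i | g. \<forall>i. g i \<in> mpow p k}"

lemma idl_mpow: "idl (mpow p k)"
proof (induction k)
  case 0 thus ?case by (rule idlI) auto
next
  case (Suc k)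
  show ?case
  proof (rule idlI)
    show "0 \<in> mpow p (Suc k)" using idlD(1)[OF Suc] by (auto intro!: exI[of _ "\<lambda>_. 0"])
    fix x y assume "x \<in> mpow p (Suc k)" "y \<in> mpow p (Suc k)"
    then obtain g h where "x = (\<Sum>i\<in>UNIV. (pvar i - of_real (p $ i)) * g i)" "\<forall>i. g i \<in> mpow p k"
      "y = (\<Sum>i\<in>UNIV. (pvar i - of_real (p $ i)) * h i)" "\<forall>i. h i \<in> mpow p k" by auto
    hence "x + y = (\<Sum>i\<in>UNIV. (pvar i - of_real (p $ i)) * (g i + h i))" "\<forall>i. g i + h i \<in> mpow p k"
      using idlD(2)[OF Suc] by (auto simp: distrib_left sum.distrib)
    thus "x + y \<in> mpow p (Suc k)" by auto
  next
    fix a x assume "x \<in> mpow p (Suc k)"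
    then obtain g where "x = (\<Sum>i\<in>UNIV. (pvar i - of_real (p $ i)) * g i)" "\<forall>i. g i \<in> mpow p k" by auto
    hence "a * x = (\<Sum>i\<in>UNIV. (pvar i - of_real (p $ i)) * (a * g i))" "\<forall>i. a * g i \<in> mpow p k"
      using idlD(3)[OF Suc] by (auto simp: sum_distrib_left mult.left_commute)
    thus "a * x \<in> mpow p (Suc k)" by auto
  qed
qed

lemma mpow_mult: "a \<in> mpow p k ==> c \<in> mpow p l ==> a * c \<in> mpow p (k + l)"
proof (induction k arbitrary: a)
  case 0 thus ?case using idlD(3)[OF idl_mpow] by simp
next
  case (Suc k)
  then obtain g where "a = (\<Sum>i\<in>UNIV. (pvar i - of_real (p $ i)) * g i)" "\<forall>i. g i \<in> mpow p k" by auto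
  thus ?case using Suc by (auto simp: sum_distrib_right mult.assoc)
qed

lemma mpow_1: "mpow p 1 = videal {p}"
proof (rule antisym)
  show "mpow p 1 <= videal {p}" by (auto simp: videal_def)
  have "\<exists>g. f - of_real (pev f p) = (\<Sum>i\<in>UNIV. (pvar i - of_real (p $ i)) * g i)" for f :: "'a pfun"
  proof (induction f rule: pfun_induct)
    case (const c) thus ?case by (intro exI[of _ "\<lambda>_. 0"]) simp
  next
    case (var j)
    have "(\<Sum>i\<in>UNIV. (pvar i - of_real (p $ i)) * (if i = j then 1 else 0)) = pvar j - of_real (p $ j)"
      by (simp add: if_distrib[of "(*) _"] cong: if_cong)
    thus ?case by (intro exI[of _ "\<lambda>i. if i = j then 1 else 0"]) simp
  next
    case (add f g)
    then obtain a b where "f - of_real (pev f p) = (\<Sum>i\<in>UNIV. (pvar i - of_real (p $ i)) * a i)"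
      "g - of_real (pev g p) = (\<Sum>i\<in>UNIV. (pvar i - of_real (p $ i)) * b i)" by blast
    hence "(f - of_real (pev f p)) + (g - of_real (pev g p)) = (\<Sum>i\<in>UNIV. (pvar i - of_real (p $ i)) * (a i + b i))"
      by (simp only: distrib_left sum.distrib)
    thus ?case by (intro exI[of _ "\<lambda>i. a i + b i"]) (simp add: algebra_simps)
  next
    case (mult f g)
    then obtain a b where "f - of_real (pev f p) = (\<Sum>i\<in>UNIV. (pvar i - of_real (p $ i)) * a i)"
      "g - of_real (pev g p) = (\<Sum>i\<in>UNIV. (pvar i - of_real (p $ i)) * b i)" by blast
    hence "(f - of_real (pev f p)) * g + of_real (pev f p) * (g - of_real (pev g p)) =
        (\<Sum>i\<in>UNIV. (pvar i - of_real (p $ i)) * (a i * g + of_real (pev f p) * b i))"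
      by (simp only: distrib_left sum.distrib sum_distrib_left sum_distrib_right) (simp only: ac_simps)
    thus ?case by (intro exI[of _ "\<lambda>i. a i * g + of_real (pev f p) * b i"]) (simp add: algebra_simps)
  qed
  note ex = this
  show "videal {p} <= mpow p 1"
  proof
    fix f assume "f \<in> videal {p}"
    thus "f \<in> mpow p 1" using ex[of f] by (auto simp: videal_def)
  qed
qed

text \<open>Pigeonhole principle: a monomial whose degree exceeds \<open>CARD('a) * S\<close>
  contains some variable to a power of at least \<open>S\<close>.\<close>

lemma mpow_subset_ideal:
  assumes L: "idl L" and pow: "!!i. \<exists>s. (pvar i - of_real (p $ i)) ^ s \<in> L"
  shows "\<exists>k. mpow p k <= L"
proof -
  define x where "x i = pvar i - of_real (p $ i)" for i
  obtain s where s: "!!i. x i ^ s i \<in> L" using pow unfolding x_def by metis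
  define S where "S = (\<Sum>i\<in>UNIV. s i)"
  have "x i ^ S = x i ^ s i * x i ^ (S - s i)" for i
    by (simp add: S_def member_le_sum flip: power_add)
  hence S: "x i ^ S \<in> L" for i using idlD(4)[OF L s] by metis
  have key: "(!!\<gamma>. sum \<gamma> UNIV = k ==> (\<Prod>i\<in>UNIV. x i ^ (\<beta> i + \<gamma> i)) \<in> L) ==> g \<in> mpow p k ==>
      (\<Prod>i\<in>UNIV. x i ^ \<beta> i) * g \<in> L" for \<beta> k g
  proof (induction k arbitrary: \<beta> g)
    case 0
    thus ?case using 0(1)[of "\<lambda>_. 0"] idlD(4)[OF L] by simp
  next
    case (Suc k)
    obtain h where h: "g = (\<Sum>i\<in>UNIV. x i * h i)" "\<forall>i. h i \<in> mpow p k" using Suc.prems(2) by (auto simp: x_def)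
    have "(\<Prod>j\<in>UNIV. x j ^ (\<beta> j + (if j = i then 1 else 0))) * h i \<in> L" for i
    proof (rule Suc.IH)
      fix \<gamma> :: "'a => nat" assume "sum \<gamma> UNIV = k"
      hence "sum (\<lambda>j. (if j = i then 1 else 0) + \<gamma> j) UNIV = Suc k" by (simp add: sum.distrib)
      from Suc.prems(1)[OF this] show "(\<Prod>j\<in>UNIV. x j ^ (\<beta> j + (if j = i then 1 else 0) + \<gamma> j)) \<in> L"
        by (simp add: add.assoc)
    qed (use h in blast)
    moreover have "(\<Prod>j\<in>UNIV. x j ^ (\<beta> j + (if j = i then 1 else 0))) = (\<Prod>j\<in>UNIV. x j ^ \<beta> j) * x i" for i
      by (simp add: power_add prod.distrib if_distrib[of "\<lambda>k. x _ ^ k"] prod.delta cong: if_cong)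
    ultimately have "(\<Prod>j\<in>UNIV. x j ^ \<beta> j) * x i * h i \<in> L" for i by metis
    thus ?case unfolding h(1) sum_distrib_left by (intro idl_sum[OF L]) (simp add: mult.assoc)
  qed
  have "mpow p (CARD('a) * S + 1) <= L"
  proof
    fix g assume g: "g \<in> mpow p (CARD('a) * S + 1)"
    have "(\<Prod>i\<in>UNIV. x i ^ 0) * g \<in> L"
    proof (rule key[OF _ g, of "\<lambda>_. 0"])
      fix \<gamma> :: "'a => nat" assume \<gamma>: "sum \<gamma> UNIV = CARD('a) * S + 1"
      have "\<exists>i. \<gamma> i >= S"
      proof (rule ccontr)
        assume "\<not> ?thesis"
        hence "sum \<gamma> UNIV <= (\<Sum>i\<in>(UNIV :: 'a set). S)" by (intro sum_mono) (auto simp: not_le less_imp_le)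
        thus False using \<gamma> by simp
      qed
      then obtain i where i: "\<gamma> i >= S" by blast
      have "(\<Prod>j\<in>UNIV. x j ^ (0 + \<gamma> j)) = x i ^ \<gamma> i * (\<Prod>j\<in>UNIV - {i}. x j ^ \<gamma> j)"
        by (simp add: prod.remove[of UNIV i])
      also have "x i ^ \<gamma> i = x i ^ S * x i ^ (\<gamma> i - S)" using i by (simp flip: power_add)
      finally show "(\<Prod>j\<in>UNIV. x j ^ (0 + \<gamma> j)) \<in> L"
        using idlD(4)[OF L S[of i]] by (simp add: mult.assoc)
    qed
    thus "g \<in> L" by simp
  qed
  thus ?thesis by blast
qed

lemma krull_intersection:
  assumes J: "idl J" and g: "!!k. \<exists>j\<in>J. g - j \<in> mpow p k"
  shows "\<exists>u. pev u p ~= 0 & u * g \<in> J"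
proof -
  obtain L where L: "idl L" "!!a. a \<in> videal {p} ==> \<exists>s. a ^ s \<in> L" "J <= L"
      "g \<in> L ==> \<exists>a\<in>videal {p}. g - a * g \<in> J"
    using krull_separation[OF noetherian_pfun idl_primeI[OF primeI_point[of p]] J, of g] by blast
  obtain k where k: "mpow p k <= L"
    using mpow_subset_ideal[OF L(1), of p] L(2) by (auto simp: videal_def)
  obtain j where "j \<in> J" "g - j \<in> mpow p k" using g by blast
  then obtain a where a: "a \<in> videal {p}" "g - a * g \<in> J" using k L(3) idlD(2)[OF L(1)] L(4) by fastforce
  thus ?thesis by (intro exI[of _ "1 - a"]) (auto simp: videal_def algebra_simps)
qed

subsection \<open>Walls define discrete valuation rings\<close>

context crossing_at
begin

text \<open>Modulo \<open>y i\<close> and terms of higher order, the Euler operator \<open>E\<close>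
  multiplies terms of order \<open>k\<close> at \<open>p\<close> by \<open>k\<close> times the value
  of \<open>b\<close>. Since \<open>Q\<close> is stable, \<open>E\<close> also raises the order of
  elements of \<open>Q\<close> modulo \<open>J\<close>. Hence elements of \<open>Q\<close> lie in
  \<open>J\<close> up to every order, and Krull's theorem applies.\<close>

lemma divisor_principal:
  assumes Q: "Q <= videal {p}" and i: "i < n"
    and st: "!!l g. l < n ==> l ~= i ==> g \<in> Q ==> \<Delta> l g \<in> Q" and g: "g \<in> Q"
  shows "\<exists>u r. pev u p ~= 0 & u * g - y i * r \<in> I"
proof -
  define J where "J = {y i * r + f | r f. r \<in> UNIV & f \<in> I}"
  have I: "idl I" by (rule idl_primeI[OF prime_I])
  have J: "idl J" unfolding J_def by (rule idl_comb[OF _ I]) (simp add: idlI)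
  have IJ: "I <= J"
    by (auto simp: J_def exI[of _ 0])
  have yJ: "y i * r \<in> J" for r unfolding J_def using idlD(1)[OF I] by (intro CollectI exI[of _ r] exI[of _ 0]) simp
  define X where "X = {..<n} - {i}"
  define E where "E g = (\<Sum>l\<in>X. y l * \<Delta> l g)" for g
  have Eadd: "E (f + g) = E f + E g" for f g
    unfolding E_def sum.distrib[symmetric] by (intro sum.cong refl) (simp add: X_def derivationD(1)[OF deriv] distrib_left)
  have Emult: "E (f * g) = E f * g + f * E g" for f g
    unfolding E_def sum_distrib_left sum_distrib_right sum.distrib[symmetric]
    by (intro sum.cong refl) (simp add: X_def derivationD(2)[OF deriv] algebra_simps)
  have E0: "E 0 = 0" unfolding E_def by (intro sum.neutral) (simp add: X_def derivationD(4)[OF deriv])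
  have Esum: "E (sum f S) = (\<Sum>x\<in>S. E (f x))" for f :: "nat => 'n pfun" and S
    by (induction S rule: infinite_finite_induct) (auto simp: Eadd E0)
  have Esum': "E (sum f S) = (\<Sum>x\<in>S. E (f x))" for f :: "'n => 'n pfun" and S
    by (induction S rule: infinite_finite_induct) (auto simp: Eadd E0)
  have Ey: "E (y j) = (if j = i then 0 else y j * b)" if j: "j < n" for j
  proof -
    have "E (y j) = (\<Sum>l\<in>X. if l = j then y l * b else 0)"
      unfolding E_def by (intro sum.cong refl) (use dual[OF j] in "auto simp: X_def")
    also have "\<dots> = (if j \<in> X then y j * b else 0)" by (simp add: X_def)
    finally show ?thesis using j by (simp add: X_def)
  qed
  have EI: "E f \<in> I" if "f \<in> I" for f
    unfolding E_def by (intro idl_sum[OF I] idlD(3)[OF I] stable_I) (use that in "auto simp: X_def")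
  have EJ: "E f \<in> J" if "f \<in> J" for f
    using \<open>f \<in> J\<close> Ey[OF i] EI by (fastforce simp: J_def Eadd Emult)
  define JK where "JK k = {f. \<exists>j\<in>J. f - j \<in> mpow p k}" for k
  have JK: "idl (JK k)" for k
  proof -
    have eq: "JK k = {1 * a + j | a j. a \<in> mpow p k & j \<in> J}"
    proof (rule Set.set_eqI, rule iffI)
      fix f assume "f \<in> JK k"
      then obtain j where "j \<in> J" "f - j \<in> mpow p k" by (auto simp: JK_def)
      thus "f \<in> {1 * a + j | a j. a \<in> mpow p k & j \<in> J}" by (intro CollectI exI[of _ "f - j"] exI[of _ j]) simp
    qed (auto simp: JK_def intro!: bexI)
    show ?thesis unfolding eq by (rule idl_comb[OF idl_mpow J])
  qed
  have J_JK: "f \<in> JK k" if "f \<in> J" for f k using that idlD(1)[OF idl_mpow] by (auto simp: JK_def intro!: bexI[of _ f])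
  have m_JK: "f \<in> JK k" if "f \<in> mpow p k" for f k using that idlD(1)[OF J] by (auto simp: JK_def intro!: bexI[of _ 0])
  have JK_mult: "a * c \<in> JK (k + l)" if a: "a \<in> JK k" and c: "c \<in> mpow p l" for a c k l
  proof -
    obtain j where j: "j \<in> J" "a - j \<in> mpow p k" using a by (auto simp: JK_def)
    show ?thesis using mpow_mult[OF j(2) c] idlD(4)[OF J j(1)] by (auto simp: algebra_simps JK_def)
  qed
  have m1: "f \<in> mpow p 1 \<longleftrightarrow> pev f p = 0" for f unfolding mpow_1 by (simp add: videal_def)
  have m2: "a * c \<in> mpow p 2" if "pev a p = 0" "pev c p = 0" for a c
    using mpow_mult[of a p 1 c 1] that unfolding m1 by (simp add: numeral_2_eq_2)
  have Ep: "pev (E f) p = 0" for f unfolding E_def using y_p by (simp add: X_def)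
  have canc: "f \<in> JK k" if "of_real c * f \<in> JK k" "c ~= 0" for f c k
    using idlD(3)[OF JK that(1), of "of_real (inverse c)"] that(2) by (simp flip: mult.assoc of_real_mult)
  \<comment> \<open>Order one: up to a unit \<open>a\<close> is a combination of the
    \<open>y j\<close>, on which \<open>E\<close> is explicit. The unit and \<open>b\<close> are
    replaced by their values at \<open>p\<close> at the cost of terms of second order.\<close>
  have E1: "E a - of_real (pev b p) * a \<in> JK 2" if a: "pev a p = 0" for a
  proof -
    obtain u c where uc: "pev u p ~= 0" "u * a - (\<Sum>j<n. c j * y j) \<in> I" using gen[OF a] by blast
    define f where "f = u * a - (\<Sum>j<n. c j * y j)"
    have fI: "f \<in> I" using uc by (simp add: f_def)
    have s: "E (\<Sum>j<n. c j * y j) - (\<Sum>j<n. c j * y j) * b \<in> JK 2"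
    proof -
      have "E (\<Sum>j<n. c j * y j) - (\<Sum>j<n. c j * y j) * b = (\<Sum>j<n. E (c j) * y j + c j * (E (y j) - y j * b))"
        by (simp add: Esum Emult sum_subtractf sum.distrib sum_distrib_left algebra_simps)
      also have "\<dots> \<in> JK 2"
      proof (intro idl_sum[OF JK] idlD(2)[OF JK])
        fix j assume "j \<in> {..<n}"
        thus "E (c j) * y j \<in> JK 2" using y_p Ep by (intro m_JK m2) auto
        have "c j * (E (y j) - y j * b) \<in> J" if "j < n"
        proof (cases "j = i")
          case True
          thus ?thesis using Ey[OF i] yJ[of "- c j * b"] by (simp add: algebra_simps)
        qed (use Ey[OF that] idlD(1)[OF J] in simp)
        thus "c j * (E (y j) - y j * b) \<in> JK 2" using \<open>j \<in> {..<n}\<close> J_JK by auto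
      qed
      finally show ?thesis .
    qed
    have "E (u * a) - u * a * b = (E f - f * b) + (E (\<Sum>j<n. c j * y j) - (\<Sum>j<n. c j * y j) * b)" by (smt (verit) f_def Eadd algebra_simps)
    also have "\<dots> \<in> JK 2"
      using idlD(2)[OF JK J_JK[OF subsetD[OF IJ idlD(6)[OF I EI[OF fI] idlD(4)[OF I fI, of b]]]] s] .
    finally have 1: "E (u * a) - u * a * b \<in> JK 2" .
    have "of_real (pev u p) * (E a - of_real (pev b p) * a) =
      (E (u * a) - u * a * b) - E u * a - (u - of_real (pev u p)) * E a + u * (a * (b - of_real (pev b p))) + (u - of_real (pev u p)) * a * of_real (pev b p)"
      unfolding Emult by (simp add: algebra_simps)
    also have "\<dots> \<in> JK 2"
      by (intro idlD(2,6)[OF JK] 1 m_JK idlD(3,4)[OF idl_mpow] m2) (use Ep a in auto)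
    finally show ?thesis using canc uc(1) by blast
  qed
  have E2: "E g - of_real (real k * pev b p) * g \<in> JK (Suc k)" if "g \<in> mpow p k" for g k
    using that
  proof (induction k arbitrary: g)
    case 0
    have "E g \<in> mpow p 1" unfolding m1 by (rule Ep)
    thus ?case using m_JK[of "E g" 1] by simp
  next
    case (Suc k)
    define x where "x l = pvar l - of_real (p $ l)" for l
    obtain h where h: "g = (\<Sum>l\<in>UNIV. x l * h l)" "\<forall>l. h l \<in> mpow p k" using Suc.prems by (auto simp: x_def)
    have xp: "pev (x l) p = 0" for l by (simp add: x_def)
    have "E g - of_real (real (Suc k) * pev b p) * g =
        (\<Sum>l\<in>UNIV. (E (x l) - of_real (pev b p) * x l) * h l + (E (h l) - of_real (real k * pev b p) * h l) * x l)"
      unfolding h(1) by (simp add: Esum' Emult sum_subtractf sum.distrib sum_distrib_left algebra_simps)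
    also have "\<dots> \<in> JK (Suc (Suc k))"
    proof (intro idl_sum[OF JK] idlD(2)[OF JK])
      fix l
      show "(E (x l) - of_real (pev b p) * x l) * h l \<in> JK (Suc (Suc k))"
        using JK_mult[OF E1[OF xp[of l]], of "h l" k] h(2) by simp
      have "x l \<in> mpow p 1" unfolding m1 by (rule xp)
      thus "(E (h l) - of_real (real k * pev b p) * h l) * x l \<in> JK (Suc (Suc k))"
        using JK_mult[OF Suc.IH[of "h l"], of "x l" 1] h(2) by simp
    qed
    finally show ?case .
  qed
  have "g \<in> Q ==> g \<in> JK k" for k g
  proof (induction k arbitrary: g)
    case 0 thus ?case using idlD(1)[OF J] by (auto simp: JK_def)
  next
    case (Suc k)
    \<comment> \<open>For \<open>k = 0\<close> the factor \<open>k\<close> times the value of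
      \<open>b\<close> vanishes; there the inclusion of \<open>Q\<close> in the ideal of
      \<open>p\<close> is used instead.\<close>
    show ?case
    proof (cases "k = 0")
      case True
      thus ?thesis using Suc.prems Q m_JK[of g 1] unfolding m1 by (auto simp: videal_def)
    next
      case False
      obtain j where j: "j \<in> J" "g - j \<in> mpow p k" using Suc by (auto simp: JK_def)
      have "E g \<in> JK (Suc k)" unfolding E_def
      proof (intro idl_sum[OF JK])
        fix l assume "l \<in> X"
        hence l: "l < n" "l ~= i" by (auto simp: X_def)
        have "\<Delta> l g * y l \<in> JK (k + 1)"
          by (rule JK_mult[OF Suc.IH]) (use st l Suc.prems y_p m1[of "y l"] in auto)
        thus "y l * \<Delta> l g \<in> JK (Suc k)" by (simp add: mult.commute)
      qed
      hence EgJ: "E g \<in> JK (Suc k)" .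
      have "E g - (E (g - j) - of_real (real k * pev b p) * (g - j)) - E j + of_real (real k * pev b p) * j
          = of_real (real k * pev b p) * g" by (smt (verit) Eadd algebra_simps)
      hence "of_real (real k * pev b p) * g \<in> JK (Suc k)" by (metis idlD(2)[OF JK idlD(6)[OF JK idlD(6)[OF JK EgJ E2[OF j(2)]] J_JK[OF EJ[OF j(1)]]] J_JK[OF idlD(3)[OF J j(1)]]])
      thus ?thesis using canc[of "real k * pev b p"] False b_p by simp
    qed
  qed
  hence "\<exists>j\<in>J. g - j \<in> mpow p k" for k using g by (auto simp: JK_def)
  then obtain u where u: "pev u p ~= 0" "u * g \<in> J" using krull_intersection[OF J] by blast
  then obtain r f where "u * g = y i * r + f" "f \<in> I" by (auto simp: J_def)
  thus ?thesis using u(1) by (intro exI[of _ u] exI[of _ r]) simp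
qed

lemma dord_cong:
  assumes P: "primeI P" and D: "derivation D" and fg: "f - g \<in> dlift D P"
  shows "dord D P f = dord D P g"
proof -
  have "(D ^^ m) f \<in> P \<longleftrightarrow> (D ^^ m) g \<in> P" for m
    using derivation_funpow(1)[OF D, of m g "f - g"] fg primeID(10)[OF P] by (auto simp: dlift_def)
  thus ?thesis by (simp add: dord_def)
qed

text \<open>Splitting off a factor \<open>y i\<close> lowers the order \<open>dord\<close> along
  \<open>\<Delta> i\<close> by one, so the process ends at a factor outside
  \<open>Q\<close>.\<close>

lemma wall_factor:
  assumes Q: "wall_ideal Q" "Q <= videal {p}"
  obtains z where "z \<in> Q" "!!f. f ~: I ==> \<exists>k u f'. u ~: Q & f' ~: Q & u * f - z ^ k * f' \<in> I"
proof -
  obtain i where i: "i < n" "y i \<in> Q" "!!l g. l < n ==> l ~= i ==> g \<in> Q ==> \<Delta> l g \<in> Q" "dlift (\<Delta> i) Q = I"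
    using wall_structure[OF Q] by metis
  have Qp: "primeI Q" using Q by (simp add: wall_ideal_def)
  have D: "derivation (\<Delta> i)" using deriv i by blast
  have un: "u ~: Q" if "pev u p ~= 0" for u using that Q(2) by (auto simp: videal_def)
  have bQ: "b ~: Q" by (rule un[OF b_p])
  have dy: "dord (\<Delta> i) Q (y i) = 1" by (rule dord_eqI) (use i dual bQ in auto)
  have "\<exists>k u f'. u ~: Q & f' ~: Q & u * f - y i ^ k * f' \<in> I" if "f ~: I" for f
    using that
  proof (induction "dord (\<Delta> i) Q f" arbitrary: f rule: less_induct)
    case (less f)
    show ?case
    proof (cases "f \<in> Q")
      case False
      thus ?thesis using primeID(2)[OF Qp] primeID(1)[OF prime_I]
        by (intro exI[of _ 0] exI[of _ 1] exI[of _ f]) simp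
    next
      case True
      obtain u r where ur: "pev u p ~= 0" "u * f - y i * r \<in> I"
        using divisor_principal[OF Q(2) i(1,3) True] by blast
      have uI: "u ~: I" using ur(1) I_sub_mp by (auto simp: videal_def)
      have yrI: "y i * r ~: I"
      proof
        assume yr: "y i * r \<in> I"
        show False using primeID(6)[OF prime_I] uI less.prems primeID(3)[OF prime_I ur(2) yr] by auto
      qed
      have rI: "r ~: I" using yrI primeID(4)[OF prime_I] by blast
      have "dord (\<Delta> i) Q (u * f) = dord (\<Delta> i) Q f"
        using dlift_mult(2)[OF D Qp, of u f] i(4) uI less.prems dord_0[OF un[OF ur(1)]] by simp
      moreover have "dord (\<Delta> i) Q (y i * r) = 1 + dord (\<Delta> i) Q r"
        using dlift_mult(2)[OF D Qp, of "y i" r] i(4) rI y_notin_I[OF i(1)] dy by simp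
      moreover have "dord (\<Delta> i) Q (u * f) = dord (\<Delta> i) Q (y i * r)"
        by (rule dord_cong[OF Qp D]) (use ur(2) i(4) in simp)
      ultimately have "dord (\<Delta> i) Q r < dord (\<Delta> i) Q f" by simp
      from less.hyps[OF this rI] obtain k v f' where h: "v ~: Q" "f' ~: Q" "v * r - y i ^ k * f' \<in> I" by blast
      have "v * (u * f - y i * r) + y i * (v * r - y i ^ k * f') \<in> I"
        by (intro primeID(3)[OF prime_I] primeID(4)[OF prime_I] ur(2) h(3))
      hence "v * u * f - y i ^ Suc k * f' \<in> I" by (simp add: algebra_simps)
      thus ?thesis using primeID(6)[OF Qp] h(1) un[OF ur(1)] h(2) by blast
    qed
  qed
  thus ?thesis using that i(2) by blast
qed

end

lemma (in crossing) wall_dvr: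
  assumes Q: "wall_ideal Q"
  obtains z where "z \<in> Q" "!!f. f ~: I ==> \<exists>k u f'. u ~: Q & f' ~: Q & u * f - z ^ k * f' \<in> I"
proof -
  have Q': "primeI Q" "I \<subset> Q" "videal (vzeros Q) = Q" using Q by (auto simp: wall_ideal_def)
  then obtain p where p: "p \<in> vzeros Q" using primeID(2)[OF Q'(1)] by (auto simp: videal_def)
  hence pM: "p \<in> M" using Q'(2) by (auto simp: M_eq vzeros_def)
  have "Q <= videal {p}" using p by (auto simp: vzeros_def videal_def)
  moreover obtain y \<Delta> b where "crossing_at I M n F \<phi> \<psi> p y \<Delta> b" using ex_at[OF pM] by blast
  ultimately show ?thesis using crossing_at.wall_factor[OF _ Q] that by metis
qed

subsection \<open>Rings of functions\<close>

lemma function_ring_simps: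
  "carrier (function_ring M F) = (\<lambda>f. restrict f M) ` F"
  "\<one>\<^bsub>function_ring M F\<^esub> = (\<lambda>x\<in>M. 1)" "\<zero>\<^bsub>function_ring M F\<^esub> = (\<lambda>x\<in>M. 0)"
  "a \<otimes>\<^bsub>function_ring M F\<^esub> c = (\<lambda>x\<in>M. a x * c x)" "a \<oplus>\<^bsub>function_ring M F\<^esub> c = (\<lambda>x\<in>M. a x + c x)"
  by (simp_all add: function_ring_def)

lemma cring_function_ring:
  fixes M :: "'a set"
  assumes add: "!!f g. f \<in> F ==> g \<in> F ==> (\<lambda>x\<in>M. f x + g x) \<in> carrier (function_ring M F)"
    and mult: "!!f g. f \<in> F ==> g \<in> F ==> (\<lambda>x\<in>M. f x * g x) \<in> carrier (function_ring M F)"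
    and const: "!!c. (\<lambda>x. c) \<in> F"
  shows "cring (function_ring M F)"
proof -
  let ?R = "function_ring M F"
  have carr: "x \<oplus>\<^bsub>?R\<^esub> y \<in> carrier ?R" "x \<otimes>\<^bsub>?R\<^esub> y \<in> carrier ?R" if "x \<in> carrier ?R" "y \<in> carrier ?R" for x y
    using that add mult by (auto simp: function_ring_simps cong: restrict_cong)
  have const': "(\<lambda>x\<in>M. c) \<in> carrier ?R" for c using const by (auto simp: function_ring_simps)
  have neg: "\<exists>y\<in>carrier ?R. y \<oplus>\<^bsub>?R\<^esub> x = \<zero>\<^bsub>?R\<^esub>" if "x \<in> carrier ?R" for x
    using carr(2)[OF const' that, of "- 1"] by (rule bexI[rotated]) (auto simp: function_ring_simps restrict_def)
  show ?thesis
    by (intro cringI abelian_groupI comm_monoidI carr neg)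
      (use const' in "auto simp: function_ring_simps restrict_def algebra_simps")
qed

lemma cring_polynomial_ring: "cring (polynomial_ring M)"
  unfolding polynomial_ring_def by (rule cring_function_ring) (auto simp: function_ring_simps)

definition rfrac :: "(real ^ 'n) set => 'n::finite pfun => 'n pfun => real ^ 'n => real" where
  "rfrac M f g = (\<lambda>x\<in>M. pev f x / pev g x)"

lemma carrier_regular_ring: "carrier (regular_ring M) = {rfrac M f g | f g. \<forall>x\<in>M. pev g x ~= 0}"
proof
  show "carrier (regular_ring M) <= {rfrac M f g | f g. \<forall>x\<in>M. pev g x ~= 0}"
  proof
    fix a assume "a \<in> carrier (regular_ring M)"
    then obtain p q where h: "real_polynomial_function p" "real_polynomial_function q" "\<forall>x\<in>M. q x ~= 0"
      "a = restrict (\<lambda>x. p x / q x) M" by (auto simp: regular_ring_def function_ring_simps)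
    thus "a \<in> {rfrac M f g | f g. \<forall>x\<in>M. pev g x ~= 0}"
      by (intro CollectI exI[of _ "Pfun p"] exI[of _ "Pfun q"]) (simp add: pev_Pfun rfrac_def)
  qed
  show "{rfrac M f g | f g. \<forall>x\<in>M. pev g x ~= 0} <= carrier (regular_ring M)"
  proof
    fix a assume "a \<in> {rfrac M f g | f g. \<forall>x\<in>M. pev g x ~= 0}"
    then obtain f g where h: "a = restrict (\<lambda>x. pev f x / pev g x) M" "\<forall>x\<in>M. pev g x ~= 0" by (auto simp: rfrac_def)
    show "a \<in> carrier (regular_ring M)"
      unfolding regular_ring_def function_ring_simps
    using h(2) rpf_pev[of f] rpf_pev[of g] h(1) by auto
  qed
qed

lemma regular_ring_simps:
  "\<one>\<^bsub>regular_ring M\<^esub> = (\<lambda>x\<in>M. 1)" "\<zero>\<^bsub>regular_ring M\<^esub> = (\<lambda>x\<in>M. 0)"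
  "a \<otimes>\<^bsub>regular_ring M\<^esub> c = (\<lambda>x\<in>M. a x * c x)" "a \<oplus>\<^bsub>regular_ring M\<^esub> c = (\<lambda>x\<in>M. a x + c x)"
  by (simp_all add: regular_ring_def function_ring_simps)

lemma cring_regular_ring:
  fixes M :: "(real ^ 'n) set"
  shows "cring (regular_ring M)"
  unfolding regular_ring_def
proof (rule cring_function_ring)
  let ?F = "{\<lambda>x. p x / q x | p q. real_polynomial_function p & real_polynomial_function q & (\<forall>x\<in>M. q x ~= 0)}"
  fix f g assume "f \<in> ?F" "g \<in> ?F"
  then obtain p q p' q' where h: "real_polynomial_function p" "real_polynomial_function q" "\<forall>x\<in>M. q x ~= 0" "f = (\<lambda>x. p x / q x)"
    "real_polynomial_function p'" "real_polynomial_function q'" "\<forall>x\<in>M. q' x ~= 0" "g = (\<lambda>x. p' x / q' x)" by blast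
  have eq: "(\<lambda>x\<in>M. f x + g x) = restrict (\<lambda>x. (p x * q' x + p' x * q x) / (q x * q' x)) M"
    unfolding h(4) h(8) by (rule restrict_ext) (use h(3,7) in "simp add: add_frac_eq")
  show "(\<lambda>x\<in>M. f x + g x) \<in> carrier (function_ring M ?F)" using h(1-3,5-7) by (fastforce simp: function_ring_simps eq)
  show "(\<lambda>x\<in>M. f x * g x) \<in> carrier (function_ring M ?F)" using h(1-3,5-7) by (fastforce simp: h(4) h(8) function_ring_simps)
next
  fix c :: real
  show "(\<lambda>x. c) \<in> {\<lambda>x. p x / q x | p q. real_polynomial_function p & real_polynomial_function q & (\<forall>x\<in>M. q x ~= 0)}"
    by (intro CollectI exI[of _ "\<lambda>x. c"] exI[of _ "\<lambda>x. 1"]) auto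
qed

subsection \<open>The quotient field\<close>

context domain
begin

lemma equiv_frac_rel: "equiv (carrier R \<times> (carrier R - {\<zero>})) (frac_rel R)"
proof (rule equivI)
  show "frac_rel R <= (carrier R \<times> (carrier R - {\<zero>})) \<times> carrier R \<times> (carrier R - {\<zero>})"
    by (auto simp: frac_rel_def)
  show "refl_on (carrier R \<times> (carrier R - {\<zero>})) (frac_rel R)" by (auto simp: refl_on_def frac_rel_def)
  show "sym (frac_rel R)" by (auto simp: sym_def frac_rel_def)
  show "trans (frac_rel R)"
  proof (rule transI)
    fix x y z assume "(x, y) \<in> frac_rel R" "(y, z) \<in> frac_rel R"
    then obtain a b c d e f where h: "x = (a, b)" "y = (c, d)" "z = (e, f)"
      "a \<in> carrier R" "c \<in> carrier R" "e \<in> carrier R" "b \<in> carrier R - {\<zero>}" "d \<in> carrier R - {\<zero>}" "f \<in> carrier R - {\<zero>}"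
      "a \<otimes> d = c \<otimes> b" "c \<otimes> f = e \<otimes> d" by (auto simp: frac_rel_def)
    have "(a \<otimes> f) \<otimes> d = (a \<otimes> d) \<otimes> f" using h(4-9) by (simp add: m_ac)
    also have "\<dots> = (c \<otimes> f) \<otimes> b" unfolding h(10) using h(4-9) by (simp add: m_ac)
    also have "\<dots> = (e \<otimes> b) \<otimes> d" unfolding h(11) using h(4-9) by (simp add: m_ac)
    finally have "a \<otimes> f = e \<otimes> b" using h m_rcancel[of d "a \<otimes> f" "e \<otimes> b"] by simp
    thus "(x, z) \<in> frac_rel R" using h by (simp add: frac_rel_def)
  qed
qed

lemma fraction_eq:
  assumes "a \<in> carrier R" "c \<in> carrier R" "b \<in> carrier R - {\<zero>}" "d \<in> carrier R - {\<zero>}"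
  shows "fraction R a b = fraction R c d \<longleftrightarrow> a \<otimes> d = c \<otimes> b"
  using assms eq_equiv_class_iff[OF equiv_frac_rel] by (auto simp: fraction_def frac_rel_def)

lemma fraction_mem: "x \<in> fraction R a b ==> \<exists>a' b'. x = (a', b') & a' \<in> carrier R & b' \<in> carrier R - {\<zero>} & a \<otimes> b' = a' \<otimes> b"
  by (auto simp: fraction_def frac_rel_def)

lemma fraction_self: "a \<in> carrier R ==> b \<in> carrier R - {\<zero>} ==> (a, b) \<in> fraction R a b"
  by (auto simp: fraction_def frac_rel_def)

lemma Un_const: "x \<in> X ==> (!!y. y \<in> X ==> g y = c) ==> (\<Union>y\<in>X. g y) = c"
  by auto

text \<open>The operations of \<open>frac_field\<close> are unions over all representatives;
  independence of the representatives collapses such a union to one class.\<close>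

lemma UN_fractions:
  assumes a: "a \<in> carrier R" "b \<in> carrier R - {\<zero>}" and c: "c \<in> carrier R" "d \<in> carrier R - {\<zero>}"
    and key: "!!a' b' c' d'. a' \<in> carrier R ==> b' \<in> carrier R - {\<zero>} ==> a \<otimes> b' = a' \<otimes> b ==>
      c' \<in> carrier R ==> d' \<in> carrier R - {\<zero>} ==> c \<otimes> d' = c' \<otimes> d ==> h a' b' c' d' = X"
  shows "(\<Union>(a', b')\<in>fraction R a b. \<Union>(c', d')\<in>fraction R c d. h a' b' c' d') = X"
proof (rule Un_const[OF fraction_self[OF a]])
  fix x assume "x \<in> fraction R a b"
  then obtain a' b' where x: "x = (a', b')" "a' \<in> carrier R" "b' \<in> carrier R - {\<zero>}" "a \<otimes> b' = a' \<otimes> b"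
    using fraction_mem by blast
  show "(case x of (a', b') => \<Union>(c', d')\<in>fraction R c d. h a' b' c' d') = X"
    unfolding x(1) prod.case
  proof (rule Un_const[OF fraction_self[OF c]])
    fix z assume "z \<in> fraction R c d"
    then obtain c' d' where z: "z = (c', d')" "c' \<in> carrier R" "d' \<in> carrier R - {\<zero>}" "c \<otimes> d' = c' \<otimes> d"
      using fraction_mem by blast
    show "(case z of (c', d') => h a' b' c' d') = X" unfolding z(1) prod.case by (rule key[OF x(2-4) z(2-4)])
  qed
qed

lemma nz_mult: "b \<in> carrier R - {\<zero>} ==> d \<in> carrier R - {\<zero>} ==> b \<otimes> d \<in> carrier R - {\<zero>}"
  using integral by auto

lemma frac_field_mult:
  assumes a: "a \<in> carrier R" "b \<in> carrier R - {\<zero>}" and c: "c \<in> carrier R" "d \<in> carrier R - {\<zero>}"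
  shows "fraction R a b \<otimes>\<^bsub>frac_field R\<^esub> fraction R c d = fraction R (a \<otimes> c) (b \<otimes> d)"
proof -
  have "fraction R (a' \<otimes> c') (b' \<otimes> d') = fraction R (a \<otimes> c) (b \<otimes> d)"
    if "a' \<in> carrier R" "b' \<in> carrier R - {\<zero>}" "a \<otimes> b' = a' \<otimes> b" "c' \<in> carrier R" "d' \<in> carrier R - {\<zero>}" "c \<otimes> d' = c' \<otimes> d"
    for a' b' c' d'
  proof -
    have "(a' \<otimes> c') \<otimes> (b \<otimes> d) = (a' \<otimes> b) \<otimes> (c' \<otimes> d)" using that(1,2,4,5) a c by (simp add: m_ac)
    also have "\<dots> = (a \<otimes> b') \<otimes> (c \<otimes> d')" using that by simp
    also have "\<dots> = (a \<otimes> c) \<otimes> (b' \<otimes> d')" using that(1,2,4,5) a c by (simp add: m_ac)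
    finally show ?thesis using that a c nz_mult[of b' d'] nz_mult[of b d] by (subst fraction_eq) auto
  qed
  from UN_fractions[OF a c this] show ?thesis by (simp add: frac_field_def)
qed

lemma frac_field_add:
  assumes a: "a \<in> carrier R" "b \<in> carrier R - {\<zero>}" and c: "c \<in> carrier R" "d \<in> carrier R - {\<zero>}"
  shows "fraction R a b \<oplus>\<^bsub>frac_field R\<^esub> fraction R c d = fraction R (a \<otimes> d \<oplus> c \<otimes> b) (b \<otimes> d)"
proof -
  have "fraction R (a' \<otimes> d' \<oplus> c' \<otimes> b') (b' \<otimes> d') = fraction R (a \<otimes> d \<oplus> c \<otimes> b) (b \<otimes> d)"
    if h: "a' \<in> carrier R" "b' \<in> carrier R - {\<zero>}" "a \<otimes> b' = a' \<otimes> b" "c' \<in> carrier R" "d' \<in> carrier R - {\<zero>}" "c \<otimes> d' = c' \<otimes> d"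
    for a' b' c' d'
  proof -
    have "(a' \<otimes> d' \<oplus> c' \<otimes> b') \<otimes> (b \<otimes> d) = (a' \<otimes> b) \<otimes> (d \<otimes> d') \<oplus> (c' \<otimes> d) \<otimes> (b \<otimes> b')"
      using h(1,2,4,5) a c by (simp add: l_distr r_distr m_ac)
    also have "\<dots> = (a \<otimes> b') \<otimes> (d \<otimes> d') \<oplus> (c \<otimes> d') \<otimes> (b \<otimes> b')" using h by simp
    also have "\<dots> = (a \<otimes> d \<oplus> c \<otimes> b) \<otimes> (b' \<otimes> d')" using h(1,2,4,5) a c by (simp add: l_distr r_distr m_ac)
    finally show ?thesis using h a c nz_mult[of b' d'] nz_mult[of b d] by (subst fraction_eq) auto
  qed
  from UN_fractions[OF a c this] show ?thesis by (simp add: frac_field_def)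
qed

end

lemma frac_field_simps:
  "carrier (frac_field R) = {fraction R a b | a b. a \<in> carrier R & b \<in> carrier R - {\<zero>\<^bsub>R\<^esub>}}"
  "\<one>\<^bsub>frac_field R\<^esub> = fraction R \<one>\<^bsub>R\<^esub> \<one>\<^bsub>R\<^esub>" "\<zero>\<^bsub>frac_field R\<^esub> = fraction R \<zero>\<^bsub>R\<^esub> \<one>\<^bsub>R\<^esub>"
  by (auto simp: frac_field_def quotient_def fraction_def)

lemma localization_simps:
  "carrier (localization R p) = {fraction R a b | a b. a \<in> carrier R & b \<in> carrier R - p}"
  "a \<otimes>\<^bsub>localization R p\<^esub> c = a \<otimes>\<^bsub>frac_field R\<^esub> c" "a \<oplus>\<^bsub>localization R p\<^esub> c = a \<oplus>\<^bsub>frac_field R\<^esub> c"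
  "\<one>\<^bsub>localization R p\<^esub> = \<one>\<^bsub>frac_field R\<^esub>" "\<zero>\<^bsub>localization R p\<^esub> = \<zero>\<^bsub>frac_field R\<^esub>"
  by (simp_all add: localization_def)

locale irreducible_variety =
  fixes M :: "(real ^ 'n::finite) set" and I :: "'n pfun set"
  assumes I_eq: "I = videal M" and prime_I: "primeI I"
begin

abbreviation "RR \<equiv> regular_ring M"
abbreviation "KK \<equiv> function_field M"

definition rs :: "'n pfun => real ^ 'n => real" where
  "rs f = restrict (pev f) M"

lemma rs_carrier: "rs f \<in> carrier RR"
  unfolding carrier_regular_ring by (intro CollectI exI[of _ f] exI[of _ 1]) (simp add: rs_def rfrac_def)

lemma rs_ops: "rs f \<otimes>\<^bsub>RR\<^esub> rs g = rs (f * g)" "rs f \<oplus>\<^bsub>RR\<^esub> rs g = rs (f + g)" "rs 1 = \<one>\<^bsub>RR\<^esub>" "rs 0 = \<zero>\<^bsub>RR\<^esub>"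
  by (auto simp: rs_def regular_ring_simps restrict_def)

lemma rs_eq: "rs f = rs g \<longleftrightarrow> f - g \<in> I"
  by (auto simp: rs_def I_eq videal_def restrict_def fun_eq_iff)

lemma rs_zero: "rs f = \<zero>\<^bsub>RR\<^esub> \<longleftrightarrow> f \<in> I"
  unfolding rs_ops(4)[symmetric] rs_eq by simp

lemma denom_notin: "\<forall>x\<in>M. pev q x ~= 0 ==> q ~: I"
  using primeID(2)[OF prime_I] by (auto simp: I_eq videal_def)

lemma rfrac_zero: "\<forall>x\<in>M. pev q x ~= 0 ==> rfrac M f q = \<zero>\<^bsub>RR\<^esub> \<longleftrightarrow> f \<in> I"
  by (auto simp: rfrac_def I_eq videal_def regular_ring_simps restrict_def fun_eq_iff)

lemma domain_RR: "domain RR"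
proof (rule domain.intro[OF cring_regular_ring domain_axioms.intro])
  show "\<one>\<^bsub>RR\<^esub> ~= \<zero>\<^bsub>RR\<^esub>" unfolding rs_ops(3)[symmetric] rs_zero using primeID(2)[OF prime_I] .
  fix a c assume h: "a \<otimes>\<^bsub>RR\<^esub> c = \<zero>\<^bsub>RR\<^esub>" "a \<in> carrier RR" "c \<in> carrier RR"
  obtain f q g r where fg: "a = rfrac M f q" "c = rfrac M g r" "\<forall>x\<in>M. pev q x ~= 0" "\<forall>x\<in>M. pev r x ~= 0"
    using h(2,3) unfolding carrier_regular_ring by blast
  have "a \<otimes>\<^bsub>RR\<^esub> c = rfrac M (f * g) (q * r)"
    unfolding fg by (auto simp: rfrac_def regular_ring_simps restrict_def)
  thus "a = \<zero>\<^bsub>RR\<^esub> | c = \<zero>\<^bsub>RR\<^esub>" using h(1) fg rfrac_zero primeID(6)[OF prime_I] by simp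
qed

text \<open>Every element of the function field is a quotient of polynomial functions, which is why
  sign functions on \<open>pfun\<close> suffice.\<close>

definition Fr :: "'n pfun => 'n pfun => ((real ^ 'n => real) \<times> (real ^ 'n => real)) set" where
  "Fr f g = fraction RR (rs f) (rs g)"

lemma rs_nz: "g ~: I ==> rs g \<in> carrier RR - {\<zero>\<^bsub>RR\<^esub>}"
  using rs_carrier rs_zero by blast

lemma Fr_eq: "g ~: I ==> g' ~: I ==> Fr f g = Fr f' g' \<longleftrightarrow> f * g' - f' * g \<in> I"
  unfolding Fr_def using domain.fraction_eq[OF domain_RR rs_carrier rs_carrier rs_nz rs_nz]
  by (simp add: rs_ops rs_eq)

lemma Fr_eqI: "g ~: I ==> g' ~: I ==> f * g' = f' * g ==> Fr f g = Fr f' g'"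
  using Fr_eq primeID(1)[OF prime_I] by simp

lemma notI_mult: "g ~: I ==> g' ~: I ==> g * g' ~: I"
  using primeID(6)[OF prime_I] by blast

lemma Fr_mult: "g ~: I ==> g' ~: I ==> Fr f g \<otimes>\<^bsub>KK\<^esub> Fr f' g' = Fr (f * f') (g * g')"
  unfolding Fr_def function_field_def
  using domain.frac_field_mult[OF domain_RR rs_carrier rs_nz rs_carrier rs_nz] by (simp add: rs_ops)

lemma Fr_add: "g ~: I ==> g' ~: I ==> Fr f g \<oplus>\<^bsub>KK\<^esub> Fr f' g' = Fr (f * g' + f' * g) (g * g')"
  unfolding Fr_def function_field_def
  using domain.frac_field_add[OF domain_RR rs_carrier rs_nz rs_carrier rs_nz] by (simp add: rs_ops)

lemma one_KK: "\<one>\<^bsub>KK\<^esub> = Fr 1 1" and zero_KK: "\<zero>\<^bsub>KK\<^esub> = Fr 0 1"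
  by (simp_all add: function_field_def frac_field_simps Fr_def rs_ops)

lemma Fr_zero: "g ~: I ==> Fr f g = \<zero>\<^bsub>KK\<^esub> \<longleftrightarrow> f \<in> I"
  using Fr_eq[of g 1 f 0] primeID(2)[OF prime_I] by (simp add: zero_KK)

lemma fraction_rfrac:
  assumes "\<forall>x\<in>M. pev q x ~= 0" "\<forall>x\<in>M. pev r x ~= 0" "g ~: I"
  shows "fraction RR (rfrac M f q) (rfrac M g r) = Fr (f * r) (g * q)"
  unfolding Fr_def
proof (subst domain.fraction_eq[OF domain_RR])
  show "rfrac M f q \<in> carrier RR" "rfrac M g r \<in> carrier RR - {\<zero>\<^bsub>RR\<^esub>}"
    using assms rfrac_zero carrier_regular_ring[of M] by auto
  show "rs (f * r) \<in> carrier RR" by (rule rs_carrier)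
  show "rs (g * q) \<in> carrier RR - {\<zero>\<^bsub>RR\<^esub>}" by (rule rs_nz[OF notI_mult[OF assms(3) denom_notin[OF assms(1)]]])
  show "rfrac M f q \<otimes>\<^bsub>RR\<^esub> rs (g * q) = rs (f * r) \<otimes>\<^bsub>RR\<^esub> rfrac M g r"
    using assms by (auto simp: rfrac_def rs_def regular_ring_simps restrict_def)
qed

lemma fractions_eq:
  assumes W: "W <= M" "W ~= {}"
  shows "{fraction RR a c | a c. a \<in> carrier RR & c \<in> carrier RR - vanishing_ideal M W} = {Fr f g | f g. g ~: videal W}" (is "?A = ?B")
    "localization_max RR (vanishing_ideal M W) = {Fr f g | f g. f \<in> videal W & g ~: videal W}" (is "_ = ?D")
proof -
  have sub: "I <= videal W" using W by (auto simp: I_eq videal_def)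
  have rsW: "rs g \<in> vanishing_ideal M W \<longleftrightarrow> g \<in> videal W" for g
    using W rs_carrier by (auto simp: vanishing_ideal_def rs_def videal_def)
  have rfW: "rfrac M g q \<in> vanishing_ideal M W \<longleftrightarrow> g \<in> videal W" if "\<forall>x\<in>M. pev q x ~= 0" for g q
  proof -
    show ?thesis using that W by (auto simp: carrier_regular_ring vanishing_ideal_def rfrac_def videal_def)
  qed
  have dW: "g * q \<in> videal W \<longleftrightarrow> g \<in> videal W" if "\<forall>x\<in>M. pev q x ~= 0" for g q
    using that W by (auto simp: videal_def)
  have 1: "\<exists>f g. fraction RR a c = Fr f g & g ~: videal W & (a \<in> vanishing_ideal M W --> f \<in> videal W)"
    if ac: "a \<in> carrier RR" "c \<in> carrier RR - vanishing_ideal M W" for a c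
  proof -
    obtain f q g r where h: "a = rfrac M f q" "c = rfrac M g r" "\<forall>x\<in>M. pev q x ~= 0" "\<forall>x\<in>M. pev r x ~= 0"
      using ac unfolding carrier_regular_ring by blast
    have g: "g ~: videal W" using ac(2) rfW h by auto
    thus ?thesis using sub fraction_rfrac[OF h(3,4)] dW h rfW by blast
  qed
  have 2: "Fr f g \<in> ?A" if "g ~: videal W" for f g
    unfolding Fr_def using rs_carrier rsW that by blast
  show "?A = ?B" using 1 2 by blast
  have "vanishing_ideal M W <= carrier RR" by (auto simp: vanishing_ideal_def)
  hence "localization_max RR (vanishing_ideal M W) <= ?D" unfolding localization_max_def using 1 by blast
  moreover have "?D <= localization_max RR (vanishing_ideal M W)"
    unfolding localization_max_def Fr_def using rs_carrier rsW by blast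
  ultimately show "localization_max RR (vanishing_ideal M W) = ?D" by blast
qed

lemma carrier_KK: "carrier KK = {Fr f g | f g. g ~: I}"
proof -
  have "M ~= {}" using primeID(2)[OF prime_I] by (auto simp: I_eq videal_def)
  moreover have "vanishing_ideal M M = {\<zero>\<^bsub>RR\<^esub>}"
  proof
    show "vanishing_ideal M M <= {\<zero>\<^bsub>RR\<^esub>}"
    proof
      fix a assume a: "a \<in> vanishing_ideal M M"
      then obtain f q where "a = rfrac M f q" "\<forall>x\<in>M. pev q x ~= 0" by (auto simp: vanishing_ideal_def carrier_regular_ring)
      thus "a \<in> {\<zero>\<^bsub>RR\<^esub>}" using a rfrac_zero[of q f] by (auto simp: vanishing_ideal_def rfrac_def I_eq videal_def)
    qed
    show "{\<zero>\<^bsub>RR\<^esub>} <= vanishing_ideal M M" using rs_carrier[of 0] by (auto simp: rs_ops vanishing_ideal_def regular_ring_simps)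
  qed
  ultimately show ?thesis using fractions_eq(1)[of M] by (simp add: function_field_def frac_field_simps I_eq)
qed

text \<open>One proof for the function field and the local rings, both of which consist of the
  fractions with denominators in a multiplicative set.\<close>

lemma cring_fractions:
  assumes S: "1 \<in> S" "!!g g'. g \<in> S ==> g' \<in> S ==> g * g' \<in> S" "S \<inter> I = {}"
    and L: "carrier L = {Fr f g | f g. g \<in> S}" "!!a c. a \<otimes>\<^bsub>L\<^esub> c = a \<otimes>\<^bsub>KK\<^esub> c" "!!a c. a \<oplus>\<^bsub>L\<^esub> c = a \<oplus>\<^bsub>KK\<^esub> c"
      "\<one>\<^bsub>L\<^esub> = \<one>\<^bsub>KK\<^esub>" "\<zero>\<^bsub>L\<^esub> = \<zero>\<^bsub>KK\<^esub>"
  shows "cring L"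
proof -
  have nI: "g ~: I" if "g \<in> S" for g using that S(3) by blast
  have fr: P if "x \<in> carrier L" "!!f g. x = Fr f g ==> g \<in> S ==> P" for x P using that L(1) by blast
  have c: "Fr f g \<in> carrier L" if "g \<in> S" for f g using that L(1) by blast
  have add: "Fr f g \<oplus>\<^bsub>L\<^esub> Fr f' g' = Fr (f * g' + f' * g) (g * g')" and mult: "Fr f g \<otimes>\<^bsub>L\<^esub> Fr f' g' = Fr (f * f') (g * g')"
    if "g \<in> S" "g' \<in> S" for f g f' g' using that nI by (simp_all add: L Fr_add Fr_mult)
  have neg: "\<exists>y\<in>carrier L. y \<oplus>\<^bsub>L\<^esub> x = \<zero>\<^bsub>L\<^esub>" if x: "x \<in> carrier L" for x
  proof -
    obtain f g where "x = Fr f g" "g \<in> S" using fr[OF x] by blast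
    thus ?thesis using add[of g g "- f" f] Fr_zero[OF nI[OF S(2)], of g g 0] primeID(1)[OF prime_I]
      by (intro bexI[OF _ c[of g "- f"]]) (simp_all add: L(5))
  qed
  have eq: "Fr f g = Fr f' g'" if "g \<in> S" "g' \<in> S" "f * g' = f' * g" for f g f' g'
    using that Fr_eqI nI by blast
  note [simp] = add mult L(4,5) one_KK zero_KK S(1,2) c
  show ?thesis
  proof (rule cringI)
    show "abelian_group L" by (rule abelian_groupI[OF _ _ _ _ _ neg]; (elim fr)?) (auto simp: algebra_simps)
    show "comm_monoid L" by (rule comm_monoidI; (elim fr)?) (auto simp: algebra_simps)
  qed (elim fr, simp, rule eq, auto simp: algebra_simps)
qed

lemma cring_KK: "cring KK"
  by (rule cring_fractions[of "- I"]) (use primeID(2)[OF prime_I] notI_mult carrier_KK in auto)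

lemma Fr_uminus: "g ~: I ==> \<ominus>\<^bsub>KK\<^esub> Fr f g = Fr (- f) g"
proof -
  assume g: "g ~: I"
  interpret cring KK by (rule cring_KK)
  show ?thesis using Fr_add[OF g g] Fr_zero[of "g * g"] notI_mult[OF g g] primeID(1)[OF prime_I] minus_equality[of "Fr (- f) g" "Fr f g"] carrier_KK g by auto
qed

lemma Fr_minus: "g ~: I ==> g' ~: I ==> Fr f g \<ominus>\<^bsub>KK\<^esub> Fr f' g' = Fr (f * g' - f' * g) (g * g')"
  unfolding a_minus_def by (simp add: Fr_uminus Fr_add)

lemma poly_in_field: "real_polynomial_function f ==> poly_in_field M f = Fr (Pfun f) 1"
  by (simp add: poly_in_field_def Fr_def rs_ops) (simp add: rs_def pev_Pfun)

end

subsection \<open>Algebraic sets and dimension\<close>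

lemma algebraic_set_vzeros: "algebraic_set (vzeros G)"
  unfolding algebraic_set_def vzeros_def
  by (rule exI[of _ "pev ` G"]) (use rpf_pev in auto)

lemma vzeros_videal:
  assumes "algebraic_set (V :: (real ^ 'n) set)" shows "vzeros (videal V) = V"
proof -
  obtain F where F: "\<forall>f\<in>F. real_polynomial_function f" "V = {x. \<forall>f\<in>F. f x = 0}"
    using assms by (auto simp: algebraic_set_def)
  show ?thesis
  proof
    show "vzeros (videal V) <= V"
    proof
      fix x assume x: "x \<in> vzeros (videal V)"
      have "f x = 0" if f: "f \<in> F" for f
      proof -
        have "Pfun f \<in> videal V" using F f by (auto simp: videal_def pev_Pfun)
        thus ?thesis using x F f by (auto simp: vzeros_def pev_Pfun)
      qed
      thus "x \<in> V" using F by blast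
    qed
  qed (auto simp: vzeros_def videal_def)
qed

lemma zariski_closure_eq: "zariski_closure (S :: (real ^ 'n) set) = vzeros (videal S)"
proof
  show "zariski_closure S <= vzeros (videal S)"
    unfolding zariski_closure_def using algebraic_set_vzeros[of "videal S"] by (auto simp: vzeros_def videal_def)
  show "vzeros (videal S) <= zariski_closure S"
    unfolding zariski_closure_def
  proof (rule Inter_greatest)
    fix V assume "V \<in> {V. algebraic_set V & S <= V}"
    hence V: "vzeros (videal V) = V" "S <= V" using vzeros_videal by auto
    show "vzeros (videal S) <= V" using V by (fastforce simp: vzeros_def videal_def)
  qed
qed

lemma primeI_irreducible:
  assumes "irreducible_algebraic_set (V :: (real ^ 'n) set)" shows "primeI (videal V)"
proof -
  have V: "algebraic_set V" "V ~= {}" "!!V1 V2. algebraic_set V1 ==> algebraic_set V2 ==> V = V1 \<union> V2 ==> V = V1 | V = V2"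
    using assms by (auto simp: irreducible_algebraic_set_def)
  show ?thesis unfolding primeI_def
  proof (intro conjI allI ballI impI)
    fix f g assume fg: "f * g \<in> videal V"
    have zs: "vzeros (insert h (videal V)) = {x\<in>V. pev h x = 0}" for h
      using vzeros_videal[OF V(1)] by (auto simp: vzeros_def)
    have "V = vzeros (insert f (videal V)) \<union> vzeros (insert g (videal V))"
      unfolding zs using fg by (auto simp: videal_def)
    hence "V = vzeros (insert f (videal V)) | V = vzeros (insert g (videal V))"
      using V(3) algebraic_set_vzeros by blast
    thus "f \<in> videal V | g \<in> videal V" unfolding zs by (auto simp: videal_def)
  qed (use V(2) in "auto simp: videal_def")
qed

lemma irreducible_vzeros:
  assumes Q: "primeI Q" "videal (vzeros Q) = Q" shows "irreducible_algebraic_set (vzeros Q)"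
  unfolding irreducible_algebraic_set_def
proof (intro conjI allI impI)
  show "algebraic_set (vzeros Q)" by (rule algebraic_set_vzeros)
  show "vzeros Q ~= {}" using primeID(2)[OF Q(1)] Q(2) by (auto simp: videal_def)
  fix V1 V2 assume h: "algebraic_set V1 & algebraic_set V2 & vzeros Q = V1 \<union> V2"
  show "vzeros Q = V1 | vzeros Q = V2"
  proof (rule ccontr)
    assume n: "\<not> (vzeros Q = V1 | vzeros Q = V2)"
    have "vzeros Q <= U" if "videal U <= Q" "vzeros (videal U) = U" for U
      using that by (auto simp: vzeros_def)
    hence "\<not> videal V1 <= Q" "\<not> videal V2 <= Q" using h vzeros_videal n by auto
    then obtain f g where fg: "f \<in> videal V1" "f ~: Q" "g \<in> videal V2" "g ~: Q" by blast
    have "f * g \<in> videal (vzeros Q)" using fg(1,3) h by (auto simp: videal_def)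
    thus False using Q primeID(6)[OF Q(1)] fg by metis
  qed
qed

lemma (in cring) ideal_of_closed:
  assumes "J <= carrier R" "\<zero> \<in> J" "!!a b. a \<in> J ==> b \<in> J ==> a \<oplus> b \<in> J"
    and mult: "!!x a. x \<in> carrier R ==> a \<in> J ==> x \<otimes> a \<in> J"
  shows "ideal J R"
proof (rule idealI[OF ring_axioms])
  have "\<ominus> a \<in> J" if "a \<in> J" for a using mult[of "\<ominus> \<one>" a] that assms(1) by (auto simp: l_minus)
  thus "subgroup J (add_monoid R)" using assms by (intro group.subgroupI[OF a_group]) (auto simp: a_inv_def)
qed (metis assms(1) mult m_comm subsetD)+

context
  fixes V :: "(real ^ 'n::finite) set"
begin

definition pr :: "'n pfun => real ^ 'n => real" where
  "pr f = restrict (pev f) V"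

lemma pr_ops: "carrier (polynomial_ring V) = range pr"
  "pr f \<otimes>\<^bsub>polynomial_ring V\<^esub> pr g = pr (f * g)" "pr f \<oplus>\<^bsub>polynomial_ring V\<^esub> pr g = pr (f + g)"
  "\<one>\<^bsub>polynomial_ring V\<^esub> = pr 1" "\<zero>\<^bsub>polynomial_ring V\<^esub> = pr 0"
proof -
  show "carrier (polynomial_ring V) = range pr"
  proof
    show "carrier (polynomial_ring V) <= range pr"
    proof
      fix a assume "a \<in> carrier (polynomial_ring V)"
      then obtain f where "real_polynomial_function f" "a = restrict f V"
        by (auto simp: polynomial_ring_def function_ring_simps)
      hence "a = pr (Pfun f)" by (simp add: pr_def pev_Pfun)
      thus "a \<in> range pr" by blast
    qed
  qed (use rpf_pev in "auto simp: polynomial_ring_def function_ring_simps pr_def")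
qed (auto simp: polynomial_ring_def function_ring_simps pr_def restrict_def)

lemma pr_eq: "pr f = pr g \<longleftrightarrow> f - g \<in> videal V"
  by (auto simp: pr_def videal_def restrict_def fun_eq_iff)

lemma primeideal_pull:
  assumes "primeideal P (polynomial_ring V)"
  shows "primeI {f. pr f \<in> P}" "videal V <= {f. pr f \<in> P}" "pr ` {f. pr f \<in> P} = P"
proof -
  interpret primeideal P "polynomial_ring V" by (rule assms)
  note as = additive_subgroup.zero_closed[OF additive_subgroup_axioms] additive_subgroup.a_closed[OF additive_subgroup_axioms]
  have z: "pr 0 \<in> P" using as(1) by (simp add: pr_ops)
  have cl: "pr (f * g) \<in> P" if "pr g \<in> P" for f g using I_l_closed[OF that, of "pr f"] by (simp add: pr_ops)
  show "primeI {f. pr f \<in> P}" unfolding primeI_def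
  proof (intro conjI allI ballI impI)
    show "1 ~: {f. pr f \<in> P}" using cl[of 1] a_subset I_notcarr by (auto simp: pr_ops)
    show "x + y \<in> {f. pr f \<in> P}" if "x \<in> {f. pr f \<in> P}" "y \<in> {f. pr f \<in> P}" for x y
      using as(2)[of "pr x" "pr y"] that by (simp add: pr_ops)
    show "x \<in> {f. pr f \<in> P} | y \<in> {f. pr f \<in> P}" if "x * y \<in> {f. pr f \<in> P}" for x y
      using I_prime[of "pr x" "pr y"] that by (simp add: pr_ops)
  qed (use z cl in auto)
  show "videal V <= {f. pr f \<in> P}"
  proof
    fix f assume "f \<in> videal V"
    hence "pr f = pr 0" unfolding pr_eq by simp
    thus "f \<in> {f. pr f \<in> P}" using z by simp
  qed
  show "pr ` {f. pr f \<in> P} = P" using a_subset by (auto simp: pr_ops)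
qed

lemma primeideal_push:
  assumes Q: "primeI Q" "videal V <= Q"
  shows "primeideal (pr ` Q) (polynomial_ring V)" "pr f \<in> pr ` Q \<longleftrightarrow> f \<in> Q"
proof -
  have mem: "pr f \<in> pr ` Q \<longleftrightarrow> f \<in> Q" for f
  proof
    assume "pr f \<in> pr ` Q"
    then obtain g where g: "g \<in> Q" "pr f = pr g" by blast
    thus "f \<in> Q" using pr_eq Q(2) primeID(3)[OF Q(1)] by fastforce
  qed blast
  thus "pr f \<in> pr ` Q \<longleftrightarrow> f \<in> Q" .
  interpret cring "polynomial_ring V" by (rule cring_polynomial_ring)
  show "primeideal (pr ` Q) (polynomial_ring V)"
  proof (rule primeidealI[OF ideal_of_closed cring_axioms])
    show "carrier (polynomial_ring V) ~= pr ` Q"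
      using mem[of 1] primeID(2)[OF Q(1)] by (auto simp: pr_ops)
    show "a \<in> pr ` Q | c \<in> pr ` Q"
      if ac: "a \<in> carrier (polynomial_ring V)" "c \<in> carrier (polynomial_ring V)" "a \<otimes>\<^bsub>polynomial_ring V\<^esub> c \<in> pr ` Q" for a c
    proof -
      obtain f g where h: "a = pr f" "c = pr g" using ac by (auto simp: pr_ops)
      thus ?thesis using ac(3) mem primeID(6)[OF Q(1), of f g] by (simp add: pr_ops)
    qed
  qed (use primeID(1,3,4)[OF Q(1)] in "auto simp: pr_ops")
qed

lemma prime_chain_shorten: "prime_chain m A C ==> k <= m ==> \<exists>C. prime_chain k A C"
  unfolding prime_chain_def by (metis le_trans less_le_trans)

text \<open>In the Krull dimension a chain may start at any prime. One that does not start at the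
  zero ideal is extended downwards to it and then cut back to its former length.\<close>

lemma krull_dim_chains:
  assumes J: "primeI (videal V)"
  shows "(\<exists>P :: nat => (real ^ 'n => real) set. (\<forall>i\<le>k. primeideal (P i) (polynomial_ring V)) & (\<forall>i<k. P i \<subset> P (Suc i)))
     \<longleftrightarrow> (\<exists>C. prime_chain k (videal V) C)" (is "?l \<longleftrightarrow> ?r")
proof
  assume ?l
  then obtain P :: "nat => (real ^ 'n => real) set" where
    P: "\<forall>i\<le>k. primeideal (P i) (polynomial_ring V)" "\<forall>i<k. P i \<subset> P (Suc i)" by blast
  define X where "X i = {f. pr f \<in> P i}" for i
  have X: "primeI (X i)" "videal V <= X i" "pr ` X i = P i" if "i <= k" for i
    unfolding X_def using primeideal_pull P(1) that by auto
  have "X i \<subset> X (Suc i)" if "i < k" for i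
    using P(2) that X(3)[of i] X(3)[of "Suc i"] by (fastforce simp: X_def)
  hence ch: "prime_chain k (X 0) (X k)" unfolding prime_chain_def using X(1) by blast
  show ?r
    using ch X(2)[of 0] prime_chain_Cons[OF J _ ch] prime_chain_shorten[of "Suc k" _ _ k] by fastforce
next
  assume ?r
  then obtain X where X: "X 0 = videal V" "\<forall>i\<le>k. primeI (X i)" "\<forall>i<k. X i \<subset> X (Suc i)"
    unfolding prime_chain_def by blast
  have sub: "i <= k ==> videal V <= X i" for i
  proof (induction i)
    case (Suc i) thus ?case using X(3) by (metis Suc_leD Suc_le_lessD order_trans psubset_imp_subset)
  qed (simp add: X)
  have "pr ` X i \<subset> pr ` X (Suc i)" if i: "i < k" for i
  proof -
    obtain f where "f \<in> X (Suc i)" "f ~: X i" using X(3) i by blast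
    moreover have "pr f ~: pr ` X i" using primeideal_push(2)[of "X i" f] X sub i calculation by auto
    moreover have "pr ` X i <= pr ` X (Suc i)" using X(3) i by (intro image_mono) auto
    ultimately show ?thesis by blast
  qed
  thus ?l using primeideal_push(1) X sub by (intro exI[of _ "\<lambda>i. pr ` X i"]) auto
qed

text \<open>The supremum is attained, since chain lengths are bounded by the number of
  variables.\<close>

lemma algebraic_dim_eq:
  assumes J: "primeI (videal V)"
  shows "algebraic_dim V = enat n \<longleftrightarrow> (\<forall>m C. prime_chain m (videal V) C --> m <= n) & (\<exists>C. prime_chain n (videal V) C)"
    "\<exists>n. algebraic_dim V = enat n"
proof -
  define A where "A = {k. \<exists>C. prime_chain k (videal V) C}"
  have fin: "A <= {..CARD('n)}" using prime_chain_bound by (auto simp: A_def)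
  have ne: "A ~= {}" "finite A" using prime_chain_refl[OF J] fin finite_subset by (auto simp: A_def)
  have "algebraic_dim V = Sup (enat ` A)"
    unfolding algebraic_dim_def krull_dim_def krull_dim_chains[OF J] A_def by (rule arg_cong[of _ _ Sup]) auto
  also have "\<dots> = enat (Max A)"
    using ne Max_in by (fastforce intro: Sup_eqI)
  finally have eq: "algebraic_dim V = enat (Max A)" .
  show "\<exists>n. algebraic_dim V = enat n" using eq by blast
  have "Max A = n \<longleftrightarrow> n \<in> A & (\<forall>m\<in>A. m <= n)" using Max_eq_iff[OF ne(2,1)] .
  thus "algebraic_dim V = enat n \<longleftrightarrow> (\<forall>m C. prime_chain m (videal V) C --> m <= n) & (\<exists>C. prime_chain n (videal V) C)"
    unfolding eq by (auto simp: A_def)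
qed

end

subsection \<open>Orderings of the function field\<close>

context irreducible_variety
begin

text \<open>\<open>f / g\<close> and \<open>f * g\<close> differ by the square of \<open>g\<close>
  and so have the same sign.\<close>

definition ord_of :: "('n pfun => int) => ((real ^ 'n => real) \<times> (real ^ 'n => real)) set set" where
  "ord_of s = {Fr f g | f g. g ~: I & s (f * g) >= 0}"

context
  fixes s :: "'n pfun => int"
  assumes s: "sgnf s" "supp s = I"
begin

lemma sgn_notin: "g ~: I ==> s g * s g = 1"
  using sgnf_square[OF s(1), of g] sgnfD(4)[OF s(1), of g g] s(2) by (auto simp: supp_def)

lemma sgn_I: "f \<in> I \<longleftrightarrow> s f = 0"
  using s(2) by (auto simp: supp_def)

lemma in_ord_of: "g ~: I ==> Fr f g \<in> ord_of s \<longleftrightarrow> s (f * g) >= 0"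
proof
  assume g: "g ~: I" and "Fr f g \<in> ord_of s"
  then obtain f' g' where h: "Fr f g = Fr f' g'" "g' ~: I" "s (f' * g') >= 0" by (auto simp: ord_of_def)
  have "s f * s g = s f * s g' * (s g' * s g)" using sgn_notin[OF h(2)] by (simp add: ac_simps)
  also have "\<dots> = s f' * s g'" using Fr_eq[OF g h(2), of f f'] h(1) s(2) sgnf_cong_supp[OF s(1), of "f * g'" "f' * g"] sgn_notin[OF g] by (simp add: sgnfD(4)[OF s(1)])
  finally show "s (f * g) >= 0" using h(3) by (simp add: sgnfD(4)[OF s(1)])
qed (auto simp: ord_of_def)

lemma field_ordering_ord_of: "field_ordering KK (ord_of s)"
  unfolding field_ordering_def
proof (intro conjI ballI impI)
  show "ord_of s <= carrier KK" unfolding carrier_KK ord_of_def by blast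
  fix a c assume "a \<in> ord_of s" "c \<in> ord_of s"
  then obtain f g f' g' where h: "a = Fr f g" "c = Fr f' g'" "g ~: I" "g' ~: I" "s (f * g) >= 0" "s (f' * g') >= 0"
    by (auto simp: ord_of_def)
  have n: "g * g' ~: I" using notI_mult h by blast
  note N = sgnf_nonneg(1)[OF s(1)]
  show "a \<otimes>\<^bsub>KK\<^esub> c \<in> ord_of s" by (smt (verit) h(1,2) Fr_mult[OF h(3,4)] in_ord_of[OF n] ac_simps N[OF h(5,6)])
  have "s ((f * g) * (g' * g') + (f' * g') * (g * g)) >= 0"
    by (intro sgnfD(13)[OF s(1)] N h sgnf_nonneg(2)[OF s(1)])
  thus "a \<oplus>\<^bsub>KK\<^esub> c \<in> ord_of s" unfolding h(1,2) Fr_add[OF h(3,4)] in_ord_of[OF n] by (simp add: algebra_simps)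
next
  fix a assume "a \<in> carrier KK"
  then obtain f g where h: "a = Fr f g" "g ~: I" by (auto simp: carrier_KK)
  show "a \<in> ord_of s | \<ominus>\<^bsub>KK\<^esub> a \<in> ord_of s"
    unfolding h(1) Fr_uminus[OF h(2)] in_ord_of[OF h(2)] using sgnfD(7)[OF s(1), of "f * g"] by auto
next
  fix a assume "a \<in> ord_of s" "\<ominus>\<^bsub>KK\<^esub> a \<in> ord_of s"
  then obtain f g where h: "a = Fr f g" "g ~: I" "s (f * g) >= 0" by (auto simp: ord_of_def)
  have "s (- f * g) >= 0" using \<open>\<ominus>\<^bsub>KK\<^esub> a \<in> ord_of s\<close> unfolding h(1) Fr_uminus[OF h(2)] in_ord_of[OF h(2)] .
  hence "f \<in> I" using h(3) sgnfD(7)[OF s(1), of "f * g"] sgn_I notI_mult h(2) by auto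
  thus "a = \<zero>\<^bsub>KK\<^esub>" unfolding h(1) Fr_zero[OF h(2)] .
qed

lemma positive_ord_of: "g ~: I ==> positive_in KK (ord_of s) (Fr f g) \<longleftrightarrow> s (f * g) = 1"
  using notI_mult primeID(5)[OF prime_I] sgn_I sgnfD(3)[OF s(1), of "f * g"] by (auto simp: positive_in_def in_ord_of Fr_zero)

lemma negative_ord_of: "g ~: I ==> negative_in KK (ord_of s) (Fr f g) \<longleftrightarrow> s (f * g) = - 1"
  unfolding negative_in_def using positive_ord_of[of g "- f"] sgnfD(7)[OF s(1), of "f * g"] by (auto simp: Fr_uminus)

end

text \<open>The passage back: an ordering of the function field is determined by its signs on
  polynomial functions.\<close>

lemma sgn_of_ordering:
  assumes \<sigma>: "field_ordering KK \<sigma>"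
  obtains s where "sgnf s" "supp s = I" "!!f g. g ~: I ==> positive_in KK \<sigma> (Fr f g) \<longleftrightarrow> s (f * g) = 1"
    "!!f g. g ~: I ==> negative_in KK \<sigma> (Fr f g) \<longleftrightarrow> s (f * g) = - 1"
proof -
  have add: "a \<oplus>\<^bsub>KK\<^esub> c \<in> \<sigma>" and mult: "a \<otimes>\<^bsub>KK\<^esub> c \<in> \<sigma>" if "a \<in> \<sigma>" "c \<in> \<sigma>" for a c
    using \<sigma> that by (auto simp: field_ordering_def)
  have tot: "Fr f g \<in> \<sigma> | Fr (- f) g \<in> \<sigma>" if "g ~: I" for f g
    using \<sigma> that Fr_uminus[OF that, of f] carrier_KK unfolding field_ordering_def by fastforce
  have zer: "f \<in> I" if "g ~: I" "Fr f g \<in> \<sigma>" "Fr (- f) g \<in> \<sigma>" for f g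
    using \<sigma> that Fr_uminus[OF that(1), of f] Fr_zero[OF that(1), of f] unfolding field_ordering_def by metis
  have n1: "1 ~: I" by (rule primeID(2)[OF prime_I])
  define P where "P f \<longleftrightarrow> Fr f 1 \<in> \<sigma>" for f
  have Padd: "P (f + g)" and Pmult: "P (f * g)" if "P f" "P g" for f g
    using add[of "Fr f 1" "Fr g 1"] mult[of "Fr f 1" "Fr g 1"] that by (auto simp: P_def Fr_add[OF n1 n1] Fr_mult[OF n1 n1])
  have Ptot: "P f | P (- f)" for f unfolding P_def by (rule tot[OF n1])
  have Pzer: "P f ==> P (- f) ==> f \<in> I" for f unfolding P_def by (rule zer[OF n1])
  have Pcong: "P f \<longleftrightarrow> P g" if "f - g \<in> I" for f g unfolding P_def using Fr_eq[OF n1 n1, of f g] that by simp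
  have Psq: "P (f * f)" for f using Ptot[of f] Pmult[of f f] Pmult[of "- f" "- f"] by auto
  define s where "s f = (if f \<in> I then 0 else if P f then 1 else - 1 :: int)" for f
  have s1: "s f = 1 \<longleftrightarrow> f ~: I & P f" and s0: "s f = 0 \<longleftrightarrow> f \<in> I" for f by (auto simp: s_def)
  have sm: "s (- f) = - s f" for f
    using Ptot[of f] Pzer[of f] primeID(7)[OF prime_I, of f] primeID(7)[OF prime_I, of "- f"] by (auto simp: s_def)
  have Iadd: "f + g \<in> I \<longleftrightarrow> g \<in> I" if "f \<in> I" for f g
    using primeID(10)[OF prime_I that, of g] by (simp add: add.commute)
  have s: "sgnf s" unfolding sgnf_def
  proof (intro conjI allI impI)
    show "s 1 = 1" using s1[of 1] n1 Psq[of 1] by simp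
    thus "s (- 1) = - 1" using sm[of 1] by simp
    show "s x \<in> {- 1, 0, 1}" for x by (simp add: s_def)
    show "s (x + y) = s y" if "s x = 0" for x y
      using that Iadd[of x y] Pcong[of "x + y" y] by (auto simp: s_def split: if_splits)
    show "s (x + y) = 1" if "s x = 1" "s y = 1" for x y
      using that s1 Pcong[of y "- x"] Pzer Padd by (auto simp: add.commute)
    show "s (x * y) = s x * s y" for x y
    proof (cases "x \<in> I | y \<in> I")
      case True
      thus ?thesis using primeID(11)[OF prime_I, of x y] s0[of "x * y"] s0[of x] s0[of y] by auto
    next
      case False
      hence nI: "x * y ~: I" using notI_mult by blast
      have pos: "s (f * g) = 1" if "s f = 1" "s g = 1" "f * g ~: I" for f g using that s1 Pmult by blast
      have c: "s x = 1 | s (- x) = 1" "s y = 1 | s (- y) = 1"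
        using False sm[of x] sm[of y] by (auto simp: s_def)
      have nI': "- (x * y) ~: I" using nI primeID(7)[OF prime_I, of "- (x * y)"] by auto
      consider "s x = 1" "s y = 1" | "s x = 1" "s (- y) = 1" | "s (- x) = 1" "s y = 1" | "s (- x) = 1" "s (- y) = 1"
        using c by blast
      thus ?thesis
      proof cases
        case 1 thus ?thesis using pos[of x y] nI by simp
      next
        case 2 thus ?thesis using pos[of x "- y"] nI' sm[of "x * y"] sm[of y] by simp
      next
        case 3 thus ?thesis using pos[of "- x" y] nI' sm[of "x * y"] sm[of x] by simp
      next
        case 4 thus ?thesis using pos[of "- x" "- y"] nI sm[of x] sm[of y] by simp
      qed
    qed
  qed
  have ss: "supp s = I" using s0 by (auto simp: supp_def)
  have "Fr f g \<in> \<sigma> \<longleftrightarrow> P (f * g)" if g: "g ~: I" for f g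
  proof -
    have gg: "g * g ~: I" using notI_mult g by blast
    have i: "Fr 1 (g * g) \<in> \<sigma>" using Fr_mult[OF g g] tot[OF g, of 1] mult by fastforce
    have gs: "Fr (g * g) 1 \<in> \<sigma>" using Psq[of g] by (simp add: P_def)
    show ?thesis
    proof
      assume "Fr f g \<in> \<sigma>"
      from mult[OF this gs] have "Fr (f * (g * g)) (g * 1) \<in> \<sigma>" unfolding Fr_mult[OF g n1] .
      moreover have "Fr (f * (g * g)) (g * 1) = Fr (f * g) 1" by (rule Fr_eqI) (use g n1 in "auto simp: ac_simps")
      ultimately show "P (f * g)" by (simp add: P_def)
    next
      assume "P (f * g)"
      hence "Fr (f * g) 1 \<in> \<sigma>" by (simp only: P_def)
      from mult[OF this i] have "Fr (f * g * 1) (1 * (g * g)) \<in> \<sigma>" unfolding Fr_mult[OF n1 gg] .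
      moreover have "Fr (f * g * 1) (1 * (g * g)) = Fr f g" by (rule Fr_eqI) (use g gg in "auto simp: ac_simps")
      ultimately show "Fr f g \<in> \<sigma>" by simp
    qed
  qed
  hence pos: "positive_in KK \<sigma> (Fr f g) \<longleftrightarrow> s (f * g) = 1" if "g ~: I" for f g
    unfolding positive_in_def Fr_zero[OF that] s1 using that notI_mult primeID(5)[OF prime_I] by blast
  moreover have "negative_in KK \<sigma> (Fr f g) \<longleftrightarrow> s (f * g) = - 1" if "g ~: I" for f g
    unfolding negative_in_def Fr_uminus[OF that] pos[OF that] using sm[of "f * g"] by auto
  ultimately show ?thesis using that s ss by blast
qed

subsection \<open>Local parameters\<close>

context
  fixes p assumes p: "p \<in> M"
begin

lemma carrier_local_ring: "carrier (local_ring M p) = {Fr f g | f g. pev g p ~= 0}"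
  unfolding local_ring_def localization_simps using fractions_eq(1)[of "{p}"] p by (simp add: videal_def)

lemma local_ring_ops:
  "a \<otimes>\<^bsub>local_ring M p\<^esub> c = a \<otimes>\<^bsub>KK\<^esub> c" "a \<oplus>\<^bsub>local_ring M p\<^esub> c = a \<oplus>\<^bsub>KK\<^esub> c"
  "\<one>\<^bsub>local_ring M p\<^esub> = \<one>\<^bsub>KK\<^esub>" "\<zero>\<^bsub>local_ring M p\<^esub> = \<zero>\<^bsub>KK\<^esub>"
  by (simp_all add: local_ring_def localization_simps function_field_def)

lemma notI_p: "pev g p ~= 0 ==> g ~: I"
  using p by (auto simp: I_eq videal_def)

lemma cring_local_ring: "cring (local_ring M p)"
  by (rule cring_fractions[of "{g. pev g p ~= 0}"]) (use notI_p carrier_local_ring local_ring_ops in auto)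

lemma local_idealI:
  assumes D: "0 \<in> D" "!!f f'. f \<in> D ==> f' \<in> D ==> f + f' \<in> D" "!!a f. f \<in> D ==> a * f \<in> D"
  shows "ideal {Fr f g | f g. f \<in> D & pev g p ~= 0} (local_ring M p)" (is "ideal ?J _")
proof -
  interpret cring "local_ring M p" by (rule cring_local_ring)
  have J: "Fr f g \<in> ?J" if "f \<in> D" "pev g p ~= 0" for f g using that by blast
  show ?thesis
  proof (rule ideal_of_closed)
    fix a c assume "a \<in> ?J" "c \<in> ?J"
    then obtain f g f' g' where h: "a = Fr f g" "c = Fr f' g'" "f \<in> D" "f' \<in> D" "pev g p ~= 0" "pev g' p ~= 0" by blast
    thus "a \<oplus>\<^bsub>local_ring M p\<^esub> c \<in> ?J"
      using J[OF D(2)[OF D(3)[OF h(3), of g'] D(3)[OF h(4), of g]], of "g * g'"]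
      by (simp add: local_ring_ops Fr_add notI_p mult.commute)
  next
    fix x a assume "x \<in> carrier (local_ring M p)" "a \<in> ?J"
    then obtain f g f' g' where h: "x = Fr f g" "a = Fr f' g'" "f' \<in> D" "pev g p ~= 0" "pev g' p ~= 0"
      unfolding carrier_local_ring by blast
    thus "x \<otimes>\<^bsub>local_ring M p\<^esub> a \<in> ?J"
      using J[OF D(3)[OF h(3), of f], of "g * g'"] by (simp add: local_ring_ops Fr_mult notI_p)
  qed (use carrier_local_ring J[OF D(1), of 1] in "auto simp: local_ring_ops zero_KK")
qed

text \<open>The ideal \<open>G\<close> generated by the parameters is maximal, hence the ideal
  \<open>m\<close> of fractions vanishing at \<open>p\<close>. Fractions whose numerator is locally
  a combination of the \<open>y j\<close> form an ideal containing the parameters, hence containing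
  \<open>m\<close>.\<close>

lemma local_parameters:
  assumes xs: "regular_system_of_parameters (local_ring M p) xs"
  obtains y d where "!!j. j < length xs ==> xs ! j = Fr (y j) (d j) & pev (d j) p ~= 0 & pev (y j) p = 0"
    "!!g. pev g p = 0 ==> \<exists>u c. pev u p ~= 0 & u * g - (\<Sum>j<length xs. c j * y j) \<in> I"
proof -
  let ?L = "local_ring M p"
  let ?n = "length xs"
  interpret cring ?L by (rule cring_local_ring)
  have sub: "set xs <= carrier ?L" and mx: "maximalideal (genideal ?L (set xs)) ?L"
    using xs by (auto simp: regular_system_of_parameters_def)
  define G where "G = genideal ?L (set xs)"
  interpret G: maximalideal G ?L using mx by (simp add: G_def)
  have "\<exists>y d. j < ?n --> xs ! j = Fr y d & pev d p ~= 0" for j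
  proof (cases "j < ?n")
    case True
    thus ?thesis using sub nth_mem[OF True] carrier_local_ring by blast
  qed simp
  then obtain y d where yd: "!!j. j < ?n ==> xs ! j = Fr (y j) (d j) & pev (d j) p ~= 0" by metis
  define m where "m = {Fr f g | f g. f \<in> videal {p} & pev g p ~= 0}"
  have mI: "ideal m ?L" unfolding m_def by (rule local_idealI) (auto simp: videal_def)
  have xG: "x \<in> G" if "x \<in> set xs" for x unfolding G_def using genideal_self[OF sub] that by blast
  have Gm: "pev f p = 0" if "Fr f g \<in> G" "pev g p ~= 0" for f g
  proof (rule ccontr)
    assume f: "pev f p ~= 0"
    have "Fr g f \<otimes>\<^bsub>?L\<^esub> Fr f g \<in> G" using carrier_local_ring f G.I_l_closed that(1) by blast
    moreover have "Fr g f \<otimes>\<^bsub>?L\<^esub> Fr f g = \<one>\<^bsub>?L\<^esub>"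
      unfolding local_ring_ops Fr_mult[OF notI_p[OF f] notI_p[OF that(2)]] one_KK
      by (rule Fr_eqI) (use notI_p f that(2) in auto)
    ultimately have "G = carrier ?L" using G.one_imp_carrier by simp
    thus False using G.I_notcarr by simp
  qed
  have yp: "pev (y j) p = 0" if "j < ?n" for j
    using Gm[of "y j" "d j"] xG[OF nth_mem[OF that]] yd[OF that] by simp
  have Gsub: "G <= m"
  proof
    fix a assume a: "a \<in> G"
    then obtain f g where h: "a = Fr f g" "pev g p ~= 0" using G.a_subset carrier_local_ring by auto
    thus "a \<in> m" using Gm[of f g] a by (auto simp: m_def videal_def)
  qed
  have "\<one>\<^bsub>?L\<^esub> ~: m"
  proof
    assume "\<one>\<^bsub>?L\<^esub> \<in> m"
    then obtain f g where h: "Fr 1 1 = Fr f g" "pev f p = 0" "pev g p ~= 0"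
      by (auto simp: m_def local_ring_ops one_KK videal_def)
    thus False using Fr_eq[OF notI_p notI_p[OF h(3)], of 1 1 f] p by (auto simp: I_eq videal_def)
  qed
  hence Gm_eq: "G = m" using mI G.I_maximal[OF mI Gsub] by (auto simp: additive_subgroup.a_subset ideal.axioms(1))
  define D where "D = {f. \<exists>u c. pev u p ~= 0 & u * f - (\<Sum>j<?n. c j * y j) \<in> I}"
  have DI: "ideal {Fr f g | f g. f \<in> D & pev g p ~= 0} ?L"
  proof (rule local_idealI)
    show "0 \<in> D" unfolding D_def using primeID(1)[OF prime_I] by (intro CollectI exI[of _ 1] exI[of _ "\<lambda>_. 0"]) simp
    fix f f' assume "f \<in> D" "f' \<in> D"
    then obtain u c u' c' where h: "pev u p ~= 0" "u * f - (\<Sum>j<?n. c j * y j) \<in> I"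
      "pev u' p ~= 0" "u' * f' - (\<Sum>j<?n. c' j * y j) \<in> I" by (auto simp: D_def)
    have "u' * (u * f - (\<Sum>j<?n. c j * y j)) + u * (u' * f' - (\<Sum>j<?n. c' j * y j)) \<in> I"
      by (intro primeID(3)[OF prime_I] primeID(4)[OF prime_I] h)
    also have "u' * (u * f - (\<Sum>j<?n. c j * y j)) + u * (u' * f' - (\<Sum>j<?n. c' j * y j)) =
        (u * u') * (f + f') - (\<Sum>j<?n. (u' * c j + u * c' j) * y j)"
      by (simp add: algebra_simps sum.distrib sum_distrib_left)
    finally show "f + f' \<in> D" unfolding D_def using h(1,3)
      by (intro CollectI exI[of _ "u * u'"] exI[of _ "\<lambda>j. u' * c j + u * c' j"]) simp
  next
    fix a f assume "f \<in> D"
    then obtain u c where h: "pev u p ~= 0" "u * f - (\<Sum>j<?n. c j * y j) \<in> I" by (auto simp: D_def)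
    have "a * (u * f - (\<Sum>j<?n. c j * y j)) \<in> I" by (rule primeID(4)[OF prime_I h(2)])
    also have "a * (u * f - (\<Sum>j<?n. c j * y j)) = u * (a * f) - (\<Sum>j<?n. (a * c j) * y j)"
      by (simp add: algebra_simps sum_distrib_left)
    finally show "a * f \<in> D" unfolding D_def using h(1) by (intro CollectI exI[of _ u] exI[of _ "\<lambda>j. a * c j"]) simp
  qed
  have yD: "y j \<in> D" if "j < ?n" for j
  proof -
    have "(\<Sum>k<?n. (if k = j then 1 else 0) * y k) = (\<Sum>k<?n. if k = j then y k else 0)"
      by (intro sum.cong) auto
    thus ?thesis using that primeID(1)[OF prime_I] by (auto simp: D_def intro!: exI[of _ 1] exI[of _ "\<lambda>k. if k = j then 1 else 0"])
  qed
  have "set xs <= {Fr f g | f g. f \<in> D & pev g p ~= 0}"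
    using yD yd by (auto simp: in_set_conv_nth) blast
  hence "m <= {Fr f g | f g. f \<in> D & pev g p ~= 0}"
    unfolding Gm_eq[symmetric] unfolding G_def by (rule genideal_minimal[OF DI])
  hence gen: "\<exists>u c. pev u p ~= 0 & u * g - (\<Sum>j<?n. c j * y j) \<in> I" if "pev g p = 0" for g
  proof -
    assume ms: "m <= {Fr f g | f g. f \<in> D & pev g p ~= 0}"
    have "Fr g 1 \<in> m" unfolding m_def
      by (rule CollectI, rule exI[of _ g], rule exI[of _ 1]) (use that in "simp add: videal_def")
    then obtain f h where fh: "Fr g 1 = Fr f h" "f \<in> D" "pev h p ~= 0" using ms by blast
    obtain u c where uc: "pev u p ~= 0" "u * f - (\<Sum>j<?n. c j * y j) \<in> I" using fh(2) by (auto simp: D_def)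
    have "u * (g * h - f * 1) + (u * f - (\<Sum>j<?n. c j * y j)) \<in> I" using Fr_eq[OF notI_p notI_p[OF fh(3)], of 1 g f] fh(1) primeID(3)[OF prime_I] primeID(4)[OF prime_I] uc(2) by auto
    also have "u * (g * h - f * 1) + (u * f - (\<Sum>j<?n. c j * y j)) = (u * h) * g - (\<Sum>j<?n. c j * y j)"
      by (simp add: algebra_simps)
    finally show ?thesis using uc(1) fh(3) by (intro exI[of _ "u * h"] exI[of _ c]) simp
  qed
  show ?thesis by (rule that[of y d]) (use yd yp gen in auto)
qed

text \<open>The denominators of the parameters and of \<open>a\<close> are cleared; the numerator of
  \<open>a\<close> does not vanish at \<open>p\<close> because \<open>a\<close> is
  invertible.\<close>

lemma local_monomial:
  assumes xs: "!!j. j < length xs ==> xs ! j = Fr (y j) (d j) & pev (d j) p ~= 0"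
    and f: "Fr f 1 = a \<otimes>\<^bsub>local_ring M p\<^esub> (\<Otimes>\<^bsub>local_ring M p\<^esub>i\<in>{..<length xs}. (xs ! i) [^]\<^bsub>local_ring M p\<^esub> (m i :: nat))"
    and a: "a \<in> Units (local_ring M p)"
  shows "\<exists>u w. pev u p ~= 0 & pev w p ~= 0 & u * f - w * (\<Prod>j<length xs. y j ^ m j) \<in> I"
proof -
  let ?L = "local_ring M p"
  interpret cring ?L by (rule cring_local_ring)
  have pw: "Fr c e [^]\<^bsub>?L\<^esub> k = Fr (c ^ k) (e ^ k)" if e: "pev e p ~= 0" for c e and k :: nat
  proof (induction k)
    case 0 thus ?case by (simp add: local_ring_ops one_KK)
  next
    case (Suc k)
    show ?case using e Suc Fr_mult[OF notI_p notI_p[OF e], of "e ^ k" "c ^ k" c] by (simp add: local_ring_ops mult.commute)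
  qed
  have "(\<Otimes>\<^bsub>?L\<^esub>i\<in>X. (xs ! i) [^]\<^bsub>?L\<^esub> m i) = Fr (\<Prod>j\<in>X. y j ^ m j) (\<Prod>j\<in>X. d j ^ m j) & pev (\<Prod>j\<in>X. d j ^ m j) p ~= 0"
    if X: "finite X" "X <= {..<length xs}" for X
    using X
  proof (induction X rule: finite_induct)
    case empty thus ?case by (simp add: local_ring_ops one_KK)
  next
    case (insert i X)
    have pd: "pev (d i ^ m i) p ~= 0" if "i < length xs" for i using xs[OF that] by simp
    have el: "(xs ! i) [^]\<^bsub>?L\<^esub> m i = Fr (y i ^ m i) (d i ^ m i)" if "i < length xs" for i
      using xs[OF that] pw by simp
    have car: "(xs ! i) [^]\<^bsub>?L\<^esub> m i \<in> carrier ?L" if "i < length xs" for i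
      unfolding el[OF that] carrier_local_ring using pd[OF that] by blast
    have i: "i < length xs" and IH: "(\<Otimes>\<^bsub>?L\<^esub>i\<in>X. (xs ! i) [^]\<^bsub>?L\<^esub> m i) = Fr (\<Prod>j\<in>X. y j ^ m j) (\<Prod>j\<in>X. d j ^ m j)"
      "pev (\<Prod>j\<in>X. d j ^ m j) p ~= 0" using insert by auto
    have "(\<Otimes>\<^bsub>?L\<^esub>i\<in>insert i X. (xs ! i) [^]\<^bsub>?L\<^esub> m i) = (xs ! i) [^]\<^bsub>?L\<^esub> m i \<otimes>\<^bsub>?L\<^esub> (\<Otimes>\<^bsub>?L\<^esub>i\<in>X. (xs ! i) [^]\<^bsub>?L\<^esub> m i)"
      by (rule finprod_insert) (use insert car in auto)
    also have "\<dots> = Fr (y i ^ m i * (\<Prod>j\<in>X. y j ^ m j)) (d i ^ m i * (\<Prod>j\<in>X. d j ^ m j))"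
      unfolding IH(1) el[OF i] local_ring_ops by (rule Fr_mult[OF notI_p[OF pd[OF i]] notI_p[OF IH(2)]])
    finally show ?case using insert(1,2) IH(2) pd[OF i] by simp
  qed
  from this[of "{..<length xs}"] have pr: "(\<Otimes>\<^bsub>?L\<^esub>i\<in>{..<length xs}. (xs ! i) [^]\<^bsub>?L\<^esub> m i) =
      Fr (\<Prod>j<length xs. y j ^ m j) (\<Prod>j<length xs. d j ^ m j)" "pev (\<Prod>j<length xs. d j ^ m j) p ~= 0" by auto
  obtain \<alpha> \<beta> where ab: "a = Fr \<alpha> \<beta>" "pev \<beta> p ~= 0" using a carrier_local_ring by (auto simp: Units_def)
  obtain a' where a': "a' \<in> carrier ?L" "a' \<otimes>\<^bsub>?L\<^esub> a = \<one>\<^bsub>?L\<^esub>" using a by (auto simp: Units_def)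
  then obtain \<alpha>' \<beta>' where ab': "a' = Fr \<alpha>' \<beta>'" "pev \<beta>' p ~= 0" using carrier_local_ring by auto
  have n1: "1 ~: I" by (rule primeID(2)[OF prime_I])
  have "Fr (\<alpha>' * \<alpha>) (\<beta>' * \<beta>) = Fr 1 1"
    using a'(2) unfolding ab(1) ab'(1) local_ring_ops one_KK Fr_mult[OF notI_p[OF ab'(2)] notI_p[OF ab(2)]] .
  hence \<alpha>: "pev \<alpha> p ~= 0" using Fr_eq[OF notI_mult[OF notI_p[OF ab'(2)] notI_p[OF ab(2)]] n1] p ab(2) ab'(2) by (auto simp: I_eq videal_def)
  define Y where "Y = (\<Prod>j<length xs. y j ^ m j)"
  define Dd where "Dd = (\<Prod>j<length xs. d j ^ m j)"
  have "(\<beta> * Dd) * f - \<alpha> * Y \<in> I" using Fr_eq[OF n1 notI_mult[OF notI_p[OF ab(2)] notI_p[OF pr(2)]]] Fr_mult[OF notI_p[OF ab(2)] notI_p[OF pr(2)]] by (fastforce simp: f pr(1) ab(1) local_ring_ops Y_def Dd_def ac_simps)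
  moreover have "pev (\<beta> * Dd) p ~= 0" using ab(2) pr(2) by (simp add: Dd_def)
  ultimately show ?thesis using \<alpha> unfolding Y_def by blast
qed

end

end

subsection \<open>Formulas, tildes and walls\<close>

lemma finite_atoms: "finite (atoms \<theta>)"
  by (induction \<theta>) auto

lemma sat_map: "sat s (map_sign_formula h \<theta>) = holds (\<lambda>f. s (h f) = 1) (\<lambda>f. s (h f) = 0) \<theta>"
  by (induction \<theta>) (auto simp: sat_def)

lemma holds_at_sat:
  fixes x :: "real ^ 'n"
  assumes "\<forall>f\<in>atoms \<theta>. real_polynomial_function f"
  shows "holds_at x \<theta> = sat (point_sgn x) (map_sign_formula Pfun \<theta>)"
  unfolding holds_at_def sat_map
  by (rule holds_cong) (use assms in "auto simp: point_sgn_def pev_Pfun sg_eq_iff")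

context irreducible_variety
begin

lemma holds_in_ordering_sat:
  assumes "sgnf s" "supp s = I" "!!f g. g ~: I ==> positive_in KK \<sigma> (Fr f g) \<longleftrightarrow> s (f * g) = 1"
    and "\<forall>f\<in>atoms \<theta>. real_polynomial_function f"
  shows "holds_in_ordering M \<sigma> \<theta> = sat s (map_sign_formula Pfun \<theta>)"
  unfolding holds_in_ordering_def sat_map
proof (rule holds_cong)
  fix f assume "f \<in> atoms \<theta>"
  hence pf: "poly_in_field M f = Fr (Pfun f) 1" using poly_in_field assms(4) by blast
  have n1: "1 ~: I" by (rule primeID(2)[OF prime_I])
  show "positive_in KK \<sigma> (poly_in_field M f) = (s (Pfun f) = 1) & (poly_in_field M f = \<zero>\<^bsub>KK\<^esub>) = (s (Pfun f) = 0)"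
    unfolding pf assms(3)[OF n1] Fr_zero[OF n1] using assms(2) by (auto simp: supp_def)
qed

text \<open>The Artin--Lang theorem is applied to the atoms of a describing formula together with
  \<open>h\<close>, so the sign of \<open>h\<close> in the ordering occurs at a real point of
  \<open>S\<close>.\<close>

lemma tilde_point:
  assumes "\<sigma> \<in> tilde M S" "M = vzeros I" "h ~: I"
  obtains s x where "sgnf s" "supp s = I" "!!f g. g ~: I ==> positive_in KK \<sigma> (Fr f g) \<longleftrightarrow> s (f * g) = 1"
    "!!f g. g ~: I ==> negative_in KK \<sigma> (Fr f g) \<longleftrightarrow> s (f * g) = - 1" "x \<in> S" "x \<in> M" "s h = sg (pev h x)"
proof -
  obtain \<theta> where \<theta>: "field_ordering KK \<sigma>" "describes M \<theta> S" "holds_in_ordering M \<sigma> \<theta>"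
    using assms by (auto simp: tilde_def)
  have rp: "\<forall>f\<in>atoms \<theta>. real_polynomial_function f" "S = {x \<in> M. holds_at x \<theta>}" using \<theta>(2) by (auto simp: describes_def)
  obtain s where s: "sgnf s" "supp s = I" "!!f g. g ~: I ==> positive_in KK \<sigma> (Fr f g) \<longleftrightarrow> s (f * g) = 1"
    "!!f g. g ~: I ==> negative_in KK \<sigma> (Fr f g) \<longleftrightarrow> s (f * g) = - 1"
    using sgn_of_ordering[OF \<theta>(1)] by blast
  obtain x where x: "\<forall>f\<in>supp s. pev f x = 0" "\<forall>g\<in>insert h (Pfun ` atoms \<theta>). sg (pev g x) = s g"
    using artin_lang[OF s(1), of "insert h (Pfun ` atoms \<theta>)"] finite_atoms by blast
  have "sat (point_sgn x) (map_sign_formula Pfun \<theta>) = sat s (map_sign_formula Pfun \<theta>)"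
    by (rule sat_cong) (use x(2) in "auto simp: sign_formula.set_map point_sgn_def")
  thus ?thesis using x(1) s(2) assms(2) holds_in_ordering_sat[OF s(1-3) rp(1)] \<theta>(3) holds_at_sat[OF rp(1), of x] rp(2) that[OF s] x(2) by (auto simp: vzeros_def)
qed

text \<open>The easy direction, for an arbitrary set \<open>X\<close> of orderings. If
  \<open>f = p / q\<close>, then \<open>p * q\<close> has the sign of \<open>f\<close> on
  \<open>M\<close>. Its sign in an ordering occurs at a point of the set, and it is nonzero because
  \<open>p * q\<close> is not in \<open>I\<close>; this makes the weak inequality strict.\<close>

theorem separable_of_generically_separable:
  assumes M: "M = vzeros I" and gs: "generically_separable M A B"
  shows "separable_in M A B X"
proof -
  obtain f where f: "f \<in> carrier RR" "f ~= \<zero>\<^bsub>RR\<^esub>" "\<forall>x\<in>A. f x >= 0" "\<forall>x\<in>B. f x <= 0"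
    using gs by (auto simp: generically_separable_def)
  obtain p q where pq: "f = rfrac M p q" "\<forall>x\<in>M. pev q x ~= 0" using f(1) by (auto simp: carrier_regular_ring)
  have pI: "p ~: I" using f(2) rfrac_zero[OF pq(2)] pq(1) by blast
  have qI: "q ~: I" by (rule denom_notin[OF pq(2)])
  have pqI: "p * q ~: I" by (rule notI_mult[OF pI qI])
  have fx: "f x * (pev q x * pev q x) = pev (p * q) x" if "x \<in> M" for x
    using pq that by (simp add: rfrac_def)
  show ?thesis unfolding separable_in_def
  proof (intro bexI[of _ "Fr p q"] conjI ballI)
    show "Fr p q \<in> carrier KK - {\<zero>\<^bsub>KK\<^esub>}" using Fr_zero[OF qI] pI carrier_KK qI by blast
    fix \<sigma> assume "\<sigma> \<in> tilde M A \<inter> X"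
    then obtain s x where h: "sgnf s" "supp s = I" "positive_in KK \<sigma> (Fr p q) \<longleftrightarrow> s (p * q) = 1"
      "x \<in> A" "x \<in> M" "s (p * q) = sg (pev (p * q) x)"
      using tilde_point[of \<sigma> A "p * q", OF _ M pqI] qI by (metis IntD1)
    have "s (p * q) ~= 0" using pqI h(2) by (auto simp: supp_def)
    thus "positive_in KK \<sigma> (Fr p q)" using h(3) by (smt (verit) fx[OF h(5)] f(3) h(4) mult_nonneg_nonneg zero_le_square h(6) sg_eq_iff)
  next
    fix \<sigma> assume "\<sigma> \<in> tilde M B \<inter> X"
    then obtain s x where h: "sgnf s" "supp s = I" "negative_in KK \<sigma> (Fr p q) \<longleftrightarrow> s (p * q) = - 1"
      "x \<in> B" "x \<in> M" "s (p * q) = sg (pev (p * q) x)"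
      using tilde_point[of \<sigma> B "p * q", OF _ M pqI] qI by (metis IntD1)
    have "s (p * q) ~= 0" using pqI h(2) by (auto simp: supp_def)
    thus "negative_in KK \<sigma> (Fr p q)" using h(3) by (smt (verit) fx[OF h(5)] f(4) h(4) mult_nonpos_nonneg zero_le_square h(6) sg_eq_iff)
  qed
qed

end

sublocale crossing \<subseteq> irreducible_variety M I
  by unfold_locales (rule I_eq, rule prime_I)

section \<open>Wall ideals versus walls, and the converse direction\<close>

context crossing
begin

abbreviation "AA \<equiv> {x \<in> M. sat (point_sgn x) \<phi>}"
abbreviation "BB \<equiv> {x \<in> M. sat (point_sgn x) \<psi>}"

text \<open>If no member of \<open>F\<close> vanishes at \<open>x\<close>, all signs on
  \<open>F\<close>, and with them the formula, are constant near \<open>x\<close>.\<close>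

lemma frontier_zero:
  assumes \<theta>: "atoms \<theta> <= F" and x: "x \<in> top_of_set M frontier_of {x \<in> M. sat (point_sgn x) \<theta>}"
  shows "x \<in> M" "\<exists>f\<in>F. pev f x = 0"
proof -
  show xM: "x \<in> M" using x frontier_of_subset_topspace[of "top_of_set M"] by auto
  show "\<exists>f\<in>F. pev f x = 0"
  proof (rule ccontr)
    assume "\<not> ?thesis"
    hence nz: "pev f x ~= 0" if "f \<in> F" for f using that by blast
    define U where "U = M \<inter> (\<Inter>f\<in>F. {z. 0 < pev f z * pev f x})"
    have "open {z. 0 < pev f z * pev f x}" for f
      by (intro open_Collect_less continuous_intros continuous_on_pev)
    hence U: "openin (top_of_set M) U" unfolding U_def
      by (intro openin_open_Int open_INT finite_F) auto
    have xU: "x \<in> U" using xM nz by (auto simp: U_def zero_less_mult_iff linorder_neq_iff)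
    have eq: "sat (point_sgn z) \<theta> = sat (point_sgn x) \<theta>" if "z \<in> U" for z
    proof (rule sat_cong)
      fix f assume "f \<in> atoms \<theta>"
      hence "0 < pev f z * pev f x" using that \<theta> by (auto simp: U_def)
      thus "point_sgn z f = point_sgn x f"
        by (auto simp: point_sgn_def zero_less_mult_iff) (metis sg_eq_iff)+
    qed
    show False
    proof (cases "sat (point_sgn x) \<theta>")
      case True
      hence "x \<in> top_of_set M interior_of {x \<in> M. sat (point_sgn x) \<theta>}" using eq U xU by (auto simp: U_def interior_of_def)
      thus False using x by (simp add: frontier_of_def)
    next
      case False
      obtain z where "z \<in> {x \<in> M. sat (point_sgn x) \<theta>}" "z \<in> U" using x U xU by (auto simp: frontier_of_def in_closure_of)
      thus False using eq False by auto
    qed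
  qed
qed

lemma algebraic_dim_M: "algebraic_dim M = enat n"
  using algebraic_dim_eq(1)[of M n] prime_I dim_le dim_ge by (simp add: I_eq[symmetric])

text \<open>The product of \<open>F\<close> vanishes on both Zariski closures. The ideal of an
  irreducible set between the zero set of \<open>Q\<close> and their union therefore contains a
  member of \<open>F\<close>, so it is strictly larger than \<open>I\<close>. If it were different
  from \<open>Q\<close>, there would be a chain of length \<open>n + 1\<close>.\<close>

lemma wall_ideal_wall:
  assumes Q: "wall_ideal Q"
  shows "vzeros Q \<in> walls M AA BB"
proof -
  obtain \<theta> where Q': "primeI Q" "I \<subset> Q" "videal (vzeros Q) = Q" "\<exists>C. prime_chain (n - 1) Q C" "\<theta> \<in> {\<phi>, \<psi>}"
    "videal (top_of_set M frontier_of {x \<in> M. sat (point_sgn x) \<theta>}) <= Q"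
    using Q by (auto simp: wall_ideal_def)
  define ZA where "ZA = zariski_closure (top_of_set M frontier_of AA)"
  define ZB where "ZB = zariski_closure (top_of_set M frontier_of BB)"
  have long: "Suc m <= n" if "prime_chain m Q C" for m C
    using dim_le prime_chain_Cons[OF prime_I Q'(2) that] by blast
  have n1: "n >= 1" using long[OF prime_chain_refl[OF Q'(1)]] by simp
  have "m <= n - 1" if "prime_chain m Q C" for m C using long[OF that] by simp
  hence dim: "algebraic_dim (vzeros Q) + 1 = algebraic_dim M" using algebraic_dim_eq(1)[of "vzeros Q" "n - 1"] Q'(1,4) n1 by (auto simp: Q'(3) algebraic_dim_M one_enat_def)
  have anti: "vzeros X <= vzeros Y" if "Y <= X" for X Y :: "'n pfun set" using that by (auto simp: vzeros_def)
  have WZ: "vzeros Q <= ZA \<union> ZB"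
    using anti[OF Q'(6)] Q'(5) by (auto simp: ZA_def ZB_def zariski_closure_eq)
  have prod0: "(\<Prod>f\<in>F. f) \<in> videal (ZA \<union> ZB)"
  proof -
    have "(\<Prod>f\<in>F. f) \<in> videal (top_of_set M frontier_of {x \<in> M. sat (point_sgn x) \<theta>})" if "atoms \<theta> <= F" for \<theta>
      using frontier_zero(2)[OF that] finite_F by (auto simp: videal_def prod_zero_iff)
    from this[OF atoms(1)] this[OF atoms(2)] have "(\<Prod>f\<in>F. f) \<in> videal ZA" "(\<Prod>f\<in>F. f) \<in> videal ZB"
      unfolding ZA_def ZB_def zariski_closure_eq vzeros_def videal_def by blast+
    thus ?thesis by (auto simp: videal_def)
  qed
  have ZM: "ZA \<union> ZB <= M"
  proof -
    have "zariski_closure (top_of_set M frontier_of S) <= M" for S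
    proof -
      have "vzeros (videal (top_of_set M frontier_of S)) <= vzeros I" using frontier_of_subset_topspace[of "top_of_set M" S] by (auto simp: I_eq videal_def intro!: anti)
      also have "vzeros I = M" by (rule M_eq[symmetric])
      finally show ?thesis unfolding zariski_closure_eq .
    qed
    thus ?thesis by (simp add: ZA_def ZB_def)
  qed
  have "W' = vzeros Q" if W': "irreducible_algebraic_set W'" "vzeros Q <= W'" "W' <= ZA \<union> ZB" for W'
  proof -
    define Q2 where "Q2 = videal W'"
    have Q2: "primeI Q2" unfolding Q2_def by (rule primeI_irreducible[OF W'(1)])
    have "I <= Q2" using W'(3) ZM by (auto simp: Q2_def I_eq videal_def)
    moreover have "(\<Prod>f\<in>F. f) \<in> Q2" using prod0 W'(3) by (auto simp: Q2_def videal_def)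
    hence "\<exists>f\<in>F. f \<in> Q2"
    proof -
      have "finite X ==> (\<Prod>f\<in>X. f) \<in> Q2 ==> \<exists>f\<in>X. f \<in> Q2" for X
        by (induction X rule: finite_induct) (use primeID(2,6)[OF Q2] in auto)
      thus ?thesis using finite_F \<open>(\<Prod>f\<in>F. f) \<in> Q2\<close> by blast
    qed
    moreover have "f ~: I" if "f \<in> F" for f
    proof -
      obtain p where "p \<in> M" using primeID(2)[OF prime_I] by (auto simp: I_eq videal_def)
      then obtain y \<Delta> b where "crossing_at I M n F \<phi> \<psi> p y \<Delta> b" using ex_at by blast
      thus ?thesis using crossing_at.F_notin_I that by blast
    qed
    ultimately have IQ2: "I \<subset> Q2" by blast
    have "Q2 = Q"
    proof (rule ccontr)
      assume "Q2 ~= Q"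
      hence "Q2 \<subset> Q" using W'(2) Q'(3) by (fastforce simp: Q2_def videal_def)
      moreover obtain C where C: "prime_chain (n - 1) Q C" using Q'(4) by blast
      ultimately have "prime_chain (Suc (Suc (n - 1))) I C"
        by (intro prime_chain_Cons[OF prime_I IQ2] prime_chain_Cons[OF Q2])
      thus False using dim_le n1 by fastforce
    qed
    moreover have "algebraic_set W'" using W'(1) by (simp add: irreducible_algebraic_set_def)
    ultimately show ?thesis using vzeros_videal[of W'] by (simp add: Q2_def)
  qed
  thus ?thesis
    unfolding walls_def irreducible_components_def
    using irreducible_vzeros[OF Q'(1,3)] WZ dim by (simp add: ZA_def ZB_def)
qed

text \<open>\<open>compat\<close> compares polynomial functions, while convexity of the maximal
  ideal compares fractions. The discrete valuation bridges the gap: a fraction outside the maximal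
  ideal can be written with a numerator outside \<open>Q\<close>.\<close>

lemma wall_convex:
  assumes Q: "wall_ideal Q" and s: "sgnf s" "supp s = I" "compat s Q"
  shows "ord_of s \<in> wall_orderings M (vzeros Q)"
proof -
  have Q': "primeI Q" "I \<subset> Q" "videal (vzeros Q) = Q" using Q by (auto simp: wall_ideal_def)
  have nI: "f ~: I" if "f ~: Q" for f using that Q'(2) by blast
  have W: "vzeros Q <= M" using Q'(2) by (auto simp: M_eq vzeros_def)
  have Wne: "vzeros Q ~= {}" using primeID(2)[OF Q'(1)] Q'(3) by (auto simp: videal_def)
  note mx = fractions_eq(2)[OF W Wne, unfolded Q'(3)]
  obtain z where z: "z \<in> Q" "!!f. f ~: I ==> \<exists>k u f'. u ~: Q & f' ~: Q & u * f - z ^ k * f' \<in> I"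
    using wall_dvr[OF Q] by blast
  have form: "Fr r t \<in> localization_max RR (vanishing_ideal M (vzeros Q)) | (\<exists>\<rho> \<tau>. Fr r t = Fr \<rho> \<tau> & \<rho> ~: Q & \<tau> ~: I)"
    if t: "t ~: I" for r t
  proof (cases "r \<in> I")
    case True
    have "Fr r t = Fr 0 1" using Fr_eq[OF t nI[OF primeID(2)[OF Q'(1)]], of r 0] True by simp
    thus ?thesis unfolding mx using primeID(1,2)[OF Q'(1)] by blast
  next
    case False
    obtain k u r' where r: "u ~: Q" "r' ~: Q" "u * r - z ^ k * r' \<in> I" using z(2)[OF False] by blast
    obtain l v t' where tt: "v ~: Q" "t' ~: Q" "v * t - z ^ l * t' \<in> I" using z(2)[OF t] by blast
    have zt: "z ^ l * t' ~: I"
    proof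
      assume h: "z ^ l * t' \<in> I"
      show False using notI_mult[OF nI[OF tt(1)] t] primeID(3)[OF prime_I tt(3) h] by auto
    qed
    have ztu: "z ^ l * t' * u ~: I" by (rule notI_mult[OF zt nI[OF r(1)]])
    have "Fr r t = Fr (z ^ k * r' * v) (z ^ l * t' * u)"
    proof -
      have "(u * r - z ^ k * r') * (v * t) - (v * t - z ^ l * t') * (u * r) \<in> I"
        by (intro primeID(5,8)[OF prime_I] r(3) tt(3))
      also have "(u * r - z ^ k * r') * (v * t) - (v * t - z ^ l * t') * (u * r) =
          r * (z ^ l * t' * u) - (z ^ k * r' * v) * t"
        by (simp add: algebra_simps)
      finally show ?thesis using Fr_eq[OF t ztu] by blast
    qed
    \<comment> \<open>Powers of the uniformizer \<open>z\<close> are cancelled; the value of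
      \<open>r / t\<close> is \<open>k - l\<close>, and it is positive exactly for the elements of
      the maximal ideal.\<close>
    show ?thesis
    proof (cases "k > l")
      case True
      have d: "t' * u ~: Q" using primeID(6)[OF Q'(1)] tt(2) r(1) by blast
      have "Fr (z ^ k * r' * v) (z ^ l * t' * u) = Fr (z ^ (k - l) * r' * v) (t' * u)"
      proof (rule Fr_eqI[OF ztu nI[OF d]])
        have "z ^ k = z ^ l * z ^ (k - l)" using True by (simp flip: power_add)
        thus "z ^ k * r' * v * (t' * u) = z ^ (k - l) * r' * v * (z ^ l * t' * u)" by (simp add: ac_simps)
      qed
      moreover obtain j where "k - l = Suc j" using True by (metis Suc_diff_Suc)
      hence "z ^ (k - l) * r' * v \<in> Q" using z(1) primeID(5)[OF Q'(1)] by (simp add: mult.assoc)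
      ultimately show ?thesis using \<open>Fr r t = _\<close> d unfolding mx by auto
    next
      case False
      have "z ^ (l - k) * t' * u ~: I"
      proof
        assume h: "z ^ (l - k) * t' * u \<in> I"
        have "z ^ l = z ^ k * z ^ (l - k)" using False by (simp flip: power_add)
        thus False using ztu primeID(4)[OF prime_I h, of "z ^ k"] by (simp add: ac_simps)
      qed
      moreover have "Fr (z ^ k * r' * v) (z ^ l * t' * u) = Fr (r' * v) (z ^ (l - k) * t' * u)"
      proof (rule Fr_eqI[OF ztu calculation])
        show "z ^ k * r' * v * (z ^ (l - k) * t' * u) = r' * v * (z ^ l * t' * u)" using False by (simp flip: power_add)
      qed
      moreover have "r' * v ~: Q" using primeID(6)[OF Q'(1)] tt(1) r(2) by blast
      ultimately show ?thesis using \<open>Fr r t = _\<close> by metis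
    qed
  qed
  have sm: "s (f * g) = s f * s g" for f g by (rule sgnfD(4)[OF s(1)])
  \<comment> \<open>Since \<open>Q\<close> is convex, \<open>\<rho> * d\<close> exceeds
    \<open>a * \<tau>\<close> in absolute value, so subtracting \<open>a / d\<close> cannot change
    the sign \<open>\<epsilon>\<close> of \<open>\<rho> / \<tau>\<close>. As before, the sign is
    read off from a product and a sum of two conjugate terms.\<close>
  have key: False
    if h: "\<rho> ~: Q" "\<tau> ~: I" "a \<in> Q" "d ~: Q" "s (\<rho> * \<tau>) = \<epsilon>" "\<epsilon> \<in> {1, - 1}" "\<epsilon> * s ((\<rho> * d - a * \<tau>) * (d * \<tau>)) <= 0" for \<rho> \<tau> a d \<epsilon>
  proof -
    have cp: "s (\<rho> * d * (\<rho> * d) - a * \<tau> * (a * \<tau>)) = 1"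
      by (metis primeID(6)[OF Q'(1)] h primeID(5)[OF Q'(1) h(3)] s(3) compat_def)
    define X where "X = (\<rho> * d - a * \<tau>) * (d * \<tau>)"
    define Y where "Y = (\<rho> * d + a * \<tau>) * (d * \<tau>)"
    have e: "X * Y = (\<rho> * d * (\<rho> * d) - a * \<tau> * (a * \<tau>)) * ((d * \<tau>) * (d * \<tau>))"
      unfolding X_def Y_def by (simp add: algebra_simps)
    have "s X * s Y = s (X * Y)" by (rule sm[symmetric])
    also have "\<dots> = 1" using sgn_notin[OF s(1,2) notI_mult[OF nI[OF h(4)] h(2)]] by (auto simp: e sm[of "_ - _"] cp sm[of "d * \<tau>" "d * \<tau>"])
    finally have "s X * s Y = 1" .
    hence XY: "s X = s Y" "s X ~= 0" using sgnfD(3)[OF s(1), of X] sgnfD(3)[OF s(1), of Y] by auto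
    hence sX: "s X = - \<epsilon>" "s Y = - \<epsilon>" using h(6,7) sgnfD(3)[OF s(1), of X] unfolding X_def[symmetric] by auto
    have "s (X + Y) = \<epsilon>" using sgn_notin[OF s(1,2) nI[OF h(4)]] sgnf_pos_nat[OF s(1), of 2] h(5) sm by (auto simp: X_def Y_def algebra_simps)
    moreover have "s (X + Y) = - \<epsilon>"
    proof (cases "\<epsilon> = 1")
      case True
      hence "s (- X + - Y) = 1" by (smt (verit) sX sgnfD(6)[OF s(1)] sgnfD(7)[OF s(1)])
      moreover have "- X + - Y = - (X + Y)" by simp
      ultimately have "- s (X + Y) = 1" using sgnfD(7)[OF s(1)] by metis
      thus ?thesis using True by simp
    next
      case False
      thus ?thesis using h(6) sgnfD(6)[OF s(1), of X Y] sX by simp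
    qed
    ultimately show False using h(6) by auto
  qed
  show ?thesis unfolding wall_orderings_def mem_Collect_eq convex_in_def
  proof (intro conjI ballI impI)
    show "field_ordering KK (ord_of s)" by (rule field_ordering_ord_of[OF s(1,2)])
    fix a c e
    assume a: "a \<in> localization_max RR (vanishing_ideal M (vzeros Q))"
      and c: "c \<in> localization_max RR (vanishing_ideal M (vzeros Q))" and e: "e \<in> carrier KK"
      and le: "e \<ominus>\<^bsub>KK\<^esub> a \<in> ord_of s & c \<ominus>\<^bsub>KK\<^esub> e \<in> ord_of s"
    show "e \<in> localization_max RR (vanishing_ideal M (vzeros Q))"
    proof (rule ccontr)
      assume n: "e ~: localization_max RR (vanishing_ideal M (vzeros Q))"
      obtain a1 a2 where a12: "a = Fr a1 a2" "a1 \<in> Q" "a2 ~: Q" using a unfolding mx by blast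
      obtain c1 c2 where c12: "c = Fr c1 c2" "c1 \<in> Q" "c2 ~: Q" using c unfolding mx by blast
      obtain r t where "e = Fr r t" "t ~: I" using e carrier_KK by auto
      then obtain \<rho> \<tau> where \<rho>: "e = Fr \<rho> \<tau>" "\<rho> ~: Q" "\<tau> ~: I" using form n by metis
      have 1: "s ((\<rho> * a2 - a1 * \<tau>) * (a2 * \<tau>)) >= 0" using le in_ord_of[OF s(1,2) notI_mult[OF \<rho>(3) nI[OF a12(3)]]] by (auto simp: \<rho>(1) a12(1) Fr_minus[OF \<rho>(3) nI[OF a12(3)]] mult.commute[of \<tau> a2])
      have "(c1 * \<tau> - \<rho> * c2) * (c2 * \<tau>) = - ((\<rho> * c2 - c1 * \<tau>) * (c2 * \<tau>))" by (simp add: algebra_simps)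
      hence 2: "s ((\<rho> * c2 - c1 * \<tau>) * (c2 * \<tau>)) <= 0" using le in_ord_of[OF s(1,2) notI_mult[OF nI[OF c12(3)] \<rho>(3)]] sgnfD(7)[OF s(1)] by (auto simp: \<rho>(1) c12(1) Fr_minus[OF nI[OF c12(3)] \<rho>(3)])
      have "s (\<rho> * \<tau>) ~= 0" using sgn_I[OF s(1,2)] notI_mult[OF nI[OF \<rho>(2)] \<rho>(3)] by blast
      then consider "s (\<rho> * \<tau>) = 1" | "s (\<rho> * \<tau>) = - 1" using sgnfD(3)[OF s(1), of "\<rho> * \<tau>"] by auto
      thus False
      proof cases
        case 1 thus ?thesis using key[OF \<rho>(2,3) c12(2,3), of 1] 2 by simp
      next
        case 2 thus ?thesis using key[OF \<rho>(2,3) a12(2,3), of "- 1"] 1 by simp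
      qed
    qed
  qed
qed

lemma ord_of_tilde:
  assumes s: "sgnf s" "supp s = I" "sat s \<theta>"
  shows "ord_of s \<in> tilde M {x \<in> M. sat (point_sgn x) \<theta>}"
proof -
  define \<eta> where "\<eta> = map_sign_formula pev \<theta>"
  have rp: "\<forall>f\<in>atoms \<eta>. real_polynomial_function f" using rpf_pev by (auto simp: \<eta>_def sign_formula.set_map)
  show ?thesis using holds_in_ordering_sat[OF s(1,2) positive_ord_of[OF s(1,2)] rp] s(3) rp holds_at_sat[OF rp] field_ordering_ord_of[OF s(1,2)] by (auto simp: \<eta>_def sign_formula.map_comp comp_def pev_inverse sign_formula.map_ident describes_def tilde_def)
qed

lemma separated_of_separable:
  assumes Q: "wall_ideal Q" and sep: "separable_in M AA BB (wall_orderings M (vzeros Q))"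
  shows "separated Q"
proof -
  obtain g where g: "g \<in> carrier KK - {\<zero>\<^bsub>KK\<^esub>}"
    "!!\<sigma>. \<sigma> \<in> tilde M AA ==> \<sigma> \<in> wall_orderings M (vzeros Q) ==> positive_in KK \<sigma> g"
    "!!\<sigma>. \<sigma> \<in> tilde M BB ==> \<sigma> \<in> wall_orderings M (vzeros Q) ==> negative_in KK \<sigma> g"
    using sep unfolding separable_in_def by blast
  obtain a d where ad: "g = Fr a d" "d ~: I" using g(1) carrier_KK by auto
  have "a * d ~: I" using g(1) ad Fr_zero notI_mult by blast
  thus ?thesis
  proof (rule separatedI)
    fix s assume s: "sgnf s" "supp s = I" "compat s Q"
    note w = wall_convex[OF Q s]
    show "s (a * d) = 1" if "sat s \<phi>"
      using g(2)[OF ord_of_tilde[OF s(1,2) that] w] positive_ord_of[OF s(1,2) ad(2)] ad(1) by simp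
    show "s (a * d) = - 1" if "sat s \<psi>"
      using g(3)[OF ord_of_tilde[OF s(1,2) that] w] negative_ord_of[OF s(1,2) ad(2)] ad(1) by simp
  qed
qed

theorem generically_separable_of_walls:
  assumes "\<forall>W\<in>walls M AA BB. separable_in M AA BB (wall_orderings M W)"
  shows "generically_separable M AA BB"
proof -
  have "separated Q" if "wall_ideal Q" for Q
    using separated_of_separable[OF that] wall_ideal_wall[OF that] assms by blast
  then obtain h where h: "h ~: I" "!!x. x \<in> M ==> sat (point_sgn x) \<phi> ==> pev h x >= 0"
    "!!x. x \<in> M ==> sat (point_sgn x) \<psi> ==> pev h x <= 0"
    using separating_polynomial by blast
  show ?thesis unfolding generically_separable_def
    by (rule bexI[of _ "rs h"]) (use h rs_zero[of h] rs_carrier[of h] in "auto simp: rs_def")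
qed

end

text \<open>Translation of the geometric hypotheses into the locale. Nonsingularity makes the number
  of local parameters equal to the dimension \<open>n\<close> at every point.\<close>

lemma crossing_of_variety:
  fixes M A B :: "(real ^ 'n) set"
  assumes "compact M" and irr: "irreducible_algebraic_set M"
    and "openin (top_of_set M) A" and "openin (top_of_set M) B" and "A \<inter> B = {}"
    and ns: "nonsingular M" and nc: "walls_normal_crossings M A B"
  obtains n F \<phi> \<psi> where "crossing (videal M) M n F \<phi> \<psi>"
    "A = {x \<in> M. sat (point_sgn x) \<phi>}" "B = {x \<in> M. sat (point_sgn x) \<psi>}"
proof -
  define I where "I = videal M"
  have prime: "primeI I" unfolding I_def by (rule primeI_irreducible[OF irr])
  interpret irreducible_variety M I by unfold_locales (rule I_def, rule prime)
  have M: "M = vzeros I" using vzeros_videal[of M] irr unfolding I_def irreducible_algebraic_set_def by simp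
  obtain F \<phi> \<psi> where F: "finite F" "\<forall>f\<in>F. real_polynomial_function f" "atoms \<phi> <= F" "describes M \<phi> A"
    "atoms \<psi> <= F" "describes M \<psi> B" "normal_crossings_family M F"
    using nc by (auto simp: walls_normal_crossings_def)
  obtain n where n: "algebraic_dim M = enat n" using algebraic_dim_eq(2)[of M] prime by (auto simp: I_def)
  have dim: "prime_chain m I C ==> m <= n" "\<exists>C. prime_chain n I C" for m C
    using algebraic_dim_eq(1)[of M n] n prime unfolding I_def by auto
  have A: "A = {x \<in> M. sat (point_sgn x) (map_sign_formula Pfun \<phi>)}"
    using F(4) holds_at_sat[of \<phi>] by (auto simp: describes_def)
  have B: "B = {x \<in> M. sat (point_sgn x) (map_sign_formula Pfun \<psi>)}"
    using F(6) holds_at_sat[of \<psi>] by (auto simp: describes_def)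
  have "crossing I M n (Pfun ` F) (map_sign_formula Pfun \<phi>) (map_sign_formula Pfun \<psi>)"
  proof
    show "I = videal M" by (rule I_def)
    show "\<exists>C. prime_chain n I C" by (rule dim(2))
    show "m <= n" if "prime_chain m I C" for m C by (rule dim(1)[OF that])
    show "atoms (map_sign_formula Pfun \<phi>) <= Pfun ` F" "atoms (map_sign_formula Pfun \<psi>) <= Pfun ` F"
      using F(3,5) by (auto simp: sign_formula.set_map)
    show "openin (top_of_set M) {x \<in> M. sat (point_sgn x) (map_sign_formula Pfun \<phi>)}"
      "openin (top_of_set M) {x \<in> M. sat (point_sgn x) (map_sign_formula Pfun \<psi>)}"
      using assms(3,4) A B by simp_all
    show "\<not> sat (point_sgn x) (map_sign_formula Pfun \<psi>)"
      if "x \<in> M" "sat (point_sgn x) (map_sign_formula Pfun \<phi>)" for x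
      using assms(5) that unfolding A B by blast
    fix p assume p: "p \<in> M"
    obtain xs where xs: "regular_system_of_parameters (local_ring M p) xs"
      "\<forall>f\<in>F. \<exists>a\<in>Units (local_ring M p). \<exists>m :: nat => nat. poly_in_field M f = a \<otimes>\<^bsub>local_ring M p\<^esub>
         (\<Otimes>\<^bsub>local_ring M p\<^esub>i\<in>{..<length xs}. (xs ! i) [^]\<^bsub>local_ring M p\<^esub> m i)"
      using F(7) p by (auto simp: normal_crossings_family_def)
    have "enat (length xs) = krull_dim (local_ring M p)" using xs(1) by (simp add: regular_system_of_parameters_def)
    also have "\<dots> = enat n" using ns p n by (auto simp: nonsingular_def)
    finally have len: "length xs = n" by simp
    obtain y d where yd: "!!j. j < length xs ==> xs ! j = Fr (y j) (d j) & pev (d j) p ~= 0 & pev (y j) p = 0"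
      "!!g. pev g p = 0 ==> \<exists>u c. pev u p ~= 0 & u * g - (\<Sum>j<length xs. c j * y j) \<in> I"
      using local_parameters[OF p xs(1)] by blast
    have "\<exists>u w m. pev u p ~= 0 & pev w p ~= 0 & u * Pfun f - w * (\<Prod>j<n. y j ^ m j) \<in> I" if f: "f \<in> F" for f
    proof -
      obtain a m where am: "a \<in> Units (local_ring M p)" "poly_in_field M f = a \<otimes>\<^bsub>local_ring M p\<^esub>
         (\<Otimes>\<^bsub>local_ring M p\<^esub>i\<in>{..<length xs}. (xs ! i) [^]\<^bsub>local_ring M p\<^esub> (m i :: nat))"
        using xs(2) f by blast
      have "poly_in_field M f = Fr (Pfun f) 1" using poly_in_field F(2) f by blast
      from local_monomial[OF p _ am(2)[unfolded this] am(1), of y d] yd(1) show ?thesis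
        unfolding len by blast
    qed
    thus "\<exists>y. (\<forall>j<n. pev (y j) p = 0) &
      (\<forall>g. pev g p = 0 --> (\<exists>u c. pev u p ~= 0 & u * g - (\<Sum>j<n. c j * y j) \<in> I)) &
      (\<forall>f\<in>Pfun ` F. \<exists>u w m. pev u p ~= 0 & pev w p ~= 0 & u * f - w * (\<Prod>j<n. y j ^ m j) \<in> I)"
      using yd unfolding len by (intro exI[of _ y]) auto
  qed (use prime M assms(1) F(1) in auto)
  thus ?thesis using that A B unfolding I_def by blast
qed

theorem theorem5p1:
  fixes M A B :: "(real ^ 'n) set"
  assumes "compact M" and "irreducible_algebraic_set M"
    and "openin (top_of_set M) A" and "semialgebraic_in M A"
    and "openin (top_of_set M) B" and "semialgebraic_in M B"
    and "A \<inter> B = {}"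
    and "nonsingular M"
    and "\<forall>W\<in>walls M A B. nonsingular W"
    and "walls_normal_crossings M A B"
  shows "generically_separable M A B \<longleftrightarrow>
    (\<forall>W\<in>walls M A B. separable_in M A B (wall_orderings M W))"
proof -
  obtain n F \<phi> \<psi> where c: "crossing (videal M) M n F \<phi> \<psi>"
    and A: "A = {x \<in> M. sat (point_sgn x) \<phi>}" and B: "B = {x \<in> M. sat (point_sgn x) \<psi>}"
    using crossing_of_variety[OF assms(1,2,3,5,7,8,10)] by blast
  interpret crossing "videal M" M n F \<phi> \<psi> by (rule c)
  show ?thesis
    using separable_of_generically_separable[OF M_eq, of A B] generically_separable_of_walls A B by blast
qed

end
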